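(* Let $\Gamma\subset G(K)$ be an arithmetic subgroup without $p'$-torsion, and let $R$ be a $\mathbb{Z}$-module with trivial $\Gamma$-action such that multiplication by $p$ is invertible in $\mathrm{End}_{\mathbb{Z}}(R)$. Then there are natural isomorphisms of $\mathbb{Z}$-modules $$H^{\cdot}(\Gamma,R)\simeq H^{\cdot}\big(C^{\cdot}(R)^{\Gamma}\big),$$ where the left side is the group cohomology of $\Gamma$ with values in the trivial $\Gamma$-module $R$ and the right side is the cohomology of the complex of $\Gamma$-invariants of the cochain complex $(C^{\cdot}(R),d^{\cdot})$ of the Bruhat-Tits building $\mathfrak{I}$ of $G(K_\infty)$.
   Context: $K$ is the function field of a smooth projective geometrically irreducible curve $\mathcal{C}$ over a finite field $\mathbb{F}$ of characteristic $p$; $\infty$ is a fixed place (closed point of $\mathcal C$); $A\subset K$ is the ring of functions regular outside $\infty$; $K_\infty$ is the completion of $K$ at $\infty$. $n\ge 1$ is an integer and $G=SL_{n+1}$. A subgroup of $G(K)$ is arithmetic if it is commensurable with $G(A)$. It is without $p'$-torsion if every element of finite order has order a power of $p$. $\mathfrak{I}$ is the Bruhat-Tits building of $G(K_\infty)$, a contractible simplicial complex of dimension $n$ with simplicial action of $G(K_\infty)$. For $0\le q\le n$, $\mathfrak{I}^*_q$ is the set of oriented $q$-simplices (a $q$-simplex together with an ordering of its vertices up to even permutations), and $\mathbb{Z}[\mathfrak{I}^*_q]$ is the $\mathbb{Z}$-module generated by $\mathfrak{I}^*_q$ with, when $q\neq 0$, the relations $\sigma_1+\sigma_2=0$ if $\sigma_1,\sigma_2$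 are the two orientations of the same simplex. The boundary is $\partial_q[v_0,\dots,v_q]=\sum_{i=0}^q(-1)^i[v_0,\dots,\hat v_i,\dots,v_q]$. Set $C^q(R)=\mathrm{Hom}_{\mathbb{Z}}(\mathbb{Z}[\mathfrak{I}^*_q],R)$ for $0\le q\le n$, $d^q(f)=f\circ\partial_{q+1}$ for $0\le q\le n-1$; $\gamma\in\Gamma$ acts by $f\mapsto f\circ\gamma^{-1}$, and $C^q(R)^\Gamma$ is the set of $\Gamma$-invariant elements. *)

theory Defs
  imports "HOL-Analysis.Analysis" "HOL-Algebra.Algebra" "HOL-Algebra.Algebraic_Closure_Type"
    "HOL-Combinatorics.Permutations"
begin

section \<open>Function fields, places and completions\<close>

text \<open>
  The function field of a smooth projective geometrically irreducible curve over the finite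
  field \<open>F\<close>: a finite extension of some \<open>F(x)\<close> with \<open>x\<close> transcendental, in which \<open>F\<close> is
  algebraically closed. As \<open>F\<close> is perfect, the last condition is geometric irreducibility.
\<close>

definition global_function_field :: "'k::field set \<Rightarrow> bool" where
  "global_function_field F \<longleftrightarrow>
     (let K = (ring_of_type_algebra :: 'k ring) in
       subfield F K \<and> finite F \<and>
       (\<exists>x. ring.transcendental K F x \<and>
            ring.finite_dimension K (generate_field K (insert x F)) (carrier K)) \<and>
       (\<forall>x\<in>carrier K. ring.algebraic K F x \<longrightarrow> x \<in> F))"

text \<open>
  Normalised discrete valuations are integer-valued; the value at \<open>0\<close> (mathematically infinite)
  is set to \<open>0\<close>, so that different functions are different valuations, and \<open>val_ge\<close>
  treats it separately.
\<close>

definition discrete_valuation :: "('a::field \<Rightarrow> int) \<Rightarrow> bool" where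
  "discrete_valuation v \<longleftrightarrow>
     v 0 = 0 \<and>
     (\<forall>x y. x \<noteq> 0 \<longrightarrow> y \<noteq> 0 \<longrightarrow> v (x * y) = v x + v y) \<and>
     (\<forall>x y. x \<noteq> 0 \<longrightarrow> y \<noteq> 0 \<longrightarrow> x + y \<noteq> 0 \<longrightarrow> min (v x) (v y) \<le> v (x + y)) \<and>
     (\<exists>x. x \<noteq> 0 \<and> v x = 1)"

definition val_ge :: "('a::field \<Rightarrow> int) \<Rightarrow> int \<Rightarrow> 'a \<Rightarrow> bool" where
  "val_ge v N x \<longleftrightarrow> x = 0 \<or> N \<le> v x"

definition valuation_ring :: "('a::field \<Rightarrow> int) \<Rightarrow> 'a set" where
  "valuation_ring v = {x. val_ge v 0 x}"

text \<open>The closed points of the curve, given by the valuations of their local rings.\<close>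

definition place :: "'k::field set \<Rightarrow> ('k \<Rightarrow> int) \<Rightarrow> bool" where
  "place F v \<longleftrightarrow> discrete_valuation v \<and> (\<forall>a\<in>F. v a = 0)"

definition regular_outside :: "'k::field set \<Rightarrow> ('k \<Rightarrow> int) \<Rightarrow> 'k set" where
  "regular_outside F v = {x. \<forall>u. place F u \<and> u \<noteq> v \<longrightarrow> x \<in> valuation_ring u}"

definition valued_completion ::
  "('k::field \<Rightarrow> int) \<Rightarrow> ('k \<Rightarrow> 'l::field) \<Rightarrow> ('l \<Rightarrow> int) \<Rightarrow> bool" where
  "valued_completion v \<iota> w \<longleftrightarrow>
     \<iota> 1 = 1 \<and> (\<forall>x y. \<iota> (x + y) = \<iota> x + \<iota> y) \<and> (\<forall>x y. \<iota> (x * y) = \<iota> x * \<iota> y) \<and>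
     discrete_valuation w \<and> (\<forall>x. w (\<iota> x) = v x) \<and>
     (\<forall>y N. \<exists>x. val_ge w N (y - \<iota> x)) \<and>
     (\<forall>s :: nat \<Rightarrow> 'l.
        (\<forall>N. \<exists>m. \<forall>i\<ge>m. \<forall>j\<ge>m. val_ge w N (s i - s j)) \<longrightarrow>
        (\<exists>y. \<forall>N. \<exists>m. \<forall>i\<ge>m. val_ge w N (s i - y)))"


section \<open>Arithmetic subgroups\<close>

definition SL_group :: "('a::comm_ring_1 ^ 'n ^ 'n) monoid" where
  "SL_group = \<lparr>carrier = {g. det g = 1}, monoid.mult = (**), one = mat 1\<rparr>"

definition SL_over :: "'a::comm_ring_1 set \<Rightarrow> ('a ^ 'n ^ 'n) set" where
  "SL_over S = {g. det g = 1 \<and> (\<forall>i j. g $ i $ j \<in> S)}"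

abbreviation subgroup_of :: "('g, 'x) monoid_scheme \<Rightarrow> 'g set \<Rightarrow> ('g, 'x) monoid_scheme" where
  "subgroup_of G H \<equiv> G\<lparr>carrier := H\<rparr>"

definition commensurable :: "('g, 'x) monoid_scheme \<Rightarrow> 'g set \<Rightarrow> 'g set \<Rightarrow> bool" where
  "commensurable G H H' \<longleftrightarrow>
     finite (rcosets\<^bsub>subgroup_of G H\<^esub> (H \<inter> H')) \<and> finite (rcosets\<^bsub>subgroup_of G H'\<^esub> (H \<inter> H'))"

definition arithmetic_subgroup ::
  "'k::field set \<Rightarrow> ('k \<Rightarrow> int) \<Rightarrow> ('k ^ 'n ^ 'n) set \<Rightarrow> bool" where
  "arithmetic_subgroup F v \<Gamma> \<longleftrightarrow>
     subgroup \<Gamma> SL_group \<and> commensurable SL_group \<Gamma> (SL_over (regular_outside F v))"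

text \<open>\<open>group.ord\<close> is \<open>0\<close> exactly on the elements of infinite order.\<close>

definition without_p'_torsion :: "nat \<Rightarrow> ('g, 'x) monoid_scheme \<Rightarrow> 'g set \<Rightarrow> bool" where
  "without_p'_torsion p G \<Gamma> \<longleftrightarrow>
     (\<forall>\<gamma>\<in>\<Gamma>. group.ord G \<gamma> \<noteq> 0 \<longrightarrow> (\<exists>k. group.ord G \<gamma> = p ^ k))"


section \<open>Cochain complexes of abelian groups\<close>

text \<open>
  Abelian groups are written multiplicatively, as in HOL-Algebra; in particular the multiple
  \<open>m x\<close> is the power \<open>x [^] m\<close>.
\<close>

definition p_invertible :: "nat \<Rightarrow> ('r, 'x) monoid_scheme \<Rightarrow> bool" where
  "p_invertible p R \<longleftrightarrow>
     (\<exists>\<psi>\<in>hom R R. \<forall>x\<in>carrier R. \<psi> (x [^]\<^bsub>R\<^esub> p) = x \<and> (\<psi> x) [^]\<^bsub>R\<^esub> p = x)"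

definition coboundaries :: "(nat \<Rightarrow> 'c monoid) \<Rightarrow> (nat \<Rightarrow> 'c \<Rightarrow> 'c) \<Rightarrow> nat \<Rightarrow> 'c set" where
  "coboundaries C d q = (if q = 0 then {\<one>\<^bsub>C 0\<^esub>} else d (q - 1) ` carrier (C (q - 1)))"

definition cohomology :: "(nat \<Rightarrow> 'c monoid) \<Rightarrow> (nat \<Rightarrow> 'c \<Rightarrow> 'c) \<Rightarrow> nat \<Rightarrow> 'c set monoid" where
  "cohomology C d q = subgroup_of (C q) (kernel (C q) (C (Suc q)) (d q)) Mod coboundaries C d q"

text \<open>
  The map \<open>G Mod N \<Rightarrow> G' Mod N'\<close> induced by a homomorphism \<open>\<phi>\<close> from \<open>G\<close> to \<open>G'\<close> with
  \<open>\<phi> ` N \<subseteq> N'\<close>: all members of the union are then equal.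
\<close>

definition quot_map ::
  "('b, 'x) monoid_scheme \<Rightarrow> 'b set \<Rightarrow> ('a \<Rightarrow> 'b) \<Rightarrow> 'a set \<Rightarrow> 'b set" where
  "quot_map G' N' \<phi> Y = (\<Union>x\<in>Y. N' #>\<^bsub>G'\<^esub> \<phi> x)"

definition cohomology_map ::
  "(nat \<Rightarrow> 'c monoid) \<Rightarrow> (nat \<Rightarrow> 'c \<Rightarrow> 'c) \<Rightarrow> nat \<Rightarrow> ('b \<Rightarrow> 'c) \<Rightarrow> 'b set \<Rightarrow> 'c set" where
  "cohomology_map C' d' q \<phi> = quot_map (C' q) (coboundaries C' d' q) \<phi>"

definition omit :: "nat \<Rightarrow> 'a list \<Rightarrow> 'a list" where
  "omit i xs = take i xs @ drop (Suc i) xs"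


section \<open>Group cohomology\<close>

text \<open>
  Cohomology of the group \<open>G\<close> with values in the \<open>G\<close>-module \<open>M\<close> (with action \<open>act\<close>), computed by
  the homogeneous cochains, that is, by equivariant functions on \<open>(q+1)\<close>-tuples of elements of \<open>G\<close>.
\<close>

definition group_tuples :: "('g, 'x) monoid_scheme \<Rightarrow> nat \<Rightarrow> 'g list set" where
  "group_tuples G q = {gs. length gs = Suc q \<and> set gs \<subseteq> carrier G}"

definition group_cochains ::
  "('g, 'x) monoid_scheme \<Rightarrow> 'm monoid \<Rightarrow> ('g \<Rightarrow> 'm \<Rightarrow> 'm) \<Rightarrow> nat \<Rightarrow> ('g list \<Rightarrow> 'm) monoid" where
  "group_cochains G M act q =
     subgroup_of (product_group (group_tuples G q) (\<lambda>_. M))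
       {f \<in> group_tuples G q \<rightarrow>\<^sub>E carrier M.
          \<forall>g\<in>carrier G. \<forall>gs\<in>group_tuples G q. f (map (\<lambda>h. g \<otimes>\<^bsub>G\<^esub> h) gs) = act g (f gs)}"

definition group_coboundary ::
  "('g, 'x) monoid_scheme \<Rightarrow> 'm monoid \<Rightarrow> nat \<Rightarrow> ('g list \<Rightarrow> 'm) \<Rightarrow> ('g list \<Rightarrow> 'm)" where
  "group_coboundary G M q f =
     (\<lambda>gs\<in>group_tuples G (Suc q).
        \<Otimes>\<^bsub>M\<^esub>i\<in>{..Suc q}. f (omit i gs) [^]\<^bsub>M\<^esub> ((-1) ^ i :: int))"

definition group_cohomology ::
  "('g, 'x) monoid_scheme \<Rightarrow> 'm monoid \<Rightarrow> ('g \<Rightarrow> 'm \<Rightarrow> 'm) \<Rightarrow> nat \<Rightarrow> ('g list \<Rightarrow> 'm) set monoid" where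
  "group_cohomology G M act = cohomology (group_cochains G M act) (group_coboundary G M)"

abbreviation trivial_action :: "'g \<Rightarrow> 'm \<Rightarrow> 'm" where
  "trivial_action \<equiv> (\<lambda>g m. m)"

definition group_cohomology_coeff ::
  "('g, 'x) monoid_scheme \<Rightarrow> 's monoid \<Rightarrow> ('g \<Rightarrow> 's \<Rightarrow> 's) \<Rightarrow> ('r \<Rightarrow> 's) \<Rightarrow> nat
     \<Rightarrow> ('g list \<Rightarrow> 'r) set \<Rightarrow> ('g list \<Rightarrow> 's) set" where
  "group_cohomology_coeff G S act h q =
     cohomology_map (group_cochains G S act) (group_coboundary G S) q
       (\<lambda>f. restrict (h \<circ> f) (group_tuples G q))"

definition group_cohomology_res ::
  "('g, 'x) monoid_scheme \<Rightarrow> 'm monoid \<Rightarrow> ('g \<Rightarrow> 'm \<Rightarrow> 'm) \<Rightarrow> nat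
     \<Rightarrow> ('g list \<Rightarrow> 'm) set \<Rightarrow> ('g list \<Rightarrow> 'm) set" where
  "group_cohomology_res G' M act q =
     cohomology_map (group_cochains G' M act) (group_coboundary G' M) q
       (\<lambda>f. restrict f (group_tuples G' q))"


section \<open>Oriented chains and invariant cochains of a simplicial complex\<close>

text \<open>
  A simplicial complex is given by its set \<open>\<Delta>\<close> of simplices, which are finite nonempty sets of
  vertices. The orientation \<open>[v\<^sub>0, \<dots>, v\<^sub>q]\<close> is the class of a list modulo even permutations.
\<close>

definition orientation :: "'v list \<Rightarrow> 'v list set" where
  "orientation vs = {permute_list \<pi> vs | \<pi>. \<pi> permutes {..<length vs} \<and> evenperm \<pi>}"

definition oriented_simplices :: "'v set set \<Rightarrow> nat \<Rightarrow> 'v list set set" where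
  "oriented_simplices \<Delta> q =
     {orientation vs | vs. length vs = Suc q \<and> distinct vs \<and> set vs \<in> \<Delta>}"

definition underlying_simplex :: "'v list set \<Rightarrow> 'v set" where
  "underlying_simplex \<sigma> = \<Union> (set ` \<sigma>)"

definition orientation_relations :: "'v set set \<Rightarrow> nat \<Rightarrow> ('v list set \<Rightarrow>\<^sub>0 int) set" where
  "orientation_relations \<Delta> q =
     generate (free_Abelian_group (oriented_simplices \<Delta> q))
       {frag_of \<sigma> + frag_of \<tau> | \<sigma> \<tau>. q \<noteq> 0 \<and>
          \<sigma> \<in> oriented_simplices \<Delta> q \<and> \<tau> \<in> oriented_simplices \<Delta> q \<and>
          \<sigma> \<noteq> \<tau> \<and> underlying_simplex \<sigma> = underlying_simplex \<tau>}"

definition oriented_chains :: "'v set set \<Rightarrow> nat \<Rightarrow> ('v list set \<Rightarrow>\<^sub>0 int) set monoid" where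
  "oriented_chains \<Delta> q =
     free_Abelian_group (oriented_simplices \<Delta> q) Mod orientation_relations \<Delta> q"

text \<open>
  Modulo the orientation relations, \<open>simplex_boundary\<close> does not depend on the chosen ordering.
  The map \<open>oriented_boundary \<Delta> q\<close> is \<open>\<partial>\<^bsub>q+1\<^esub>\<close>, from \<open>(q+1)\<close>-chains to \<open>q\<close>-chains.
\<close>

definition simplex_boundary :: "'v list set \<Rightarrow> ('v list set \<Rightarrow>\<^sub>0 int)" where
  "simplex_boundary \<sigma> =
     (let vs = (SOME vs. vs \<in> \<sigma>)
      in \<Sum>i<length vs. frag_cmul ((-1) ^ i) (frag_of (orientation (omit i vs))))"

definition oriented_boundary ::
  "'v set set \<Rightarrow> nat \<Rightarrow> ('v list set \<Rightarrow>\<^sub>0 int) set \<Rightarrow> ('v list set \<Rightarrow>\<^sub>0 int) set" where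
  "oriented_boundary \<Delta> q =
     quot_map (free_Abelian_group (oriented_simplices \<Delta> q)) (orientation_relations \<Delta> q)
       (frag_extend simplex_boundary)"

definition oriented_chain_map ::
  "'v set set \<Rightarrow> nat \<Rightarrow> ('v \<Rightarrow> 'v) \<Rightarrow> ('v list set \<Rightarrow>\<^sub>0 int) set \<Rightarrow> ('v list set \<Rightarrow>\<^sub>0 int) set" where
  "oriented_chain_map \<Delta> q \<alpha> =
     quot_map (free_Abelian_group (oriented_simplices \<Delta> q)) (orientation_relations \<Delta> q)
       (frag_extend (\<lambda>\<sigma>. frag_of (map \<alpha> ` \<sigma>)))"

text \<open>
  \<open>C\<^sup>q(R) = Hom(\<int>[\<Delta>\<^sup>*\<^sub>q], R)\<close>. There are no simplices of dimension \<open>q > dim \<Delta>\<close>, so the complex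
  vanishes there.
\<close>

definition Hom_group :: "('a, 'x) monoid_scheme \<Rightarrow> 'r monoid \<Rightarrow> ('a \<Rightarrow> 'r) monoid" where
  "Hom_group N R =
     subgroup_of (product_group (carrier N) (\<lambda>_. R)) (hom N R \<inter> extensional (carrier N))"

definition simplicial_cochains ::
  "'v set set \<Rightarrow> 'r monoid \<Rightarrow> nat \<Rightarrow> (('v list set \<Rightarrow>\<^sub>0 int) set \<Rightarrow> 'r) monoid" where
  "simplicial_cochains \<Delta> R q = Hom_group (oriented_chains \<Delta> q) R"

definition simplicial_coboundary ::
  "'v set set \<Rightarrow> nat \<Rightarrow> (('v list set \<Rightarrow>\<^sub>0 int) set \<Rightarrow> 'r) \<Rightarrow> (('v list set \<Rightarrow>\<^sub>0 int) set \<Rightarrow> 'r)" where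
  "simplicial_coboundary \<Delta> q f =
     restrict (f \<circ> oriented_boundary \<Delta> q) (carrier (oriented_chains \<Delta> (Suc q)))"

text \<open>Below, \<open>act\<close> is an action of \<open>G\<close> on the vertices of \<open>\<Delta>\<close>.\<close>

definition invariant_cochains ::
  "('g, 'x) monoid_scheme \<Rightarrow> ('g \<Rightarrow> 'v \<Rightarrow> 'v) \<Rightarrow> 'v set set \<Rightarrow> 'r monoid \<Rightarrow> nat
     \<Rightarrow> (('v list set \<Rightarrow>\<^sub>0 int) set \<Rightarrow> 'r) monoid" where
  "invariant_cochains G act \<Delta> R q =
     subgroup_of (simplicial_cochains \<Delta> R q)
       {f \<in> carrier (simplicial_cochains \<Delta> R q). \<forall>\<gamma>\<in>carrier G.
          restrict (f \<circ> oriented_chain_map \<Delta> q (act (inv\<^bsub>G\<^esub> \<gamma>))) (carrier (oriented_chains \<Delta> q)) = f}"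

definition invariant_cohomology ::
  "('g, 'x) monoid_scheme \<Rightarrow> ('g \<Rightarrow> 'v \<Rightarrow> 'v) \<Rightarrow> 'v set set \<Rightarrow> 'r monoid \<Rightarrow> nat
     \<Rightarrow> (('v list set \<Rightarrow>\<^sub>0 int) set \<Rightarrow> 'r) set monoid" where
  "invariant_cohomology G act \<Delta> R =
     cohomology (invariant_cochains G act \<Delta> R) (simplicial_coboundary \<Delta>)"

text \<open>
  Functoriality in the coefficients, and restriction along \<open>G' \<subseteq> G\<close>, which is induced by the
  inclusion of the \<open>G\<close>-invariant cochains in the \<open>G'\<close>-invariant ones.
\<close>

definition invariant_cohomology_coeff ::
  "('g, 'x) monoid_scheme \<Rightarrow> ('g \<Rightarrow> 'v \<Rightarrow> 'v) \<Rightarrow> 'v set set \<Rightarrow> 's monoid \<Rightarrow> ('r \<Rightarrow> 's) \<Rightarrow> nat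
     \<Rightarrow> (('v list set \<Rightarrow>\<^sub>0 int) set \<Rightarrow> 'r) set \<Rightarrow> (('v list set \<Rightarrow>\<^sub>0 int) set \<Rightarrow> 's) set" where
  "invariant_cohomology_coeff G act \<Delta> S h q =
     cohomology_map (invariant_cochains G act \<Delta> S) (simplicial_coboundary \<Delta>) q
       (\<lambda>f. restrict (h \<circ> f) (carrier (oriented_chains \<Delta> q)))"

definition invariant_cohomology_res ::
  "('g, 'x) monoid_scheme \<Rightarrow> ('g \<Rightarrow> 'v \<Rightarrow> 'v) \<Rightarrow> 'v set set \<Rightarrow> 'r monoid \<Rightarrow> nat
     \<Rightarrow> (('v list set \<Rightarrow>\<^sub>0 int) set \<Rightarrow> 'r) set \<Rightarrow> (('v list set \<Rightarrow>\<^sub>0 int) set \<Rightarrow> 'r) set" where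
  "invariant_cohomology_res G' act \<Delta> R q =
     cohomology_map (invariant_cochains G' act \<Delta> R) (simplicial_coboundary \<Delta>) q (\<lambda>f. f)"


section \<open>The Bruhat-Tits building of the special linear group\<close>

text \<open>
  Lattices are the submodules spanned over the valuation ring by a basis (the columns of \<open>b\<close>).
  The vertices of the building are the homothety classes of lattices, and the simplices are the
  sets of classes of lattices \<open>L\<^sub>0 \<supset> L\<^sub>1 \<supset> \<dots> \<supset> L\<^sub>q \<supset> \<pi> L\<^sub>0\<close> (strict inclusions), where \<open>\<pi>\<close> is a uniformiser.
\<close>

type_synonym ('l, 'n) vertex = "('l ^ 'n) set set"

definition valuation_lattice :: "('l::field \<Rightarrow> int) \<Rightarrow> ('l ^ 'n) set \<Rightarrow> bool" where
  "valuation_lattice w L \<longleftrightarrow>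
     (\<exists>b :: 'l ^ 'n ^ 'n. invertible b \<and> L = {b *v x | x. \<forall>i. x $ i \<in> valuation_ring w})"

definition homothety_class :: "('l::field ^ 'n) set \<Rightarrow> ('l, 'n::finite) vertex" where
  "homothety_class L = {(*s) c ` L | c. c \<noteq> 0}"

definition building :: "('l::field \<Rightarrow> int) \<Rightarrow> ('l, 'n::finite) vertex set set" where
  "building w =
     {homothety_class ` set Ls | Ls.
        Ls \<noteq> [] \<and> (\<forall>L\<in>set Ls. valuation_lattice w L) \<and> sorted_wrt (\<supset>) Ls \<and>
        (\<exists>\<pi>. w \<pi> = 1 \<and> (*s) \<pi> ` hd Ls \<subset> last Ls)}"

definition building_action ::
  "('k \<Rightarrow> 'l::field) \<Rightarrow> 'k ^ 'n ^ 'n \<Rightarrow> ('l, 'n) vertex \<Rightarrow> ('l, 'n::finite) vertex" where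
  "building_action \<iota> g V = (\<lambda>L. (*v) (map_matrix \<iota> g) ` L) ` V"

end

theory Submission
  imports Defs
begin

text \<open>
  Invert \<open>p\<close> in the coefficients. A lattice \<open>L\<close> is pushed to a cube \<open>\<pi>\<^sup>k O\<^sup>n\<close> by adding smaller
  and smaller multiples of the standard lattice, and prism operators along these steps contract
  the chains of the building. A vertex stabiliser in \<open>\<Gamma>\<close> is finite, since functions with
  bounded poles at \<open>\<infinity>\<close> and none elsewhere form a finite set; without \<open>p'\<close>-torsion its order is a
  power of \<open>p\<close>, so one can average over it. Hence the chains of the building and the chains on
  tuples of elements of \<open>\<Gamma>\<close> are joined by equivariant chain maps in both directions, which are
  mutually inverse up to equivariant homotopy. Elements of determinant \<open>1\<close> preserve the type of
  a vertex, so listing the vertices of a simplex by type removes the signs of the orientations.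
\<close>

section \<open>Discrete valuations\<close>

text \<open>The contraction of the building is not compatible with the group, which moves the
  standard lattice. Acyclicity is therefore used only to fill single cycles, and equivariance is
  restored when a filling is assigned to a basis element: it is transported by the first entry of a
  tuple, on which the group acts freely, or averaged over the elements that carry an orbit
  representative to a simplex. The averages are what forces Z[1/p] on the chains. A group in which
  \<open>p\<close> is invertible is a module over this ring, so its cochains can be evaluated on
  such chains. The finiteness of functions with bounded poles rests on two facts. Counting
  polynomials of bounded degree shows that residue fields are finite. A function that vanishes at
  the given place and is regular elsewhere is zero, since its inverse would be nonconstant and would
  vanish at some place, where the function itself has a pole. All complexes are augmented by the
  empty list, so that the choices in degree zero are fillings like all others.\<close>

locale discretely_valued =
  fixes v :: "'a::field \<Rightarrow> int"
  assumes disc_val: "discrete_valuation v"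
begin

lemma val_zero [simp]: "v 0 = 0"
  using disc_val by (simp add: discrete_valuation_def)

lemma val_mult: "x \<noteq> 0 \<Longrightarrow> y \<noteq> 0 \<Longrightarrow> v (x * y) = v x + v y"
  using disc_val by (simp add: discrete_valuation_def)

lemma val_add: "x \<noteq> 0 \<Longrightarrow> y \<noteq> 0 \<Longrightarrow> x + y \<noteq> 0 \<Longrightarrow> min (v x) (v y) \<le> v (x + y)"
  using disc_val unfolding discrete_valuation_def by blast

lemma val_one [simp]: "v 1 = 0"
  using val_mult[of 1 1] by simp

lemma val_minus_one: "v (- 1) = 0"
  using val_mult[of "- 1" "- 1"] by simp

lemma val_uminus [simp]: "v (- x) = v x"
  using val_mult[of "- 1" x] by (cases "x = 0") (auto simp: val_minus_one)

lemma val_inverse: "v (inverse x) = - v x"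
  using val_mult[of x "inverse x"] by (cases "x = 0") auto

lemma val_divide: "x \<noteq> 0 \<Longrightarrow> y \<noteq> 0 \<Longrightarrow> v (x / y) = v x - v y"
  by (simp add: divide_inverse val_mult val_inverse)

lemma val_power: "x \<noteq> 0 \<Longrightarrow> v (x ^ n) = int n * v x"
  by (induction n) (simp_all add: val_mult algebra_simps)

lemma val_power_int: "x \<noteq> 0 \<Longrightarrow> v (x powi k) = k * v x"
  by (cases k rule: int_cases2) (simp_all add: val_power val_inverse power_int_minus)

lemma val_ge_zero [simp]: "val_ge v N 0"
  by (simp add: val_ge_def)

lemma val_ge_add: "val_ge v N x \<Longrightarrow> val_ge v N y \<Longrightarrow> val_ge v N (x + y)"
  using val_add[of x y] unfolding val_ge_def by fastforce

lemma val_ge_uminus: "val_ge v N (- x) \<longleftrightarrow> val_ge v N x"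
  by (simp add: val_ge_def)

lemma val_ge_diff: "val_ge v N x \<Longrightarrow> val_ge v N y \<Longrightarrow> val_ge v N (x - y)"
  using val_ge_add[of N x "- y"] by (simp add: val_ge_uminus)

lemma val_ge_mult: "val_ge v M x \<Longrightarrow> val_ge v N y \<Longrightarrow> val_ge v (M + N) (x * y)"
  by (auto simp: val_ge_def val_mult)

lemma val_ge_sum: "(\<And>i. i \<in> A \<Longrightarrow> val_ge v N (f i)) \<Longrightarrow> val_ge v N (sum f A)"
  by (induction A rule: infinite_finite_induct) (auto intro: val_ge_add)

lemma val_ge_mono: "val_ge v N x \<Longrightarrow> M \<le> N \<Longrightarrow> val_ge v M x"
  by (auto simp: val_ge_def)

lemma uniformiser_exists: "\<exists>t. t \<noteq> 0 \<and> v t = 1"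
  using disc_val by (auto simp: discrete_valuation_def)

end


section \<open>Bounded regular functions\<close>

lemma ring_of_type_simps:
  "carrier (ring_of_type_algebra :: 'k::field ring) = UNIV"
  "monoid.mult (ring_of_type_algebra :: 'k ring) = (*)"
  "one (ring_of_type_algebra :: 'k ring) = 1"
  "ring.zero (ring_of_type_algebra :: 'k ring) = 0"
  "add (ring_of_type_algebra :: 'k ring) = (+)"
  by (simp_all add: ring_of_type_algebra_def)

lemma a_inv_ring_of_type: "\<ominus>\<^bsub>ring_of_type_algebra\<^esub> x = - (x :: 'k::field)"
proof -
  interpret K: Ring.field "ring_of_type_algebra :: 'k ring" by (rule field_from_type_algebra)
  show ?thesis using K.minus_equality[of "- x" x] by (simp add: ring_of_type_simps)
qed

lemma m_inv_ring_of_type: "x \<noteq> 0 \<Longrightarrow> inv\<^bsub>ring_of_type_algebra\<^esub> x = inverse (x :: 'k::field)"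
proof -
  interpret K: Ring.field "ring_of_type_algebra :: 'k ring" by (rule field_from_type_algebra)
  show "x \<noteq> 0 \<Longrightarrow> ?thesis" using K.comm_inv_char[of x "inverse x"] by (simp add: ring_of_type_simps)
qed

text \<open>\<open>F\<close> is a subset of the field and not a type, so the ring F[X] appears as a
  set of polynomials over the whole field.\<close>

definition polys :: "'k::comm_ring_1 set \<Rightarrow> 'k poly set" where
  "polys F = {P. \<forall>i. poly.coeff P i \<in> F}"

definition bounded_polys :: "'k::comm_ring_1 set \<Rightarrow> nat \<Rightarrow> 'k poly set" where
  "bounded_polys F n = {P \<in> polys F. \<forall>i\<ge>n. poly.coeff P i = 0}"

section \<open>Linear dependence over the polynomials in one function\<close>

locale constant_field =
  fixes F :: "'k::field set"
  assumes gff: "global_function_field F"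
begin

lemma subfield_F: "subfield F (ring_of_type_algebra :: 'k ring)"
  and finite_F: "finite F"
  using gff by (simp_all add: global_function_field_def Let_def)

lemma F_ring: "0 \<in> F" "1 \<in> F" "a \<in> F \<Longrightarrow> - a \<in> F" "a \<in> F \<Longrightarrow> b \<in> F \<Longrightarrow> a + b \<in> F"
  "a \<in> F \<Longrightarrow> b \<in> F \<Longrightarrow> a * b \<in> F"
  using subringE(2,3,5-7)[OF subfieldE(1)[OF subfield_F]]
  by (auto simp: ring_of_type_simps a_inv_ring_of_type)

lemma F_diff: "a \<in> F \<Longrightarrow> b \<in> F \<Longrightarrow> a - b \<in> F"
  using F_ring(4)[of a "- b"] F_ring(3) by simp

lemma F_sum: "(\<And>i. i \<in> A \<Longrightarrow> f i \<in> F) \<Longrightarrow> sum f A \<in> F"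
  by (induction A rule: infinite_finite_induct) (auto intro: F_ring)

lemma F_inverse: "a \<in> F \<Longrightarrow> inverse a \<in> F"
proof (cases "a = 0")
  case False
  interpret K: Ring.field "ring_of_type_algebra :: 'k ring" by (rule field_from_type_algebra)
  assume "a \<in> F"
  then show ?thesis
    using K.subfield_m_inv(1)[OF subfield_F, of a] False
    by (simp add: ring_of_type_simps m_inv_ring_of_type)
qed (simp add: F_ring)

lemma polys_ring: "0 \<in> polys F" "1 \<in> polys F" "P \<in> polys F \<Longrightarrow> - P \<in> polys F"
  "P \<in> polys F \<Longrightarrow> Q \<in> polys F \<Longrightarrow> P + Q \<in> polys F" "P \<in> polys F \<Longrightarrow> Q \<in> polys F \<Longrightarrow> P - Q \<in> polys F"
  "P \<in> polys F \<Longrightarrow> Q \<in> polys F \<Longrightarrow> P * Q \<in> polys F" "a \<in> F \<Longrightarrow> [:a:] \<in> polys F"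
  "a \<in> F \<Longrightarrow> P \<in> polys F \<Longrightarrow> pCons a P \<in> polys F"
  by (auto simp: polys_def F_ring F_diff coeff_mult coeff_pCons one_poly_def[symmetric] split: nat.split
      intro!: F_sum F_ring)

lemma bounded_polys_add:
  "P \<in> bounded_polys F n \<Longrightarrow> Q \<in> bounded_polys F n \<Longrightarrow> P + Q \<in> bounded_polys F n"
  "P \<in> bounded_polys F n \<Longrightarrow> Q \<in> bounded_polys F n \<Longrightarrow> P - Q \<in> bounded_polys F n"
  by (auto simp: bounded_polys_def polys_ring)

lemma bounded_polys_mult:
  assumes "P \<in> bounded_polys F m" "Q \<in> bounded_polys F n"
  shows "P * Q \<in> bounded_polys F (m + n)"
proof -
  have "poly.coeff (P * Q) i = 0" if "i \<ge> m + n" for i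
  proof -
    have "poly.coeff P j * poly.coeff Q (i - j) = 0" for j
      using assms that by (cases "j \<ge> m") (auto simp: bounded_polys_def)
    then show ?thesis unfolding coeff_mult by (intro sum.neutral) blast
  qed
  then show ?thesis using assms by (auto simp: bounded_polys_def polys_ring)
qed

lemma polys_bounded: "P \<in> polys F \<Longrightarrow> \<exists>n. P \<in> bounded_polys F n"
  by (auto simp: bounded_polys_def intro!: exI[of _ "Suc (Polynomial.degree P)"] coeff_eq_0)

lemma bounded_polys_mono: "P \<in> bounded_polys F m \<Longrightarrow> m \<le> n \<Longrightarrow> P \<in> bounded_polys F n"
  by (auto simp: bounded_polys_def)

lemma card_bounded_polys: "finite (bounded_polys F n) \<and> card (bounded_polys F n) = card F ^ n"
proof (induction n)
  case 0
  have "bounded_polys F 0 = {0}"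
    by (auto simp: bounded_polys_def polys_ring intro: poly_eqI)
  then show ?case by simp
next
  case (Suc n)
  have "bounded_polys F (Suc n) = (\<lambda>(a, P). pCons a P) ` (F \<times> bounded_polys F n)" (is "_ = ?f ` ?A")
  proof (intro equalityI subsetI)
    fix P assume P: "P \<in> bounded_polys F (Suc n)"
    obtain a Q where PQ: "P = pCons a Q" by (cases P) auto
    have "a = poly.coeff P 0" "\<And>i. poly.coeff Q i = poly.coeff P (Suc i)" by (simp_all add: PQ)
    then have "a \<in> F" "\<And>i. poly.coeff Q i \<in> F" "\<And>i. i \<ge> n \<Longrightarrow> poly.coeff Q i = 0"
      using P unfolding bounded_polys_def polys_def by auto
    then show "P \<in> ?f ` ?A" using PQ by (auto simp: bounded_polys_def polys_def)
  qed (auto simp: bounded_polys_def polys_ring coeff_pCons split: nat.split)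
  moreover have "inj_on ?f ?A" by (auto simp: inj_on_def)
  ultimately show ?case using Suc finite_F
    by (simp add: card_image card_cartesian_product)
qed

lemma card_F: "card F \<ge> 2"
proof -
  have "card {0, 1 :: 'k} \<le> card F" using finite_F F_ring by (intro card_mono) auto
  then show ?thesis by simp
qed

text \<open>The constant field is algebraically closed in the function field, so every
  \<open>y\<close> outside \<open>F\<close> is transcendental over it. This makes F[y] a polynomial
  ring when a zero of \<open>y\<close> is sought.\<close>

lemma transcendental_nonconstant:
  assumes y: "y \<notin> F" and P: "P \<in> polys F" "P \<noteq> 0"
  shows "poly P y \<noteq> 0"
proof
  assume "poly P y = 0"
  let ?K = "ring_of_type_algebra :: 'k ring"
  interpret K: Ring.field ?K by (rule field_from_type_algebra)
  \<comment> \<open>HOL-Algebra lists coefficients from the leading one down, the polynomial type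
    from the constant one up; hence the reversal.\<close>
  have eval: "K.eval (rev xs) y = poly (Poly xs) y" for xs
    by (induction xs) (simp_all add: K.eval_append_aux ring_of_type_simps)
  have "set (rev (coeffs P)) \<subseteq> F" using P by (auto simp: polys_def coeffs_def)
  moreover have "hd (rev (coeffs P)) \<noteq> 0" using P by (simp add: hd_rev last_coeffs_eq_coeff_degree)
  ultimately have "rev (coeffs P) \<in> carrier (F[X]\<^bsub>?K\<^esub>)"
    by (simp add: univ_poly_carrier[symmetric] polynomial_def ring_of_type_simps)
  moreover have "K.eval (rev (coeffs P)) y = 0" using eval[of "coeffs P"] \<open>poly P y = 0\<close> by simp
  ultimately have "\<not> (K.transcendental over F) y"
    using K.algebraicI[of "rev (coeffs P)" F y] P by (simp add: over_def ring_of_type_simps)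
  then show False
    using gff y by (auto simp: global_function_field_def Let_def over_def ring_of_type_simps)
qed

lemma generate_field_fraction:
  assumes "a \<in> generate_field (ring_of_type_algebra :: 'k ring) (insert x F)"
  shows "\<exists>P\<in>polys F. \<exists>Q\<in>polys F. poly Q x \<noteq> 0 \<and> a = poly P x / poly Q x"
  using assms
proof induction
  case one
  show ?case by (intro bexI[of _ 1]) (auto simp: polys_ring ring_of_type_simps)
next
  case (incl h)
  have "[:0, 1:] \<in> polys F" using F_ring by (simp add: polys_ring)
  then show ?case using incl polys_ring(2)
    by (metis F_ring(1) div_by_1 insertE mult.right_neutral poly_1 poly_pCons poly_0 polys_ring(7) add_0 mult_zero_right add.right_neutral zero_neq_one)
next
  case (a_inv h)
  then show ?case by (metis a_inv_ring_of_type minus_divide_left poly_minus polys_ring(3))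
next
  case (m_inv h)
  then obtain P Q where "P \<in> polys F" "Q \<in> polys F" "poly Q x \<noteq> 0" "h = poly P x / poly Q x" by blast
  then show ?case using m_inv(2)
    by (intro bexI[of _ Q] bexI[of _ P]) (auto simp: ring_of_type_simps m_inv_ring_of_type)
next
  case (eng_add h1 h2)
  then obtain P Q P' Q' where "P \<in> polys F" "Q \<in> polys F" "poly Q x \<noteq> 0" "h1 = poly P x / poly Q x"
    "P' \<in> polys F" "Q' \<in> polys F" "poly Q' x \<noteq> 0" "h2 = poly P' x / poly Q' x" by blast
  moreover from this have "h1 + h2 = poly (P * Q' + P' * Q) x / poly (Q * Q') x"
    by (simp add: add_frac_eq)
  ultimately show ?case
    by (intro bexI[of _ "P * Q' + P' * Q"] bexI[of _ "Q * Q'"])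
      (auto simp: ring_of_type_simps polys_ring)
next
  case (eng_mult h1 h2)
  then obtain P Q P' Q' where "P \<in> polys F" "Q \<in> polys F" "poly Q x \<noteq> 0" "h1 = poly P x / poly Q x"
    "P' \<in> polys F" "Q' \<in> polys F" "poly Q' x \<noteq> 0" "h2 = poly P' x / poly Q' x" by blast
  moreover from this have "h1 * h2 = poly (P * P') x / poly (Q * Q') x" by simp
  ultimately show ?case
    by (intro bexI[of _ "P * P'"] bexI[of _ "Q * Q'"])
      (auto simp: ring_of_type_simps polys_ring)
qed

text \<open>A finite spanning family over F(x), with the coordinates of each element brought to a
  common denominator \<open>Q\<close>. The numerators in F[x] can be truncated by degree, which
  turns finite dimension into finite sets that can be counted.\<close>

lemma finite_over_rational_functions:
  "\<exists>x d (e :: nat \<Rightarrow> 'k). \<forall>a. \<exists>P Q. (\<forall>j<d. P j \<in> polys F) \<and> Q \<in> polys F \<and> poly Q x \<noteq> 0 \<and>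
     poly Q x * a = (\<Sum>j<d. poly (P j) x * e j)"
proof -
  let ?K = "ring_of_type_algebra :: 'k ring"
  interpret K: Ring.field ?K by (rule field_from_type_algebra)
  obtain x where "K.finite_dimension (generate_field ?K (insert x F)) (carrier ?K)"
    using gff by (auto simp: global_function_field_def Let_def)
  then obtain d where d: "K.dimension d (generate_field ?K (insert x F)) (carrier ?K)"
    by (auto simp: K.finite_dimension_def)
  let ?rep = "\<lambda>d e a. \<exists>P Q. (\<forall>j<d. P j \<in> polys F) \<and> Q \<in> polys F \<and> poly Q x \<noteq> 0 \<and>
     poly Q x * a = (\<Sum>j<d. poly (P j) x * e j)"
  have "\<exists>e :: nat \<Rightarrow> 'k. \<forall>a\<in>E. ?rep n e a" if "K.dimension n L E" "L = generate_field ?K (insert x F)" for n L E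
    using that
  proof (induction rule: K.dimension.induct)
    case (zero_dim L)
    have "?rep 0 e 0" for e :: "nat \<Rightarrow> 'k" by (intro exI[of _ "\<lambda>_. 0"] exI[of _ 1]) (simp add: polys_ring)
    then show ?case by (simp add: ring_of_type_simps)
  next
    case (Suc_dim u E n L)
    then obtain e where e: "\<forall>a\<in>E. ?rep n e a" by blast
    have "?rep (Suc n) (e(n := u)) a" if a_in: "a \<in> K.line_extension L u E" for a
    proof -
      obtain k b where k: "k \<in> L" and b: "b \<in> E" and a: "a = k * u + b"
        using a_in K.line_extension_mem_iff by (auto simp: ring_of_type_simps)
      obtain P Q where PQ: "P \<in> polys F" "Q \<in> polys F" "poly Q x \<noteq> 0" "k = poly P x / poly Q x"
        using generate_field_fraction k Suc_dim by blast
      obtain P' Q' where PQ': "\<forall>j<n. P' j \<in> polys F" "Q' \<in> polys F" "poly Q' x \<noteq> 0"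
          "poly Q' x * b = (\<Sum>j<n. poly (P' j) x * e j)"
        using e b by blast
      have "poly (Q * Q') x * a = poly (P * Q') x * u + poly Q x * (poly Q' x * b)"
        using PQ by (simp add: a field_simps)
      also have "\<dots> = (\<Sum>j<Suc n. poly (((\<lambda>j. Q * P' j)(n := P * Q')) j) x * (e(n := u)) j)"
        unfolding PQ'(4) by (simp add: sum_distrib_left mult.assoc)
      finally show ?thesis using PQ PQ'
        by (intro exI[of _ "(\<lambda>j. Q * P' j)(n := P * Q')"] exI[of _ "Q * Q'"])
          (auto simp: polys_ring less_Suc_eq)
    qed
    then show ?case by blast
  qed
  from this[OF d refl] show ?thesis by (auto simp: ring_of_type_simps)
qed

text \<open>
  Pigeonhole: after clearing denominators, the combinations with coefficients of degree
  \<open>< N\<close> take at most \<open>q ^ (d (C' + C N))\<close> values.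
\<close>

lemma dependent_over_polys:
  "\<exists>m. \<forall>z :: nat \<Rightarrow> 'k. \<exists>c. (\<forall>i<m. c i \<in> polys F) \<and> (\<exists>i<m. c i \<noteq> 0) \<and> (\<Sum>i<m. poly (c i) y * z i) = 0"
proof -
  obtain x d and e :: "nat \<Rightarrow> 'k" where rep: "\<And>a. \<exists>P Q. (\<forall>j<d. P j \<in> polys F) \<and> Q \<in> polys F \<and> poly Q x \<noteq> 0 \<and>
     poly Q x * a = (\<Sum>j<d. poly (P j) x * e j)"
    using finite_over_rational_functions by metis
  \<comment> \<open>\<open>V n\<close> consists of the elements with denominator 1 and numerators of
    degree below \<open>n\<close>. It is finite, and every element lies in some \<open>V n\<close>
    after multiplication by a denominator.\<close>
  define V where "V n = (\<lambda>P. \<Sum>j<d. poly (P j) x * e j) ` (PiE {..<d} (\<lambda>_. bounded_polys F n))" for n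
  have VI: "(\<Sum>j<d. poly (P j) x * e j) \<in> V n" if "\<And>j. j < d \<Longrightarrow> P j \<in> bounded_polys F n" for P n
    unfolding V_def using that by (intro image_eqI[of _ _ "restrict P {..<d}"]) auto
  have VE: "\<exists>P. (\<forall>j<d. P j \<in> bounded_polys F n) \<and> a = (\<Sum>j<d. poly (P j) x * e j)" if "a \<in> V n" for a n
    using that unfolding V_def by auto
  have V_finite: "finite (V n)" and V_card: "card (V n) \<le> card F ^ (n * d)" for n
  proof -
    show "finite (V n)" unfolding V_def by (intro finite_imageI finite_PiE) (auto simp: card_bounded_polys)
    have "card (V n) \<le> card (PiE {..<d} (\<lambda>_. bounded_polys F n))"
      unfolding V_def by (intro card_image_le finite_PiE) (auto simp: card_bounded_polys)
    then show "card (V n) \<le> card F ^ (n * d)"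
      by (simp add: card_PiE card_bounded_polys power_mult)
  qed
  have V_add: "a + b \<in> V n" if "a \<in> V n" "b \<in> V n" for a b n
    using VE[OF that(1)] VE[OF that(2)]
    by clarify (auto simp flip: sum.distrib distrib_right poly_add intro!: VI bounded_polys_add)
  have V_zero: "0 \<in> V n" for n
    using VI[of "\<lambda>_. 0" n] by (simp add: bounded_polys_def polys_ring)
  have V_sum: "(\<And>i. i \<in> A \<Longrightarrow> f i \<in> V n) \<Longrightarrow> sum f A \<in> V n" for f :: "nat \<Rightarrow> 'k" and A n
    by (induction A rule: infinite_finite_induct) (auto simp: V_zero V_add)
  have V_mult: "poly P x * a \<in> V (k + n)" if "P \<in> bounded_polys F k" "a \<in> V n" for P a k n
    using VE[OF that(2)] that(1)
    by clarify (auto simp: sum_distrib_left simp flip: mult.assoc poly_mult intro!: VI bounded_polys_mult)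
  have V_mono: "a \<in> V n" if "a \<in> V m" "m \<le> n" for a m n
    using VE[OF that(1)] that(2) by (auto intro!: VI intro: bounded_polys_mono)
  have V_F: "c * a \<in> V n" if "c \<in> F" and aV: "a \<in> V n" for c a n
  proof -
    have cP: "[:c:] * P \<in> bounded_polys F n" if "P \<in> bounded_polys F n" for P
      using that \<open>c \<in> F\<close> by (auto simp: bounded_polys_def polys_def F_ring)
    obtain P where P: "\<forall>j<d. P j \<in> bounded_polys F n" "a = (\<Sum>j<d. poly (P j) x * e j)"
      using VE[OF aV] by blast
    have "c * a = (\<Sum>j<d. poly ([:c:] * P j) x * e j)"
      by (simp add: P(2) sum_distrib_left mult.assoc)
    also have "\<dots> \<in> V n" by (rule VI, rule cP) (use P(1) in auto)
    finally show ?thesis .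
  qed
  have denom: "\<exists>D\<in>polys F. \<exists>n. poly D x \<noteq> 0 \<and> (\<forall>i<l. poly D x * a i \<in> V n)" for a :: "nat \<Rightarrow> 'k" and l
  proof (induction l)
    case 0
    show ?case by (intro bexI[of _ 1]) (auto simp: polys_ring)
  next
    case (Suc l)
    then obtain D n where D: "D \<in> polys F" "poly D x \<noteq> 0" "\<forall>i<l. poly D x * a i \<in> V n" by blast
    obtain P Q where PQ: "\<forall>j<d. P j \<in> polys F" "Q \<in> polys F" "poly Q x \<noteq> 0"
        "poly Q x * a l = (\<Sum>j<d. poly (P j) x * e j)" using rep by blast
    have "\<exists>n. \<forall>j<d'. P j \<in> bounded_polys F n" if "d' \<le> d" for d'
      using that
    proof (induction d')
      case (Suc d')
      then obtain n where "\<forall>j<d'. P j \<in> bounded_polys F n" by auto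
      moreover obtain n' where "P d' \<in> bounded_polys F n'" using polys_bounded PQ(1) Suc.prems by force
      ultimately show ?case
        by (intro exI[of _ "max n n'"]) (auto simp: less_Suc_eq intro: bounded_polys_mono)
    qed auto
    then obtain n' where n': "poly Q x * a l \<in> V n'" using VI PQ(4) by (metis order_refl)
    obtain kD where kD: "D \<in> bounded_polys F kD" using polys_bounded D by blast
    obtain kQ where kQ: "Q \<in> bounded_polys F kQ" using polys_bounded PQ by blast
    have "poly (D * Q) x * a i \<in> V (kD + n' + (kQ + n))" if "i < Suc l" for i
    proof (cases "i = l")
      case True
      have "poly D x * (poly Q x * a l) \<in> V (kD + n')" by (rule V_mult[OF kD n'])
      then show ?thesis using True by (auto simp: mult.assoc intro: V_mono)
    next
      case False
      then have "poly Q x * (poly D x * a i) \<in> V (kQ + n)" using D(3) that by (intro V_mult[OF kQ]) auto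
      then show ?thesis by (auto simp: ac_simps intro: V_mono)
    qed
    then show ?case using D PQ by (intro bexI[of _ "D * Q"]) (auto simp: polys_ring)
  qed
  \<comment> \<open>\<open>D\<close> clears the denominators of multiplication by \<open>y\<close>
    on the spanning family, so that multiplication by \<open>poly D x * y\<close> raises the index
    of \<open>V\<close> by at most the constant \<open>C\<close>.\<close>
  obtain D n0 where D: "D \<in> polys F" "poly D x \<noteq> 0" "\<forall>i<d. poly D x * (y * e i) \<in> V n0"
    using denom[of d "\<lambda>i. y * e i"] by auto
  obtain kD where kD: "D \<in> bounded_polys F kD" using polys_bounded D by blast
  define C where "C = max n0 kD"
  have DV: "poly D x * a \<in> V (C + n)" if "a \<in> V n" for a n
    using V_mult[OF kD that] by (rule V_mono) (simp add: C_def)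
  have yV: "poly D x * y * a \<in> V (C + n)" if a: "a \<in> V n" for a n
  proof -
    obtain P where P: "\<forall>j<d. P j \<in> bounded_polys F n" "a = (\<Sum>j<d. poly (P j) x * e j)"
      using VE[OF a] by blast
    have "poly D x * y * a = (\<Sum>j<d. poly (P j) x * (poly D x * (y * e j)))"
      by (simp add: P(2) sum_distrib_left ac_simps)
    also have "\<dots> \<in> V (n + n0)" using P(1) D(3) by (intro V_sum V_mult) auto
    finally show ?thesis by (rule V_mono) (simp add: C_def)
  qed
  have pV: "poly D x ^ N * y ^ k * a \<in> V (C * N + n)" if "a \<in> V n" "k \<le> N" for a n k N
    using that
  proof (induction N arbitrary: k)
    case (Suc N)
    show ?case
    proof (cases "k \<le> N")
      case True
      then have "poly D x * (poly D x ^ N * y ^ k * a) \<in> V (C + (C * N + n))"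
        using Suc by (intro DV) auto
      then show ?thesis by (simp add: ac_simps)
    next
      case False
      then have k: "k = Suc N" using Suc by simp
      have "poly D x * y * (poly D x ^ N * y ^ N * a) \<in> V (C + (C * N + n))"
        using Suc by (intro yV) auto
      then show ?thesis by (simp add: k ac_simps)
    qed
  qed simp
  \<comment> \<open>The number of coefficient vectors is \<open>card F ^ (N * m)\<close>, while the
    number of values is at most \<open>card F ^ (d * C * N)\<close> up to a factor independent of
    \<open>N\<close>. Hence any \<open>m\<close> above \<open>d * C\<close> forces a collision for
    large \<open>N\<close>, uniformly in \<open>z\<close>.\<close>
  define m where "m = d * C + 1"
  have "\<exists>c. (\<forall>i<m. c i \<in> polys F) \<and> (\<exists>i<m. c i \<noteq> 0) \<and> (\<Sum>i<m. poly (c i) y * z i) = 0" for z :: "nat \<Rightarrow> 'k"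
  proof -
    obtain D' n' where D': "poly D' x \<noteq> 0" "\<forall>i<m. poly D' x * z i \<in> V n'"
      using denom[of m z] by blast
    \<comment> \<open>The least \<open>N\<close> for which \<open>N * m\<close> exceeds
      \<open>(C * N + n') * d\<close>.\<close>
    define N where "N = d * n' + 1"
    define T where "T c = poly D x ^ N * (\<Sum>i<m. poly (c i) y * (poly D' x * z i))" for c
    let ?A = "PiE {..<m} (\<lambda>_. bounded_polys F N)"
    have "T c \<in> V (C * N + n')" if c: "c \<in> ?A" for c
    proof -
      have "poly D x ^ N * (poly P y * a) \<in> V (C * N + n')" if P: "P \<in> bounded_polys F N" and a: "a \<in> V n'" for P a
      proof -
        have "poly P y = (\<Sum>k\<le>N. poly.coeff P k * y ^ k)"
          unfolding poly_altdef
          by (rule sum.mono_neutral_left)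
            (use P in \<open>auto simp: bounded_polys_def coeff_eq_0 intro!: degree_le\<close>)
        then have "poly D x ^ N * (poly P y * a) = (\<Sum>k\<le>N. poly.coeff P k * (poly D x ^ N * y ^ k * a))"
          by (simp add: sum_distrib_left sum_distrib_right ac_simps)
        also have "\<dots> \<in> V (C * N + n')"
          using P a by (intro V_sum V_F pV) (auto simp: bounded_polys_def polys_def)
        finally show ?thesis .
      qed
      then show ?thesis unfolding T_def sum_distrib_left using c D'
        by (intro V_sum) (auto simp: PiE_iff)
    qed
    then have "card (T ` ?A) \<le> card F ^ ((C * N + n') * d)"
      using card_mono[OF V_finite, of "T ` ?A" "C * N + n'"] V_card[of "C * N + n'"] by fastforce
    also have "\<dots> < card F ^ (N * m)"
      using card_F by (intro power_strict_increasing) (auto simp: N_def m_def algebra_simps)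
    also have "\<dots> = card ?A" by (simp add: card_PiE card_bounded_polys power_mult)
    finally have "\<not> inj_on T ?A" by (rule pigeonhole)
    then obtain c c' where cc: "c \<in> ?A" "c' \<in> ?A" "c \<noteq> c'" "T c = T c'" by (auto simp: inj_on_def)
    then have "(\<Sum>i<m. poly (c i) y * (poly D' x * z i)) = (\<Sum>i<m. poly (c' i) y * (poly D' x * z i))"
      using D(2) by (simp add: T_def)
    then have "poly D' x * (\<Sum>i<m. poly (c i) y * z i) = poly D' x * (\<Sum>i<m. poly (c' i) y * z i)"
      by (simp add: sum_distrib_left ac_simps)
    then have "(\<Sum>i<m. poly (c i - c' i) y * z i) = 0"
      using D' by (simp add: left_diff_distrib sum_subtractf)
    moreover obtain i where "i < m" "c i \<noteq> c' i" using cc by (meson PiE_ext lessThan_iff)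
    moreover have "c i - c' i \<in> polys F" if "i < m" for i
      using cc that by (auto simp: PiE_iff bounded_polys_def intro!: polys_ring)
    ultimately show ?thesis by (intro exI[of _ "\<lambda>i. c i - c' i"]) auto
  qed
  then show ?thesis by blast
qed

text \<open>If all coefficients vanish at 0, the relation can be divided by \<open>y\<close> and the
  degrees drop. A surviving constant coefficient is what keeps the relation nontrivial after
  reduction modulo a place at which \<open>y\<close> vanishes.\<close>

lemma dependent_over_polys_nonzero_at_0:
  assumes "y \<noteq> 0"
  shows "\<exists>m. \<forall>z :: nat \<Rightarrow> 'k. \<exists>c. (\<forall>i<m. c i \<in> polys F) \<and> (\<exists>i<m. poly.coeff (c i) 0 \<noteq> 0) \<and>
    (\<Sum>i<m. poly (c i) y * z i) = 0"
proof -
  obtain m where m: "\<And>z :: nat \<Rightarrow> 'k. \<exists>c. (\<forall>i<m. c i \<in> polys F) \<and> (\<exists>i<m. c i \<noteq> 0) \<and>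
      (\<Sum>i<m. poly (c i) y * z i) = 0"
    using dependent_over_polys by meson
  have "\<exists>c. (\<forall>i<m. c i \<in> polys F) \<and> (\<exists>i<m. poly.coeff (c i) 0 \<noteq> 0) \<and> (\<Sum>i<m. poly (c i) y * z i) = 0"
    if "\<forall>i<m. c i \<in> polys F" "\<exists>i<m. c i \<noteq> 0" "(\<Sum>i<m. poly (c i) y * z i) = 0" for c and z :: "nat \<Rightarrow> 'k"
    using that
  proof (induction "\<Sum>i<m. Polynomial.degree (c i)" arbitrary: c rule: less_induct)
    case less
    show ?case
    proof (cases "\<exists>i<m. poly.coeff (c i) 0 \<noteq> 0")
      case False
      define c' where "c' i = (if i < m then poly_shift 1 (c i) else 0)" for i
      have c': "c i = pCons 0 (c' i)" if "i < m" for i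
        using False that by (intro poly_eqI) (auto simp: c'_def coeff_poly_shift coeff_pCons split: nat.split)
      have "(\<Sum>i<m. Polynomial.degree (c' i)) < (\<Sum>i<m. Polynomial.degree (c i))"
      proof (rule sum_strict_mono_ex1)
        show "\<forall>i\<in>{..<m}. Polynomial.degree (c' i) \<le> Polynomial.degree (c i)"
          using c' by (auto simp: degree_pCons_eq_if)
        show "\<exists>i\<in>{..<m}. Polynomial.degree (c' i) < Polynomial.degree (c i)"
          using less.prems(2) c' by (auto simp: degree_pCons_eq_if)
      qed auto
      moreover have "\<forall>i<m. c' i \<in> polys F"
        using less.prems(1) by (auto simp: c'_def polys_def coeff_poly_shift)
      moreover have "\<exists>i<m. c' i \<noteq> 0" using less.prems(2) c' by force
      moreover have "y * (\<Sum>i<m. poly (c' i) y * z i) = 0"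
        using less.prems(3) c' by (simp add: sum_distrib_left mult.assoc)
      ultimately show ?thesis using less.hyps[of c'] assms by simp
    qed (use less in blast)
  qed
  note reduce = this
  show ?thesis
  proof (intro exI[of _ m] allI)
    fix z
    show "\<exists>c. (\<forall>i<m. c i \<in> polys F) \<and> (\<exists>i<m. poly.coeff (c i) 0 \<noteq> 0) \<and> (\<Sum>i<m. poly (c i) y * z i) = 0"
    proof -
      obtain c where "\<forall>i<m. c i \<in> polys F" "\<exists>i<m. c i \<noteq> 0" "(\<Sum>i<m. poly (c i) y * z i) = 0"
        using m by blast
      then show ?thesis by (rule reduce)
    qed
  qed
qed

end

section \<open>Finiteness of residue fields\<close>

context constant_field
begin

lemma place_discretely_valued: "place F v \<Longrightarrow> discretely_valued v"
  by (simp add: place_def discretely_valued_def)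

lemma place_F: "place F v \<Longrightarrow> a \<in> F \<Longrightarrow> v a = 0"
  by (simp add: place_def)

lemma poly_val_ge:
  assumes "place F v" "P \<in> polys F" "val_ge v 0 t"
  shows "val_ge v 0 (poly P t)"
proof -
  interpret discretely_valued v by (rule place_discretely_valued[OF assms(1)])
  have "val_ge v 0 (poly.coeff P i)" for i
    using assms by (auto simp: polys_def place_F val_ge_def)
  then show ?thesis
  proof (induction P)
    case (pCons a P)
    have "val_ge v 0 a" using pCons(3)[of 0] by simp
    moreover have "val_ge v 0 (poly.coeff P i)" for i using pCons(3)[of "Suc i"] by simp
    then have "val_ge v (0 + 0) (t * poly P t)" by (intro val_ge_mult pCons assms)
    ultimately show ?case by (simp add: val_ge_add)
  qed simp
qed

text \<open>A polynomial relation in the uniformiser becomes, modulo the uniformiser, a linear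
  relation of residues over \<open>F\<close>. So fewer than \<open>m\<close> residues can be
  independent, and the combinations of a maximal independent family over the finite field
  \<open>F\<close> represent all residues.\<close>

lemma residue_field_finite:
  assumes "place F v"
  shows "\<exists>R. finite R \<and> (\<forall>x. val_ge v 0 x \<longrightarrow> (\<exists>r\<in>R. val_ge v 1 (x - r)))"
proof -
  interpret discretely_valued v by (rule place_discretely_valued[OF assms])
  obtain t where t: "t \<noteq> 0" "v t = 1" using uniformiser_exists by blast
  obtain m where m: "\<And>z :: nat \<Rightarrow> 'k. \<exists>c. (\<forall>i<m. c i \<in> polys F) \<and> (\<exists>i<m. poly.coeff (c i) 0 \<noteq> 0) \<and>
      (\<Sum>i<m. poly (c i) t * z i) = 0"
    using dependent_over_polys_nonzero_at_0[OF t(1)] by metis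
  \<comment> \<open>Linear independence over \<open>F\<close> of residue classes; a value of at
    least 1 means that the residue is zero.\<close>
  define indep where "indep r z \<longleftrightarrow> (\<forall>i<r. val_ge v 0 (z i)) \<and>
    (\<forall>a. (\<forall>i<r. a i \<in> F) \<longrightarrow> val_ge v 1 (\<Sum>i<r. a i * z i) \<longrightarrow> (\<forall>i<r. a i = 0))" for r and z :: "nat \<Rightarrow> 'k"
  have small: "r < m" if "indep r z" for r z
  proof (rule ccontr)
    assume "\<not> r < m"
    obtain c where c: "\<forall>i<m. c i \<in> polys F" "\<exists>i<m. poly.coeff (c i) 0 \<noteq> 0" "(\<Sum>i<m. poly (c i) t * z i) = 0"
      using m by blast
    define a where "a i = (if i < m then poly.coeff (c i) 0 else 0)" for i
    have aF: "\<forall>i<r. a i \<in> F" using c by (auto simp: a_def polys_def F_ring)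
    have "poly (c i) t = a i + t * poly (poly_shift 1 (c i)) t" if "i < m" for i
    proof -
      have "c i = pCons (a i) (poly_shift 1 (c i))"
        using that by (intro poly_eqI) (auto simp: a_def coeff_pCons coeff_poly_shift split: nat.split)
      then show ?thesis by (metis poly_pCons)
    qed
    then have "(\<Sum>i<m. a i * z i) = - (\<Sum>i<m. t * (poly (poly_shift 1 (c i)) t * z i))"
      using c(3) by (simp add: distrib_right sum.distrib mult.assoc eq_neg_iff_add_eq_0)
    moreover have "val_ge v 1 (t * (poly (poly_shift 1 (c i)) t * z i))" if "i < m" for i
    proof -
      have "poly_shift 1 (c i) \<in> polys F" using c that by (auto simp: polys_def coeff_poly_shift)
      then have "val_ge v (1 + (0 + 0)) (t * (poly (poly_shift 1 (c i)) t * z i))"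
        using \<open>indep r z\<close> \<open>\<not> r < m\<close> that t
        by (intro val_ge_mult poly_val_ge[OF assms]) (auto simp: indep_def val_ge_def)
      then show ?thesis by simp
    qed
    ultimately have "val_ge v 1 (\<Sum>i<m. a i * z i)"
      by (auto simp: val_ge_uminus intro!: val_ge_sum)
    moreover have "(\<Sum>i<r. a i * z i) = (\<Sum>i<m. a i * z i)"
      using \<open>\<not> r < m\<close> by (intro sum.mono_neutral_right) (auto simp: a_def)
    ultimately have "\<forall>i<r. a i = 0" using \<open>indep r z\<close> aF by (simp add: indep_def)
    moreover obtain i where "i < m" "poly.coeff (c i) 0 \<noteq> 0" using c(2) by blast
    ultimately show False using \<open>\<not> r < m\<close> by (metis a_def less_le_trans not_less)
  qed
  define r where "r = (GREATEST r. \<exists>z. indep r z)"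
  have "\<exists>z. indep 0 z" by (simp add: indep_def)
  then have "\<exists>z. indep r z" unfolding r_def
    by (rule GreatestI_nat[where b = m]) (use small less_imp_le in blast)
  then obtain z where z: "indep r z" by blast
  have max: "\<not> indep (Suc r) z'" for z'
    using Greatest_le_nat[of "\<lambda>r. \<exists>z. indep r z" "Suc r" m] small less_imp_le unfolding r_def[symmetric]
    by (meson not_less_eq_eq order_refl)
  let ?R = "(\<lambda>a. \<Sum>i<r. a i * z i) ` PiE {..<r} (\<lambda>_. F)"
  have "\<exists>r\<in>?R. val_ge v 1 (x - r)" if x: "val_ge v 0 x" for x
  proof -
    \<comment> \<open>Adjoining \<open>x\<close> to a maximal independent family creates a relation.
      The coefficient of \<open>x\<close> in it cannot vanish, so the relation can be solved for
      \<open>x\<close>.\<close>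
    have "\<forall>i<Suc r. val_ge v 0 ((z(r := x)) i)" using z x by (auto simp: indep_def less_Suc_eq)
    then obtain a where a: "\<forall>i<Suc r. a i \<in> F" "val_ge v 1 (\<Sum>i<Suc r. a i * (z(r := x)) i)"
        "\<not> (\<forall>i<Suc r. a i = 0)"
      using max[of "z(r := x)"] unfolding indep_def by blast
    have eq: "(\<Sum>i<Suc r. a i * (z(r := x)) i) = (\<Sum>i<r. a i * z i) + a r * x" by simp
    have ar: "a r \<noteq> 0"
    proof
      assume "a r = 0"
      then have "\<forall>i<r. a i = 0" using a z unfolding eq indep_def by auto
      then show False using a(3) \<open>a r = 0\<close> by (auto simp: less_Suc_eq)
    qed
    let ?b = "\<lambda>i\<in>{..<r}. - (inverse (a r) * a i)"
    have "val_ge v (0 + 1) (inverse (a r) * ((\<Sum>i<r. a i * z i) + a r * x))"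
      using a ar unfolding eq by (intro val_ge_mult) (auto simp: val_ge_def val_inverse place_F[OF assms])
    moreover have "inverse (a r) * ((\<Sum>i<r. a i * z i) + a r * x) = x - (\<Sum>i<r. ?b i * z i)"
      using ar by (simp add: distrib_left sum_distrib_left sum_negf mult.assoc)
    ultimately have "val_ge v 1 (x - (\<Sum>i<r. ?b i * z i))" by simp
    moreover have "?b \<in> PiE {..<r} (\<lambda>_. F)" using a by (auto intro!: F_ring F_inverse)
    ultimately show ?thesis by blast
  qed
  moreover have "finite ?R" using finite_F by (intro finite_imageI finite_PiE) auto
  ultimately show ?thesis by blast
qed

text \<open>The leading coefficient of a pole has finitely many possible residues; subtracting a
  representative lowers the order of the pole by one.\<close>

lemma bounded_poles_finite_mod_zeros:
  assumes "place F v"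
  shows "\<exists>R. finite R \<and> (\<forall>x. val_ge v (- int N) x \<longrightarrow> (\<exists>r\<in>R. val_ge v 1 (x - r)))"
proof (induction N)
  case 0
  then show ?case using residue_field_finite[OF assms] by simp
next
  case (Suc N)
  interpret discretely_valued v by (rule place_discretely_valued[OF assms])
  obtain t where t: "t \<noteq> 0" "v t = 1" using uniformiser_exists by blast
  obtain R0 where R0: "finite R0" "\<And>x. val_ge v 0 x \<Longrightarrow> \<exists>r\<in>R0. val_ge v 1 (x - r)"
    using residue_field_finite[OF assms] by blast
  obtain R where R: "finite R" "\<And>x. val_ge v (- int N) x \<Longrightarrow> \<exists>r\<in>R. val_ge v 1 (x - r)"
    using Suc by blast
  let ?s = "inverse (t ^ Suc N)"
  let ?R = "(\<lambda>(r, r'). ?s * r + r') ` (R0 \<times> R)"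
  have "\<exists>r\<in>?R. val_ge v 1 (x - r)" if x: "val_ge v (- int (Suc N)) x" for x
  proof -
    have "val_ge v (int (Suc N) + - int (Suc N)) (t ^ Suc N * x)"
      using t x by (intro val_ge_mult) (auto simp: val_ge_def val_power simp del: power_Suc)
    then obtain r where r: "r \<in> R0" "val_ge v 1 (t ^ Suc N * x - r)" using R0(2)[of "t ^ Suc N * x"] by auto
    have "val_ge v (- int (Suc N) + 1) (?s * (t ^ Suc N * x - r))"
      using t r by (intro val_ge_mult) (auto simp: val_ge_def val_power val_inverse simp del: power_Suc)
    moreover have "- int (Suc N) + 1 = - int N" by simp
    moreover have "?s * (t ^ Suc N * x - r) = x - ?s * r"
      using t by (simp add: right_diff_distrib mult.assoc[symmetric] del: power_Suc)
    ultimately have "val_ge v (- int N) (x - ?s * r)" by (simp only:)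
    then obtain r' where "r' \<in> R" "val_ge v 1 (x - ?s * r - r')" using R(2) by blast
    then show ?thesis using r(1) by (intro bexI[of _ "?s * r + r'"]) (auto simp: diff_diff_eq)
  qed
  moreover have "finite ?R" using R0 R by auto
  ultimately show ?case by blast
qed

end

subsection \<open>Existence of poles\<close>

text \<open>
  \<open>B\<close> is a ring maximal with respect to \<open>1 \<notin> y B\<close>; it is the valuation ring of a place at which
  \<open>1 / y\<close> has a pole.
\<close>

locale maximal_dominating_ring =
  fixes y :: "'k::field" and B :: "'k set"
  assumes y0: "y \<noteq> 0"
    and one: "1 \<in> B" and diff: "\<And>a b. a \<in> B \<Longrightarrow> b \<in> B \<Longrightarrow> a - b \<in> B"
    and mult: "\<And>a b. a \<in> B \<Longrightarrow> b \<in> B \<Longrightarrow> a * b \<in> B"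
    and y_in: "y \<in> B" and nonunit: "\<And>b. b \<in> B \<Longrightarrow> y * b \<noteq> 1"
    and maximal: "\<And>C. B \<subseteq> C \<Longrightarrow> (\<And>a b. a \<in> C \<Longrightarrow> b \<in> C \<Longrightarrow> a - b \<in> C) \<Longrightarrow>
      (\<And>a b. a \<in> C \<Longrightarrow> b \<in> C \<Longrightarrow> a * b \<in> C) \<Longrightarrow> (\<And>b. b \<in> C \<Longrightarrow> y * b \<noteq> 1) \<Longrightarrow> C = B"
begin

lemma zero: "0 \<in> B"
  using diff[OF one one] by simp

lemma uminus: "a \<in> B \<Longrightarrow> - a \<in> B"
  using diff[OF zero] by force

lemma add: "a \<in> B \<Longrightarrow> b \<in> B \<Longrightarrow> a + b \<in> B"
  using diff[of a "- b"] by (simp add: uminus)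

lemma sum_B: "(\<And>i. i \<in> A \<Longrightarrow> f i \<in> B) \<Longrightarrow> sum f A \<in> B"
  by (induction A rule: infinite_finite_induct) (auto intro: add zero)

lemma power_B: "a \<in> B \<Longrightarrow> a ^ n \<in> B"
  by (induction n) (auto intro: mult one)

text \<open>The fractions with denominators in \<open>1 + y B\<close> form a ring in which
  \<open>y\<close> still has no inverse, so maximality makes it equal to \<open>B\<close>. Thus
  \<open>y\<close> lies in the Jacobson radical.\<close>

lemma local_ring: "b \<in> B \<Longrightarrow> inverse (1 + y * b) \<in> B"
proof -
  assume b: "b \<in> B"
  let ?C = "{a / (1 + y * c) | a c. a \<in> B \<and> c \<in> B}"
  have nz: "1 + y * c \<noteq> 0" if "c \<in> B" for c
    using nonunit[OF uminus[OF that]] by (auto simp: add_eq_0_iff)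
  have "?C = B"
  proof (rule maximal)
    show "B \<subseteq> ?C" using zero by force
    fix u w assume "u \<in> ?C" "w \<in> ?C"
    then obtain a c a' c' where *: "a \<in> B" "c \<in> B" "u = a / (1 + y * c)" "a' \<in> B" "c' \<in> B" "w = a' / (1 + y * c')"
      by blast
    have "(1 + y * c) * (1 + y * c') = 1 + y * (c + c' + y * c * c')" by (simp add: algebra_simps)
    moreover have "u - w = (a * (1 + y * c') - a' * (1 + y * c)) / ((1 + y * c) * (1 + y * c'))"
      "u * w = a * a' / ((1 + y * c) * (1 + y * c'))"
      using nz * by (simp_all add: diff_frac_eq)
    moreover have "a * (1 + y * c') - a' * (1 + y * c) \<in> B" "a * a' \<in> B" "c + c' + y * c * c' \<in> B"
      using * by (auto intro!: diff add mult one y_in)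
    ultimately show "u - w \<in> ?C" "u * w \<in> ?C" by auto
  next
    fix u assume "u \<in> ?C"
    then obtain a c where *: "a \<in> B" "c \<in> B" "u = a / (1 + y * c)" by blast
    show "y * u \<noteq> 1"
    proof
      assume "y * u = 1"
      then have "y * (a - c) = 1" using * nz[of c] by (simp add: field_simps)
      then show False using nonunit[of "a - c"] * diff by simp
    qed
  qed
  moreover have "inverse (1 + y * b) \<in> ?C" using b one by (auto simp: inverse_eq_divide)
  ultimately show ?thesis by blast
qed

text \<open>The ideal generated by \<open>y\<close> in B[z] contains 1, with a witness of degree at
  most \<open>m\<close> in \<open>z\<close>.\<close>

definition relation :: "nat \<Rightarrow> 'k \<Rightarrow> bool" where
  "relation m z \<longleftrightarrow> (\<exists>p. (\<forall>i. p i \<in> B) \<and> 1 = y * (\<Sum>i\<le>m. p i * z ^ i))"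

text \<open>Chevalley's descent. In the relation for \<open>inverse z\<close> the constant term can
  be absorbed, since \<open>1 - y * q 0\<close> is a unit of \<open>B\<close>. Multiplied by
  \<open>z ^ m\<close> the result expresses \<open>z ^ m\<close> through lower powers, which removes
  the leading term of the relation for \<open>z\<close>.\<close>

lemma relation_reduce:
  assumes z: "z \<noteq> 0" and m: "relation m z" and n: "relation n (inverse z)" and nm: "n \<le> m"
  shows "\<exists>m'<m. relation m' z"
proof -
  obtain p where p: "\<And>i. p i \<in> B" "1 = y * (\<Sum>i\<le>m. p i * z ^ i)"
    using m by (auto simp: relation_def)
  obtain q where q: "\<And>i. q i \<in> B" "1 = y * (\<Sum>i\<le>n. q i * inverse z ^ i)"
    using n by (auto simp: relation_def)
  define u where "u = 1 + y * (- q 0)"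
  have u0: "u \<noteq> 0" using nonunit[OF q(1)[of 0]] by (auto simp: u_def)
  have uB: "inverse u \<in> B" unfolding u_def by (intro local_ring uminus q)
  \<comment> \<open>A relation of degree 0 would make \<open>y\<close> invertible in
    \<open>B\<close>.\<close>
  have n0: "n > 0" using q nonunit[OF q(1)[of 0]] by (cases n) auto
  have "(\<Sum>i\<le>n. q i * inverse z ^ i) = q 0 + (\<Sum>i\<in>{1..n}. q i * inverse z ^ i)"
    by (simp add: atMost_atLeast0 sum.atLeast_Suc_atMost)
  then have "u = y * (\<Sum>i\<in>{1..n}. q i * inverse z ^ i)"
    using q(2) by (simp add: u_def algebra_simps)
  then have "inverse u * u = (\<Sum>i\<in>{1..n}. inverse u * y * q i * inverse z ^ i)"
    by (simp only: sum_distrib_left mult.assoc)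
  then have one_eq: "1 = (\<Sum>i\<in>{1..n}. inverse u * y * q i * inverse z ^ i)"
    using u0 by simp
  have "z ^ m = (\<Sum>i\<in>{1..n}. inverse u * y * q i * (inverse z ^ i * z ^ m))"
    using arg_cong[OF one_eq, of "\<lambda>a. a * z ^ m"] by (simp add: sum_distrib_right mult.assoc)
  also have "\<dots> = (\<Sum>i\<in>{1..n}. inverse u * y * q i * z ^ (m - i))"
    using z nm by (intro sum.cong) (auto simp: power_diff field_simps)
  also have "\<dots> = (\<Sum>j\<in>{m-n..<m}. inverse u * y * q (m - j) * z ^ j)"
    by (rule sum.reindex_bij_witness[of _ "\<lambda>j. m - j" "\<lambda>i. m - i"]) (use nm n0 in auto)
  also have "\<dots> = (\<Sum>j<m. (if m - n \<le> j then inverse u * y * q (m - j) else 0) * z ^ j)"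
    by (rule sum.mono_neutral_cong_left) auto
  finally have zm: "z ^ m = \<dots>" .
  \<comment> \<open>The coefficient of \<open>z ^ m\<close> is redistributed over the powers
    \<open>z ^ j\<close> with \<open>m - n \<le> j < m\<close>.\<close>
  define p' where "p' j = p j + p m * (if m - n \<le> j then inverse u * y * q (m - j) else 0)" for j
  have "p' j \<in> B" for j
    unfolding p'_def by (auto intro!: add mult p q uB y_in zero)
  moreover have "(\<Sum>i\<le>m. p i * z ^ i) = (\<Sum>j<m. p' j * z ^ j)"
  proof -
    have "(\<Sum>i\<le>m. p i * z ^ i) = (\<Sum>i<m. p i * z ^ i) + p m * z ^ m"
      by (simp add: lessThan_Suc_atMost[symmetric])
    then show ?thesis unfolding zm
      by (simp add: p'_def distrib_right sum.distrib sum_distrib_left mult.assoc)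
  qed
  moreover have "{..<m} = {..m - 1}" using n0 nm by auto
  ultimately have "relation (m - 1) z" using p(2) unfolding relation_def by metis
  then show ?thesis using n0 nm by (intro exI[of _ "m - 1"]) auto
qed

text \<open>If \<open>z\<close> is not in \<open>B\<close>, adjoining it enlarges the ring, and by
  maximality \<open>y\<close> becomes invertible in B[z]. Such relations for \<open>z\<close> and
  for \<open>inverse z\<close> at the same time contradict the descent on the sum of their
  degrees.\<close>

lemma valuation_dichotomy: "z \<noteq> 0 \<Longrightarrow> z \<in> B \<or> inverse z \<in> B"
proof -
  have no_relations: False if "z \<noteq> 0" "relation m z" "relation n (inverse z)" for m n z
    using that
  proof (induction "m + n" arbitrary: m n z rule: less_induct)
    case less
    show ?case
    proof (cases "n \<le> m")
      case True
      then obtain m' where "m' < m" "relation m' z" using relation_reduce less by blast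
      then show False using less.hyps[of m' n z] less.prems by auto
    next
      case False
      then obtain n' where "n' < n" "relation n' (inverse z)"
        using relation_reduce[of "inverse z" n m] less.prems by auto
      then show False using less.hyps[of m n' z] less.prems by auto
    qed
  qed
  have rel: "\<exists>m. relation m z" if "z \<notin> B" for z
  proof (rule ccontr)
    assume no: "\<nexists>m. relation m z"
    \<comment> \<open>\<open>?C\<close> is B[z]. Coefficients have to lie in \<open>B\<close> at
      every index, so sums of different degrees are compared after padding with zeros.\<close>
    let ?C = "{\<Sum>i\<le>m. p i * z ^ i | p m. \<forall>i. p i \<in> B}"
    have sumI: "(\<Sum>i\<le>m. p i * z ^ i) = (\<Sum>i\<le>N. (if i \<le> m then p i else 0) * z ^ i)" if "m \<le> N" for m p N
      by (rule sum.mono_neutral_cong_left) (use that in auto)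
    have "?C = B"
    proof (rule maximal)
      show "B \<subseteq> ?C"
      proof
        fix a assume "a \<in> B"
        then show "a \<in> ?C" by (intro CollectI exI[of _ "\<lambda>_. a"] exI[of _ 0]) auto
      qed
      fix u w assume "u \<in> ?C" "w \<in> ?C"
      then obtain p m p' m' where *: "\<forall>i. p i \<in> B" "u = (\<Sum>i\<le>m. p i * z ^ i)" "\<forall>i. p' i \<in> B"
          "w = (\<Sum>i\<le>m'. p' i * z ^ i)" by blast
      let ?N = "max m m'"
      let ?d = "\<lambda>i. (if i \<le> m then p i else 0) - (if i \<le> m' then p' i else 0)"
      have "u - w = (\<Sum>i\<le>?N. ?d i * z ^ i)"
        unfolding *(2,4) sumI[of m ?N p, OF max.cobounded1] sumI[of m' ?N p', OF max.cobounded2]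
        by (simp add: left_diff_distrib sum_subtractf)
      moreover have "\<forall>i. ?d i \<in> B" using * zero by (intro allI diff) auto
      ultimately show "u - w \<in> ?C"
        by (intro CollectI exI[of _ ?d] exI[of _ ?N] conjI)
      \<comment> \<open>The convolution of the two padded coefficient sequences; a detour through
        the polynomial type supplies the product formula.\<close>
      let ?e = "\<lambda>k. \<Sum>i\<le>k. (if i \<le> m then p i else 0) * (if k - i \<le> m' then p' (k - i) else 0)"
      have "u * w = (\<Sum>k\<le>m + m'. ?e k * z ^ k)"
      proof -
        let ?P = "\<Sum>i\<le>m. Polynomial.monom (p i) i" and ?Q = "\<Sum>i\<le>m'. Polynomial.monom (p' i) i"
        have cP: "poly.coeff ?P i = (if i \<le> m then p i else 0)" for i by (simp add: coeff_sum)
        have cQ: "poly.coeff ?Q i = (if i \<le> m' then p' i else 0)" for i by (simp add: coeff_sum)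
        have "u * w = poly (?P * ?Q) z" by (simp add: * poly_sum poly_monom)
        also have "\<dots> = (\<Sum>k\<le>m + m'. poly.coeff (?P * ?Q) k * z ^ k)"
          unfolding poly_altdef
        proof (rule sum.mono_neutral_left)
          have "Polynomial.degree ?P \<le> m" "Polynomial.degree ?Q \<le> m'"
            by (auto intro!: degree_le simp: cP cQ)
          then show "{..Polynomial.degree (?P * ?Q)} \<subseteq> {..m + m'}"
            using degree_mult_le[of ?P ?Q] by auto
        qed (auto simp: coeff_eq_0)
        also have "\<dots> = (\<Sum>k\<le>m + m'. ?e k * z ^ k)" unfolding coeff_mult cP cQ ..
        finally show ?thesis .
      qed
      moreover have "\<forall>k. ?e k \<in> B" using * zero by (auto intro!: sum_B mult)
      ultimately show "u * w \<in> ?C"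
        by (intro CollectI exI[of _ ?e] exI[of _ "m + m'"] conjI)
    next
      fix u assume "u \<in> ?C"
      then show "y * u \<noteq> 1" using no by (auto simp: relation_def)
    qed
    moreover have "z = (\<Sum>i\<le>1. (if i = 1 then 1 else 0) * z ^ i)" by simp
    then have "z \<in> ?C" using zero one
      by (intro CollectI exI[of _ "\<lambda>i. if i = 1 then 1 else 0"] exI[of _ "1 :: nat"]) auto
    ultimately show False using that by blast
  qed
  assume "z \<noteq> 0"
  then show ?thesis using no_relations rel by blast
qed

text \<open>The maximal ideal of \<open>B\<close>. The clause for 0 is separate because
  \<open>inverse 0 = 0\<close> lies in \<open>B\<close>.\<close>

definition nonunits :: "'k set" where
  "nonunits = {x \<in> B. inverse x \<notin> B \<or> x = 0}"

lemma nonunits_mult: "x \<in> nonunits \<Longrightarrow> a \<in> B \<Longrightarrow> a * x \<in> nonunits"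
proof (cases "a = 0 \<or> x = 0")
  case False
  assume *: "x \<in> nonunits" "a \<in> B"
  show ?thesis
  proof (rule ccontr)
    assume "a * x \<notin> nonunits"
    then have "inverse (a * x) \<in> B" using * False by (auto simp: nonunits_def mult)
    then have "a * inverse (a * x) \<in> B" using * by (intro mult)
    moreover have "a * inverse (a * x) = inverse x" using False by (simp add: field_simps)
    ultimately have "inverse x \<in> B" by (simp only:)
    then show False using * False by (simp add: nonunits_def)
  qed
qed (auto simp: nonunits_def zero)

text \<open>One of the two quotients of the summands lies in \<open>B\<close>, so the sum is a
  multiple of one summand by an element of \<open>B\<close>.\<close>

lemma nonunits_add: "x \<in> nonunits \<Longrightarrow> x' \<in> nonunits \<Longrightarrow> x + x' \<in> nonunits"
proof -
  have *: "x + x' \<in> nonunits" if "x \<in> nonunits" "x' / x \<in> B" "x \<noteq> 0" for x x'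
  proof -
    have "(1 + x' / x) * x \<in> nonunits" using that one by (intro nonunits_mult add) auto
    then show ?thesis using that by (simp add: distrib_right)
  qed
  assume "x \<in> nonunits" "x' \<in> nonunits"
  then show ?thesis
    using *[of x x'] *[of x' x] valuation_dichotomy[of "x' / x"]
    by (cases "x = 0"; cases "x' = 0") (auto simp: add.commute)
qed

lemma nonunits_sum: "(\<And>i. i \<in> A \<Longrightarrow> f i \<in> nonunits) \<Longrightarrow> sum f A \<in> nonunits"
proof (induction A rule: infinite_finite_induct)
  case (insert x A)
  then show ?case by (auto intro: nonunits_add)
qed (auto simp: nonunits_def zero)

lemma nonunits_uminus: "x \<in> nonunits \<Longrightarrow> - x \<in> nonunits"
  using nonunits_mult[of x "- 1"] uminus[OF one] by simp

lemma y_nonunit: "y \<in> nonunits"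
  using nonunit[of "inverse y"] y0 y_in by (auto simp: nonunits_def)

lemma not_in_B: "x \<notin> B \<Longrightarrow> inverse x \<in> nonunits"
  using valuation_dichotomy[of x] zero by (auto simp: nonunits_def)

end

section \<open>The discrete valuation of the maximal ring\<close>

locale dominating_place = constant_field F + maximal_dominating_ring y B
  for F :: "'k::field set" and y :: 'k and B :: "'k set" +
  assumes F_B: "F \<subseteq> B"
begin

text \<open>Elements of the maximal ideal with strictly decreasing value, \<open>x 0\<close> being
  the most divisible. No valuation is available yet, so the order of values is expressed by
  quotients.\<close>

definition divisor_chain :: "nat \<Rightarrow> (nat \<Rightarrow> 'k) \<Rightarrow> bool" where
  "divisor_chain n x \<longleftrightarrow> (\<forall>i<n. x i \<in> nonunits - {0}) \<and> (\<forall>j<n. \<forall>i<j. x i / x j \<in> nonunits)"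

text \<open>In a long chain from \<open>z\<close>, a relation over F[z] is divided by the last
  \<open>x j\<close> whose coefficient does not vanish at 0. Earlier terms are nonunits because
  \<open>x i / x j\<close> is one, later terms because their coefficients are divisible by
  \<open>z\<close> and \<open>z / x j\<close> lies in \<open>B\<close>. A nonzero constant of
  \<open>F\<close> would then be a nonunit.\<close>

lemma divisor_chain_bounded:
  assumes z: "z \<in> nonunits - {0}"
  shows "\<exists>m. \<forall>n x. divisor_chain n x \<longrightarrow> x 0 = z \<longrightarrow> n \<le> m"
proof -
  obtain m where m: "\<And>x :: nat \<Rightarrow> 'k. \<exists>c. (\<forall>i<m. c i \<in> polys F) \<and> (\<exists>i<m. poly.coeff (c i) 0 \<noteq> 0) \<and>
      (\<Sum>i<m. poly (c i) z * x i) = 0"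
    using dependent_over_polys_nonzero_at_0[of z] z by auto
  have "n \<le> m" if x: "divisor_chain n x" "x 0 = z" for n x
  proof (rule ccontr)
    assume "\<not> n \<le> m"
    obtain c where c: "\<forall>i<m. c i \<in> polys F" "\<exists>i<m. poly.coeff (c i) 0 \<noteq> 0" "(\<Sum>i<m. poly (c i) z * x i) = 0"
      using m by blast
    define j where "j = (GREATEST i. i < m \<and> poly.coeff (c i) 0 \<noteq> 0)"
    have "j < m \<and> poly.coeff (c j) 0 \<noteq> 0"
      unfolding j_def using c(2) by (rule GreatestI_ex_nat[where b = m]) auto
    then have j: "j < m" "poly.coeff (c j) 0 \<noteq> 0" by auto
    have above: "poly.coeff (c i) 0 = 0" if "i < m" "j < i" for i
      using that Greatest_le_nat[of "\<lambda>i. i < m \<and> poly.coeff (c i) 0 \<noteq> 0" i m] unfolding j_def by force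
    have xi: "x i \<in> nonunits" "x i \<noteq> 0" if "i < m" for i
      using x that \<open>\<not> n \<le> m\<close> by (auto simp: divisor_chain_def)
    have xij: "x i / x j \<in> nonunits" if "i < j" for i
      using x that j \<open>\<not> n \<le> m\<close> by (auto simp: divisor_chain_def)
    have polyB: "poly P z \<in> B" if "P \<in> polys F" for P
      unfolding poly_altdef using that F_B z
      by (intro sum_B mult power_B) (auto simp: polys_def nonunits_def)
    have split: "\<exists>g\<in>B. poly (c i) z = poly.coeff (c i) 0 + z * g" if "i < m" for i
    proof -
      have "poly_shift 1 (c i) \<in> polys F" using c(1) that by (auto simp: polys_def coeff_poly_shift)
      moreover have "c i = pCons (poly.coeff (c i) 0) (poly_shift 1 (c i))"
        by (intro poly_eqI) (auto simp: coeff_pCons coeff_poly_shift split: nat.split)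
      then have "poly (c i) z = poly.coeff (c i) 0 + z * poly (poly_shift 1 (c i)) z" by (metis poly_pCons)
      ultimately show ?thesis using polyB by blast
    qed
    have zj: "z / x j \<in> B"
      using xij[of 0] xi(2)[OF j(1)] x(2) one by (cases "j = 0") (auto simp: nonunits_def)
    have rest: "poly (c i) z * x i / x j \<in> nonunits" if i: "i < m" "i \<noteq> j" for i
    proof (cases "i < j")
      case True
      then show ?thesis using nonunits_mult[OF xij polyB] c i by (simp add: mult.commute)
    next
      case False
      obtain g where g: "g \<in> B" "poly (c i) z = z * g" using split[OF i(1)] above i False by auto
      have "(z / x j * g) * x i \<in> nonunits" by (intro nonunits_mult xi i mult zj g)
      then show ?thesis by (simp add: g ac_simps)
    qed
    obtain g where g: "g \<in> B" "poly (c j) z = poly.coeff (c j) 0 + z * g" using split[OF j(1)] by blast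
    have "0 = (\<Sum>i<m. poly (c i) z * x i) / x j" using c(3) by simp
    also have "\<dots> = (\<Sum>i<m. poly (c i) z * x i / x j)" by (rule sum_divide_distrib)
    also have "\<dots> = poly (c j) z * x j / x j + (\<Sum>i\<in>{..<m} - {j}. poly (c i) z * x i / x j)"
      using j by (simp add: sum.remove)
    also have "\<dots> = poly.coeff (c j) 0 + (g * z + (\<Sum>i\<in>{..<m} - {j}. poly (c i) z * x i / x j))"
      using xi[OF j(1)] by (simp add: g)
    finally have "poly.coeff (c j) 0 = - (g * z + (\<Sum>i\<in>{..<m} - {j}. poly (c i) z * x i / x j))"
      by (simp only: eq_neg_iff_add_eq_0)
    also have "\<dots> \<in> nonunits"
      using z g rest by (intro nonunits_uminus nonunits_add nonunits_mult nonunits_sum) auto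
    finally have "poly.coeff (c j) 0 \<in> nonunits" .
    moreover have "inverse (poly.coeff (c j) 0) \<in> B" using c(1) j F_B by (auto simp: polys_def intro!: F_inverse)
    ultimately show False using j by (simp add: nonunits_def)
  qed
  then show ?thesis by blast
qed

text \<open>The last member of a longest chain from \<open>y\<close> divides every nonunit, since a
  nonunit that it did not divide could be appended.\<close>

lemma uniformiser: "\<exists>t\<in>nonunits - {0}. \<forall>s\<in>nonunits. s / t \<in> B"
proof -
  obtain m where m: "\<And>n x. divisor_chain n x \<Longrightarrow> x 0 = y \<Longrightarrow> n \<le> m"
    using divisor_chain_bounded[of y] y_nonunit y0 by auto
  let ?P = "\<lambda>n. \<exists>x. divisor_chain (Suc n) x \<and> x 0 = y"
  define n where "n = (GREATEST n. ?P n)"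
  have "?P 0" using y_nonunit y0 by (auto simp: divisor_chain_def intro: exI[of _ "\<lambda>_. y"])
  then have "?P n" unfolding n_def by (rule GreatestI_nat[where b = m]) (use m in force)
  then obtain x where x: "divisor_chain (Suc n) x" "x 0 = y" by blast
  have max: "\<not> ?P (Suc n)"
    using Greatest_le_nat[of ?P "Suc n" m] m unfolding n_def[symmetric] by force
  have xn: "x n \<in> nonunits - {0}" using x by (auto simp: divisor_chain_def)
  have "s / x n \<in> B" if s: "s \<in> nonunits" for s
  proof (rule ccontr)
    assume "s / x n \<notin> B"
    then have s0: "s \<noteq> 0" and q: "x n / s \<in> nonunits" using not_in_B[of "s / x n"] zero by auto
    have "x i / s \<in> nonunits" if "i < Suc n" for i
    proof (cases "i = n")
      case False
      then have "x i / x n \<in> B" using x that by (auto simp: divisor_chain_def nonunits_def)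
      then show ?thesis using nonunits_mult[OF q, of "x i / x n"] xn by simp
    qed (use q in simp)
    then have "divisor_chain (Suc (Suc n)) (x(Suc n := s))"
      using x s s0 by (auto simp: divisor_chain_def less_Suc_eq)
    then show False using max x by (metis fun_upd_other nat.simps(3))
  qed
  then show ?thesis using xn by blast
qed

text \<open>If \<open>t ^ k\<close> divides \<open>z\<close>, then \<open>z\<close>,
  \<open>t ^ (k - 1)\<close>, ..., \<open>t\<close> is a divisor chain of length \<open>k\<close>,
  so the exponent is bounded. At the largest exponent the quotient is a unit, as every nonunit is
  divisible by \<open>t\<close>.\<close>

lemma factorisation:
  assumes t: "t \<in> nonunits - {0}" "\<forall>s\<in>nonunits. s / t \<in> B" and z: "z \<in> B" "z \<noteq> 0"
  shows "\<exists>k. z / t ^ k \<in> B - nonunits"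
proof (cases "z \<in> nonunits")
  case True
  obtain m where m: "\<And>n x. divisor_chain n x \<Longrightarrow> x 0 = z \<Longrightarrow> n \<le> m"
    using divisor_chain_bounded[of z] True z by auto
  have pow: "t ^ k \<in> nonunits - {0}" if "k > 0" for k
    using that t nonunits_mult[of t "t ^ (k - 1)"] power_B[of t "k - 1"]
    by (cases k) (auto simp: nonunits_def mult.commute)
  have bound: "k \<le> m" if k: "z / t ^ k \<in> B" for k
  proof (cases "k = 0")
    case False
    let ?x = "\<lambda>i. if i = 0 then z else t ^ (k - i)"
    have "divisor_chain k ?x" unfolding divisor_chain_def
    proof (intro conjI allI impI)
      fix i j assume ij: "j < k" "i < j"
      have "t ^ k = t ^ j * t ^ (k - j)" using ij by (simp flip: power_add)
      then have "z / t ^ (k - j) = z / t ^ k * t ^ j" using t by (simp add: field_simps)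
      moreover have "t ^ (k - i) / t ^ (k - j) = t ^ (j - i)" using ij t by (simp add: power_diff[symmetric])
      ultimately show "?x i / ?x j \<in> nonunits"
        using ij nonunits_mult[OF _ k, of "t ^ j"] pow[of j] pow[of "j - i"]
        by (cases "i = 0") simp_all
    qed (use True z pow in auto)
    then show ?thesis using m by simp
  qed simp
  define k where "k = (GREATEST k. z / t ^ k \<in> B)"
  have k: "z / t ^ k \<in> B" unfolding k_def by (rule GreatestI_nat[of _ 0 m]) (use z bound in auto)
  have "z / t ^ k \<notin> nonunits"
  proof
    assume "z / t ^ k \<in> nonunits"
    then have "z / t ^ Suc k \<in> B" using t by (auto simp: mult.commute)
    then show False using Greatest_le_nat[of "\<lambda>k. z / t ^ k \<in> B" "Suc k" m] bound k_def by force
  qed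
  then show ?thesis using k by blast
qed (use z in \<open>auto intro: exI[of _ 0]\<close>)

text \<open>Every nonzero element is \<open>t powi k * e\<close> with a unit \<open>e\<close> and a
  unique exponent, and this exponent is the valuation. It vanishes on \<open>F\<close>, whose
  nonzero elements are units of \<open>B\<close>, and is positive at the nonunit
  \<open>y\<close>.\<close>

lemma place_exists: "\<exists>u. place F u \<and> u y > 0"
proof -
  obtain t where t: "t \<in> nonunits - {0}" "\<forall>s\<in>nonunits. s / t \<in> B" using uniformiser by blast
  then have t0: "t \<noteq> 0" by simp
  define U where "U = B - nonunits"
  have U_iff: "a \<in> U \<longleftrightarrow> a \<noteq> 0 \<and> a \<in> B \<and> inverse a \<in> B" for a by (auto simp: U_def nonunits_def)
  have U_mult: "a * b \<in> U" if "a \<in> U" "b \<in> U" for a b using that unfolding U_iff by (auto intro: mult)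
  have U_inv: "inverse a \<in> U" if "a \<in> U" for a using that unfolding U_iff by auto
  have tpow: "t ^ k \<in> nonunits" if "k > 0" for k
    using that t nonunits_mult[of t "t ^ (k - 1)"] power_B[of t "k - 1"]
    by (cases k) (auto simp: nonunits_def mult.commute)
  have B_nonneg: "0 \<le> k" if "e \<in> U" "t powi k * e \<in> B" for k e
  proof (rule ccontr)
    assume "\<not> 0 \<le> k"
    then obtain n where n: "k = - int n" "n > 0" by (metis neg_int_cases of_nat_0_less_iff not_le)
    have "inverse e * (t powi k * e) \<in> B" using that U_iff by (blast intro: mult)
    moreover have "inverse e * (t powi k * e) = inverse (t ^ n)"
      using that(1) U_iff t0 by (simp add: n power_int_minus field_simps)
    ultimately have "inverse (t ^ n) \<in> B" by (simp only:)
    then show False using tpow[OF n(2)] t0 by (simp add: nonunits_def)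
  qed
  have uniq: "k = l" if "e \<in> U" "e' \<in> U" "t powi k * e = t powi l * e'" for k l e e'
  proof -
    have *: "k \<le> l" if "e \<in> U" "e' \<in> U" "t powi k * e = t powi l * e'" for k l e e'
    proof -
      have "t powi (l - k) * e' = t powi (- k) * (t powi l * e')" using t0 by (simp add: power_int_diff power_int_minus field_simps)
      also have "\<dots> = e" unfolding that(3)[symmetric] using t0 by (simp add: power_int_minus)
      finally have "t powi (l - k) * e' \<in> B" using that U_iff by simp
      then show ?thesis using B_nonneg[of e' "l - k"] that by simp
    qed
    show ?thesis using *[OF that] *[OF that(2,1) that(3)[symmetric]] by simp
  qed
  have ex: "\<exists>k. \<exists>e\<in>U. z = t powi k * e" if z0: "z \<noteq> 0" for z
  proof (cases "z \<in> B")
    case True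
    then obtain k where "z / t ^ k \<in> U" using factorisation[OF t True z0] by (auto simp: U_def)
    moreover have "z = t powi int k * (z / t ^ k)" using t0 by simp
    ultimately show ?thesis by blast
  next
    case False
    then have "inverse z \<in> B" using valuation_dichotomy that by blast
    then obtain k where k: "inverse z / t ^ k \<in> U" using factorisation[OF t, of "inverse z"] z0 by (auto simp: U_def)
    have "z = t powi (- int k) * inverse (inverse z / t ^ k)"
      using t0 that by (simp add: power_int_minus field_simps)
    then show ?thesis using U_inv[OF k] by blast
  qed
  define u where "u z = (if z = 0 then 0 else THE k. \<exists>e\<in>U. z = t powi k * e)" for z
  have uI: "u (t powi k * e) = k" if "e \<in> U" for k e
  proof -
    have "(THE l. \<exists>e'\<in>U. t powi k * e = t powi l * e') = k"
      by (rule the_equality) (use that uniq in blast)+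
    moreover have "t powi k * e \<noteq> 0" using that U_iff t0 by auto
    ultimately show ?thesis by (simp add: u_def)
  qed
  have uE: "\<exists>e\<in>U. z = t powi (u z) * e" if "z \<noteq> 0" for z using ex[OF that] uI by metis
  have uB: "0 \<le> u z" if "z \<in> B" "z \<noteq> 0" for z using uE[OF that(2)] B_nonneg that(1) by metis
  have u_mult: "u (a * b) = u a + u b" if ab: "a \<noteq> 0" "b \<noteq> 0" for a b
  proof -
    obtain e e' where e: "e \<in> U" "a = t powi (u a) * e" "e' \<in> U" "b = t powi (u b) * e'"
      using uE ab by metis
    have "a * b = t powi (u a) * e * (t powi (u b) * e')" using e by metis
    also have "\<dots> = t powi (u a + u b) * (e * e')" using t0 by (simp add: power_int_add ac_simps)
    finally show ?thesis using uI U_mult e by metis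
  qed
  have u_add: "u a \<le> u (a + b)" if ab: "a \<noteq> 0" "b \<noteq> 0" "a + b \<noteq> 0" "u a \<le> u b" for a b
  proof -
    obtain e e' where e: "e \<in> U" "a = t powi (u a) * e" "e' \<in> U" "b = t powi (u b) * e'"
      using uE ab by metis
    have "t powi (u b) = t powi (u a) * t ^ nat (u b - u a)"
      using ab t0 by (simp add: power_int_add[symmetric] flip: power_int_of_nat)
    then have "a + b = t powi (u a) * (e + t ^ nat (u b - u a) * e')"
      using e by (metis (no_types, lifting) distrib_left mult.assoc)
    moreover define c where "c = e + t ^ nat (u b - u a) * e'"
    ultimately have abc: "a + b = t powi (u a) * c" by simp
    have "c \<in> B"
      unfolding c_def using e t U_iff by (intro add mult power_B) (auto simp: nonunits_def)
    moreover have "c \<noteq> 0" using abc ab by auto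
    ultimately have "0 \<le> u c" by (rule uB)
    moreover have "u (t powi (u a)) = u a" using uI[of 1 "u a"] one U_iff by simp
    ultimately show ?thesis
      unfolding abc using u_mult[of "t powi (u a)" c] \<open>c \<noteq> 0\<close> t0 by simp
  qed
  have "discrete_valuation u"
    unfolding discrete_valuation_def
  proof (intro conjI allI impI)
    show "u 0 = 0" by (simp add: u_def)
    show "\<exists>x. x \<noteq> 0 \<and> u x = 1" using uI[of 1 1] t0 one U_iff by (intro exI[of _ t]) auto
    fix a b :: 'k assume "a \<noteq> 0" "b \<noteq> 0" "a + b \<noteq> 0"
    then show "min (u a) (u b) \<le> u (a + b)"
      using u_add[of a b] u_add[of b a] by (cases "u a \<le> u b") (auto simp: add.commute)
  qed (use u_mult in auto)
  moreover have "u a = 0" if "a \<in> F" for a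
  proof (cases "a = 0")
    case False
    then have "a \<in> U" using that F_B F_inverse U_iff by blast
    then show ?thesis using uI[of a 0] by simp
  qed (simp add: u_def)
  moreover have "u y > 0"
  proof -
    have "y / t \<in> B" using t y_nonunit by blast
    then have "0 \<le> u (y / t)" using uB y0 t0 by simp
    moreover have "u t = 1" using uI[of 1 1] one U_iff by auto
    moreover have "u y = u (y / t) + u t" using u_mult[of "y / t" t] y0 t0 by simp
    ultimately show ?thesis by simp
  qed
  ultimately show ?thesis unfolding place_def by blast
qed

end

section \<open>Zeros of nonconstant functions and the finiteness theorem\<close>

context constant_field
begin

text \<open>In the polynomial ring F[y] the element \<open>y\<close> is not invertible. Zorn's lemma
  extends F[y] to a maximal ring with this property, and its valuation is a place where
  \<open>y\<close> vanishes.\<close>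

lemma zero_exists:
  assumes y: "y \<notin> F"
  shows "\<exists>u. place F u \<and> u y > 0"
proof -
  let ?ring = "\<lambda>B. 1 \<in> B \<and> (\<forall>a\<in>B. \<forall>b\<in>B. a - b \<in> B \<and> a * b \<in> B)"
  let ?A = "{B. ?ring B \<and> F \<subseteq> B \<and> y \<in> B \<and> (\<forall>b\<in>B. y * b \<noteq> 1)}"
  let ?B0 = "(\<lambda>P. poly P y) ` polys F"
  have "?B0 \<in> ?A"
  proof (intro CollectI conjI ballI)
    show "1 \<in> ?B0" using polys_ring(2) by (force intro: image_eqI[of _ _ 1])
    show "F \<subseteq> ?B0"
    proof
      fix a assume "a \<in> F"
      then show "a \<in> ?B0" using polys_ring(7) by (intro image_eqI[of _ _ "[:a:]"]) auto
    qed
    show "y \<in> ?B0" using F_ring by (intro image_eqI[of _ _ "[:0, 1:]"]) (auto intro!: polys_ring)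
    fix b assume "b \<in> ?B0"
    then obtain P where P: "P \<in> polys F" "b = poly P y" by blast
    \<comment> \<open>An inverse \<open>P\<close> of \<open>y\<close> in F[y] would make
      \<open>y\<close> a root of the nonzero polynomial \<open>X * P - 1\<close>.\<close>
    have "poly (pCons (- 1) P) y \<noteq> 0"
      using P F_ring by (intro transcendental_nonconstant[OF y]) (auto intro!: polys_ring)
    then show "y * b \<noteq> 1" using P by simp
  next
    fix a b assume "a \<in> ?B0" "b \<in> ?B0"
    then show "a - b \<in> ?B0" "a * b \<in> ?B0"
      using polys_ring(5,6) by (auto simp flip: poly_diff poly_mult)
  qed
  moreover have "\<Union>\<C> \<in> ?A" if C: "\<C> \<noteq> {}" "subset.chain ?A \<C>" for \<C>
  proof -
    have sub: "\<C> \<subseteq> ?A" and chain: "\<And>M M'. M \<in> \<C> \<Longrightarrow> M' \<in> \<C> \<Longrightarrow> M \<subseteq> M' \<or> M' \<subseteq> M"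
      using C by (auto simp: subset.chain_def)
    have "a - b \<in> \<Union>\<C> \<and> a * b \<in> \<Union>\<C>" if "a \<in> \<Union>\<C>" "b \<in> \<Union>\<C>" for a b
    proof -
      obtain M where "M \<in> \<C>" "a \<in> M" "b \<in> M" using \<open>a \<in> \<Union>\<C>\<close> \<open>b \<in> \<Union>\<C>\<close> chain by (meson UnionE subsetD)
      then show ?thesis using sub by blast
    qed
    moreover obtain M where "M \<in> \<C>" using C by blast
    ultimately show ?thesis using sub by blast
  qed
  ultimately obtain B where B: "B \<in> ?A" "\<And>C. C \<in> ?A \<Longrightarrow> B \<subseteq> C \<Longrightarrow> C = B"
    using subset_Zorn_nonempty[of ?A] by (metis (no_types, lifting) empty_iff)
  have "y \<noteq> 0" using y F_ring by auto
  interpret dominating_place F y B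
  proof
    fix C assume C: "B \<subseteq> C" "\<And>a b. a \<in> C \<Longrightarrow> b \<in> C \<Longrightarrow> a - b \<in> C"
      "\<And>a b. a \<in> C \<Longrightarrow> b \<in> C \<Longrightarrow> a * b \<in> C" "\<And>b. b \<in> C \<Longrightarrow> y * b \<noteq> 1"
    then have "C \<in> ?A" using B(1) by blast
    then show "C = B" using B(2) C(1) by blast
  qed (use B(1) \<open>y \<noteq> 0\<close> in auto)
  show ?thesis by (rule place_exists)
qed

text \<open>Two functions with the same representative modulo functions vanishing at
  \<open>v\<close> differ by a regular function vanishing at \<open>v\<close>, which must be 0. So
  the representative, out of a finite set, determines the function.\<close>

theorem finite_bounded_regular:
  assumes v: "place F v"
  shows "finite {x \<in> regular_outside F v. val_ge v (- int N) x}"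
proof -
  interpret discretely_valued v by (rule place_discretely_valued[OF v])
  have zero: "x = 0" if x: "x \<in> regular_outside F v" "val_ge v 1 x" for x
  proof (rule ccontr)
    assume x0: "x \<noteq> 0"
    then have "v x \<ge> 1" using x by (simp add: val_ge_def)
    then have "inverse x \<notin> F" using place_F[OF v] val_inverse[of x] by force
    then obtain u where u: "place F u" "u (inverse x) > 0" using zero_exists by blast
    interpret u: discretely_valued u by (rule place_discretely_valued[OF u(1)])
    have "u x < 0" using u(2) u.val_inverse[of x] by simp
    then have "u \<noteq> v" "x \<notin> valuation_ring u"
      using \<open>v x \<ge> 1\<close> x0 by (auto simp: valuation_ring_def val_ge_def)
    then show False using x(1) u(1) by (auto simp: regular_outside_def)
  qed
  have diff: "x - x' \<in> regular_outside F v" if "x \<in> regular_outside F v" "x' \<in> regular_outside F v" for x x'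
    using that place_discretely_valued discretely_valued.val_ge_diff
    unfolding regular_outside_def valuation_ring_def by blast
  let ?X = "{x \<in> regular_outside F v. val_ge v (- int N) x}"
  obtain R where R: "finite R" "\<And>x. val_ge v (- int N) x \<Longrightarrow> \<exists>r\<in>R. val_ge v 1 (x - r)"
    using bounded_poles_finite_mod_zeros[OF v] by blast
  define r where "r x = (SOME r. r \<in> R \<and> val_ge v 1 (x - r))" for x
  have r: "r x \<in> R" "val_ge v 1 (x - r x)" if "x \<in> ?X" for x
    unfolding r_def using someI_ex[of "\<lambda>r. r \<in> R \<and> val_ge v 1 (x - r)"] R(2) that by blast+
  have inj: "inj_on r ?X"
  proof (rule inj_onI)
    fix x x' assume *: "x \<in> ?X" "x' \<in> ?X" "r x = r x'"
    have "val_ge v 1 ((x - r x) - (x' - r x'))" by (rule val_ge_diff[OF r(2)[OF *(1)] r(2)[OF *(2)]])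
    then show "x = x'" using zero[of "x - x'"] diff * by simp
  qed
  have "r ` ?X \<subseteq> R" using r(1) by (rule image_subsetI)
  then have "finite (r ` ?X)" using R(1) by (rule finite_subset)
  then show ?thesis using inj by (rule finite_imageD)
qed

end

section \<open>Chains on lists of vertices\<close>

definition cscale :: "rat \<Rightarrow> ('a \<Rightarrow>\<^sub>0 rat) \<Rightarrow> ('a \<Rightarrow>\<^sub>0 rat)" where
  "cscale c x = Poly_Mapping.map ((*) c) x"

lemma lookup_scale [simp]: "Poly_Mapping.lookup (cscale c x) b = c * Poly_Mapping.lookup x b"
  by (simp add: cscale_def Poly_Mapping.map.rep_eq when_def)

lemma scale_simps [simp]:
  "cscale 0 x = 0" "cscale c 0 = 0" "cscale 1 x = x" "cscale c (cscale d x) = cscale (c * d) x"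
  "cscale c (- x) = - cscale c x" "cscale (- c) x = - cscale c x"
  by (auto intro!: poly_mapping_eqI simp: algebra_simps)

lemma scale_add:
  "cscale c (x + y) = cscale c x + cscale c y" "cscale (c + d) x = cscale c x + cscale d x"
  "cscale c (x - y) = cscale c x - cscale c y" "cscale (c - d) x = cscale c x - cscale d x"
  by (auto intro!: poly_mapping_eqI simp: algebra_simps lookup_add lookup_minus)

lemma scale_single [simp]: "cscale c (Poly_Mapping.single b d) = Poly_Mapping.single b (c * d)"
  by (auto intro!: poly_mapping_eqI simp: lookup_single when_def)

lemma scale_sum: "cscale c (sum f A) = (\<Sum>a\<in>A. cscale c (f a))"
  by (induction A rule: infinite_finite_induct) (auto simp: scale_add)

abbreviation unit_chain :: "'a \<Rightarrow> ('a \<Rightarrow>\<^sub>0 rat)" where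
  "unit_chain b \<equiv> Poly_Mapping.single b 1"

definition lext :: "('a \<Rightarrow> ('b \<Rightarrow>\<^sub>0 rat)) \<Rightarrow> ('a \<Rightarrow>\<^sub>0 rat) \<Rightarrow> ('b \<Rightarrow>\<^sub>0 rat)" where
  "lext T x = (\<Sum>b\<in>Poly_Mapping.keys x. cscale (Poly_Mapping.lookup x b) (T b))"

lemma lext_superset:
  assumes "finite A" "Poly_Mapping.keys x \<subseteq> A"
  shows "lext T x = (\<Sum>b\<in>A. cscale (Poly_Mapping.lookup x b) (T b))"
  unfolding lext_def
  by (rule sum.mono_neutral_left) (use assms in \<open>auto simp: in_keys_iff\<close>)

lemma lext_zero [simp]: "lext T 0 = 0"
  by (simp add: lext_def)

lemma lext_add: "lext T (x + y) = lext T x + lext T y"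
proof -
  let ?A = "Poly_Mapping.keys x \<union> Poly_Mapping.keys y"
  have "finite ?A" "Poly_Mapping.keys (x + y) \<subseteq> ?A" by (auto dest: subsetD[OF keys_add])
  then show ?thesis
    by (simp add: lext_superset[of ?A] lookup_add scale_add sum.distrib)
qed

lemma lext_uminus: "lext T (- x) = - lext T x"
  by (simp add: lext_def keys_def sum_negf)

lemma lext_diff: "lext T (x - y) = lext T x - lext T y"
  using lext_add[of T x "- y"] by (simp add: lext_uminus)

lemma lext_scale: "lext T (cscale c x) = cscale c (lext T x)"
proof -
  have "Poly_Mapping.keys (cscale c x) \<subseteq> Poly_Mapping.keys x" by (auto simp: in_keys_iff)
  then show ?thesis
    by (simp add: lext_superset[of "Poly_Mapping.keys x"] scale_sum)
qed

lemma lext_single [simp]: "lext T (Poly_Mapping.single b c) = cscale c (T b)"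
  by (simp add: lext_def)

lemma lext_sum: "lext T (sum f A) = (\<Sum>a\<in>A. lext T (f a))"
  by (induction A rule: infinite_finite_induct) (auto simp: lext_add)

lemma lext_lext: "lext T (lext U x) = lext (\<lambda>b. lext T (U b)) x"
  unfolding lext_def[of U] lext_def[of "\<lambda>b. lext T (U b)"] by (simp add: lext_sum lext_scale)

lemma lext_cong: "(\<And>b. b \<in> Poly_Mapping.keys x \<Longrightarrow> T b = U b) \<Longrightarrow> lext T x = lext U x"
  by (simp add: lext_def)

lemma lext_unit_chain [simp]: "lext unit_chain x = x"
  by (rule poly_mapping_eqI)
    (simp add: lext_def lookup_sum lookup_single when_def in_keys_iff sum.delta')

lemma lext_fun_diff: "lext (\<lambda>b. T b - U b) x = lext T x - lext U x"
  by (simp add: lext_def scale_add sum_subtractf)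

lemma lext_fun_uminus: "lext (\<lambda>b. - T b) x = - lext T x"
  by (simp add: lext_def sum_negf)

lemma lext_fun_zero [simp]: "lext (\<lambda>b. 0) x = 0"
  by (simp add: lext_def)

text \<open>Integral chains and chains over Z[1/p] share one type with rational coefficients; the
  ring of coefficients is the subset \<open>S\<close>.\<close>

definition chains :: "rat set \<Rightarrow> 'a set \<Rightarrow> ('a \<Rightarrow>\<^sub>0 rat) set" where
  "chains S B = {x. Poly_Mapping.keys x \<subseteq> B \<and> (\<forall>b. Poly_Mapping.lookup x b \<in> S)}"

lemma chains_mono: "B \<subseteq> B' \<Longrightarrow> x \<in> chains S B \<Longrightarrow> x \<in> chains S B'"
  by (auto simp: chains_def)

locale coeff_ring =
  fixes S :: "rat set"
  assumes one_S: "1 \<in> S"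
    and diff_S: "\<And>a b. a \<in> S \<Longrightarrow> b \<in> S \<Longrightarrow> a - b \<in> S"
    and mult_S: "\<And>a b. a \<in> S \<Longrightarrow> b \<in> S \<Longrightarrow> a * b \<in> S"
begin

lemma zero_S: "0 \<in> S"
  using diff_S[OF one_S one_S] by simp

lemma uminus_S: "a \<in> S \<Longrightarrow> - a \<in> S"
  using diff_S[OF zero_S] by force

lemma zero_chains [simp]: "0 \<in> chains S B"
  by (simp add: chains_def zero_S)

lemma diff_chains: "x \<in> chains S B \<Longrightarrow> y \<in> chains S B \<Longrightarrow> x - y \<in> chains S B"
  using keys_diff[of x y] by (auto simp: chains_def lookup_minus diff_S)

lemma uminus_chains: "x \<in> chains S B \<Longrightarrow> - x \<in> chains S B"
  using diff_chains[of 0 B x] by simp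

lemma add_chains: "x \<in> chains S B \<Longrightarrow> y \<in> chains S B \<Longrightarrow> x + y \<in> chains S B"
  using diff_chains[of x B "- y"] by (simp add: uminus_chains)

lemma scale_chains: "c \<in> S \<Longrightarrow> x \<in> chains S B \<Longrightarrow> cscale c x \<in> chains S B"
  by (auto simp: chains_def mult_S in_keys_iff)

lemma sum_chains: "(\<And>a. a \<in> A \<Longrightarrow> f a \<in> chains S B) \<Longrightarrow> sum f A \<in> chains S B"
  by (induction A rule: infinite_finite_induct) (auto intro: add_chains)

lemma unit_chains: "b \<in> B \<Longrightarrow> unit_chain b \<in> chains S B"
  by (auto simp: chains_def lookup_single when_def one_S zero_S)

lemma lext_chains:
  "x \<in> chains S A \<Longrightarrow> (\<And>a. a \<in> A \<Longrightarrow> T a \<in> chains S B) \<Longrightarrow> lext T x \<in> chains S B"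
  unfolding lext_def by (rule sum_chains, rule scale_chains) (auto simp: chains_def)

end

lemma lext_cong_chains:
  "x \<in> chains S B \<Longrightarrow> (\<And>b. b \<in> B \<Longrightarrow> T b = U b) \<Longrightarrow> lext T x = lext U x"
  by (rule lext_cong) (auto simp: chains_def)

lemma lext_id_chains:
  "x \<in> chains S B \<Longrightarrow> (\<And>b. b \<in> B \<Longrightarrow> T b = unit_chain b) \<Longrightarrow> lext T x = x"
  using lext_cong_chains[of x S B T unit_chain] by simp


subsection \<open>The augmented boundary\<close>

text \<open>The empty list, of degree \<open>-1\<close>, is the target of the augmentation.\<close>

definition prepend :: "'a \<Rightarrow> ('a list \<Rightarrow>\<^sub>0 rat) \<Rightarrow> ('a list \<Rightarrow>\<^sub>0 rat)" where
  "prepend x = lext (\<lambda>xs. unit_chain (x # xs))"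

text \<open>The alternating sum of faces as a recursion: the boundary of a cone is its base minus
  the cone over the boundary of the base. The form with omitted entries is
  \<open>face_omit\<close>.\<close>

primrec face :: "'a list \<Rightarrow> ('a list \<Rightarrow>\<^sub>0 rat)" where
  "face [] = 0"
| "face (x # xs) = unit_chain xs - prepend x (face xs)"

definition bd :: "('a list \<Rightarrow>\<^sub>0 rat) \<Rightarrow> ('a list \<Rightarrow>\<^sub>0 rat)" where
  "bd = lext face"

lemma bd_apply: "bd c = lext face c"
  by (simp add: bd_def)

lemma prepend_linear:
  "prepend x (a - b) = prepend x a - prepend x b" "prepend x (a + b) = prepend x a + prepend x b"
  "prepend x (- a) = - prepend x a" "prepend x 0 = 0" "prepend x (cscale c a) = cscale c (prepend x a)"
  by (simp_all add: prepend_def lext_diff lext_add lext_uminus lext_scale)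

lemma prepend_single [simp]: "prepend x (Poly_Mapping.single xs c) = Poly_Mapping.single (x # xs) c"
  by (simp add: prepend_def)

lemma bd_linear:
  "bd (a - b) = bd a - bd b" "bd (a + b) = bd a + bd b" "bd (- a) = - bd a" "bd 0 = 0"
  "bd (cscale c a) = cscale c (bd a)" "bd (sum f A) = (\<Sum>i\<in>A. bd (f i))"
  by (simp_all add: bd_def lext_diff lext_add lext_uminus lext_scale lext_sum)

lemma bd_single [simp]: "bd (Poly_Mapping.single xs c) = cscale c (face xs)"
  by (simp add: bd_def)

lemma lext_prepend: "lext T (prepend x c) = lext (\<lambda>xs. T (x # xs)) c"
  by (simp add: prepend_def lext_lext)

lemma prepend_lext: "prepend x (lext T c) = lext (\<lambda>b. prepend x (T b)) c"
  by (simp add: prepend_def lext_lext)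

lemma bd_lext: "bd (lext T c) = lext (\<lambda>b. bd (T b)) c"
  by (simp add: bd_def lext_lext)

text \<open>The cone formula. It fills cycles of tuples of group elements, and cycles of flags in
  which only the standard lattice occurs.\<close>

lemma bd_prepend: "bd (prepend x c) = c - prepend x (bd c)"
  by (simp add: bd_def lext_prepend lext_fun_diff prepend_lext)

lemma bd_face: "bd (face xs) = 0"
  by (induction xs) (simp_all add: bd_linear bd_prepend prepend_linear)

lemma bd_bd [simp]: "bd (bd c) = 0"
proof -
  have "bd (bd c) = lext (\<lambda>b. bd (face b)) c" by (simp add: bd_def lext_lext)
  also have "\<dots> = 0" by (simp only: bd_face lext_fun_zero)
  finally show ?thesis .
qed

definition mapc :: "('a \<Rightarrow> 'b) \<Rightarrow> ('a list \<Rightarrow>\<^sub>0 rat) \<Rightarrow> ('b list \<Rightarrow>\<^sub>0 rat)" where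
  "mapc f = lext (\<lambda>xs. unit_chain (map f xs))"

lemma mapc_linear:
  "mapc f (a - b) = mapc f a - mapc f b" "mapc f (a + b) = mapc f a + mapc f b"
  "mapc f (- a) = - mapc f a" "mapc f 0 = 0" "mapc f (cscale c a) = cscale c (mapc f a)"
  "mapc f (sum h A) = (\<Sum>i\<in>A. mapc f (h i))"
  by (simp_all add: mapc_def lext_diff lext_add lext_uminus lext_scale lext_sum)

lemma mapc_single [simp]: "mapc f (Poly_Mapping.single xs c) = Poly_Mapping.single (map f xs) c"
  by (simp add: mapc_def)

lemma mapc_prepend: "mapc f (prepend x c) = prepend (f x) (mapc f c)"
  by (simp add: mapc_def prepend_lext lext_prepend)

lemma mapc_lext: "mapc f (lext T c) = lext (\<lambda>b. mapc f (T b)) c"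
  by (simp add: mapc_def lext_lext)

lemma lext_mapc: "lext T (mapc f c) = lext (\<lambda>xs. T (map f xs)) c"
  by (simp add: mapc_def lext_lext)

lemma mapc_face: "mapc f (face xs) = face (map f xs)"
  by (induction xs) (simp_all add: mapc_linear mapc_prepend)

lemma bd_mapc: "bd (mapc f c) = mapc f (bd c)"
  by (simp add: bd_def mapc_lext mapc_face lext_mapc)

lemma mapc_mapc: "mapc f (mapc g c) = mapc (f \<circ> g) c"
  by (simp add: mapc_def lext_lext)

lemma mapc_id: "(\<And>xs x. xs \<in> Poly_Mapping.keys c \<Longrightarrow> x \<in> set xs \<Longrightarrow> f x = x) \<Longrightarrow> mapc f c = c"
proof -
  assume "\<And>xs x. xs \<in> Poly_Mapping.keys c \<Longrightarrow> x \<in> set xs \<Longrightarrow> f x = x"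
  then have "mapc f c = lext unit_chain c"
    unfolding mapc_def by (intro lext_cong) (simp add: map_idI)
  then show ?thesis by simp
qed

text \<open>Degrees count entries: \<open>deg B q\<close> holds simplices of dimension
  \<open>q - 1\<close>, and \<open>deg B 0\<close> at most the empty list.\<close>

definition deg :: "'a list set \<Rightarrow> nat \<Rightarrow> 'a list set" where
  "deg B q = {xs \<in> B. length xs = q}"

definition face_closed :: "'a list set \<Rightarrow> bool" where
  "face_closed B \<longleftrightarrow> (\<forall>us x vs. us @ x # vs \<in> B \<longrightarrow> us @ vs \<in> B)"

context coeff_ring
begin

lemma prepend_chains:
  "c \<in> chains S A \<Longrightarrow> (\<And>xs. xs \<in> A \<Longrightarrow> x # xs \<in> B) \<Longrightarrow> prepend x c \<in> chains S B"
  unfolding prepend_def by (rule lext_chains) (auto intro: unit_chains)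

lemma mapc_chains:
  "c \<in> chains S A \<Longrightarrow> (\<And>xs. xs \<in> A \<Longrightarrow> map f xs \<in> B) \<Longrightarrow> mapc f c \<in> chains S B"
  unfolding mapc_def by (rule lext_chains) (auto intro: unit_chains)

lemma face_chains_faces: "face xs \<in> chains S {us @ vs | us x vs. xs = us @ x # vs}"
proof (induction xs)
  case (Cons x xs)
  have "prepend x (face xs) \<in> chains S {us @ vs | us y vs. x # xs = us @ y # vs}"
    by (rule prepend_chains[OF Cons], clarify) (metis append_Cons)
  then show ?case by (auto intro!: diff_chains unit_chains intro: exI[of _ "[]"])
qed simp

lemma face_chains: "face_closed B \<Longrightarrow> xs \<in> deg B (Suc q) \<Longrightarrow> face xs \<in> chains S (deg B q)"
  by (rule chains_mono[OF _ face_chains_faces]) (auto simp: deg_def face_closed_def)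

lemma bd_chains: "face_closed B \<Longrightarrow> c \<in> chains S (deg B (Suc q)) \<Longrightarrow> bd c \<in> chains S (deg B q)"
  unfolding bd_def by (rule lext_chains) (auto intro: face_chains)

end


subsection \<open>The prism operator\<close>

text \<open>The homotopy between \<open>f\<close> and the identity on ordered simplices, the
  alternating sum of the lists \<open>f x_0, ..., f x_i, x_i, ..., x_q\<close>.\<close>

primrec prism :: "('a \<Rightarrow> 'a) \<Rightarrow> 'a list \<Rightarrow> ('a list \<Rightarrow>\<^sub>0 rat)" where
  "prism f [] = 0"
| "prism f (x # xs) = prepend (f x) (unit_chain (x # xs) - prism f xs)"

lemma bd_prism: "bd (prism f xs) = unit_chain xs - unit_chain (map f xs) - lext (prism f) (face xs)"
proof (induction xs)
  case (Cons x xs)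
  have "lext (prism f) (prepend x c) = prepend (f x) (prepend x c - lext (prism f) c)" for c
    by (simp add: lext_prepend prepend_linear lext_fun_diff prepend_lext)
      (simp add: prepend_def lext_lext)
  then show ?case
    by (simp add: bd_prepend bd_linear prepend_linear lext_diff Cons algebra_simps)
qed (simp add: bd_linear)

lemma (in coeff_ring) prism_chains:
  "prism f xs \<in> chains S {map f us @ f x # x # vs | us x vs. xs = us @ x # vs}"
proof (induction xs)
  case (Cons x xs)
  have "prepend (f x) (prism f xs) \<in> chains S {map f us @ f y # y # vs | us y vs. x # xs = us @ y # vs}"
    by (rule prepend_chains[OF Cons], clarify) (metis append_Cons list.simps(9))
  then show ?case
    by (auto simp: prepend_linear intro!: diff_chains unit_chains intro: exI[of _ "[]"])
qed simp


subsection \<open>Sorting with signs\<close>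

text \<open>Left multiplication by \<open>x\<close> in an exterior algebra with basis ordered by the
  key: every entry passed costs a sign, and a repeated key gives 0.\<close>

primrec ins :: "('a \<Rightarrow> 'k::linorder) \<Rightarrow> 'a \<Rightarrow> 'a list \<Rightarrow> ('a list \<Rightarrow>\<^sub>0 rat)" where
  "ins k x [] = unit_chain [x]"
| "ins k x (z # zs) = (if k x < k z then unit_chain (x # z # zs) else
     if k x = k z then 0 else - prepend z (ins k x zs))"

text \<open>The signed normal form of a list. It kills lists with a repeated key, and so leads from
  ordered chains to oriented ones.\<close>

primrec sortc :: "('a \<Rightarrow> 'k::linorder) \<Rightarrow> 'a list \<Rightarrow> ('a list \<Rightarrow>\<^sub>0 rat)" where
  "sortc k [] = unit_chain []"
| "sortc k (x # xs) = lext (ins k x) (sortc k xs)"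

abbreviation ascending :: "('a \<Rightarrow> 'k::linorder) \<Rightarrow> 'a list \<Rightarrow> bool" where
  "ascending k xs \<equiv> sorted_wrt (<) (map k xs)"

lemma ins_Cons:
  "k x < k z \<Longrightarrow> ins k x (z # zs) = unit_chain (x # z # zs)"
  "k x = k z \<Longrightarrow> ins k x (z # zs) = 0"
  "k z < k x \<Longrightarrow> ins k x (z # zs) = - prepend z (ins k x zs)"
  by (auto simp: not_less_iff_gr_or_eq)

lemma ins_prepend:
  "k x < k z \<Longrightarrow> lext (ins k x) (prepend z c) = prepend x (prepend z c)"
  "k x = k z \<Longrightarrow> lext (ins k x) (prepend z c) = 0"
  "k z < k x \<Longrightarrow> lext (ins k x) (prepend z c) = - prepend z (lext (ins k x) c)"
  by (simp_all only: lext_prepend ins_Cons lext_fun_zero lext_fun_uminus prepend_lext)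
    (simp add: prepend_def lext_lext)

lemma ins_ins: "lext (ins k x) (ins k y zs) = - lext (ins k y) (ins k x zs)"
proof (induction zs)
  case (Cons z zs)
  note [simp del] = ins.simps(2) and [simp] = ins_Cons ins_prepend
  show ?case
    by (cases "k x" "k z" rule: linorder_cases; cases "k y" "k z" rule: linorder_cases;
        cases "k x" "k y" rule: linorder_cases)
      (simp_all add: lext_uminus prepend_linear Cons)
next
  case Nil
  show ?case
    by (cases "k x" "k y" rule: linorder_cases) (simp_all add: ins_Cons del: ins.simps(2))
qed

lemma ins_same_key: "k x = k y \<Longrightarrow> lext (ins k x) (ins k y zs) = 0"
proof (induction zs)
  case (Cons z zs)
  have eq: "lext (ins k x) (prepend z c) = - prepend z (lext (ins k x) c)" if "k z < k x" for x c
    using that less_not_sym[OF that] less_imp_neq[OF that, symmetric] by (simp add: lext_prepend prepend_lext lext_fun_uminus)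
  show ?case
    using Cons by (cases "k y" "k z" rule: linorder_cases) (simp_all add: eq lext_uminus prepend_linear)
qed auto

lemma sortc_swap: "sortc k (xs @ a # b # ys) = - sortc k (xs @ b # a # ys)"
proof (induction xs)
  case Nil
  show ?case by (simp add: lext_lext ins_ins[of k a b] lext_fun_uminus)
qed (simp add: lext_uminus)

lemma sortc_ascending: "ascending k xs \<Longrightarrow> sortc k xs = unit_chain xs"
proof (induction xs)
  case (Cons x xs)
  then show ?case by (cases xs) auto
qed simp

lemma sortc_move: "sortc k (xs @ a # ys @ zs) = cscale ((-1) ^ length ys) (sortc k (xs @ ys @ a # zs))"
proof (induction ys arbitrary: xs)
  case (Cons y ys)
  have "sortc k (xs @ a # y # ys @ zs) = - sortc k ((xs @ [y]) @ a # ys @ zs)"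
    using sortc_swap[of k xs a y "ys @ zs"] by simp
  then show ?case by (simp only: Cons) simp
qed simp

text \<open>The moves of \<open>a\<close> and of \<open>b\<close> across \<open>ys\<close>
  contribute the same sign and cancel; the swap of \<open>a\<close> with \<open>b\<close>
  remains.\<close>

lemma sortc_transpose:
  "sortc k (xs @ a # ys @ b # zs) = - sortc k (xs @ b # ys @ a # zs)"
proof -
  have "sortc k (xs @ a # ys @ b # zs) = cscale ((-1) ^ length ys) (sortc k (xs @ ys @ a # b # zs))"
    using sortc_move[of k xs a ys "b # zs"] by simp
  also have "\<dots> = - cscale ((-1) ^ length ys) (sortc k (xs @ ys @ b # a # zs))"
    using sortc_swap[of k "xs @ ys" a b zs] by simp
  also have "\<dots> = - sortc k (xs @ b # ys @ a # zs)"
    using sortc_move[of k xs b ys "a # zs"] by simp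
  finally show ?thesis .
qed

lemma (in coeff_ring) ins_chains:
  "ascending k zs \<Longrightarrow> ins k x zs \<in> chains S {ys. mset ys = add_mset x (mset zs) \<and> ascending k ys}"
proof (induction zs)
  case (Cons z zs)
  have "prepend z (ins k x zs) \<in> chains S {ys. mset ys = add_mset x (mset (z # zs)) \<and> ascending k ys}"
    if "k z < k x"
  proof (rule prepend_chains[OF Cons.IH], goal_cases)
    case (2 ys)
    then have "set ys = insert x (set zs)"
      by (metis (mono_tags, lifting) mem_Collect_eq set_mset_add_mset_insert set_mset_mset)
    then show ?case using 2 Cons.prems that by auto
  qed (use Cons.prems in auto)
  moreover have "unit_chain (x # z # zs) \<in> chains S {ys. mset ys = add_mset x (mset (z # zs)) \<and> ascending k ys}"
    if "k x < k z" using Cons.prems that by (intro unit_chains) (auto intro: order.strict_trans)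
  ultimately show ?case by (auto simp: not_less le_less intro!: uminus_chains)
qed (auto intro: unit_chains)

lemma (in coeff_ring) sortc_chains:
  "sortc k xs \<in> chains S {ys. mset ys = mset xs \<and> ascending k ys}"
proof (induction xs)
  case (Cons x xs)
  show ?case unfolding sortc.simps
    by (rule lext_chains[OF Cons], rule chains_mono[OF _ ins_chains]) auto
qed (auto intro: unit_chains)

lemma sortc_chains_UNIV: "sortc k xs \<in> chains UNIV {ys. mset ys = mset xs \<and> ascending k ys}"
proof -
  interpret coeff_ring UNIV by standard auto
  show ?thesis by (rule sortc_chains)
qed

lemma sortc_map: "sortc k (map f xs) = mapc f (sortc (k \<circ> f) xs)"
proof (induction xs)
  case (Cons x xs)
  have ins: "ins k (f x) (map f zs) = mapc f (ins (k \<circ> f) x zs)" for x zs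
    by (induction zs) (auto simp: mapc_linear mapc_prepend)
  show ?case by (simp add: Cons lext_mapc mapc_lext ins comp_def)
qed simp

lemma sortc_cong: "(\<And>x. x \<in> set xs \<Longrightarrow> k x = l x) \<Longrightarrow> sortc k xs = sortc l xs"
proof (induction xs)
  case (Cons x xs)
  have ins: "ins k x zs = ins l x zs" if "k x = l x" "\<And>z. z \<in> set zs \<Longrightarrow> k z = l z" for x zs
    using that by (induction zs) auto
  have "lext (ins k x) (sortc l xs) = lext (ins l x) (sortc l xs)"
  proof (rule lext_cong_chains[OF sortc_chains_UNIV], rule ins)
    fix b z assume "b \<in> {ys. mset ys = mset xs \<and> ascending l ys}" "z \<in> set b"
    then have "z \<in> set xs" by (auto dest: mset_eq_setD)
    then show "k z = l z" using Cons.prems by auto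
  qed (use Cons.prems in auto)
  then show ?case using Cons by simp
qed simp

lemma sortc_mapc:
  "(\<And>x. x \<in> set xs \<Longrightarrow> k (f x) = k x) \<Longrightarrow> sortc k (map f xs) = mapc f (sortc k xs)"
  using sortc_cong[of xs "k \<circ> f" k] by (simp add: sortc_map comp_def)

text \<open>The Leibniz rule. If \<open>x\<close> has the key of the first entry \<open>z\<close>,
  the left side is 0, and on the right the lists without \<open>x\<close> and without
  \<open>z\<close> cancel because equal keys are assumed to mean \<open>z = x\<close>.\<close>

lemma bd_ins:
  "ascending k zs \<Longrightarrow> (\<And>z. z \<in> set zs \<Longrightarrow> k z = k x \<Longrightarrow> z = x) \<Longrightarrow>
    bd (ins k x zs) = unit_chain zs - lext (ins k x) (face zs)"
proof (induction zs)
  case (Cons z r)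
  have first: "ins k x r = unit_chain (x # r)" if "k x \<le> k z"
    using that Cons.prems by (cases r) auto
  show ?case
  proof (cases "k x" "k z" rule: linorder_cases)
    case less
    then show ?thesis using first
      by (simp add: lext_diff lext_prepend bd_prepend prepend_linear)
        (simp add: prepend_def lext_lext)
  next
    case equal
    then have "z = x" using Cons.prems by simp
    moreover have "ins k x r = unit_chain (x # r)" using first equal by simp
    ultimately show ?thesis by (simp add: lext_diff ins_prepend bd_linear)
  next
    case greater
    then have [simp]: "\<not> k x < k z" "k x \<noteq> k z" by auto
    have "lext (ins k x) (prepend z c) = - prepend z (lext (ins k x) c)" for c
      by (simp add: lext_prepend prepend_lext lext_fun_uminus)
    then show ?thesis using Cons
      by (simp add: lext_diff bd_linear bd_prepend prepend_linear)
  qed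
qed (simp add: prepend_linear)

text \<open>The Leibniz rule, one entry at a time. Lists may repeat an entry, as flags do; only
  distinct entries with a common key are excluded.\<close>

lemma bd_sortc: "inj_on k (set xs) \<Longrightarrow> bd (sortc k xs) = lext (sortc k) (face xs)"
proof (induction xs)
  case (Cons x xs)
  have "bd (sortc k (x # xs)) = lext (\<lambda>zs. unit_chain zs - lext (ins k x) (face zs)) (sortc k xs)"
    unfolding sortc.simps bd_lext
  proof (rule lext_cong_chains[OF sortc_chains_UNIV], rule bd_ins)
    fix b z assume "b \<in> {ys. mset ys = mset xs \<and> ascending k ys}" "z \<in> set b" "k z = k x"
    then show "z = x" using Cons.prems
      by (metis (mono_tags, lifting) inj_onD list.set_intros mem_Collect_eq mset_eq_setD)
  qed auto
  also have "\<dots> = sortc k xs - lext (ins k x) (bd (sortc k xs))"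
    by (simp add: lext_fun_diff lext_lext bd_def)
  also have "\<dots> = lext (sortc k) (face (x # xs))"
    using Cons by (simp add: lext_diff lext_prepend lext_lext)
  finally show ?case .
qed (simp add: bd_linear)

text \<open>Preliminary sorting by a finer key changes nothing: the swaps it makes have the same
  sign for \<open>k\<close>, and what it kills is killed by \<open>k\<close> as well. It is applied
  to covolumes, which refine types.\<close>

lemma sortc_sortc:
  "(\<And>x y. x \<in> set xs \<Longrightarrow> y \<in> set xs \<Longrightarrow> l x = l y \<Longrightarrow> k x = k y) \<Longrightarrow>
    lext (sortc k) (sortc l xs) = sortc k xs"
proof (induction xs)
  case (Cons x xs)
  have ins: "lext (sortc k) (ins l x zs) = lext (ins k x) (sortc k zs)"
    if "\<And>z. z \<in> set zs \<Longrightarrow> l z = l x \<Longrightarrow> k z = k x" for zs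
    using that
  proof (induction zs)
    case (Cons z zs)
    show ?case
    proof (cases "l x" "l z" rule: linorder_cases)
      case equal
      then show ?thesis using Cons.prems[of z] 
        by (simp add: lext_lext ins_same_key)
    next
      case greater
      then have "lext (sortc k) (ins l x (z # zs)) = - lext (ins k z) (lext (sortc k) (ins l x zs))"
        using less_not_sym[OF greater] less_imp_neq[OF greater, symmetric] by (simp add: lext_uminus lext_prepend lext_lext)
      also have "\<dots> = lext (\<lambda>b. - lext (ins k z) (ins k x b)) (sortc k zs)"
        using Cons by (simp add: lext_lext lext_fun_uminus)
      also have "\<dots> = lext (ins k x) (sortc k (z # zs))"
        by (simp add: lext_lext ins_ins[of k x z])
      finally show ?thesis .
    qed simp
  qed simp
  have "lext (sortc k) (sortc l (x # xs)) = lext (\<lambda>zs. lext (ins k x) (sortc k zs)) (sortc l xs)"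
    unfolding sortc.simps lext_lext
  proof (rule lext_cong_chains[OF sortc_chains_UNIV], rule ins)
    fix b z assume "b \<in> {ys. mset ys = mset xs \<and> ascending l ys}" "z \<in> set b" "l z = l x"
    then show "k z = k x" using Cons.prems[of z x]
      by (metis (mono_tags, lifting) list.set_intros mem_Collect_eq mset_eq_setD)
  qed
  then show ?case using Cons by (simp flip: lext_lext)
qed simp

lemma sortc_permute_list:
  assumes "\<pi> permutes {..<length xs}"
  shows "sortc k (permute_list \<pi> xs) = cscale (of_int (sign \<pi>)) (sortc k xs)"
proof -
  have swap: "sortc k (permute_list (Transposition.transpose i j) xs) = - sortc k xs"
    if "i < j" "j < length xs" for i j and xs :: "'a list"
  proof -
    define us vs ws where "us = take i xs" and "vs = drop (Suc i) (take j xs)" and "ws = drop (Suc j) xs"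
    have len: "length us = i" "length vs = j - Suc i" using that by (auto simp: us_def vs_def)
    have "take j xs = us @ xs ! i # vs"
      using that id_take_nth_drop[of i "take j xs"] by (simp add: us_def vs_def min_absorb1)
    then have xs: "xs = us @ xs ! i # vs @ xs ! j # ws"
      using id_take_nth_drop[OF that(2)] by (simp add: ws_def)
    have lw: "length ws = length xs - Suc j" by (simp add: ws_def)
    have "permute_list (Transposition.transpose i j) xs = us @ xs ! j # vs @ xs ! i # ws"
    proof (rule nth_equalityI)
      show "length (permute_list (Transposition.transpose i j) xs) = length (us @ xs ! j # vs @ xs ! i # ws)"
        using that by (simp add: len lw)
      fix m assume m: "m < length (permute_list (Transposition.transpose i j) xs)"
      have perm: "Transposition.transpose i j permutes {..<length xs}" using that by (auto intro: permutes_swap_id)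
      have x: "xs ! m = (us @ xs ! i # vs @ xs ! j # ws) ! m" by (simp flip: xs)
      show "permute_list (Transposition.transpose i j) xs ! m = (us @ xs ! j # vs @ xs ! i # ws) ! m"
        unfolding permute_list_nth[OF perm m[unfolded length_permute_list]]
      proof (cases "m = i \<or> m = j")
        case True
        then show "xs ! Transposition.transpose i j m = (us @ xs ! j # vs @ xs ! i # ws) ! m"
          using that by (auto simp: nth_append len)
      next
        case False
        then have "xs ! Transposition.transpose i j m = xs ! m" by simp
        also have "\<dots> = (us @ xs ! j # vs @ xs ! i # ws) ! m"
          by (subst x) (use False that in \<open>auto simp: nth_append len nth_Cons'\<close>)
        finally show "xs ! Transposition.transpose i j m = (us @ xs ! j # vs @ xs ! i # ws) ! m" .
      qed
    qed
    then show ?thesis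
      using sortc_transpose[of k us "xs ! j" vs "xs ! i" ws] by (simp flip: xs)
  qed
  have swap': "sortc k (permute_list (Transposition.transpose i j) xs) = - sortc k xs"
    if "i \<noteq> j" "i < length xs" "j < length xs" for i j and xs :: "'a list"
    using that swap[of i j xs] swap[of j i xs] by (metis linorder_neqE_nat transpose_commute)
  have "\<forall>xs :: 'a list. length xs = n \<longrightarrow>
      sortc k (permute_list \<pi> xs) = cscale (of_int (sign \<pi>)) (sortc k xs)"
    if "\<pi> permutes {..<n}" for n
    using finite_lessThan that
  proof (induction rule: permutes_rev_induct)
    case id
    then show ?case by (simp add: permute_list_def map_nth)
  next
    case (swap a b p)
    have "sortc k (permute_list (p \<circ> Transposition.transpose a b) xs) = cscale (of_int (sign (p \<circ> Transposition.transpose a b))) (sortc k xs)"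
      if "length xs = n" for xs :: "'a list"
    proof (cases "a = b")
      case False
      have pt: "Transposition.transpose a b permutes {..<length xs}"
        using swap that by (auto intro: permutes_swap_id)
      have "permute_list (p \<circ> Transposition.transpose a b) xs = permute_list (Transposition.transpose a b) (permute_list p xs)"
        by (rule permute_list_compose[OF pt])
      moreover have "sign (p \<circ> Transposition.transpose a b) = - sign p"
        using False swap sign_compose[of p "Transposition.transpose a b"] permutation_permutes
        by (auto simp: sign_swap_id permutation_swap_id)
      ultimately show ?thesis
        using swap False that swap'[of a b "permute_list p xs"] by simp
    qed (use swap that in auto)
    then show ?case by blast
  qed
  then show ?thesis using assms by blast
qed


subsection \<open>Equivariant chain maps by acyclic carriers\<close>

text \<open>The value at \<open>[]\<close> says that the augmentation is respected. All conditions
  concern basis lists, and the linear extension is left to \<open>lext\<close>.\<close>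

definition equivariant_chain_map ::
  "rat set \<Rightarrow> 'a list set \<Rightarrow> 'b list set \<Rightarrow> 'g set \<Rightarrow> ('g \<Rightarrow> 'a \<Rightarrow> 'a) \<Rightarrow> ('g \<Rightarrow> 'b \<Rightarrow> 'b) \<Rightarrow>
    ('a list \<Rightarrow> ('b list \<Rightarrow>\<^sub>0 rat)) \<Rightarrow> bool" where
  "equivariant_chain_map S A B G actA actB f \<longleftrightarrow> f [] = unit_chain [] \<and>
     (\<forall>q. \<forall>a\<in>deg A q. f a \<in> chains S (deg B q) \<and> bd (f a) = lext f (face a) \<and>
        (\<forall>g\<in>G. f (map (actA g) a) = mapc (actB g) (f a)))"

definition equivariant_homotopy ::
  "rat set \<Rightarrow> 'a list set \<Rightarrow> 'b list set \<Rightarrow> 'g set \<Rightarrow> ('g \<Rightarrow> 'a \<Rightarrow> 'a) \<Rightarrow> ('g \<Rightarrow> 'b \<Rightarrow> 'b) \<Rightarrow>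
    ('a list \<Rightarrow> ('b list \<Rightarrow>\<^sub>0 rat)) \<Rightarrow> ('a list \<Rightarrow> ('b list \<Rightarrow>\<^sub>0 rat)) \<Rightarrow> ('a list \<Rightarrow> ('b list \<Rightarrow>\<^sub>0 rat)) \<Rightarrow> bool" where
  "equivariant_homotopy S A B G actA actB f f' D \<longleftrightarrow> D [] = 0 \<and>
     (\<forall>q. \<forall>a\<in>deg A q. D a \<in> chains S (deg B (Suc q)) \<and> bd (D a) = f a - f' a - lext D (face a) \<and>
        (\<forall>g\<in>G. D (map (actA g) a) = mapc (actB g) (D a)))"

text \<open>
  \<open>h q a\<close> fills cycles of degree \<open>q\<close>; it need not be linear, as it is only used to
  choose values on basis elements.
\<close>

definition equivariant_filling ::
  "rat set \<Rightarrow> 'a list set \<Rightarrow> 'b list set \<Rightarrow> 'g set \<Rightarrow> ('g \<Rightarrow> 'a \<Rightarrow> 'a) \<Rightarrow> ('g \<Rightarrow> 'b \<Rightarrow> 'b) \<Rightarrow>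
    (nat \<Rightarrow> 'a list \<Rightarrow> ('b list \<Rightarrow>\<^sub>0 rat) \<Rightarrow> ('b list \<Rightarrow>\<^sub>0 rat)) \<Rightarrow> bool" where
  "equivariant_filling S A B G actA actB h \<longleftrightarrow>
     (\<forall>q. \<forall>a\<in>A - {[]}. \<forall>z\<in>chains S (deg B q). bd z = 0 \<longrightarrow>
        h q a z \<in> chains S (deg B (Suc q)) \<and> bd (h q a z) = z \<and>
        (\<forall>g\<in>G. h q (map (actA g) a) (mapc (actB g) z) = mapc (actB g) (h q a z)))"

context coeff_ring
begin

text \<open>The value on a basis list fills the image of its boundary, which is a cycle by
  induction. Equivariance passes from the filling to the map because the filling may depend on the
  basis list and not only on the cycle.\<close>

lemma chain_map_exists:
  assumes A: "face_closed A" and B: "[] \<in> B"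
    and act: "\<And>g a. g \<in> G \<Longrightarrow> a \<in> A \<Longrightarrow> map (actA g) a \<in> A"
    and fill: "equivariant_filling S A B G actA actB h"
  shows "\<exists>f. equivariant_chain_map S A B G actA actB f"
proof -
  \<comment> \<open>The recursion runs over the length: \<open>F n\<close> matters only on lists of
    length \<open>n\<close>, and \<open>f\<close> selects the stage by the length of its
    argument.\<close>
  define F where "F = rec_nat (\<lambda>a. unit_chain []) (\<lambda>n F a. h n a (lext F (face a)))"
  define f where "f a = F (length a) a" for a
  have F: "F 0 a = unit_chain []" "F (Suc n) a = h n a (lext (F n) (face a))" for n a
    by (simp_all add: F_def)
  have step: "f a = h n a (lext f (face a))" if "a \<in> deg A (Suc n)" for a n
  proof -
    have "lext f (face a) = lext (F n) (face a)"
      by (rule lext_cong_chains[OF face_chains[OF A that]]) (simp add: f_def deg_def)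
    then show ?thesis using that by (simp add: f_def F deg_def)
  qed
  have *: "f a \<in> chains S (deg B q) \<and> bd (f a) = lext f (face a) \<and>
        (\<forall>g\<in>G. f (map (actA g) a) = mapc (actB g) (f a))" if "a \<in> deg A q" for q a
    using that
  proof (induction q arbitrary: a)
    case 0
    then show ?case using B by (auto simp: deg_def f_def F intro!: unit_chains)
  next
    case (Suc q)
    note fc = face_chains[OF A Suc.prems]
    let ?z = "lext f (face a)"
    have z: "?z \<in> chains S (deg B q)" using fc Suc.IH by (auto intro: lext_chains)
    have "bd ?z = lext (\<lambda>b. lext f (face b)) (face a)"
      unfolding bd_lext by (rule lext_cong_chains[OF fc]) (use Suc.IH in auto)
    then have bz: "bd ?z = 0" using bd_face[of a] by (simp add: bd_def flip: lext_lext)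
    have a: "a \<in> A - {[]}" using Suc.prems by (auto simp: deg_def)
    note h = fill[unfolded equivariant_filling_def, rule_format, OF a z bz]
    have "f (map (actA g) a) = mapc (actB g) (f a)" if "g \<in> G" for g
    proof -
      have "lext f (face (map (actA g) a)) = mapc (actB g) ?z"
        unfolding mapc_face[symmetric] lext_mapc mapc_lext
        by (rule lext_cong_chains[OF fc]) (use Suc.IH that in auto)
      moreover have "map (actA g) a \<in> deg A (Suc q)" using act that Suc.prems by (auto simp: deg_def)
      ultimately show ?thesis using h that step Suc.prems by auto
    qed
    then show ?case using h by (simp add: step[OF Suc.prems])
  qed
  have "f [] = unit_chain []" by (simp add: f_def F)
  then show ?thesis using * unfolding equivariant_chain_map_def by blast
qed

text \<open>The same recursion one degree higher: \<open>f1 a - f2 a - lext D (face a)\<close> is a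
  cycle, which at the start uses that both maps agree on the empty list.\<close>

lemma homotopy_exists:
  assumes A: "face_closed A" and act: "\<And>g a. g \<in> G \<Longrightarrow> a \<in> A \<Longrightarrow> map (actA g) a \<in> A"
    and fill: "equivariant_filling S A B G actA actB h"
    and f1: "equivariant_chain_map S A B G actA actB f1"
    and f2: "equivariant_chain_map S A B G actA actB f2"
  shows "\<exists>D. equivariant_homotopy S A B G actA actB f1 f2 D"
proof -
  define F where "F = rec_nat (\<lambda>a. 0) (\<lambda>n F a. h (Suc n) a (f1 a - f2 a - lext F (face a)))"
  define D where "D a = F (length a) a" for a
  have F: "F 0 a = 0" "F (Suc n) a = h (Suc n) a (f1 a - f2 a - lext (F n) (face a))" for n a
    by (simp_all add: F_def)
  have step: "D a = h (Suc n) a (f1 a - f2 a - lext D (face a))" if "a \<in> deg A (Suc n)" for a n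
  proof -
    have "lext D (face a) = lext (F n) (face a)"
      by (rule lext_cong_chains[OF face_chains[OF A that]]) (simp add: D_def deg_def)
    then show ?thesis using that by (simp add: D_def F deg_def)
  qed
  note fD = f1[unfolded equivariant_chain_map_def] f2[unfolded equivariant_chain_map_def]
  have *: "D a \<in> chains S (deg B (Suc q)) \<and> bd (D a) = f1 a - f2 a - lext D (face a) \<and>
        (\<forall>g\<in>G. D (map (actA g) a) = mapc (actB g) (D a))" if "a \<in> deg A q" for q a
    using that
  proof (induction q arbitrary: a)
    case 0
    then show ?case using fD by (auto simp: deg_def D_def F mapc_linear bd_linear)
  next
    case (Suc q)
    note fc = face_chains[OF A Suc.prems]
    let ?z = "f1 a - f2 a - lext D (face a)"
    have z: "?z \<in> chains S (deg B (Suc q))"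
      using fD Suc.prems by (intro diff_chains lext_chains[OF fc]) (use Suc.IH in auto)
    have "bd (lext D (face a)) = lext (\<lambda>b. f1 b - f2 b - lext D (face b)) (face a)"
      unfolding bd_lext by (rule lext_cong_chains[OF fc]) (use Suc.IH in auto)
    also have "\<dots> = lext f1 (face a) - lext f2 (face a)"
      using bd_face[of a] by (simp add: bd_def lext_fun_diff flip: lext_lext)
    finally have bz: "bd ?z = 0" using fD Suc.prems by (simp add: bd_linear)
    have a: "a \<in> A - {[]}" using Suc.prems by (auto simp: deg_def)
    note h = fill[unfolded equivariant_filling_def, rule_format, OF a z bz]
    have "D (map (actA g) a) = mapc (actB g) (D a)" if "g \<in> G" for g
    proof -
      have "lext D (face (map (actA g) a)) = mapc (actB g) (lext D (face a))"
        unfolding mapc_face[symmetric] lext_mapc mapc_lext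
        by (rule lext_cong_chains[OF fc]) (use Suc.IH that in auto)
      moreover have "map (actA g) a \<in> deg A (Suc q)" using act that Suc.prems by (auto simp: deg_def)
      moreover have "f1 (map (actA g) a) = mapc (actB g) (f1 a)" "f2 (map (actA g) a) = mapc (actB g) (f2 a)"
        using fD Suc.prems that by blast+
      ultimately show ?thesis using h that step Suc.prems by (simp add: mapc_linear)
    qed
    then show ?case using h by (simp add: step[OF Suc.prems])
  qed
  have "D [] = 0" by (simp add: D_def F)
  then show ?thesis using * unfolding equivariant_homotopy_def by blast
qed

lemma chain_map_compose:
  assumes A: "face_closed A" and B: "face_closed B"
    and f: "equivariant_chain_map S A B G actA actB f"
    and f': "equivariant_chain_map S B C G actB actC f'"
  shows "equivariant_chain_map S A C G actA actC (\<lambda>a. lext f' (f a))"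
proof -
  note fD = f[unfolded equivariant_chain_map_def] f'[unfolded equivariant_chain_map_def]
  have "lext f' (f a) \<in> chains S (deg C q) \<and> bd (lext f' (f a)) = lext (\<lambda>a. lext f' (f a)) (face a) \<and>
        (\<forall>g\<in>G. lext f' (f (map (actA g) a)) = mapc (actC g) (lext f' (f a)))" if a: "a \<in> deg A q" for q a
  proof -
    have fa: "f a \<in> chains S (deg B q)" "bd (f a) = lext f (face a)" using fD a by blast+
    have "bd (lext f' (f a)) = lext (\<lambda>b. lext f' (face b)) (f a)"
      unfolding bd_lext by (rule lext_cong_chains[OF fa(1)]) (use fD in blast)
    also have "\<dots> = lext (\<lambda>a. lext f' (f a)) (face a)"
      using fa(2) by (simp add: bd_def flip: lext_lext)
    finally have "bd (lext f' (f a)) = lext (\<lambda>a. lext f' (f a)) (face a)" .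
    moreover have "lext f' (f (map (actA g) a)) = mapc (actC g) (lext f' (f a))" if "g \<in> G" for g
    proof -
      have "f (map (actA g) a) = mapc (actB g) (f a)" using fD a that by blast
      then show ?thesis unfolding mapc_lext
        by (simp add: lext_mapc) (rule lext_cong_chains[OF fa(1)], use fD that in blast)
    qed
    moreover have "lext f' (f a) \<in> chains S (deg C q)"
      by (rule lext_chains[OF fa(1)]) (use fD in blast)
    ultimately show ?thesis by blast
  qed
  moreover have "lext f' (f []) = unit_chain []" using fD by simp
  ultimately show ?thesis unfolding equivariant_chain_map_def by blast
qed

lemma chain_map_id: "face_closed A \<Longrightarrow> equivariant_chain_map S A A G act act unit_chain"
  unfolding equivariant_chain_map_def by (auto intro!: unit_chains)

end

section \<open>Lattices\<close>

context discretely_valued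
begin

text \<open>The standard lattice multiplied by the \<open>k\<close>-th power of a
  uniformiser.\<close>

definition cube :: "int \<Rightarrow> ('a ^ 'n) set" where
  "cube k = {x. \<forall>i. val_ge v k (x $ i)}"

definition submodule :: "('a ^ 'n) set \<Rightarrow> bool" where
  "submodule L \<longleftrightarrow> 0 \<in> L \<and> (\<forall>x\<in>L. \<forall>y\<in>L. x + y \<in> L) \<and> (\<forall>c. \<forall>x\<in>L. val_ge v 0 c \<longrightarrow> c *s x \<in> L)"

lemma val_ge_prod: "(\<And>i. i \<in> A \<Longrightarrow> val_ge v M (f i)) \<Longrightarrow> val_ge v (int (card A) * M) (prod f A)"
proof (induction A rule: infinite_finite_induct)
  case (insert x A)
  then have "val_ge v (M + int (card A) * M) (f x * prod f A)" by (intro val_ge_mult) auto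
  then show ?case using insert by (simp add: algebra_simps)
qed (simp_all add: val_ge_def)

lemma val_ge_det:
  fixes b :: "'a ^ 'n ^ 'n"
  assumes "\<And>i j. val_ge v M (b $ i $ j)"
  shows "val_ge v (int CARD('n) * M) (det b)"
  unfolding det_def
proof (rule val_ge_sum)
  fix p :: "'n \<Rightarrow> 'n"
  have "val_ge v (0 + int CARD('n) * M) (of_int (sign p) * (\<Prod>i\<in>UNIV. b $ i $ p i))"
    using assms by (intro val_ge_mult val_ge_prod) (auto simp: sign_def val_ge_def)
  then show "val_ge v (int CARD('n) * M) (of_int (sign p) * (\<Prod>i\<in>UNIV. b $ i $ p i))" by simp
qed

lemma cube_mono: "k \<le> l \<Longrightarrow> cube l \<subseteq> cube k"
  by (auto simp: cube_def intro: val_ge_mono)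

lemma submodule_cube: "submodule (cube k)"
  unfolding submodule_def cube_def using val_ge_mult[of 0 _ k] by (auto intro: val_ge_add)

lemma smult_cube: "x \<in> cube k \<Longrightarrow> c \<noteq> 0 \<Longrightarrow> c *s x \<in> cube (k + v c)"
  using val_ge_mult[of "v c" c k] by (auto simp: cube_def val_ge_def add.commute)

lemma image_smult_cube: "c \<noteq> 0 \<Longrightarrow> (*s) c ` cube k = cube (k + v c)"
proof (intro equalityI subsetI)
  fix x assume "c \<noteq> 0" "x \<in> cube (k + v c)"
  then have "inverse c *s x \<in> cube k" using smult_cube[of x "k + v c" "inverse c"] by (simp add: val_inverse)
  moreover have "x = c *s (inverse c *s x)" using \<open>c \<noteq> 0\<close> by simp
  ultimately show "x \<in> (*s) c ` cube k" by blast
qed (auto simp: smult_cube)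

lemma valuation_lattice_cube_image:
  "valuation_lattice v L \<longleftrightarrow> (\<exists>b :: 'a ^ 'n ^ 'n. invertible b \<and> L = (*v) b ` cube 0)"
proof -
  have "{b *v x | x. \<forall>i. x $ i \<in> valuation_ring v} = (*v) b ` cube 0" for b :: "'a ^ 'n ^ 'n"
    by (auto simp: cube_def valuation_ring_def)
  then show ?thesis by (simp add: valuation_lattice_def)
qed

lemma submodule_image: "submodule L \<Longrightarrow> submodule ((*v) b ` L)"
  unfolding submodule_def
proof (intro conjI ballI allI impI)
  fix x y assume L: "0 \<in> L \<and> (\<forall>x\<in>L. \<forall>y\<in>L. x + y \<in> L) \<and> (\<forall>c. \<forall>x\<in>L. val_ge v 0 c \<longrightarrow> c *s x \<in> L)"
    "x \<in> (*v) b ` L" "y \<in> (*v) b ` L"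
  then show "x + y \<in> (*v) b ` L"
    by (auto simp flip: matrix_vector_right_distrib)
next
  fix x c assume L: "0 \<in> L \<and> (\<forall>x\<in>L. \<forall>y\<in>L. x + y \<in> L) \<and> (\<forall>c. \<forall>x\<in>L. val_ge v 0 c \<longrightarrow> c *s x \<in> L)"
    "x \<in> (*v) b ` L" "val_ge v 0 c"
  then show "c *s x \<in> (*v) b ` L"
    by (auto simp flip: vector_scalar_commute)
qed (force intro: image_eqI[of _ _ 0])

lemma submodule_sum:
  "submodule L \<Longrightarrow> (\<And>i. i \<in> A \<Longrightarrow> f i \<in> L) \<Longrightarrow> sum f A \<in> L"
  by (induction A rule: infinite_finite_induct) (auto simp: submodule_def)

lemma entries_bounded: "\<exists>M. \<forall>i j. val_ge v M ((b :: 'a ^ 'n ^ 'm) $ i $ j)"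
proof -
  let ?S = "insert 0 (range (\<lambda>(i, j). v (b $ i $ j)))"
  have "Min ?S \<le> v (b $ i $ j)" for i j by (rule Min_le) (auto intro: image_eqI[of _ _ "(i, j)"])
  then show ?thesis by (auto simp: val_ge_def)
qed

lemma matrix_image_cube:
  fixes b :: "'a ^ 'n ^ 'm"
  assumes "\<And>i j. val_ge v M (b $ i $ j)" "x \<in> cube k"
  shows "b *v x \<in> cube (M + k)"
  using assms by (auto simp: cube_def matrix_vector_mult_def intro!: val_ge_sum val_ge_mult)

lemma matrix_entries_of_image:
  fixes b :: "'a ^ 'n ^ 'm"
  assumes "\<And>x. x \<in> cube 0 \<Longrightarrow> b *v x \<in> cube k"
  shows "val_ge v k (b $ i $ j)"
proof -
  have "axis j 1 \<in> cube 0" by (auto simp: cube_def axis_def val_ge_def)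
  then have "val_ge v k ((b *v axis j 1) $ i)" using assms by (simp add: cube_def)
  moreover have "(b *v axis j 1) $ i = b $ i $ j"
    by (simp add: matrix_vector_mult_def axis_def if_distrib[of "\<lambda>a. _ * a"] cong: if_cong)
  ultimately show ?thesis by simp
qed

text \<open>
  Among the bases of the vector space contained in \<open>L\<close>, one with determinant of least valuation
  generates \<open>L\<close>, by Cramer's rule.
\<close>

lemma valuation_lattice_iff:
  fixes L :: "('a ^ 'n) set"
  shows "valuation_lattice v L \<longleftrightarrow> submodule L \<and> (\<exists>k. cube k \<subseteq> L) \<and> (\<exists>k. L \<subseteq> cube k)"
proof (intro iffI conjI)
  assume "valuation_lattice v L"
  then obtain b :: "'a ^ 'n ^ 'n" where b: "invertible b" "L = (*v) b ` cube 0"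
    by (auto simp: valuation_lattice_cube_image)
  show "submodule L" using b submodule_image submodule_cube by blast
  obtain M where "\<forall>i j. val_ge v M (b $ i $ j)" using entries_bounded by blast
  then show "\<exists>k. L \<subseteq> cube k" using matrix_image_cube[of M b _ 0] b by (intro exI[of _ M]) auto
  obtain b' where b': "b ** b' = mat 1" using b by (auto simp: invertible_def)
  obtain M' where "\<forall>i j. val_ge v M' (b' $ i $ j)" using entries_bounded by blast
  then have "b' *v x \<in> cube 0" if "x \<in> cube (- M')" for x
    using matrix_image_cube[of M' b' x "- M'"] that by simp
  moreover have "x = b *v (b' *v x)" for x using b' by (simp add: matrix_vector_mul_assoc)
  ultimately show "\<exists>k. cube k \<subseteq> L" using b by blast
next
  assume "submodule L \<and> (\<exists>k. cube k \<subseteq> L) \<and> (\<exists>k. L \<subseteq> cube k)"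
  then obtain k l where L: "submodule L" "cube k \<subseteq> L" "L \<subseteq> cube l" by blast
  let ?N = "int CARD('n)"
  let ?P = "\<lambda>b :: 'a ^ 'n ^ 'n. det b \<noteq> 0 \<and> (\<forall>j. column j b \<in> L)"
  obtain t where t: "t \<noteq> 0" "v t = 1" using uniformiser_exists by blast
  have "?P (mat (t powi k))"
  proof -
    have "column j (mat (t powi k) :: 'a ^ 'n ^ 'n) \<in> cube k" for j
      using t by (auto simp: cube_def column_def mat_def val_ge_def val_power_int)
    moreover have "det (mat (t powi k) :: 'a ^ 'n ^ 'n) \<noteq> 0"
      using t by (subst det_diagonal) (auto simp: mat_def)
    ultimately show ?thesis using L by blast
  qed
  \<comment> \<open>\<open>?N * l\<close> bounds the value of every such determinant from below, as
    \<open>bound\<close> shows; subtracting it permits a minimal choice among natural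
    numbers.\<close>
  then obtain b where b: "?P b" and least: "\<And>c. ?P c \<Longrightarrow> nat (v (det b) - ?N * l) \<le> nat (v (det c) - ?N * l)"
    using ex_has_least_nat[of ?P _ "\<lambda>b. nat (v (det b) - ?N * l)"] by blast
  have bound: "?N * l \<le> v (det c)" if "?P c" for c
  proof -
    have "val_ge v l (c $ i $ j)" for i j using that L(3) by (force simp: cube_def column_def)
    then show ?thesis using val_ge_det[of l c] that by (simp add: val_ge_def)
  qed
  have inv: "invertible b" using b by (simp add: invertible_det_nz)
  then obtain b' where b': "b ** b' = mat 1" by (auto simp: invertible_def)
  have "L = (*v) b ` cube 0"
  proof (intro equalityI subsetI)
    fix x assume x: "x \<in> L"
    define y where "y = b' *v x"
    have xy: "x = b *v y" using b' by (simp add: y_def matrix_vector_mul_assoc)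
    have "val_ge v 0 (y $ j)" for j
    proof (rule ccontr)
      assume "\<not> val_ge v 0 (y $ j)"
      then have yj: "y $ j \<noteq> 0" "v (y $ j) < 0" by (auto simp: val_ge_def)
      \<comment> \<open>Replacing column \<open>j\<close> by \<open>x\<close> multiplies the
        determinant by \<open>y $ j\<close>, which has negative value, so the new basis would beat
        the chosen one.\<close>
      let ?c = "(\<chi> i m. if m = j then (b *v y) $ i else b $ i $ m) :: 'a ^ 'n ^ 'n"
      have det: "det ?c = y $ j * det b" by (rule cramer_lemma)
      have "column m ?c = (if m = j then x else column m b)" for m
        by (auto simp: column_def xy vec_eq_iff)
      then have c: "?P ?c" using b x yj det by auto
      have "v (det ?c) < v (det b)" using det b yj by (simp add: val_mult)
      then show False using least[OF c] bound[OF c] bound[OF b] by linarith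
    qed
    then have "y \<in> cube 0" by (simp add: cube_def)
    then show "x \<in> (*v) b ` cube 0" using xy by blast
  next
    fix x assume "x \<in> (*v) b ` cube 0"
    then obtain y where y: "y \<in> cube 0" "x = b *v y" by blast
    show "x \<in> L" unfolding y(2) matrix_mult_sum
      by (rule submodule_sum[OF L(1)]) (use y b L(1) in \<open>auto simp: submodule_def cube_def\<close>)
  qed
  then show "valuation_lattice v L" using inv by (auto simp: valuation_lattice_cube_image)
qed

text \<open>The value of the determinant of a basis. Two bases of a lattice differ by an integral
  matrix with integral inverse, so the choice is immaterial; see \<open>covolume_eq\<close>.\<close>

definition covolume :: "('a ^ 'n) set \<Rightarrow> int" where
  "covolume L = (SOME k. \<exists>b :: 'a ^ 'n ^ 'n. invertible b \<and> L = (*v) b ` cube 0 \<and> v (det b) = k)"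

text \<open>Inclusion means \<open>b = c ** m\<close> with \<open>m\<close> integral, so the value
  can only grow. If it does not, \<open>det m\<close> is a unit, and Cramer's rule solves
  \<open>m *v z = y\<close> over the valuation ring.\<close>

lemma det_image_mono:
  fixes b c :: "'a ^ 'n ^ 'n"
  assumes b: "invertible b" and c: "invertible c" and sub: "(*v) b ` cube 0 \<subseteq> (*v) c ` cube 0"
  shows "v (det c) \<le> v (det b)" and "v (det c) = v (det b) \<Longrightarrow> (*v) b ` cube 0 = (*v) c ` cube 0"
proof -
  obtain c' where c': "c' ** c = mat 1" "c ** c' = mat 1" using c by (auto simp: invertible_def)
  define m where "m = c' ** b"
  have bm: "b = c ** m" using c' by (simp add: m_def matrix_mul_assoc)
  have m_int: "val_ge v 0 (m $ i $ j)" for i j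
  proof (rule matrix_entries_of_image)
    fix x :: "'a ^ 'n" assume "x \<in> cube 0"
    then obtain y where y: "y \<in> cube 0" "b *v x = c *v y" using sub by blast
    have "m *v x = c' *v (b *v x)" by (simp add: m_def matrix_vector_mul_assoc)
    also have "\<dots> = y" by (simp add: y matrix_vector_mul_assoc c')
    finally show "m *v x \<in> cube 0" using y by simp
  qed
  have det: "det b = det c * det m" by (simp add: bm det_mul)
  have nz: "det b \<noteq> 0" "det c \<noteq> 0" using b c by (simp_all add: invertible_det_nz)
  then have mz: "det m \<noteq> 0" using det by auto
  have "val_ge v 0 (det m)" using val_ge_det[of 0 m] m_int by simp
  then show "v (det c) \<le> v (det b)" using det nz mz by (simp add: val_mult val_ge_def)
  assume "v (det c) = v (det b)"
  then have vm: "v (det m) = 0" using det nz mz by (simp add: val_mult)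
  show "(*v) b ` cube 0 = (*v) c ` cube 0"
  proof (rule antisym[OF sub], rule subsetI)
    fix x assume "x \<in> (*v) c ` cube 0"
    then obtain y where y: "y \<in> cube 0" "x = c *v y" by blast
    define z where "z = (\<chi> k. det (\<chi> i j. if j = k then y $ i else m $ i $ j) / det m)"
    have mz': "m *v z = y" using cramer[OF mz, of z y] by (simp add: z_def)
    have "val_ge v 0 (det (\<chi> i j. if j = k then y $ i else m $ i $ j))" for k
      using val_ge_det[of 0 "\<chi> i j. if j = k then y $ i else m $ i $ j"] y m_int by (simp add: cube_def)
    then have "val_ge v 0 (z $ k)" for k
      using mz vm by (cases "det (\<chi> i j. if j = k then y $ i else m $ i $ j) = 0")
        (auto simp: z_def val_ge_def val_divide)
    then have "z \<in> cube 0" by (simp add: cube_def)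
    moreover have "x = b *v z" by (simp add: bm y(2) mz'[symmetric] matrix_vector_mul_assoc)
    ultimately show "x \<in> (*v) b ` cube 0" by blast
  qed
qed

lemma covolume_eq: "invertible b \<Longrightarrow> covolume ((*v) b ` cube 0) = v (det (b :: 'a ^ 'n ^ 'n))"
proof -
  assume b: "invertible b"
  let ?P = "\<lambda>k. \<exists>c :: 'a ^ 'n ^ 'n. invertible c \<and> (*v) b ` cube 0 = (*v) c ` cube 0 \<and> v (det c) = k"
  have "?P (covolume ((*v) b ` cube 0))"
    unfolding covolume_def by (rule someI_ex) (use b in blast)
  then show ?thesis using det_image_mono(1)[of b] det_image_mono(1)[of _ b] b
    by (metis order_antisym order_refl)
qed

lemma covolume_mono:
  fixes L M :: "('a ^ 'n) set"
  assumes "valuation_lattice v L" "valuation_lattice v M" "L \<subseteq> M"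
  shows "covolume M \<le> covolume L" and "covolume M = covolume L \<Longrightarrow> L = M"
proof -
  obtain b c :: "'a ^ 'n ^ 'n" where "invertible b" "L = (*v) b ` cube 0" "invertible c" "M = (*v) c ` cube 0"
    using assms by (auto simp: valuation_lattice_cube_image)
  then show "covolume M \<le> covolume L" "covolume M = covolume L \<Longrightarrow> L = M"
    using det_image_mono[of b c] assms(3) by (auto simp: covolume_eq)
qed

lemma lattice_image:
  fixes g :: "'a ^ 'n ^ 'n"
  assumes L: "valuation_lattice v L" and g: "det g \<noteq> 0"
  shows "valuation_lattice v ((*v) g ` L)" and "covolume ((*v) g ` L) = covolume L + v (det g)"
proof -
  obtain b :: "'a ^ 'n ^ 'n" where b: "invertible b" "L = (*v) b ` cube 0"
    using L by (auto simp: valuation_lattice_cube_image)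
  have gb: "(*v) g ` L = (*v) (g ** b) ` cube 0"
    by (simp add: b(2) image_image matrix_vector_mul_assoc)
  have inv: "invertible (g ** b)" using b g by (simp add: invertible_det_nz det_mul)
  then show "valuation_lattice v ((*v) g ` L)" unfolding gb valuation_lattice_cube_image by blast
  have "det b \<noteq> 0" using b by (simp add: invertible_det_nz)
  then show "covolume ((*v) g ` L) = covolume L + v (det g)"
    unfolding gb using inv b g by (simp add: covolume_eq det_mul val_mult)
qed

lemma smult_eq_mat: "c *s x = mat c *v (x :: 'a ^ 'n)"
  by (simp add: vec_eq_iff matrix_vector_mult_def mat_def if_distrib[of "\<lambda>a. a * _"] cong: if_cong)

lemma lattice_smult:
  fixes L :: "('a ^ 'n) set"
  assumes L: "valuation_lattice v L" and c: "c \<noteq> 0"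
  shows "valuation_lattice v ((*s) c ` L)" and "covolume ((*s) c ` L) = covolume L + int CARD('n) * v c"
proof -
  have det: "det (mat c :: 'a ^ 'n ^ 'n) = c ^ CARD('n)"
    by (subst det_diagonal) (auto simp: mat_def)
  have eq: "(*s) c ` L = (*v) (mat c) ` L" by (simp add: smult_eq_mat)
  show "valuation_lattice v ((*s) c ` L)" "covolume ((*s) c ` L) = covolume L + int CARD('n) * v c"
    unfolding eq using lattice_image[OF L, of "mat c"] c by (simp_all add: det val_power)
qed

lemma smult_image_subset:
  assumes L: "submodule L" and cd: "c \<noteq> 0" "d \<noteq> 0" "v d \<le> v c"
  shows "(*s) c ` L \<subseteq> (*s) d ` L"
proof
  fix x assume "x \<in> (*s) c ` L"
  then obtain y where y: "y \<in> L" "x = c *s y" by blast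
  have "c / d *s y \<in> L" using L y cd by (auto simp: submodule_def val_ge_def val_divide)
  moreover have "x = d *s (c / d *s y)" using cd by (simp add: y)
  ultimately show "x \<in> (*s) d ` L" by blast
qed

lemma smult_image_eq:
  "submodule L \<Longrightarrow> c \<noteq> 0 \<Longrightarrow> d \<noteq> 0 \<Longrightarrow> v c = v d \<Longrightarrow> (*s) c ` L = (*s) d ` L"
  by (intro antisym smult_image_subset) auto

lemma smult_image_self: "submodule L \<Longrightarrow> c \<noteq> 0 \<Longrightarrow> v c = 0 \<Longrightarrow> (*s) c ` L = L"
  using smult_image_eq[of L c 1] by simp

end

subsection \<open>Primitive representatives of vertices\<close>

lemma sorted_list_of_chain:
  assumes "finite A" "\<And>x y. x \<in> A \<Longrightarrow> y \<in> A \<Longrightarrow> x \<subseteq> y \<or> y \<subseteq> (x :: 'a set)"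
  shows "\<exists>xs. set xs = A \<and> sorted_wrt (\<supset>) xs"
  using assms
proof (induction "card A" arbitrary: A)
  case 0
  then show ?case by (intro exI[of _ "[]"]) auto
next
  case (Suc n)
  then have "A \<noteq> {}" by auto
  then obtain m where m: "m \<in> A" "\<forall>x\<in>A. m \<le> x \<longrightarrow> m = x"
    using finite_has_maximal[OF Suc.prems(1)] by metis
  have "\<exists>xs. set xs = A - {m} \<and> sorted_wrt (\<supset>) xs"
    using Suc.hyps(2) Suc.prems m(1) by (intro Suc.hyps(1)) auto
  then obtain xs where xs: "set xs = A - {m}" "sorted_wrt (\<supset>) xs" by blast
  have "x \<subset> m" if "x \<in> A - {m}" for x
    using that Suc.prems(2)[of x m] m by auto
  then show ?case using xs m(1) by (intro exI[of _ "m # xs"]) auto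
qed

lemma sorted_wrt_supset_bounds:
  "sorted_wrt (\<supset>) xs \<Longrightarrow> x \<in> set xs \<Longrightarrow> last xs \<subseteq> x \<and> x \<subseteq> hd xs"
  by (induction xs) auto

lemma sorted_wrt_supset_comparable:
  "sorted_wrt (\<supset>) xs \<Longrightarrow> x \<in> set xs \<Longrightarrow> y \<in> set xs \<Longrightarrow> x \<subseteq> y \<or> y \<subseteq> x"
  by (induction xs) auto

context discretely_valued
begin

definition unif :: 'a where
  "unif = (SOME t. t \<noteq> 0 \<and> v t = 1)"

lemma unif: "unif \<noteq> 0" "v unif = 1"
  using someI_ex[OF uniformiser_exists] by (simp_all add: unif_def)

abbreviation shrink :: "('a ^ 'n) set \<Rightarrow> ('a ^ 'n) set" where
  "shrink L \<equiv> (*s) unif ` L"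

text \<open>Every homothety class contains exactly one such lattice, which serves as its canonical
  representative; it depends on the choice of the standard lattice.\<close>

definition primitive :: "('a ^ 'n) set \<Rightarrow> bool" where
  "primitive L \<longleftrightarrow> valuation_lattice v L \<and> L \<subseteq> cube 0 \<and> \<not> L \<subseteq> cube 1"

text \<open>Incidence of vertices, read off their primitive lattices. The relation is pairwise and
  symmetric and does not refer to the first lattice of a chain.\<close>

definition compatible :: "('a ^ 'n) set \<Rightarrow> ('a ^ 'n) set \<Rightarrow> bool" where
  "compatible L M \<longleftrightarrow> (L \<subseteq> M \<or> M \<subseteq> L) \<and> shrink L \<subseteq> M \<and> shrink M \<subseteq> L"

lemma lattice_submodule: "valuation_lattice v L \<Longrightarrow> submodule L"
  by (simp add: valuation_lattice_iff)

lemma primitive_lattice: "primitive L \<Longrightarrow> valuation_lattice v L"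
  by (simp add: primitive_def)

lemma primitive_submodule: "primitive L \<Longrightarrow> submodule L"
  by (intro lattice_submodule primitive_lattice)

lemma shrink_subset: "submodule L \<Longrightarrow> shrink L \<subseteq> L"
  using unif by (auto simp: submodule_def val_ge_def)

lemma smult_smult_image: "(*s) c ` (*s) d ` L = (*s) (c * d) ` (L :: ('a ^ 'n) set)"
  by (simp add: image_image)

lemma smult_subset_cube:
  "c \<noteq> 0 \<Longrightarrow> (*s) c ` L \<subseteq> cube (k + v c) \<longleftrightarrow> L \<subseteq> (cube k :: ('a ^ 'n) set)"
proof
  assume c: "c \<noteq> 0" and "(*s) c ` L \<subseteq> cube (k + v c)"
  then have "(*s) (inverse c) ` (*s) c ` L \<subseteq> (*s) (inverse c) ` cube (k + v c)" by (intro image_mono)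
  then show "L \<subseteq> cube k" using c by (simp add: smult_smult_image image_smult_cube val_inverse)
next
  assume c: "c \<noteq> 0" and "L \<subseteq> cube k"
  then have "(*s) c ` L \<subseteq> (*s) c ` cube k" by (intro image_mono)
  then show "(*s) c ` L \<subseteq> cube (k + v c)" using c by (simp add: image_smult_cube)
qed

lemma primitive_multiple_exists:
  fixes L :: "('a ^ 'n) set"
  assumes "valuation_lattice v L"
  shows "\<exists>c. c \<noteq> 0 \<and> primitive ((*s) c ` L)"
proof -
  obtain k l where kl: "L \<subseteq> cube k" "cube l \<subseteq> L"
    using assms by (auto simp: valuation_lattice_iff)
  \<comment> \<open>The shift by \<open>l + 1\<close> makes containment in \<open>cube 0\<close>
    fail at \<open>n = 0\<close>, because \<open>cube l \<subseteq> L\<close>. So the least good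
    \<open>n\<close> has a predecessor, whose failure is the second half of primitivity.\<close>
  let ?c = "\<lambda>n :: nat. unif powi (int n - l - 1)"
  let ?P = "\<lambda>n. (*s) (?c n) ` L \<subseteq> cube 0"
  have c: "?c n \<noteq> 0" "v (?c n) = int n - l - 1" for n using unif by (simp_all add: val_power_int)
  have P: "?P n \<longleftrightarrow> L \<subseteq> cube (- (int n - l - 1))" for n
    using smult_subset_cube[OF c(1), of n L "- (int n - l - 1)"] c by simp
  have "?P (nat (1 + l - k))" unfolding P by (rule order.trans[OF kl(1) cube_mono]) auto
  then obtain n where n: "?P n" "\<forall>i<n. \<not> ?P i" using ex_least_nat_le[of ?P] by blast
  have "n \<noteq> 0"
  proof
    assume "n = 0"
    then have "cube l \<subseteq> (cube (l + 1) :: ('a ^ 'n) set)"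
      using n(1) kl(2) unfolding P by (auto simp: add.commute)
    moreover have "(\<chi> i. unif powi l) \<in> (cube l :: ('a ^ 'n) set)"
      using unif by (simp add: cube_def val_ge_def val_power_int)
    moreover have "(\<chi> i. unif powi l) \<notin> (cube (l + 1) :: ('a ^ 'n) set)"
      using unif by (simp add: cube_def val_ge_def val_power_int)
    ultimately show False by blast
  qed
  then have "\<not> ?P (n - 1)" by (intro n(2)[rule_format]) simp
  moreover have "- (int (n - 1) - l - 1) = 1 - (int n - l - 1)" using \<open>n \<noteq> 0\<close> by simp
  ultimately have "\<not> L \<subseteq> cube (1 - (int n - l - 1))" unfolding P by (simp only: not_False_eq_True)
  then have "\<not> (*s) (?c n) ` L \<subseteq> cube 1"
    using smult_subset_cube[OF c(1), of n L "1 - (int n - l - 1)"] c by simp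
  then show ?thesis using n(1) lattice_smult(1)[OF assms c(1)[of n]] c(1)[of n]
    by (intro exI[of _ "?c n"]) (auto simp: primitive_def)
qed

lemma primitive_multiple_unique:
  fixes L :: "('a ^ 'n) set"
  assumes "primitive L" "primitive ((*s) c ` L)" "c \<noteq> 0"
  shows "(*s) c ` L = L"
proof -
  have "v c \<le> 0"
    using assms smult_subset_cube[OF assms(3), of L 0] cube_mono[of 1 "v c"] by (force simp: primitive_def)
  moreover have "- v c \<le> 0"
  proof (rule ccontr)
    assume "\<not> - v c \<le> 0"
    then have "(*s) c ` L \<subseteq> cube (1 + v c)" using assms(2) cube_mono[of "1 + v c" 0] by (force simp: primitive_def)
    then show False using smult_subset_cube[OF assms(3), of L 1] assms(1) by (auto simp: primitive_def)
  qed
  ultimately show ?thesis using assms lattice_submodule by (intro smult_image_self) (auto simp: primitive_def)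
qed

text \<open>Either \<open>M\<close> is primitive itself, or it lies in \<open>cube 1\<close> and can
  be divided by the uniformiser. The quotient then contains \<open>L\<close>, which keeps it out of
  \<open>cube 1\<close>; the two lattices merely change places in the chain.\<close>

lemma primitive_multiple_compatible:
  fixes L M :: "('a ^ 'n) set"
  assumes L: "primitive L" and M: "valuation_lattice v M" "M \<subseteq> L" "shrink L \<subseteq> M"
  shows "\<exists>c. c \<noteq> 0 \<and> primitive ((*s) c ` M) \<and> compatible L ((*s) c ` M)"
proof (cases "M \<subseteq> cube 1")
  case False
  have "shrink M \<subseteq> L" using shrink_subset[OF lattice_submodule[OF M(1)]] M by blast
  then have "primitive M" "compatible L M" using False L M by (auto simp: primitive_def compatible_def)
  then show ?thesis by (intro exI[of _ 1]) auto
next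
  case True
  let ?N = "(*s) (inverse unif) ` M"
  have "(*s) (inverse unif) ` shrink L \<subseteq> ?N" using M by (intro image_mono)
  then have LN: "L \<subseteq> ?N" using unif by (simp add: smult_smult_image)
  have sN: "shrink ?N = M" using unif by (simp add: smult_smult_image)
  have "?N \<subseteq> cube 0" using smult_subset_cube[of "inverse unif" M 1] True unif by (simp add: val_inverse)
  moreover have "\<not> ?N \<subseteq> cube 1" using L LN by (auto simp: primitive_def)
  moreover have "valuation_lattice v ?N" using lattice_smult(1)[OF M(1)] unif by simp
  moreover have "shrink L \<subseteq> ?N"
    using shrink_subset[of L] LN L lattice_submodule by (auto simp: primitive_def)
  ultimately show ?thesis using LN sN M unif
    by (intro exI[of _ "inverse unif"]) (auto simp: primitive_def compatible_def)
qed

lemma homothety_class_smult: "c \<noteq> 0 \<Longrightarrow> homothety_class ((*s) c ` L) = homothety_class (L :: ('a ^ 'n) set)"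
proof -
  assume c: "c \<noteq> 0"
  have "(*s) d ` (*s) c ` L = (*s) (d * c) ` L" "(*s) d ` L = (*s) (d / c) ` (*s) c ` L" for d
    using c by (simp_all add: smult_smult_image)
  moreover have "d * c \<noteq> 0 \<and> d / c \<noteq> 0" if "d \<noteq> 0" for d using that c by simp
  ultimately show ?thesis unfolding homothety_class_def
    by (intro equalityI subsetI; clarify) (metis, metis)
qed

lemma in_homothety_class: "L \<in> homothety_class (L :: ('a ^ 'n) set)"
  unfolding homothety_class_def by (intro CollectI exI[of _ 1]) auto

lemma compatible_smult:
  "c \<noteq> 0 \<Longrightarrow> shrink L \<subseteq> M \<Longrightarrow> shrink ((*s) c ` L) \<subseteq> (*s) c ` (M :: ('a ^ 'n) set)"
  using image_mono[of "shrink L" M "(*s) c"] by (simp add: smult_smult_image mult.commute)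

lemma compatible_sym: "compatible L M \<Longrightarrow> compatible M L"
  by (auto simp: compatible_def)

text \<open>Rescaling each member of a chain to a primitive lattice removes the dependence on the
  first one and leaves a set of pairwise compatible lattices. Conversely such a set is totally
  ordered by inclusion, and sorting it gives a chain again.\<close>

lemma building_iff:
  "\<sigma> \<in> (building v :: ('a, 'n::finite) vertex set set) \<longleftrightarrow>
     (\<exists>\<L>. finite \<L> \<and> \<L> \<noteq> {} \<and> (\<forall>L\<in>\<L>. primitive L) \<and> (\<forall>L\<in>\<L>. \<forall>M\<in>\<L>. compatible L M) \<and>
        \<sigma> = homothety_class ` \<L>)"
proof
  assume "\<sigma> \<in> building v"
  then obtain Ls \<pi> where Ls: "\<sigma> = homothety_class ` set Ls" "Ls \<noteq> []" "\<forall>L\<in>set Ls. valuation_lattice v L"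
      "sorted_wrt (\<supset>) Ls" "v \<pi> = 1" "(*s) \<pi> ` hd Ls \<subset> last Ls"
    by (auto simp: building_def)
  have \<pi>0: "\<pi> \<noteq> 0" using Ls(5) by auto
  have shr: "shrink (hd Ls) \<subset> last Ls"
    using smult_image_eq[of "hd Ls" unif \<pi>] Ls \<pi>0 unif
      lattice_submodule[OF Ls(3)[rule_format, OF hd_in_set[OF Ls(2)]]] by simp
  define p where "p L = (SOME M. primitive M \<and> (\<exists>c. c \<noteq> 0 \<and> M = (*s) c ` L))" for L :: "('a ^ 'n) set"
  have p: "primitive (p L) \<and> (\<exists>c. c \<noteq> 0 \<and> p L = (*s) c ` L)" if "valuation_lattice v L" for L
    unfolding p_def by (rule someI_ex) (use primitive_multiple_exists[OF that] in blast)
  have p_unique: "M = p L" if L: "valuation_lattice v L" and M: "primitive M" "M = (*s) c ` L" "c \<noteq> 0" for L M c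
  proof -
    obtain d where d: "d \<noteq> 0" "p L = (*s) d ` L" using p[OF L] by blast
    then have "M = (*s) (c / d) ` p L" by (simp add: M smult_smult_image)
    then show ?thesis using primitive_multiple_unique[of "p L" "c / d"] p[OF L] M d by simp
  qed
  have compat: "compatible (p L) (p M)" if L: "L \<in> set Ls" "M \<in> set Ls" "M \<subseteq> L" for L M
  proof -
    note lat = Ls(3)[rule_format, OF L(1)] Ls(3)[rule_format, OF L(2)]
    obtain c where c: "c \<noteq> 0" "p L = (*s) c ` L" using p lat by blast
    have "shrink L \<subseteq> shrink (hd Ls)" using sorted_wrt_supset_bounds[OF Ls(4) L(1)] by (intro image_mono) auto
    also have "\<dots> \<subseteq> M" using shr sorted_wrt_supset_bounds[OF Ls(4) L(2)] by auto
    finally have sLM: "shrink L \<subseteq> M" .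
    have "\<exists>d. d \<noteq> 0 \<and> primitive ((*s) d ` (*s) c ` M) \<and> compatible (p L) ((*s) d ` (*s) c ` M)"
      using p[OF lat(1)] c L(3) compatible_smult[OF c(1) sLM]
      by (intro primitive_multiple_compatible lattice_smult(1)[OF lat(2)]) auto
    then obtain d where d: "d \<noteq> 0" "primitive ((*s) (d * c) ` M)" "compatible (p L) ((*s) (d * c) ` M)"
      by (auto simp: smult_smult_image)
    then show ?thesis using p_unique[OF lat(2) d(2) refl] c by simp
  qed
  have "homothety_class (p L) = homothety_class L" if "L \<in> set Ls" for L
    using p[of L] Ls(3) that homothety_class_smult by metis
  then have "\<sigma> = homothety_class ` p ` set Ls" using Ls(1) by (simp add: image_image)
  moreover have "compatible (p L) (p M)" if "L \<in> set Ls" "M \<in> set Ls" for L M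
    using compat[OF that] compatible_sym[OF compat[OF that(2,1)]]
      sorted_wrt_supset_comparable[OF Ls(4) that] by auto
  ultimately show "\<exists>\<L>. finite \<L> \<and> \<L> \<noteq> {} \<and> (\<forall>L\<in>\<L>. primitive L) \<and> (\<forall>L\<in>\<L>. \<forall>M\<in>\<L>. compatible L M) \<and>
        \<sigma> = homothety_class ` \<L>"
    using p Ls(2,3) by (intro exI[of _ "p ` set Ls"]) (simp add: image_image)
next
  assume "\<exists>\<L>. finite \<L> \<and> \<L> \<noteq> {} \<and> (\<forall>L\<in>\<L>. primitive L) \<and> (\<forall>L\<in>\<L>. \<forall>M\<in>\<L>. compatible L M) \<and>
        \<sigma> = homothety_class ` \<L>"
  then obtain \<L> :: "('a ^ 'n) set set" where \<L>: "finite \<L>" "\<L> \<noteq> {}" "\<And>L. L \<in> \<L> \<Longrightarrow> primitive L"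
      "\<And>L M. L \<in> \<L> \<Longrightarrow> M \<in> \<L> \<Longrightarrow> compatible L M" "\<sigma> = homothety_class ` \<L>" by blast
  obtain Ls where Ls: "set Ls = \<L>" "sorted_wrt (\<supset>) Ls"
    using sorted_list_of_chain[of \<L>] \<L> by (auto simp: compatible_def)
  then have ne: "Ls \<noteq> []" using \<L> by auto
  have hl: "hd Ls \<in> \<L>" "last Ls \<in> \<L>" using Ls(1)[symmetric] ne by simp_all
  have "shrink (hd Ls) \<subseteq> last Ls" using \<L>(4)[OF hl] by (simp add: compatible_def)
  \<comment> \<open>The shrunken lattice lies in \<open>cube 1\<close>, and the last one, being
    primitive, does not.\<close>
  moreover have "shrink (hd Ls) \<noteq> last Ls"
  proof -
    have "primitive (hd Ls)" "primitive (last Ls)" using \<L>(3) hl by auto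
    then show ?thesis using smult_subset_cube[OF unif(1), of "hd Ls" 0] unif by (auto simp: primitive_def)
  qed
  ultimately have "shrink (hd Ls) \<subset> last Ls" by blast
  then show "\<sigma> \<in> building v"
    unfolding building_def
    by (intro CollectI exI[of _ Ls] conjI exI[of _ unif])
      (use \<L> Ls ne unif in \<open>simp_all add: primitive_def\<close>)
qed

lemma building_face: "\<sigma> \<in> building v \<Longrightarrow> \<tau> \<subseteq> \<sigma> \<Longrightarrow> \<tau> \<noteq> {} \<Longrightarrow> \<tau> \<in> building v"
proof -
  assume \<sigma>: "\<sigma> \<in> building v" and \<tau>: "\<tau> \<subseteq> \<sigma>" "\<tau> \<noteq> {}"
  obtain \<L> where \<L>: "finite \<L>" "\<forall>L\<in>\<L>. primitive L" "\<forall>L\<in>\<L>. \<forall>M\<in>\<L>. compatible L M" "\<sigma> = homothety_class ` \<L>"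
    using \<sigma> unfolding building_iff by blast
  obtain \<M> where "\<M> \<subseteq> \<L>" "\<tau> = homothety_class ` \<M>" using \<tau> \<L>(4) by (auto simp: subset_image_iff)
  moreover from this have "finite \<M>" "\<forall>L\<in>\<M>. primitive L" "\<forall>L\<in>\<M>. \<forall>M\<in>\<M>. compatible L M" "\<M> \<noteq> {}"
    using finite_subset[of \<M> \<L>] \<L>(1-3) \<tau>(2) by auto
  ultimately show ?thesis unfolding building_iff by (intro exI[of _ \<M>] conjI)
qed

text \<open>The usual colouring of the vertices: homothety changes the covolume by a multiple of the
  rank, so the residue does not depend on the lattice chosen in the class.\<close>

definition vertex_type :: "('a, 'n::finite) vertex \<Rightarrow> int" where
  "vertex_type V = covolume (SOME L. L \<in> V) mod int CARD('n)"

definition primitive_representative :: "('a, 'n::finite) vertex \<Rightarrow> ('a ^ 'n) set" where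
  "primitive_representative V = (SOME L. L \<in> V \<and> primitive L)"

lemma vertex_type_class:
  fixes L :: "('a ^ 'n) set"
  assumes "valuation_lattice v L"
  shows "vertex_type (homothety_class L) = covolume L mod int CARD('n)"
proof -
  have "(SOME M. M \<in> homothety_class L) \<in> homothety_class L"
    using in_homothety_class by (rule someI)
  then obtain c where "c \<noteq> 0" "(SOME M. M \<in> homothety_class L) = (*s) c ` L"
    by (auto simp: homothety_class_def)
  then show ?thesis using lattice_smult(2)[OF assms] by (simp add: vertex_type_def)
qed

lemma primitive_representative_class: "primitive L \<Longrightarrow> primitive_representative (homothety_class L) = L"
  unfolding primitive_representative_def
proof (rule some_equality)
  fix M assume "primitive L" "M \<in> homothety_class L \<and> primitive M"
  then show "M = L" using primitive_multiple_unique by (auto simp: homothety_class_def)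
qed (simp add: in_homothety_class)

lemma covolume_inj: "primitive L \<Longrightarrow> primitive M \<Longrightarrow> compatible L M \<Longrightarrow> covolume L = covolume M \<Longrightarrow> L = M"
  using covolume_mono(2)[of L M] covolume_mono(2)[of M L] by (auto simp: compatible_def primitive_def)

text \<open>
  If \<open>\<pi> L \<subset> M \<subseteq> L\<close>, the covolumes of \<open>L\<close> and \<open>M\<close> differ by less than the rank, so vertices of
  a simplex have distinct types.
\<close>

lemma vertex_type_inj:
  fixes L M :: "('a ^ 'n) set"
  assumes "primitive L" "primitive M" "compatible L M"
    and type: "vertex_type (homothety_class L) = vertex_type (homothety_class M)"
  shows "L = M"
proof -
  have *: "L = M" if "primitive L" "primitive M" "shrink L \<subseteq> M" "M \<subseteq> L"
    "covolume L mod int CARD('n) = covolume M mod int CARD('n)" for L M :: "('a ^ 'n) set"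
  proof -
    have lat: "valuation_lattice v L" "valuation_lattice v M" "valuation_lattice v (shrink L)"
      using that unif lattice_smult(1) by (auto simp: primitive_def)
    have "covolume L \<le> covolume M" using covolume_mono(1) lat that by blast
    moreover have "covolume M \<le> covolume (shrink L)" using covolume_mono(1) lat that by blast
    moreover have "covolume M \<noteq> covolume (shrink L)"
    proof
      assume "covolume M = covolume (shrink L)"
      then have "shrink L = M" using covolume_mono(2)[OF lat(3,2)] that by blast
      then show False using that smult_subset_cube[OF unif(1), of L 0] unif by (auto simp: primitive_def)
    qed
    ultimately have "0 \<le> covolume M - covolume L" "covolume M - covolume L < int CARD('n)"
      using lattice_smult(2)[OF lat(1) unif(1)] unif by auto
    moreover have "int CARD('n) dvd covolume M - covolume L" using that(5)[symmetric] by (simp add: mod_eq_dvd_iff)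
    ultimately have "covolume M = covolume L"
      using zdvd_imp_le[of "int CARD('n)" "covolume M - covolume L"] by linarith
    then show ?thesis using covolume_mono(2)[OF lat(2,1) that(4)] by simp
  qed
  have "covolume L mod int CARD('n) = covolume M mod int CARD('n)"
    using type assms by (simp add: vertex_type_class primitive_def)
  then show ?thesis using *[of L M] *[of M L] assms by (auto simp: compatible_def)
qed

end

subsection \<open>Acyclicity of the building\<close>

context discretely_valued
begin

text \<open>Lists decrease only weakly, since thickening can make neighbours equal and a prism puts
  a lattice next to its thickening. The index filters the complex: for \<open>k = 0\<close> only the
  standard lattice is left, and any finite set of lattices contains a common
  \<open>cube k\<close>.\<close>

definition flags :: "int \<Rightarrow> ('a ^ 'n) set list set" where
  "flags k = {Ls. (\<forall>L\<in>set Ls. primitive L \<and> cube k \<subseteq> L) \<and> sorted_wrt (\<supseteq>) Ls \<and>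
     (\<forall>L\<in>set Ls. \<forall>M\<in>set Ls. shrink L \<subseteq> M)}"

lemma flagsI:
  "(\<And>L M. L \<in> set Ls \<Longrightarrow> M \<in> set Ls \<Longrightarrow> shrink L \<subseteq> M) \<Longrightarrow>
    (\<And>L. L \<in> set Ls \<Longrightarrow> primitive L \<and> cube k \<subseteq> L) \<Longrightarrow> sorted_wrt (\<supseteq>) Ls \<Longrightarrow> Ls \<in> flags k"
  unfolding flags_def by simp

lemma sorted_wrt_supseteq_comparable:
  "sorted_wrt (\<supseteq>) xs \<Longrightarrow> x \<in> set xs \<Longrightarrow> y \<in> set xs \<Longrightarrow> x \<subseteq> y \<or> y \<subseteq> x"
  by (induction xs) auto

lemma flags_compatible:
  assumes "Ls \<in> flags k" "L \<in> set Ls" "M \<in> set Ls"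
  shows "compatible L M"
proof -
  have "sorted_wrt (\<supseteq>) Ls" "shrink L \<subseteq> M" "shrink M \<subseteq> L" using assms by (simp_all add: flags_def)
  then show ?thesis using sorted_wrt_supseteq_comparable[OF _ assms(2,3)] by (simp add: compatible_def)
qed

definition thicken :: "int \<Rightarrow> ('a ^ 'n) set \<Rightarrow> ('a ^ 'n) set" where
  "thicken k L = {x + y | x y. x \<in> L \<and> y \<in> cube k}"

lemma zero_in_submodule: "submodule L \<Longrightarrow> 0 \<in> L"
  by (simp add: submodule_def)

lemma thicken_upper: "submodule L \<Longrightarrow> L \<subseteq> thicken k L" "submodule L \<Longrightarrow> cube k \<subseteq> thicken k L"
  using zero_in_submodule[OF submodule_cube] zero_in_submodule[of L] unfolding thicken_def by force+

lemma thicken_mono: "L \<subseteq> M \<Longrightarrow> thicken k L \<subseteq> thicken k M"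
  unfolding thicken_def by blast

lemma thicken_least: "submodule M \<Longrightarrow> L \<subseteq> M \<Longrightarrow> cube k \<subseteq> M \<Longrightarrow> thicken k L \<subseteq> M"
  unfolding thicken_def submodule_def by blast

lemma submodule_thicken: "submodule L \<Longrightarrow> submodule (thicken k L)"
  unfolding submodule_def[of "thicken k L"]
proof (intro conjI ballI allI impI)
  assume L: "submodule L"
  show "0 \<in> thicken k L" using thicken_upper(1)[OF L] zero_in_submodule[OF L] by blast
  fix x y assume "x \<in> thicken k L" "y \<in> thicken k L"
  then obtain a b a' b' where "x = a + b" "a \<in> L" "b \<in> cube k" "y = a' + b'" "a' \<in> L" "b' \<in> cube k"
    unfolding thicken_def by blast
  moreover from this have "x + y = (a + a') + (b + b')" by (simp add: algebra_simps)
  ultimately show "x + y \<in> thicken k L"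
    using L submodule_cube[of k] unfolding thicken_def submodule_def by blast
next
  assume L: "submodule L"
  fix x c assume "x \<in> thicken k L" "val_ge v 0 c"
  then obtain a b where "x = a + b" "a \<in> L" "b \<in> cube k" "val_ge v 0 c"
    unfolding thicken_def by blast
  moreover from this have "c *s x = c *s a + c *s b" by (simp add: vector_add_ldistrib)
  ultimately show "c *s x \<in> thicken k L"
    using L submodule_cube[of k] unfolding thicken_def submodule_def by blast
qed

text \<open>For \<open>0 \<le> k\<close> nothing leaves \<open>cube 0\<close>, and enlarging a
  lattice cannot push it into \<open>cube 1\<close>.\<close>

lemma primitive_thicken: "primitive L \<Longrightarrow> 0 \<le> k \<Longrightarrow> primitive (thicken k L)"
proof -
  assume L: "primitive L" and k: "0 \<le> k"
  have sub: "submodule L" using L by (rule primitive_submodule)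
  have "thicken k L \<subseteq> cube 0"
    using L cube_mono[OF k] by (intro thicken_least submodule_cube) (auto simp: primitive_def)
  then show ?thesis
    using L thicken_upper[OF sub, of k] submodule_thicken[OF sub, of k]
    unfolding primitive_def valuation_lattice_iff by blast
qed

text \<open>The uniformiser sends \<open>cube k\<close> into \<open>cube (k + 1)\<close>. This is
  why the index is lowered by one at a time: lattices of level \<open>k + 1\<close> contain the
  shrunken addition.\<close>

lemma shrink_thicken:
  "submodule M \<Longrightarrow> shrink L \<subseteq> M \<Longrightarrow> cube (k + 1) \<subseteq> M \<Longrightarrow> shrink (thicken k L) \<subseteq> M"
proof
  fix z assume *: "submodule M" "shrink L \<subseteq> M" "cube (k + 1) \<subseteq> M" "z \<in> shrink (thicken k L)"
  then obtain x y where "z = unif *s x + unif *s y" "x \<in> L" "y \<in> cube k"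
    unfolding thicken_def by (auto simp: vector_add_ldistrib)
  moreover from this have "unif *s y \<in> M" using smult_cube[of y k unif] unif * by auto
  ultimately show "z \<in> M" using * unfolding submodule_def by blast
qed

lemma flags_mono: "k \<le> l \<Longrightarrow> flags k \<subseteq> (flags l :: ('a ^ 'n) set list set)"
proof -
  assume "k \<le> l"
  then have "(cube l :: ('a ^ 'n) set) \<subseteq> cube k" by (rule cube_mono)
  then show ?thesis by (auto simp: flags_def)
qed

lemma thicken_flags:
  assumes "Ls \<in> flags (k + 1)" "0 \<le> k"
  shows "map (thicken k) Ls \<in> flags k"
proof -
  have sub: "submodule L" if "L \<in> set Ls" for L
    using assms that by (auto simp: flags_def intro: primitive_submodule)
  have "shrink (thicken k L) \<subseteq> thicken k M" if "L \<in> set Ls" "M \<in> set Ls" for L M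
  proof -
    have "shrink L \<subseteq> M" "cube (k + 1) \<subseteq> M" using that assms by (auto simp: flags_def)
    then have "shrink L \<subseteq> thicken k M" "cube (k + 1) \<subseteq> thicken k M"
      using thicken_upper(1)[OF sub[OF that(2)], of k] by (meson order.trans)+
    then show ?thesis using sub that by (intro shrink_thicken submodule_thicken) auto
  qed
  moreover have "sorted_wrt (\<supseteq>) Ls" using assms(1) by (simp add: flags_def)
  then have "sorted_wrt (\<lambda>L M. thicken k M \<subseteq> thicken k L) Ls"
    by (rule sorted_wrt_mono_rel[rotated]) (rule thicken_mono)
  moreover have "primitive (thicken k L) \<and> cube k \<subseteq> thicken k L" if "L \<in> set Ls" for L
    using assms(1) primitive_thicken[OF _ assms(2), of L] thicken_upper(2)[OF sub[OF that], of k] that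
    by (simp add: flags_def)
  ultimately show ?thesis by (auto simp: flags_def sorted_wrt_map)
qed

text \<open>Earlier lattices are thickened and later ones are not, so the order persists:
  \<open>L\<close> lies in \<open>thicken k L\<close>, which lies in the thickening of every earlier
  lattice. The reverse bounds come from \<open>shrink_thicken\<close>, as all lattices contain
  \<open>cube (k + 1)\<close>.\<close>

lemma prism_flags:
  assumes "us @ L # vs \<in> flags (k + 1)" "0 \<le> k"
  shows "map (thicken k) us @ thicken k L # L # vs \<in> flags (k + 1)"
proof -
  let ?Ls = "us @ L # vs"
  have sub: "submodule M" if "M \<in> set ?Ls" for M
    using assms that unfolding flags_def by (blast intro: primitive_submodule)
  have up: "M \<subseteq> thicken k M" if "M \<in> set ?Ls" for M using thicken_upper(1) sub that by blast
  note flag = assms(1)[unfolded flags_def mem_Collect_eq]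
  have fl: "primitive M \<and> cube (k + 1) \<subseteq> M" if "M \<in> set ?Ls" for M
    using flag[THEN conjunct1] that by (rule bspec)
  have sh: "shrink M \<subseteq> N" if "M \<in> set ?Ls" "N \<in> set ?Ls" for M N
    using flag[THEN conjunct2, THEN conjunct2] that by (meson bspec)
  have sh1: "shrink (thicken k M) \<subseteq> N" if "M \<in> set ?Ls" "N \<in> set ?Ls" for M N
    using sh[OF that] fl that sub by (intro shrink_thicken) auto
  have el: "N \<in> set ?Ls \<or> (\<exists>M\<in>set ?Ls. N = thicken k M)"
    if "N \<in> set (map (thicken k) us @ thicken k L # L # vs)" for N using that by auto
  have "shrink M \<subseteq> N" if "M \<in> set (map (thicken k) us @ thicken k L # L # vs)"
    "N \<in> set (map (thicken k) us @ thicken k L # L # vs)" for M N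
  proof -
    note MN = that
    \<comment> \<open>Every lattice of the prism contains an original one, so only original lattices
      need to be considered on the right.\<close>
    obtain N' where N': "N' \<in> set ?Ls" "N' \<subseteq> N" using el[OF MN(2)] up by blast
    have "shrink M \<subseteq> N'"
      using el[OF MN(1)]
    proof
      assume "M \<in> set ?Ls"
      then show ?thesis using sh N'(1) by blast
    next
      assume "\<exists>M'\<in>set ?Ls. M = thicken k M'"
      then obtain M' where "M' \<in> set ?Ls" "M = thicken k M'" by blast
      then show ?thesis using sh1[OF _ N'(1), of M'] by simp
    qed
    then show ?thesis using N'(2) by (rule order.trans)
  qed
  moreover have "primitive M \<and> cube (k + 1) \<subseteq> M" if "M \<in> set (map (thicken k) us @ thicken k L # L # vs)" for M
    using el[OF that]
  proof
    assume "\<exists>M'\<in>set ?Ls. M = thicken k M'"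
    then obtain M' where M': "M' \<in> set ?Ls" "M = thicken k M'" by blast
    have "primitive M" using fl[OF M'(1)] primitive_thicken[OF _ assms(2), of M'] M'(2) by simp
    moreover have "cube (k + 1) \<subseteq> M"
      using fl[OF M'(1)] up[OF M'(1)] unfolding M'(2) by (meson order.trans)
    ultimately show ?thesis by blast
  qed (rule fl)
  moreover have "sorted_wrt (\<supseteq>) (map (thicken k) us @ thicken k L # L # vs)"
  proof -
    have s: "sorted_wrt (\<supseteq>) us" "\<forall>M\<in>set us. L \<subseteq> M \<and> (\<forall>N\<in>set vs. N \<subseteq> M)" "\<forall>N\<in>set vs. N \<subseteq> L" "sorted_wrt (\<supseteq>) vs"
      using assms(1) by (auto simp: flags_def sorted_wrt_append)
    have "sorted_wrt (\<lambda>L M. thicken k M \<subseteq> thicken k L) us"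
      by (rule sorted_wrt_mono_rel[OF _ s(1)]) (rule thicken_mono)
    moreover have "thicken k L \<subseteq> thicken k M" "L \<subseteq> thicken k M" "\<forall>N\<in>set vs. N \<subseteq> thicken k M"
      if "M \<in> set us" for M
    proof -
      have sM: "L \<subseteq> M" "\<forall>N\<in>set vs. N \<subseteq> M" and uM: "M \<subseteq> thicken k M" using s(2) that up by simp_all
      show "thicken k L \<subseteq> thicken k M" by (rule thicken_mono[OF sM(1)])
      show "L \<subseteq> thicken k M" by (rule order.trans[OF sM(1) uM])
      show "\<forall>N\<in>set vs. N \<subseteq> thicken k M" by (rule ballI, rule order.trans[OF bspec[OF sM(2)] uM])
    qed
    moreover have "L \<subseteq> thicken k L" using up by simp
    moreover have "N \<subseteq> thicken k L" if "N \<in> set vs" for N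
      using s(3) that up[of L] by (meson order.trans list.set_intros(1) in_set_conv_decomp)
    ultimately show ?thesis using s by (simp add: sorted_wrt_append sorted_wrt_map)
  qed
  ultimately show ?thesis by (rule flagsI)
qed

text \<open>Thickening retracts level \<open>k + 1\<close> onto level \<open>k\<close>, and within
  level \<open>k + 1\<close> the prism makes it homotopic to the identity. At level 0 the cone with
  the standard lattice as apex fills every cycle.\<close>

lemma flags_acyclic:
  fixes z :: "('a ^ 'n) set list \<Rightarrow>\<^sub>0 rat"
  assumes "coeff_ring S" "z \<in> chains S (deg (flags (int k)) q)" "bd z = 0"
  shows "\<exists>y\<in>chains S (deg (flags (int k)) (Suc q)). bd y = z"
proof -
  interpret coeff_ring S by (rule assms(1))
  show ?thesis using assms(2,3)
  proof (induction k arbitrary: z)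
    case 0
    have p0: "primitive (cube 0 :: ('a ^ 'n) set)"
    proof -
      have "(\<chi> i. 1) \<in> (cube 0 :: ('a ^ 'n) set)" "(\<chi> i. 1) \<notin> (cube 1 :: ('a ^ 'n) set)"
        by (auto simp: cube_def val_ge_def)
      then show ?thesis by (auto simp: primitive_def valuation_lattice_iff submodule_cube)
    qed
    have s0: "shrink (cube 0) \<subseteq> (cube 0 :: ('a ^ 'n) set)" by (rule shrink_subset[OF submodule_cube])
    have "cube 0 # Ls \<in> flags 0" if "Ls \<in> flags 0" for Ls :: "('a ^ 'n) set list"
    proof -
      have eq: "L = cube 0" if "L \<in> set Ls" for L using that \<open>Ls \<in> flags 0\<close> by (auto simp: flags_def primitive_def)
      have eq0: "M = cube 0" if "M \<in> set (cube 0 # Ls)" for M using that eq by auto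
      have "sorted_wrt (\<supseteq>) Ls" using that by (simp add: flags_def)
      then have "sorted_wrt (\<supseteq>) (cube 0 # Ls)" using eq by fastforce
      then show ?thesis
      proof (rule flagsI[rotated 2])
        fix L M assume LM: "L \<in> set (cube 0 # Ls)" "M \<in> set (cube 0 # Ls)"
        show "shrink L \<subseteq> M" unfolding eq0[OF LM(1)] eq0[OF LM(2)] by (rule s0)
      next
        fix L assume L: "L \<in> set (cube 0 # Ls)"
        show "primitive L \<and> cube 0 \<subseteq> L" unfolding eq0[OF L] using p0 by simp
      qed
    qed
    then have "prepend (cube 0) z \<in> chains S (deg (flags (int 0)) (Suc q))"
      using 0 by (intro prepend_chains[OF 0(1)]) (auto simp: deg_def)
    moreover have "bd (prepend (cube 0) z) = z" using 0 by (simp add: bd_prepend prepend_linear)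
    ultimately show ?case by blast
  next
    case (Suc k)
    let ?\<rho> = "thicken (int k)"
    have "mapc ?\<rho> z \<in> chains S (deg (flags (int k)) q)"
      by (rule mapc_chains[OF Suc.prems(1)]) (auto simp: deg_def add.commute[of 1] intro!: thicken_flags)
    moreover have "bd (mapc ?\<rho> z) = 0" using Suc.prems by (simp add: bd_mapc mapc_linear)
    ultimately obtain y where y: "y \<in> chains S (deg (flags (int k)) (Suc q))" "bd y = mapc ?\<rho> z"
      using Suc.IH by blast
    have "lext (prism ?\<rho>) z \<in> chains S (deg (flags (int (Suc k))) (Suc q))"
    proof (rule lext_chains[OF Suc.prems(1)], rule chains_mono[OF _ prism_chains], clarify)
      fix us L vs assume "us @ L # vs \<in> deg (flags (int (Suc k))) q"
      then show "map ?\<rho> us @ ?\<rho> L # L # vs \<in> deg (flags (int (Suc k))) (Suc q)"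
        using prism_flags[of us L vs "int k"] by (auto simp: deg_def algebra_simps)
    qed
    moreover have "flags (int k) \<subseteq> (flags (int (Suc k)) :: ('a ^ 'n) set list set)"
      by (rule flags_mono) simp
    then have "y \<in> chains S (deg (flags (int (Suc k))) (Suc q))"
      by (intro chains_mono[OF _ y(1)]) (auto simp: deg_def)
    moreover have "bd (lext (prism ?\<rho>) z) = z - mapc ?\<rho> z - lext (prism ?\<rho>) (bd z)"
      by (simp add: bd_lext bd_prism lext_fun_diff mapc_def) (simp add: bd_def lext_lext)
    ultimately show ?case using Suc.prems y by (intro bexI[of _ "lext (prism ?\<rho>) z + y"]) (auto simp: bd_linear intro: add_chains)
  qed
qed

section \<open>Acyclicity for simplices listed by type\<close>

definition simplex_lists :: "('a, 'n::finite) vertex list set" where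
  "simplex_lists = {xs. ascending vertex_type xs \<and> (xs = [] \<or> set xs \<in> building v)}"

lemma simplex_primitives:
  assumes "\<sigma> \<in> (building v :: ('a, 'n::finite) vertex set set)" "V \<in> \<sigma>" "W \<in> \<sigma>"
  shows "primitive (primitive_representative V)" "homothety_class (primitive_representative V) = V"
    "compatible (primitive_representative V) (primitive_representative W)"
proof -
  obtain \<L> where \<L>: "\<forall>L\<in>\<L>. primitive L" "\<forall>L\<in>\<L>. \<forall>M\<in>\<L>. compatible L M" "\<sigma> = homothety_class ` \<L>"
    using assms(1) unfolding building_iff by blast
  obtain L M where "L \<in> \<L>" "V = homothety_class L" "M \<in> \<L>" "W = homothety_class M" using assms \<L> by blast
  then show "primitive (primitive_representative V)" "homothety_class (primitive_representative V) = V"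
    "compatible (primitive_representative V) (primitive_representative W)"
    using \<L> by (auto simp: primitive_representative_class)
qed

lemma vertex_type_inj_on: "\<sigma> \<in> (building v :: ('a, 'n::finite) vertex set set) \<Longrightarrow> inj_on vertex_type \<sigma>"
proof (rule inj_onI)
  fix V W assume *: "\<sigma> \<in> building v" "V \<in> \<sigma>" "W \<in> \<sigma>" "vertex_type V = vertex_type W"
  have "primitive_representative V = primitive_representative W"
    using * simplex_primitives(1,2)[OF *(1,2,3)] simplex_primitives(1,2)[OF *(1,3,2)]
    by (intro vertex_type_inj simplex_primitives(3)[OF *(1,2,3)]) auto
  then show "V = W"
    using simplex_primitives(2)[OF *(1,2,3)] simplex_primitives(2)[OF *(1,3,2)] by metis
qed

text \<open>Flags are ordered by inclusion, simplex lists by type. The signed sortings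
  \<open>T\<close> and \<open>U\<close> are chain maps between the two, and \<open>U\<close> after
  \<open>T\<close> is the identity. A cycle is therefore filled by moving it to flags, filling it
  there and moving back.\<close>

theorem simplex_lists_acyclic:
  fixes z :: "('a, 'n::finite) vertex list \<Rightarrow>\<^sub>0 rat"
  assumes S: "coeff_ring S" and z: "z \<in> chains S (deg simplex_lists q)" "bd z = 0"
  shows "\<exists>y\<in>chains S (deg simplex_lists (Suc q)). bd y = z"
proof -
  interpret coeff_ring S by (rule S)
  let ?pr = "primitive_representative :: ('a, 'n) vertex \<Rightarrow> _"
  let ?cl = "homothety_class :: ('a ^ 'n) set \<Rightarrow> _"
  define T where "T xs = sortc covolume (map ?pr xs)" for xs
  have inj: "inj_on covolume (set (map ?pr xs))" if "xs \<in> simplex_lists" for xs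
  proof (cases "xs = []")
    case False
    then have b: "set xs \<in> building v" using that by (simp add: simplex_lists_def)
    have "?pr V = ?pr W" if "V \<in> set xs" "W \<in> set xs" "covolume (?pr V) = covolume (?pr W)" for V W
      using that by (intro covolume_inj simplex_primitives[OF b]) auto
    then show ?thesis unfolding inj_on_def by simp
  qed simp
  have flag: "\<exists>k. ys \<in> flags (int k)" if xs: "xs \<in> simplex_lists" "mset ys = mset (map ?pr xs)" "ascending covolume ys" for xs ys
  proof (cases "xs = []")
    case True
    then show ?thesis using xs by (auto simp: flags_def)
  next
    case False
    then have b: "set xs \<in> building v" using xs by (simp add: simplex_lists_def)
    have set: "set ys = ?pr ` set xs" using xs(2) by (metis mset_eq_setD set_map)
    have prim: "primitive L" if "L \<in> set ys" for L using that set simplex_primitives(1)[OF b] by auto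
    have comp: "compatible L M" if "L \<in> set ys" "M \<in> set ys" for L M
      using that set simplex_primitives(3)[OF b] by auto
    have "sorted_wrt (\<lambda>L M. covolume L < covolume M) ys" using xs(3) by (simp add: sorted_wrt_map)
    \<comment> \<open>Larger lattices have smaller covolume, so ascending covolumes give a
      descending flag.\<close>
    then have "sorted_wrt (\<supseteq>) ys"
    proof (rule sorted_wrt_mono_rel[rotated])
      fix L M assume "L \<in> set ys" "M \<in> set ys" "covolume L < covolume M"
      then show "M \<subseteq> L" using comp[of L M] prim covolume_mono(1)[of L M] by (auto simp: compatible_def primitive_def)
    qed
    moreover have "\<exists>k. \<forall>L\<in>set ys. cube (int k) \<subseteq> L" 
      using prim
    proof (induction ys)
      case (Cons L ys)
      then obtain k where k: "\<forall>L\<in>set ys. cube (int k) \<subseteq> L" by auto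
      obtain l where l: "cube l \<subseteq> L" using Cons.prems[of L] by (auto simp: primitive_def valuation_lattice_iff)
      have "cube (int (max k (nat l))) \<subseteq> (cube (int k) :: ('a ^ 'n) set)"
        "cube (int (max k (nat l))) \<subseteq> (cube l :: ('a ^ 'n) set)" by (rule cube_mono, simp)+
      then show ?case using k l by (intro exI[of _ "max k (nat l)"]) auto
    qed simp
    ultimately show ?thesis using prim comp unfolding flags_def compatible_def by blast
  qed
  define K where "K xs = {ys. mset ys = mset (map ?pr xs) \<and> ascending covolume ys}" for xs
  have T: "T xs \<in> chains S (K xs)" for xs unfolding T_def K_def by (rule sortc_chains)
  have bdT: "bd (T xs) = lext T (face xs)" if "xs \<in> simplex_lists" for xs
    unfolding T_def using bd_sortc[OF inj[OF that]] by (simp add: lext_mapc flip: mapc_face)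
  let ?z = "lext T z"
  have "bd ?z = lext T (bd z)"
    unfolding bd_lext bd_apply[of z] lext_lext
    by (rule lext_cong_chains[OF z(1)]) (simp add: bdT deg_def)
  then have bz: "bd ?z = 0" using z by simp
  have "?z \<in> chains S {ys. length ys = q \<and> (\<exists>k. ys \<in> flags (int k))}"
  proof (rule lext_chains[OF z(1)], rule chains_mono[OF _ T], rule subsetI)
    fix xs ys assume "xs \<in> deg simplex_lists q" "ys \<in> K xs"
    then show "ys \<in> {ys. length ys = q \<and> (\<exists>k. ys \<in> flags (int k))}"
      using flag[of xs ys] size_mset[of ys] by (auto simp: K_def deg_def)
  qed
  then have keys: "finite (Poly_Mapping.keys ?z)"
    "\<forall>ys\<in>Poly_Mapping.keys ?z. length ys = q \<and> (\<exists>k. ys \<in> flags (int k))" and zS: "\<forall>b. Poly_Mapping.lookup ?z b \<in> S"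
    by (auto simp: chains_def)
  have fm: "ys \<in> flags (int l)" if "ys \<in> flags (int k)" "k \<le> l" for k l and ys :: "('a ^ 'n) set list"
    using that flags_mono[of "int k" "int l"] by auto
  \<comment> \<open>The support is finite, so one level accommodates all flags that occur.\<close>
  have "\<exists>k. \<forall>ys\<in>A. ys \<in> flags (int k)" if "finite A" "\<forall>ys\<in>A. \<exists>k. ys \<in> flags (int k)" for A :: "('a ^ 'n) set list set"
    using that
  proof (induction A rule: finite_induct)
    case (insert ys A)
    then obtain k l where "\<forall>ys\<in>A. ys \<in> flags (int k)" "ys \<in> flags (int l)" by auto
    then show ?case using fm by (intro exI[of _ "max k l"]) (auto simp: max_def)
  qed simp
  then obtain k where "\<forall>ys\<in>Poly_Mapping.keys ?z. ys \<in> flags (int k)" using keys by blast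
  then have "?z \<in> chains S (deg (flags (int k)) q)" using keys(2) zS by (auto simp: chains_def deg_def)
  then obtain y where y: "y \<in> chains S (deg (flags (int k)) (Suc q))" "bd y = ?z"
    using flags_acyclic[OF S _ bz] by blast
  define U where "U Ls = sortc vertex_type (map ?cl Ls)" for Ls
  note comp = flags_compatible
  have injU: "inj_on vertex_type (set (map ?cl Ls))" if "Ls \<in> flags j" for Ls j
  proof (rule inj_onI)
    fix V W assume VW: "V \<in> set (map ?cl Ls)" "W \<in> set (map ?cl Ls)" "vertex_type V = vertex_type W"
    then obtain L M where LM: "L \<in> set Ls" "M \<in> set Ls" "V = ?cl L" "W = ?cl M" by auto
    have "primitive L" "primitive M" using that LM by (simp_all add: flags_def)
    then have "L = M" using comp[OF that LM(1,2)] VW(3) unfolding LM(3,4) by (intro vertex_type_inj)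
    then show "V = W" using LM by simp
  qed
  have U: "U Ls \<in> chains S (deg simplex_lists n)" if "Ls \<in> deg (flags j) n" for Ls j n
    unfolding U_def
  proof (rule chains_mono[OF _ sortc_chains], rule subsetI)
    fix ys assume "ys \<in> {ys. mset ys = mset (map ?cl Ls) \<and> ascending vertex_type ys}"
    then have ys: "mset ys = mset (map ?cl Ls)" "ascending vertex_type ys" by auto
    have Ls: "Ls \<in> flags j" "length Ls = n" using that by (auto simp: deg_def)
    have "set ys = ?cl ` set Ls" using mset_eq_setD[OF ys(1)] by simp
    moreover have "?cl ` set Ls \<in> building v" if "Ls \<noteq> []"
      unfolding building_iff using that Ls(1) comp[OF Ls(1)]
      by (intro exI[of _ "set Ls"]) (auto simp: flags_def)
    ultimately show "ys \<in> deg simplex_lists n"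
      using ys Ls mset_eq_length[OF ys(1)] by (cases "Ls = []") (auto simp: deg_def simplex_lists_def)
  qed
  have bdU: "bd (U Ls) = lext U (face Ls)" if "Ls \<in> flags j" for Ls j
    unfolding U_def using bd_sortc[OF injU[OF that]] by (simp add: lext_mapc flip: mapc_face)
  have UT: "lext U (T xs) = unit_chain xs" if xs: "xs \<in> simplex_lists" for xs
  proof -
    have prim: "primitive (?pr V)" "?cl (?pr V) = V" if "V \<in> set xs" for V
      using that xs simplex_primitives[of "set xs"] by (auto simp: simplex_lists_def)
    have "lext U (T xs) = mapc ?cl (lext (sortc (vertex_type \<circ> ?cl)) (sortc covolume (map ?pr xs)))"
      by (simp add: U_def[abs_def] T_def sortc_map mapc_lext)
    \<comment> \<open>The covolume of a lattice determines the type of its class, so the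
      intermediate order is a refinement.\<close>
    also have "lext (sortc (vertex_type \<circ> ?cl)) (sortc covolume (map ?pr xs)) = sortc (vertex_type \<circ> ?cl) (map ?pr xs)"
    proof (rule sortc_sortc)
      fix L M assume "L \<in> set (map ?pr xs)" "M \<in> set (map ?pr xs)" "covolume L = covolume M"
      then show "(vertex_type \<circ> ?cl) L = (vertex_type \<circ> ?cl) M"
        using prim(1) by (auto simp: vertex_type_class primitive_def)
    qed
    also have "mapc ?cl \<dots> = sortc vertex_type (map ?cl (map ?pr xs))" by (simp only: sortc_map)
    also have "map ?cl (map ?pr xs) = xs" using prim(2) by (simp add: map_idI)
    also have "sortc vertex_type xs = unit_chain xs" using xs by (intro sortc_ascending) (simp add: simplex_lists_def)
    finally show ?thesis .
  qed
  have "bd (lext U y) = lext U (bd y)"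
    unfolding bd_lext bd_apply[of y] lext_lext
    by (rule lext_cong_chains[OF y(1)]) (auto simp: deg_def intro: bdU)
  also have "\<dots> = lext (\<lambda>xs. lext U (T xs)) z" by (simp add: y lext_lext)
  also have "\<dots> = z" by (rule lext_id_chains[OF z(1)]) (simp add: UT deg_def)
  finally have "bd (lext U y) = z" .
  moreover have "lext U y \<in> chains S (deg simplex_lists (Suc q))" by (rule lext_chains[OF y(1) U])
  ultimately show ?thesis by blast
qed

end

subsection \<open>Automorphisms of the building and stabilisers\<close>

lemma map_det_ring_hom:
  fixes \<iota> :: "'k::field \<Rightarrow> 'l::field"
  assumes "\<iota> 1 = 1" and add: "\<And>x y. \<iota> (x + y) = \<iota> x + \<iota> y" and mult: "\<And>x y. \<iota> (x * y) = \<iota> x * \<iota> y"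
  shows "det (map_matrix \<iota> (g :: 'k ^ 'n ^ 'n)) = \<iota> (det g)"
    and "map_matrix \<iota> ((g :: 'k ^ 'n ^ 'n) ** h) = map_matrix \<iota> g ** map_matrix \<iota> h"
    and "map_matrix \<iota> (mat 1 :: 'k ^ 'n ^ 'n) = mat 1"
proof -
  have "\<iota> 0 + \<iota> 0 = \<iota> 0 + 0" using add[of 0 0] by simp
  then have zero: "\<iota> 0 = 0" by (simp only: add_left_cancel)
  have minus: "\<iota> (- x) = - \<iota> x" for x using add[of x "- x"] zero by (simp add: eq_neg_iff_add_eq_0 add.commute)
  have sum: "\<iota> (sum f A) = (\<Sum>a\<in>A. \<iota> (f a))" for f and A :: "'x set"
    by (induction A rule: infinite_finite_induct) (auto simp: zero add)
  have prod: "\<iota> (prod f A) = (\<Prod>a\<in>A. \<iota> (f a))" for f and A :: "'x set"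
    by (induction A rule: infinite_finite_induct) (auto simp: assms)
  have "\<iota> (of_int (sign p)) = of_int (sign p)" for p :: "'n \<Rightarrow> 'n" by (simp add: sign_def minus assms)
  then show "det (map_matrix \<iota> g) = \<iota> (det g)"
    by (simp add: det_def sum prod mult map_matrix_def)
  show "map_matrix \<iota> (g ** h) = map_matrix \<iota> g ** map_matrix \<iota> h"
    by (simp add: vec_eq_iff matrix_matrix_mult_def map_matrix_def sum mult)
  show "map_matrix \<iota> (mat 1 :: 'k ^ 'n ^ 'n) = mat 1"
    by (simp add: vec_eq_iff mat_def map_matrix_def zero assms)
qed

context discretely_valued
begin

text \<open>The action of matrices whose entries already lie in the completed field;
  \<open>building_action\<close> is its composite with the embedding.\<close>

definition move :: "'a ^ 'n ^ 'n \<Rightarrow> ('a, 'n::finite) vertex \<Rightarrow> ('a, 'n) vertex" where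
  "move g V = (\<lambda>L. (*v) g ` L) ` V"

lemma move_class:
  fixes L :: "('a ^ 'n::finite) set"
  shows "move g (homothety_class L) = homothety_class ((*v) g ` L)"
proof -
  have "homothety_class M = (\<lambda>c. (*s) c ` M) ` {c. c \<noteq> 0}" for M :: "('a ^ 'n) set"
    by (auto simp: homothety_class_def)
  then show ?thesis by (simp add: move_def image_image vector_scalar_commute)
qed

lemma move_building:
  fixes g :: "'a ^ 'n ^ 'n"
  assumes g: "det g \<noteq> 0" and \<sigma>: "\<sigma> \<in> building v"
  shows "move g ` \<sigma> \<in> building v"
proof -
  obtain Ls \<pi> where Ls: "\<sigma> = homothety_class ` set Ls" "Ls \<noteq> []" "\<forall>L\<in>set Ls. valuation_lattice v L"
      "sorted_wrt (\<supset>) Ls" "v \<pi> = 1" "(*s) \<pi> ` hd Ls \<subset> last Ls"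
    using \<sigma> by (auto simp: building_def)
  obtain g' where g': "g' ** g = mat 1" using g by (auto simp: invertible_det_nz[symmetric] invertible_def)
  have "inj ((*v) g)"
  proof (rule injI)
    fix x y assume "g *v x = g *v y"
    then have "g' *v (g *v x) = g' *v (g *v y)" by simp
    then show "x = y" by (simp add: matrix_vector_mul_assoc g')
  qed
  then have strict: "L \<subset> M \<Longrightarrow> (*v) g ` L \<subset> (*v) g ` M" for L M
    by (meson image_strict_mono inj_on_subset subset_UNIV)
  let ?Ls = "map ((`) ((*v) g)) Ls"
  have "sorted_wrt (\<lambda>L M. (*v) g ` M \<subset> (*v) g ` L) Ls"
    by (rule sorted_wrt_mono_rel[OF _ Ls(4)]) (rule strict)
  then have "sorted_wrt (\<supset>) ?Ls" by (simp add: sorted_wrt_map)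
  moreover have "(*s) \<pi> ` hd ?Ls = (*v) g ` (*s) \<pi> ` hd Ls"
    using Ls(2) by (simp add: hd_map image_image vector_scalar_commute)
  then have "(*s) \<pi> ` hd ?Ls \<subset> last ?Ls" using strict[OF Ls(6)] Ls(2) by (simp add: last_map)
  moreover have "move g ` \<sigma> = homothety_class ` set ?Ls" by (simp add: Ls(1) image_image move_class)
  ultimately show ?thesis
    unfolding building_def using Ls(2,3,5) lattice_image(1)[OF _ g]
    by (intro CollectI exI[of _ ?Ls] conjI exI[of _ \<pi>]) simp_all
qed

lemma building_vertex:
  assumes "\<sigma> \<in> building v" "V \<in> \<sigma>"
  obtains L :: "('a ^ 'n) set" where "valuation_lattice v L" "V = homothety_class L"
  using assms by (auto simp: building_def)

lemma vertex_type_move: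
  fixes g :: "'a ^ 'n ^ 'n"
  assumes "det g = 1" "\<sigma> \<in> building v" "V \<in> \<sigma>"
  shows "vertex_type (move g V) = vertex_type V"
proof -
  obtain L :: "('a ^ 'n) set" where L: "valuation_lattice v L" "V = homothety_class L"
    using building_vertex assms(2,3) by blast
  then show ?thesis
    using lattice_image[OF L(1), of g] assms(1) by (simp add: move_class vertex_type_class)
qed

text \<open>
  A matrix of determinant \<open>1\<close> preserves covolumes, so it fixes a vertex only if it fixes the
  lattices in it.
\<close>

lemma stabiliser_bounded:
  assumes "\<sigma> \<in> building v" "V \<in> \<sigma>"
  shows "\<exists>M. \<forall>g :: 'a ^ 'n ^ 'n. det g = 1 \<longrightarrow> move g V = V \<longrightarrow> (\<forall>i j. val_ge v M (g $ i $ j))"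
proof -
  obtain L :: "('a ^ 'n) set" where L: "valuation_lattice v L" "V = homothety_class L"
    using building_vertex assms by blast
  obtain k l where kl: "cube k \<subseteq> L" "L \<subseteq> cube l" using L(1) by (auto simp: valuation_lattice_iff)
  have "val_ge v (l - k) (g $ i $ j)" if g: "det g = 1" "move g V = V" for g :: "'a ^ 'n ^ 'n" and i j
  proof -
    have "(*v) g ` L \<in> homothety_class L"
      using g(2) in_homothety_class[of "(*v) g ` L"] by (simp add: L(2) move_class)
    then obtain c where c: "c \<noteq> 0" "(*v) g ` L = (*s) c ` L" by (auto simp: homothety_class_def)
    have "covolume ((*s) c ` L) = covolume L" using lattice_image(2)[OF L(1), of g] g(1) c(2) by simp
    then have "v c = 0" using lattice_smult(2)[OF L(1) c(1)] by simp
    then have gL: "(*v) g ` L = L"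
      using c smult_image_self[OF lattice_submodule[OF L(1)] c(1)] by simp
    obtain t where t: "t \<noteq> 0" "v t = 1" using uniformiser_exists by blast
    \<comment> \<open>A multiple of \<open>x\<close> lies in \<open>cube k\<close> and hence in
      \<open>L\<close>, which \<open>g\<close> preserves and which lies in \<open>cube l\<close>;
      scaling back leaves the bound \<open>l - k\<close>.\<close>
    have "g *v x \<in> cube (l - k)" if x: "x \<in> cube 0" for x
    proof -
      have "t powi k *s x \<in> cube k" using smult_cube[OF x, of "t powi k"] t by (simp add: val_power_int)
      then have "g *v (t powi k *s x) \<in> cube l" using kl gL by blast
      then have "t powi (- k) *s (g *v (t powi k *s x)) \<in> cube (l + v (t powi (- k)))"
        using t by (intro smult_cube) auto
      moreover have "v (t powi (- k)) = - k" using t by (simp add: val_power_int)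
      ultimately show ?thesis using t by (simp add: vector_scalar_commute power_int_minus)
    qed
    then show ?thesis by (rule matrix_entries_of_image)
  qed
  then show ?thesis by blast
qed

end

lemma finite_vectors: "finite D \<Longrightarrow> finite {r :: 'a ^ 'n::finite. \<forall>j. r $ j \<in> D}"
proof -
  assume "finite D"
  then have "finite (PiE (UNIV :: 'n set) (\<lambda>_. D))" by (intro finite_PiE) auto
  moreover have "vec_nth ` {r :: 'a ^ 'n. \<forall>j. r $ j \<in> D} \<subseteq> PiE UNIV (\<lambda>_. D)" by auto
  ultimately have "finite (vec_nth ` {r :: 'a ^ 'n. \<forall>j. r $ j \<in> D})" by (rule finite_subset[rotated])
  then show ?thesis by (rule finite_imageD) (simp add: inj_on_def vec_nth_inject)
qed

lemma (in discretely_valued) building_action_eq_move: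
  "building_action \<iota> g = move (map_matrix \<iota> g)"
  by (simp add: building_action_def[abs_def] move_def[abs_def])

lemma SL_group_group: "group (SL_group :: ('a::field ^ 'n ^ 'n) monoid)"
proof (rule groupI)
  fix x assume "x \<in> carrier (SL_group :: ('a ^ 'n ^ 'n) monoid)"
  then have x: "det x = 1" by (simp add: SL_group_def)
  then obtain y where y: "x ** y = mat 1" "y ** x = mat 1"
    using invertible_det_nz[of x] by (auto simp: invertible_def)
  have "det y = 1" using arg_cong[OF y(1), of det] x by (simp add: det_mul)
  then show "\<exists>y\<in>carrier SL_group. y \<otimes>\<^bsub>SL_group\<^esub> x = \<one>\<^bsub>SL_group\<^esub>" using y by (auto simp: SL_group_def)
qed (auto simp: SL_group_def det_mul matrix_mul_assoc)

text \<open>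
  Entries of matrices over \<open>A\<close> that stabilise a vertex have bounded poles at \<open>\<infinity>\<close> and none
  elsewhere.
\<close>

lemma stabiliser_finite:
  fixes F :: "'k::field set" and \<iota> :: "'k \<Rightarrow> 'l::field" and \<Gamma> :: "('k ^ 'n::finite ^ 'n) set"
  assumes F: "global_function_field F" and v: "place F v" and w: "valued_completion v \<iota> w"
    and \<Gamma>: "arithmetic_subgroup F v \<Gamma>" and V: "\<sigma> \<in> building w" "V \<in> \<sigma>"
  shows "finite {g \<in> \<Gamma>. building_action \<iota> g V = V}"
proof -
  interpret constant_field F using F by unfold_locales
  interpret w: discretely_valued w using w by (simp add: valued_completion_def discretely_valued_def)
  interpret v: discretely_valued v by (rule place_discretely_valued[OF v])
  have \<iota>: "\<iota> 1 = 1" "\<And>x y. \<iota> (x + y) = \<iota> x + \<iota> y" "\<And>x y. \<iota> (x * y) = \<iota> x * \<iota> y" "\<And>x. w (\<iota> x) = v x"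
    using w by (simp_all add: valued_completion_def)
  have \<iota>0: "\<iota> x = 0 \<longleftrightarrow> x = 0" for x
  proof
    assume "\<iota> x = 0"
    then show "x = 0" using \<iota>(3)[of x "inverse x"] \<iota>(1) by (cases "x = 0") auto
  next
    have "\<iota> 0 + \<iota> 0 = \<iota> 0 + 0" using \<iota>(2)[of 0 0] by simp
    then show "x = 0 \<Longrightarrow> \<iota> x = 0" by (simp only: add_left_cancel)
  qed
  interpret SL: group "SL_group :: ('k ^ 'n ^ 'n) monoid" by (rule SL_group_group)
  let ?SA = "SL_over (regular_outside F v) :: ('k ^ 'n ^ 'n) set"
  let ?act = "building_action \<iota> :: 'k ^ 'n ^ 'n \<Rightarrow> ('l, 'n) vertex \<Rightarrow> _"
  let ?G = "subgroup_of SL_group \<Gamma>"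
  have sub: "subgroup \<Gamma> SL_group" and fin: "finite (rcosets\<^bsub>?G\<^esub> (\<Gamma> \<inter> ?SA))"
    using \<Gamma> by (simp_all add: arithmetic_subgroup_def commensurable_def)
  have det: "det g = 1" if "g \<in> \<Gamma>" for g using subgroup.subset[OF sub] that by (auto simp: SL_group_def)
  have act_mult: "?act (g ** h) W = ?act g (?act h W)" for g h W
    by (simp add: building_action_def map_det_ring_hom(2)[OF \<iota>(1-3)] image_image matrix_vector_mul_assoc)
  have act_one: "?act (mat 1) W = W" for W
    by (simp add: building_action_def map_det_ring_hom(3)[OF \<iota>(1-3)])
  obtain M where M: "\<And>(g :: 'l ^ 'n ^ 'n) i j. det g = 1 \<Longrightarrow> w.move g V = V \<Longrightarrow> val_ge w M (g $ i $ j)"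
    using w.stabiliser_bounded[OF V] by metis
  have entries: "val_ge v M (g $ i $ j)" if "g \<in> \<Gamma>" "?act g V = V" for g :: "'k ^ 'n ^ 'n" and i j
  proof -
    have "val_ge w M (map_matrix \<iota> g $ i $ j)"
      using that det[of g] by (intro M) (simp_all add: map_det_ring_hom(1)[OF \<iota>(1-3)] \<iota>(1) w.building_action_eq_move)
    then show ?thesis by (simp add: map_matrix_def val_ge_def \<iota>0 \<iota>(4))
  qed
  \<comment> \<open>The bound on poles has to be given by a natural number;
    \<open>- int (nat (- M))\<close> is at most \<open>M\<close>, so all entries of the matrices in
    question are covered.\<close>
  define D where "D = {x \<in> regular_outside F v. val_ge v (- int (nat (- M))) x}"
  have finX: "finite D" unfolding D_def by (rule finite_bounded_regular[OF v])
  let ?St = "{g \<in> \<Gamma>. ?act g V = V}"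
  have finA: "finite (?St \<inter> ?SA)"
  proof (rule finite_subset)
    show "?St \<inter> ?SA \<subseteq> {g. \<forall>i. g $ i \<in> {r. \<forall>j. r $ j \<in> D}}"
      using entries v.val_ge_mono[of M _ "- int (nat (- M))"] by (auto simp: D_def SL_over_def)
    have "finite {r :: 'k ^ 'n. \<forall>j. r $ j \<in> D}" by (rule finite_vectors[OF finX])
    then show "finite {g :: 'k ^ 'n ^ 'n. \<forall>i. g $ i \<in> {r. \<forall>j. r $ j \<in> D}}" by (rule finite_vectors)
  qed
  \<comment> \<open>The stabiliser need not lie in SL(A). Two of its elements in one coset of
    \<open>\<Gamma> \<inter> ?SA\<close> differ by an element of this intersection that fixes the
    vertex too, so every fibre of \<open>?coset\<close> on the stabiliser is finite, and there are
    finitely many cosets.\<close>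
  let ?coset = "\<lambda>g. (\<Gamma> \<inter> ?SA) #>\<^bsub>?G\<^esub> g"
  have "finite {g \<in> ?St. ?coset g = c}" for c
  proof (cases "\<exists>g0\<in>?St. ?coset g0 = c")
    case True
    then obtain g0 where g0: "g0 \<in> \<Gamma>" "?act g0 V = V" "?coset g0 = c" by blast
    have "{g \<in> ?St. ?coset g = c} \<subseteq> (\<lambda>h. h ** g0) ` (?St \<inter> ?SA)"
    proof
      fix g assume "g \<in> {g \<in> ?St. ?coset g = c}"
      then have g: "g \<in> \<Gamma>" "?act g V = V" "?coset g = ?coset g0" using g0 by auto
      have "mat 1 \<in> \<Gamma> \<inter> ?SA"
      proof -
        have one: "mat 1 \<in> \<Gamma>" using subgroup.one_closed[OF sub] by (simp add: SL_group_def)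
        have val1: "u 1 = 0" if "place F u" for u
          using discretely_valued.val_one[OF place_discretely_valued[OF that]] .
        have "(0 :: 'k) \<in> regular_outside F v" "(1 :: 'k) \<in> regular_outside F v"
          by (simp_all add: regular_outside_def valuation_ring_def val_ge_def val1)
        then have "(mat 1 :: 'k ^ 'n ^ 'n) $ i $ j \<in> regular_outside F v" for i j by (simp add: mat_def)
        then show ?thesis using one by (simp add: SL_over_def)
      qed
      then have "g \<in> ?coset g" by (auto simp: r_coset_def SL_group_def intro!: bexI[of _ "mat 1"])
      then obtain h where h: "h \<in> \<Gamma>" "h \<in> ?SA" "g = h ** g0"
        unfolding g(3) by (auto simp: r_coset_def SL_group_def)
      have "?act h V = ?act h (?act g0 V)" by (simp add: g0)
      also have "\<dots> = V" using g(2) by (simp add: h(3) act_mult)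
      finally show "g \<in> (\<lambda>h. h ** g0) ` (?St \<inter> ?SA)" using h by blast
    qed
    then show ?thesis using finA by (meson finite_imageI finite_subset)
  next
    case False
    then have "{g \<in> ?St. ?coset g = c} = {}" by blast
    then show ?thesis by (simp only: finite.emptyI)
  qed
  moreover have "?coset ` ?St \<subseteq> rcosets\<^bsub>?G\<^esub> (\<Gamma> \<inter> ?SA)" by (auto simp: RCOSETS_def)
  then have "finite (?coset ` ?St)" using fin by (rule finite_subset)
  ultimately have "finite (\<Union>c\<in>?coset ` ?St. {g \<in> ?St. ?coset g = c})" by (intro finite_UN_I)
  moreover have "?St \<subseteq> (\<Union>c\<in>?coset ` ?St. {g \<in> ?St. ?coset g = c})" by blast
  ultimately show ?thesis by (rule finite_subset[rotated])
qed

section \<open>Modules in which \<open>p\<close> is invertible\<close>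

text \<open>The ring Z[1/p] as a subset of the rationals.\<close>

definition p_fractions :: "nat \<Rightarrow> rat set" where
  "p_fractions p = {s. \<exists>k m. s * of_nat p ^ k = of_int m}"

lemma coeff_ring_p_fractions: "coeff_ring (p_fractions p)"
proof
  show "1 \<in> p_fractions p" unfolding p_fractions_def by (intro CollectI exI[of _ 0] exI[of _ 1]) simp
  fix a b assume "a \<in> p_fractions p" "b \<in> p_fractions p"
  then obtain k m l n where *: "a * of_nat p ^ k = of_int m" "b * of_nat p ^ l = of_int n"
    by (auto simp: p_fractions_def)
  have "(a - b) * of_nat p ^ (k + l) = (a * of_nat p ^ k) * of_nat p ^ l - (b * of_nat p ^ l) * of_nat p ^ k"
    by (simp add: power_add algebra_simps)
  also have "\<dots> = of_int (m * int p ^ l - n * int p ^ k)" unfolding * by simp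
  finally show "a - b \<in> p_fractions p" unfolding p_fractions_def by blast
  have "a * b * of_nat p ^ (k + l) = (a * of_nat p ^ k) * (b * of_nat p ^ l)"
    by (simp add: power_add algebra_simps)
  also have "\<dots> = of_int (m * n)" unfolding * by simp
  finally show "a * b \<in> p_fractions p" unfolding p_fractions_def by blast
qed

lemma of_int_p_fractions: "of_int m \<in> p_fractions p"
  unfolding p_fractions_def by (intro CollectI exI[of _ 0] exI[of _ m]) simp

lemma inverse_power_p_fractions: "p > 0 \<Longrightarrow> inverse (of_nat p ^ k) \<in> p_fractions p"
  unfolding p_fractions_def by (intro CollectI exI[of _ k] exI[of _ 1]) simp

text \<open>Such a group is a module over Z[1/p], written multiplicatively; the action of scalars is
  \<open>frac_pow\<close>.\<close>

locale p_divisible_group = comm_group R for R (structure) +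
  fixes p :: nat
  assumes p_pos: "p > 0" and p_inv: "p_invertible p R"
begin

sublocale coeff_ring "p_fractions p" by (rule coeff_ring_p_fractions)

lemma pow_p_inj: "x \<in> carrier R \<Longrightarrow> y \<in> carrier R \<Longrightarrow> x [^] (p ^ k) = y [^] (p ^ k) \<Longrightarrow> x = y"
proof (induction k)
  case (Suc k)
  obtain \<psi> where \<psi>: "\<And>x. x \<in> carrier R \<Longrightarrow> \<psi> (x [^] p) = x"
    using p_inv by (auto simp: p_invertible_def)
  have "(x [^] (p ^ k)) [^] p = (y [^] (p ^ k)) [^] p" using Suc by (simp add: nat_pow_pow mult.commute)
  then have "x [^] (p ^ k) = y [^] (p ^ k)" using \<psi> Suc.prems by (metis nat_pow_closed)
  then show ?case using Suc by simp
qed simp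

lemma pow_p_surj: "x \<in> carrier R \<Longrightarrow> \<exists>y\<in>carrier R. y [^] (p ^ k) = x"
proof (induction k arbitrary: x)
  case 0
  then show ?case by (intro bexI[of _ x]) simp_all
next
  case (Suc k)
  obtain \<psi> where \<psi>: "\<psi> \<in> hom R R" "\<And>x. x \<in> carrier R \<Longrightarrow> \<psi> x [^] p = x"
    using p_inv by (auto simp: p_invertible_def)
  obtain y where y: "y \<in> carrier R" "y [^] (p ^ k) = \<psi> x"
    using Suc.IH[of "\<psi> x"] Suc.prems \<psi>(1) by (auto simp: hom_def)
  then have "y [^] (p ^ Suc k) = x" using \<psi>(2)[OF Suc.prems] nat_pow_pow[OF y(1), of "p ^ k" p] by (simp add: mult.commute)
  then show ?case using y by blast
qed

text \<open>For \<open>s = m / p ^ k\<close> this is the unique \<open>p ^ k\<close>-th root of the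
  \<open>m\<close>-th power. Independence of \<open>k\<close> and \<open>m\<close> is contained in
  \<open>frac_pow_eqI\<close>.\<close>

definition frac_pow :: "'a \<Rightarrow> rat \<Rightarrow> 'a" where
  "frac_pow r s = (SOME y. y \<in> carrier R \<and>
     (\<exists>k m. s * of_nat p ^ k = of_int m \<and> y [^] (p ^ k) = r [^] (m :: int)))"

lemma frac_pow_props:
  assumes "r \<in> carrier R" "s \<in> p_fractions p"
  shows "frac_pow r s \<in> carrier R"
    and "\<exists>k m. s * of_nat p ^ k = of_int m \<and> frac_pow r s [^] (p ^ k) = r [^] (m :: int)"
proof -
  obtain k m where km: "s * of_nat p ^ k = of_int m" using assms(2) by (auto simp: p_fractions_def)
  obtain y where "y \<in> carrier R" "y [^] (p ^ k) = r [^] (m :: int)" using pow_p_surj[of "r [^] m" k] assms by auto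
  then have "\<exists>y. y \<in> carrier R \<and> (\<exists>k m. s * of_nat p ^ k = of_int m \<and> y [^] (p ^ k) = r [^] (m :: int))"
    using km by blast
  from someI_ex[OF this] show "frac_pow r s \<in> carrier R"
    "\<exists>k m. s * of_nat p ^ k = of_int m \<and> frac_pow r s [^] (p ^ k) = r [^] (m :: int)"
    unfolding frac_pow_def by blast+
qed

lemma pow_cross: "y \<in> carrier R \<Longrightarrow> r \<in> carrier R \<Longrightarrow> y [^] (p ^ k) = r [^] (m :: int) \<Longrightarrow>
    y [^] (p ^ (k + l)) = r [^] (m * int p ^ l)"
proof -
  assume *: "y \<in> carrier R" "r \<in> carrier R" "y [^] (p ^ k) = r [^] (m :: int)"
  have "y [^] (p ^ (k + l)) = (r [^] m) [^] (p ^ l)" using * by (simp add: power_add nat_pow_pow[symmetric])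
  also have "\<dots> = (r [^] m) [^] int (p ^ l)" by (simp only: int_pow_int)
  finally show ?thesis using * by (simp add: int_pow_pow)
qed

text \<open>Two representations of \<open>s\<close> are compared after raising to the common power
  \<open>p ^ (k + l)\<close>, which is injective on the group.\<close>

lemma frac_pow_eqI:
  assumes "r \<in> carrier R" "y \<in> carrier R" "s * of_nat p ^ k = of_int m" "y [^] (p ^ k) = r [^] (m :: int)"
  shows "frac_pow r s = y"
proof -
  have s: "s \<in> p_fractions p" using assms(3) by (auto simp: p_fractions_def)
  obtain l n where ln: "s * of_nat p ^ l = of_int n" "frac_pow r s [^] (p ^ l) = r [^] (n :: int)"
    using frac_pow_props[OF assms(1) s] by blast
  have "of_int (n * int p ^ k) = (of_int (m * int p ^ l) :: rat)"
    using ln(1)[symmetric] assms(3)[symmetric] by (simp add: ac_simps)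
  then have eq: "n * int p ^ k = m * int p ^ l" by (simp only: of_int_eq_iff)
  have "frac_pow r s [^] (p ^ (l + k)) = y [^] (p ^ (k + l))"
    using pow_cross[OF frac_pow_props(1)[OF assms(1) s] assms(1) ln(2), of k]
      pow_cross[OF assms(2,1,4), of l] eq by simp
  then show ?thesis
    using pow_p_inj[of "frac_pow r s" y "l + k"] frac_pow_props(1)[OF assms(1) s] assms by (simp add: add.commute)
qed

lemma frac_pow_closed [simp]: "r \<in> carrier R \<Longrightarrow> s \<in> p_fractions p \<Longrightarrow> frac_pow r s \<in> carrier R"
  by (rule frac_pow_props)

lemma frac_pow_of_int: "r \<in> carrier R \<Longrightarrow> frac_pow r (of_int m) = r [^] m"
  by (rule frac_pow_eqI[of _ _ _ 0 m]) auto

lemma frac_pow_0 [simp]: "r \<in> carrier R \<Longrightarrow> frac_pow r 0 = \<one>"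
  using frac_pow_of_int[of r 0] by simp

lemma frac_pow_1 [simp]: "r \<in> carrier R \<Longrightarrow> frac_pow r 1 = r"
  using frac_pow_of_int[of r 1] by simp

lemma frac_pow_add:
  assumes r: "r \<in> carrier R" and s: "s \<in> p_fractions p" "t \<in> p_fractions p"
  shows "frac_pow r (s + t) = frac_pow r s \<otimes> frac_pow r t"
proof -
  obtain k m where km: "s * of_nat p ^ k = of_int m" "frac_pow r s [^] (p ^ k) = r [^] (m :: int)"
    using frac_pow_props[OF r s(1)] by blast
  obtain l n where ln: "t * of_nat p ^ l = of_int n" "frac_pow r t [^] (p ^ l) = r [^] (n :: int)"
    using frac_pow_props[OF r s(2)] by blast
  show ?thesis
  proof (rule frac_pow_eqI[of _ _ _ "k + l" "m * int p ^ l + n * int p ^ k"])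
    have "(s + t) * of_nat p ^ (k + l) = (s * of_nat p ^ k) * of_nat p ^ l + (t * of_nat p ^ l) * of_nat p ^ k"
      by (simp add: power_add algebra_simps)
    then show "(s + t) * of_nat p ^ (k + l) = of_int (m * int p ^ l + n * int p ^ k)" unfolding km ln by simp
    show "(frac_pow r s \<otimes> frac_pow r t) [^] (p ^ (k + l)) = r [^] (m * int p ^ l + n * int p ^ k)"
      using pow_cross[OF _ r km(2), of l] pow_cross[OF _ r ln(2), of k] r s
      by (simp add: nat_pow_distrib int_pow_mult add.commute[of l k])
  qed (use r s in auto)
qed

lemma frac_pow_mult:
  assumes r: "r \<in> carrier R" and s: "s \<in> p_fractions p" "t \<in> p_fractions p"
  shows "frac_pow (frac_pow r s) t = frac_pow r (s * t)"
proof -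
  obtain k m where km: "s * of_nat p ^ k = of_int m" "frac_pow r s [^] (p ^ k) = r [^] (m :: int)"
    using frac_pow_props[OF r s(1)] by blast
  let ?y = "frac_pow (frac_pow r s) t"
  obtain l n where ln: "t * of_nat p ^ l = of_int n" "?y [^] (p ^ l) = frac_pow r s [^] (n :: int)"
    using frac_pow_props[of "frac_pow r s" t] r s by auto
  show ?thesis
  proof (rule frac_pow_eqI[of _ _ _ "l + k" "m * n", symmetric])
    have "s * t * of_nat p ^ (l + k) = (s * of_nat p ^ k) * (t * of_nat p ^ l)"
      by (simp add: power_add algebra_simps)
    then show "s * t * of_nat p ^ (l + k) = of_int (m * n)" unfolding km ln by simp
    have "?y [^] (p ^ (l + k)) = frac_pow r s [^] (n * int p ^ k)"
      using pow_cross[of ?y "frac_pow r s" l n k] ln r s by simp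
    also have "\<dots> = (frac_pow r s [^] (p ^ k)) [^] n"
      using r s by (simp add: int_pow_pow mult.commute flip: int_pow_int)
    also have "\<dots> = r [^] (m * n)" using r by (simp add: km int_pow_pow)
    finally show "?y [^] (p ^ (l + k)) = r [^] (m * n)" .
  qed (use r s in auto)
qed

lemma frac_pow_distrib:
  assumes r: "r \<in> carrier R" "r' \<in> carrier R" and s: "s \<in> p_fractions p"
  shows "frac_pow (r \<otimes> r') s = frac_pow r s \<otimes> frac_pow r' s"
proof -
  obtain k m where km: "s * of_nat p ^ k = of_int m" "frac_pow r s [^] (p ^ k) = r [^] (m :: int)"
    using frac_pow_props[OF r(1) s] by blast
  obtain l n where ln: "s * of_nat p ^ l = of_int n" "frac_pow r' s [^] (p ^ l) = r' [^] (n :: int)"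
    using frac_pow_props[OF r(2) s] by blast
  have "of_int (n * int p ^ k) = (of_int (m * int p ^ l) :: rat)"
    using ln(1)[symmetric] km(1)[symmetric] by (simp add: ac_simps)
  then have eq: "n * int p ^ k = m * int p ^ l" by (simp only: of_int_eq_iff)
  show ?thesis
  proof (rule frac_pow_eqI[of _ _ _ "k + l" "m * int p ^ l"])
    show "s * of_nat p ^ (k + l) = of_int (m * int p ^ l)"
      using km(1) by (simp add: power_add flip: mult.assoc)
    show "(frac_pow r s \<otimes> frac_pow r' s) [^] (p ^ (k + l)) = (r \<otimes> r') [^] (m * int p ^ l)"
      using pow_cross[OF _ r(1) km(2), of l] pow_cross[OF _ r(2) ln(2), of k] r s eq
      by (simp add: nat_pow_distrib int_pow_distrib add.commute[of l k])
  qed (use r s in auto)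
qed

lemma frac_pow_one [simp]: "s \<in> p_fractions p \<Longrightarrow> frac_pow \<one> s = \<one>"
proof -
  assume "s \<in> p_fractions p"
  then obtain k m where "s * of_nat p ^ k = of_int m" by (auto simp: p_fractions_def)
  then show ?thesis by (intro frac_pow_eqI[of _ _ _ k m]) auto
qed

text \<open>Evaluation of a cochain on a chain: the extension of \<open>f\<close> that is linear
  over Z[1/p].\<close>

definition pair :: "('v \<Rightarrow> 'a) \<Rightarrow> ('v \<Rightarrow>\<^sub>0 rat) \<Rightarrow> 'a" where
  "pair f x = (\<Otimes>b\<in>Poly_Mapping.keys x. frac_pow (f b) (Poly_Mapping.lookup x b))"

lemma pair_superset:
  assumes "finite A" "Poly_Mapping.keys x \<subseteq> A" "x \<in> chains (p_fractions p) B" "f \<in> A \<rightarrow> carrier R"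
  shows "pair f x = (\<Otimes>b\<in>A. frac_pow (f b) (Poly_Mapping.lookup x b))"
  unfolding pair_def
  by (rule finprod_mono_neutral_cong_left)
    (use assms in \<open>auto simp: chains_def in_keys_iff Pi_iff intro!: frac_pow_closed\<close>)

lemma pair_closed [simp]: "x \<in> chains (p_fractions p) B \<Longrightarrow> f \<in> B \<rightarrow> carrier R \<Longrightarrow> pair f x \<in> carrier R"
  unfolding pair_def by (rule finprod_closed) (auto simp: chains_def Pi_iff intro!: frac_pow_closed)

lemma pair_zero [simp]: "pair f 0 = \<one>"
  by (simp add: pair_def)

lemma pair_single: "f b \<in> carrier R \<Longrightarrow> s \<in> p_fractions p \<Longrightarrow> pair f (Poly_Mapping.single b s) = frac_pow (f b) s"
  by (cases "s = 0") (simp_all add: pair_def)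

lemma pair_add:
  assumes x: "x \<in> chains (p_fractions p) B" and y: "y \<in> chains (p_fractions p) B" and f: "f \<in> B \<rightarrow> carrier R"
  shows "pair f (x + y) = pair f x \<otimes> pair f y"
proof -
  let ?A = "Poly_Mapping.keys x \<union> Poly_Mapping.keys y"
  have A: "finite ?A" "f \<in> ?A \<rightarrow> carrier R" "Poly_Mapping.keys (x + y) \<subseteq> ?A"
    using x y f keys_add[of x y] by (auto simp: chains_def)
  have cl: "frac_pow (f b) (Poly_Mapping.lookup z b) \<in> carrier R" if "b \<in> ?A" "z \<in> chains (p_fractions p) B" for b z
    using that A(2) by (auto simp: chains_def Pi_iff intro!: frac_pow_closed)
  have "pair f (x + y) = (\<Otimes>b\<in>?A. frac_pow (f b) (Poly_Mapping.lookup x b) \<otimes> frac_pow (f b) (Poly_Mapping.lookup y b))"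
    unfolding pair_superset[OF A(1,3) add_chains[OF x y] A(2)]
  proof (rule finprod_cong')
    show "?A = ?A" ..
    show "(\<lambda>b. frac_pow (f b) (Poly_Mapping.lookup x b) \<otimes> frac_pow (f b) (Poly_Mapping.lookup y b)) \<in> ?A \<rightarrow> carrier R"
      using cl x y by (auto intro!: m_closed)
    fix b assume "b \<in> ?A"
    then have "f b \<in> carrier R" using A(2) by auto
    then show "frac_pow (f b) (Poly_Mapping.lookup (x + y) b) =
        frac_pow (f b) (Poly_Mapping.lookup x b) \<otimes> frac_pow (f b) (Poly_Mapping.lookup y b)"
      using x y by (simp add: lookup_add chains_def frac_pow_add)
  qed
  also have "\<dots> = pair f x \<otimes> pair f y"
    using cl x y A by (subst finprod_multf) (auto simp: pair_superset[OF A(1) _ x A(2)] pair_superset[OF A(1) _ y A(2)])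
  finally show ?thesis .
qed

lemma pair_uminus:
  assumes "x \<in> chains (p_fractions p) B" "f \<in> B \<rightarrow> carrier R"
  shows "pair f (- x) = inv (pair f x)"
proof -
  have "pair f (- x) \<otimes> pair f x = \<one>"
    using pair_add[OF uminus_chains[OF assms(1)] assms] by simp
  then show ?thesis using assms inv_equality[of "pair f (- x)" "pair f x"] uminus_chains[OF assms(1)] by simp
qed

lemma pair_diff:
  assumes "x \<in> chains (p_fractions p) B" "y \<in> chains (p_fractions p) B" "f \<in> B \<rightarrow> carrier R"
  shows "pair f (x - y) = pair f x \<otimes> inv (pair f y)"
  using pair_add[OF assms(1) uminus_chains[OF assms(2)] assms(3)] pair_uminus[OF assms(2,3)] by simp

lemma chains_induct [consumes 1, case_names zero add]:
  assumes "x \<in> chains (p_fractions p) B"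
    and "P 0"
    and "\<And>b s y. b \<in> B \<Longrightarrow> s \<in> p_fractions p \<Longrightarrow> y \<in> chains (p_fractions p) B \<Longrightarrow> P y \<Longrightarrow> P (Poly_Mapping.single b s + y)"
  shows "P x"
  using assms(1)
proof (induction "card (Poly_Mapping.keys x)" arbitrary: x)
  case 0
  then show ?case using assms(2) by simp
next
  case (Suc n)
  then obtain b where b: "b \<in> Poly_Mapping.keys x" by (metis card.empty ex_in_conv nat.simps(3))
  let ?s = "Poly_Mapping.lookup x b"
  let ?y = "x - Poly_Mapping.single b ?s"
  have bB: "b \<in> B" "?s \<in> p_fractions p" using b Suc.prems by (auto simp: chains_def)
  have keys: "Poly_Mapping.keys ?y = Poly_Mapping.keys x - {b}"
    by (auto simp: in_keys_iff lookup_minus lookup_single when_def split: if_splits)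
  have y: "?y \<in> chains (p_fractions p) B"
    using Suc.prems bB by (intro diff_chains) (auto simp: chains_def lookup_single when_def zero_S)
  have "P ?y" using Suc.hyps(2) b y by (intro Suc.hyps(1)) (simp_all add: keys)
  then have "P (Poly_Mapping.single b ?s + ?y)" using bB y by (intro assms(3))
  then show ?case by simp
qed

lemma pair_scale:
  assumes s: "s \<in> p_fractions p" and x: "x \<in> chains (p_fractions p) B" and f: "f \<in> B \<rightarrow> carrier R"
  shows "pair f (cscale s x) = frac_pow (pair f x) s"
  using x
proof (induction rule: chains_induct)
  case (add b t y)
  have fb: "f b \<in> carrier R" using f add by auto
  have single: "Poly_Mapping.single b t \<in> chains (p_fractions p) B" if "t \<in> p_fractions p" for t
    using that add by (auto simp: chains_def lookup_single when_def zero_S)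
  have "pair f (cscale s (Poly_Mapping.single b t + y)) = frac_pow (f b) (s * t) \<otimes> frac_pow (pair f y) s"
    using add f fb s by (simp add: scale_add pair_add[OF single scale_chains[OF s add(3)] f] mult_S pair_single)
  also have "\<dots> = frac_pow (pair f (Poly_Mapping.single b t + y)) s"
    using add f fb s
    by (simp add: pair_add[OF single add(3) f] pair_single frac_pow_distrib frac_pow_mult mult.commute)
  finally show ?case .
qed (use s in simp)

text \<open>The adjunction between chain maps and pullback of functions, through which identities
  for chains become identities for cochains.\<close>

lemma pair_lext:
  assumes x: "x \<in> chains (p_fractions p) A" and T: "\<And>a. a \<in> A \<Longrightarrow> T a \<in> chains (p_fractions p) B"
    and f: "f \<in> B \<rightarrow> carrier R"
  shows "pair f (lext T x) = pair (\<lambda>a. pair f (T a)) x"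
  using x
proof (induction rule: chains_induct)
  case (add b t y)
  have g: "(\<lambda>a. pair f (T a)) \<in> A \<rightarrow> carrier R" using pair_closed[OF T f] by auto
  have single: "Poly_Mapping.single b t \<in> chains (p_fractions p) A"
    using add by (auto simp: chains_def lookup_single when_def zero_S)
  have "pair f (lext T (Poly_Mapping.single b t + y)) = frac_pow (pair f (T b)) t \<otimes> pair (\<lambda>a. pair f (T a)) y"
    using add f by (simp add: lext_add pair_add[OF scale_chains[OF add(2) T[OF add(1)]] lext_chains[OF add(3) T] f]
        pair_scale[OF add(2) T f])
  also have "\<dots> = pair (\<lambda>a. pair f (T a)) (Poly_Mapping.single b t + y)"
    using add pair_closed[OF T[OF add(1)] f] by (simp add: pair_add[OF single add(3) g] pair_single)
  finally show ?case .
qed simp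

lemma pair_cong:
  assumes "x \<in> chains (p_fractions p) B" "\<And>b. b \<in> B \<Longrightarrow> f b = g b" "g \<in> B \<rightarrow> carrier R"
  shows "pair f x = pair g x"
  unfolding pair_def
  by (rule finprod_cong) (use assms in \<open>auto simp: chains_def Pi_iff simp_implies_def intro!: frac_pow_closed\<close>)

lemma pair_mult:
  assumes x: "x \<in> chains (p_fractions p) B" and f: "f \<in> B \<rightarrow> carrier R" and g: "g \<in> B \<rightarrow> carrier R"
  shows "pair (\<lambda>b. f b \<otimes> g b) x = pair f x \<otimes> pair g x"
  using x
proof (induction rule: chains_induct)
  case (add b t y)
  have fg: "(\<lambda>b. f b \<otimes> g b) \<in> B \<rightarrow> carrier R" using f g by auto
  have cl: "f b \<in> carrier R" "g b \<in> carrier R" "pair f y \<in> carrier R" "pair g y \<in> carrier R"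
    using add f g by auto
  have single: "Poly_Mapping.single b t \<in> chains (p_fractions p) B"
    using add by (auto simp: chains_def lookup_single when_def zero_S)
  show ?case
    using add cl
    by (simp add: pair_add[OF single add(3) fg] pair_add[OF single add(3) f] pair_add[OF single add(3) g]
        pair_single frac_pow_distrib m_ac)
qed simp

lemma pair_unit [simp]: "f b \<in> carrier R \<Longrightarrow> pair f (unit_chain b) = f b"
  by (simp add: pair_single one_S)

lemma pair_one: "x \<in> chains (p_fractions p) B \<Longrightarrow> pair (\<lambda>b. \<one>) x = \<one>"
  unfolding pair_def by (intro finprod_one_eqI) (auto simp: chains_def)

end

text \<open>Roots of \<open>p\<close>-power order are unique in the target, so a homomorphism of
  groups is automatically linear over Z[1/p]. Naturality in the coefficients comes from
  here.\<close>

lemma p_divisible_hom: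
  assumes "p_divisible_group R p" "p_divisible_group S p" "h \<in> hom R S"
    and x: "x \<in> chains (p_fractions p) B" and f: "f \<in> B \<rightarrow> carrier R"
  shows "h (p_divisible_group.pair R p f x) = p_divisible_group.pair S p (\<lambda>b. h (f b)) x"
proof -
  interpret R: p_divisible_group R p by (rule assms(1))
  interpret S: p_divisible_group S p by (rule assms(2))
  interpret h: group_hom R S h using assms(3) by unfold_locales
  have frac: "h (R.frac_pow r s) = S.frac_pow (h r) s" if r: "r \<in> carrier R" and s: "s \<in> p_fractions p" for r s
  proof -
    obtain k m where km: "s * of_nat p ^ k = of_int m" "R.frac_pow r s [^]\<^bsub>R\<^esub> (p ^ k) = r [^]\<^bsub>R\<^esub> (m :: int)"
      using R.frac_pow_props[OF r s] by blast
    have "h (R.frac_pow r s) [^]\<^bsub>S\<^esub> (p ^ k) = h (R.frac_pow r s [^]\<^bsub>R\<^esub> (p ^ k))"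
      using r s by (simp add: h.hom_nat_pow)
    also have "\<dots> = h r [^]\<^bsub>S\<^esub> m" unfolding km(2) using r by (simp add: h.hom_int_pow)
    finally show ?thesis using km r s by (intro S.frac_pow_eqI[symmetric, of _ _ _ k m]) auto
  qed
  have hf: "(\<lambda>b. h (f b)) \<in> B \<rightarrow> carrier S" using f by (auto intro!: h.hom_closed)
  show ?thesis
    using x
  proof (induction rule: R.chains_induct)
    case (add b t y)
    have single: "Poly_Mapping.single b t \<in> chains (p_fractions p) B"
      using add by (auto simp: chains_def lookup_single when_def R.zero_S)
    have "f b \<in> carrier R" "R.pair f y \<in> carrier R" using f add by auto
    then show ?case
      using add hf f by (simp add: R.pair_add[OF single add(3) f] S.pair_add[OF single add(3) hf]
          R.pair_single S.pair_single frac)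
  qed simp
qed

section \<open>Maps of cochain complexes\<close>

definition cochain_complex :: "(nat \<Rightarrow> 'c monoid) \<Rightarrow> (nat \<Rightarrow> 'c \<Rightarrow> 'c) \<Rightarrow> bool" where
  "cochain_complex C d \<longleftrightarrow> (\<forall>q. comm_group (C q) \<and> d q \<in> hom (C q) (C (Suc q)) \<and>
     (\<forall>x\<in>carrier (C q). d (Suc q) (d q x) = \<one>\<^bsub>C (Suc (Suc q))\<^esub>))"

definition cochain_map ::
  "(nat \<Rightarrow> 'b monoid) \<Rightarrow> (nat \<Rightarrow> 'b \<Rightarrow> 'b) \<Rightarrow> (nat \<Rightarrow> 'c monoid) \<Rightarrow> (nat \<Rightarrow> 'c \<Rightarrow> 'c) \<Rightarrow> (nat \<Rightarrow> 'b \<Rightarrow> 'c) \<Rightarrow> bool" where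
  "cochain_map C d C' d' \<phi> \<longleftrightarrow>
     (\<forall>q. \<phi> q \<in> hom (C q) (C' q) \<and> (\<forall>x\<in>carrier (C q). \<phi> (Suc q) (d q x) = d' q (\<phi> q x)))"

lemma (in comm_group) coset_eq_iff:
  assumes N: "subgroup N G" and xy: "x \<in> carrier G" "y \<in> carrier G"
  shows "N #> x = N #> y \<longleftrightarrow> x \<otimes> inv y \<in> N"
proof
  assume "N #> x = N #> y"
  then have "x \<in> N #> y" using rcos_self[OF xy(1) N] by simp
  then obtain n where n: "n \<in> N" "x = n \<otimes> y" by (auto simp: r_coset_def)
  then have "x \<otimes> inv y = n" using subgroup.mem_carrier[OF N n(1)] xy by (simp add: m_assoc)
  then show "x \<otimes> inv y \<in> N" using n by simp
next
  assume n: "x \<otimes> inv y \<in> N"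
  have "x = (x \<otimes> inv y) \<otimes> y" using xy by (simp add: m_assoc)
  then have "x \<in> N #> y" using n by (auto simp: r_coset_def)
  then show "N #> x = N #> y" using repr_independence[OF _ xy(2) N] by simp
qed

lemma (in comm_group) coset_mult:
  "subgroup N G \<Longrightarrow> x \<in> carrier G \<Longrightarrow> y \<in> carrier G \<Longrightarrow> (N #> x) <#> (N #> y) = N #> (x \<otimes> y)"
  using normal.rcos_sum[OF subgroup_imp_normal] by blast

locale complex =
  fixes C :: "nat \<Rightarrow> 'c monoid" and d :: "nat \<Rightarrow> 'c \<Rightarrow> 'c"
  assumes cochain_complex: "cochain_complex C d"
begin

lemma group_C: "comm_group (C q)"
  and d_hom: "d q \<in> hom (C q) (C (Suc q))"
  and d_d: "x \<in> carrier (C q) \<Longrightarrow> d (Suc q) (d q x) = \<one>\<^bsub>C (Suc (Suc q))\<^esub>"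
  using cochain_complex by (auto simp: cochain_complex_def)

sublocale C: comm_group "C q" for q by (rule group_C)

lemma d_group_hom: "group_hom (C q) (C (Suc q)) (d q)"
  by (intro group_hom.intro group_hom_axioms.intro C.is_group d_hom)

definition cocycles :: "nat \<Rightarrow> 'c set" where
  "cocycles q = {x \<in> carrier (C q). d q x = \<one>\<^bsub>C (Suc q)\<^esub>}"

abbreviation B where "B q \<equiv> coboundaries C d q"

lemma cocycles_subgroup: "subgroup (cocycles q) (C q)"
  using group_hom.subgroup_kernel[OF d_group_hom[of q]] by (simp add: cocycles_def kernel_def)

lemma coboundaries_subgroup: "subgroup (B q) (C q)"
proof (cases q)
  case 0
  then show ?thesis by (simp add: coboundaries_def C.triv_subgroup)
next
  case (Suc m)
  then show ?thesis using group_hom.img_is_subgroup[OF d_group_hom[of m]] by (simp add: coboundaries_def)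
qed

lemma coboundaries_cocycles: "B q \<subseteq> cocycles q"
proof
  fix x assume x: "x \<in> B q"
  show "x \<in> cocycles q"
  proof (cases q)
    case 0
    then show ?thesis using x group_hom.hom_one[OF d_group_hom[of 0]] by (simp add: coboundaries_def cocycles_def)
  next
    case (Suc m)
    then obtain y where "y \<in> carrier (C m)" "x = d m y" using x by (auto simp: coboundaries_def)
    then show ?thesis using d_d[of y m] d_hom[of m] Suc by (auto simp: cocycles_def hom_def)
  qed
qed

lemma carrier_cohomology: "carrier (cohomology C d q) = (\<lambda>x. B q #>\<^bsub>C q\<^esub> x) ` cocycles q"
  by (auto simp: cohomology_def FactGroup_def RCOSETS_def r_coset_def kernel_def cocycles_def)

lemma mult_cohomology:
  "x \<in> cocycles q \<Longrightarrow> y \<in> cocycles q \<Longrightarrow>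
    (B q #>\<^bsub>C q\<^esub> x) \<otimes>\<^bsub>cohomology C d q\<^esub> (B q #>\<^bsub>C q\<^esub> y) = B q #>\<^bsub>C q\<^esub> (x \<otimes>\<^bsub>C q\<^esub> y)"
  using C.coset_mult[OF coboundaries_subgroup, of x q y]
  by (simp add: cohomology_def FactGroup_def set_mult_def cocycles_def)

lemma class_eq_iff:
  "x \<in> cocycles q \<Longrightarrow> y \<in> cocycles q \<Longrightarrow>
    B q #>\<^bsub>C q\<^esub> x = B q #>\<^bsub>C q\<^esub> y \<longleftrightarrow> x \<otimes>\<^bsub>C q\<^esub> inv\<^bsub>C q\<^esub> y \<in> B q"
  by (rule C.coset_eq_iff[OF coboundaries_subgroup]) (auto simp: cocycles_def)

end

locale complex_map = source: complex C d + target: complex C' d'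
  for C :: "nat \<Rightarrow> 'b monoid" and d and C' :: "nat \<Rightarrow> 'c monoid" and d' +
  fixes \<phi> :: "nat \<Rightarrow> 'b \<Rightarrow> 'c"
  assumes cochain_map: "cochain_map C d C' d' \<phi>"
begin

lemma map_hom: "\<phi> q \<in> hom (C q) (C' q)"
  and map_d: "x \<in> carrier (C q) \<Longrightarrow> \<phi> (Suc q) (d q x) = d' q (\<phi> q x)"
  using cochain_map by (auto simp: cochain_map_def)

sublocale map: group_hom "C q" "C' q" "\<phi> q" for q
  by (intro group_hom.intro group_hom_axioms.intro source.C.is_group target.C.is_group map_hom)

lemma map_coboundaries: "x \<in> source.B q \<Longrightarrow> \<phi> q x \<in> target.B q"
proof (cases q)
  case 0
  then show "x \<in> source.B q \<Longrightarrow> ?thesis" using map.hom_one[of 0] by (simp add: coboundaries_def)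
next
  case (Suc m)
  assume "x \<in> source.B q"
  then obtain y where "y \<in> carrier (C m)" "x = d m y" using Suc by (auto simp: coboundaries_def)
  then show ?thesis using map_d[of y m] Suc by (auto simp: coboundaries_def)
qed

lemma map_cocycles: "x \<in> source.cocycles q \<Longrightarrow> \<phi> q x \<in> target.cocycles q"
  using map_d[of x q] map.hom_one[of "Suc q"] by (auto simp: source.cocycles_def target.cocycles_def)

lemma map_class:
  assumes x: "x \<in> source.cocycles q"
  shows "cohomology_map C' d' q (\<phi> q) (source.B q #>\<^bsub>C q\<^esub> x) = target.B q #>\<^bsub>C' q\<^esub> \<phi> q x"
proof -
  have xc: "x \<in> carrier (C q)" using x by (simp add: source.cocycles_def)
  have "target.B q #>\<^bsub>C' q\<^esub> \<phi> q y = target.B q #>\<^bsub>C' q\<^esub> \<phi> q x" if y: "y \<in> source.B q #>\<^bsub>C q\<^esub> x" for y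
  proof -
    obtain b where b: "b \<in> source.B q" "y = b \<otimes>\<^bsub>C q\<^esub> x" using y by (auto simp: r_coset_def)
    have bc: "b \<in> carrier (C q)" using b source.coboundaries_cocycles[of q] by (auto simp: source.cocycles_def)
    have "\<phi> q y \<otimes>\<^bsub>C' q\<^esub> inv\<^bsub>C' q\<^esub> \<phi> q x = \<phi> q b"
      using bc xc by (simp add: b(2) target.C.m_assoc)
    then show ?thesis
      using target.C.coset_eq_iff[OF target.coboundaries_subgroup, of "\<phi> q y" q "\<phi> q x"]
        map_coboundaries[OF b(1)] bc xc b(2) by simp
  qed
  moreover have "x \<in> source.B q #>\<^bsub>C q\<^esub> x" by (rule source.C.rcos_self[OF xc source.coboundaries_subgroup])
  ultimately show ?thesis unfolding cohomology_map_def quot_map_def by blast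
qed

lemma map_cohomology_closed:
  "\<xi> \<in> carrier (cohomology C d q) \<Longrightarrow> cohomology_map C' d' q (\<phi> q) \<xi> \<in> carrier (cohomology C' d' q)"
  by (auto simp: source.carrier_cohomology target.carrier_cohomology map_class map_cocycles)

text \<open>Both conditions are put on cocycles modulo coboundaries, the form in which a homotopy
  inverse delivers them.\<close>

lemma cohomology_map_iso:
  assumes inj: "\<And>x. x \<in> source.cocycles q \<Longrightarrow> \<phi> q x \<in> target.B q \<Longrightarrow> x \<in> source.B q"
    and surj: "\<And>z. z \<in> target.cocycles q \<Longrightarrow>
      \<exists>x\<in>source.cocycles q. z \<otimes>\<^bsub>C' q\<^esub> inv\<^bsub>C' q\<^esub> \<phi> q x \<in> target.B q"
  shows "cohomology_map C' d' q (\<phi> q) \<in> iso (cohomology C d q) (cohomology C' d' q)"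
proof -
  let ?f = "cohomology_map C' d' q (\<phi> q)"
  have car: "x \<in> carrier (C q)" if "x \<in> source.cocycles q" for x using that by (simp add: source.cocycles_def)
  have "?f \<in> hom (cohomology C d q) (cohomology C' d' q)"
  proof (rule homI)
    fix \<xi> \<eta> assume "\<xi> \<in> carrier (cohomology C d q)" "\<eta> \<in> carrier (cohomology C d q)"
    then obtain x y where xy: "x \<in> source.cocycles q" "\<xi> = source.B q #>\<^bsub>C q\<^esub> x"
        "y \<in> source.cocycles q" "\<eta> = source.B q #>\<^bsub>C q\<^esub> y"
      by (auto simp: source.carrier_cohomology)
    have "x \<otimes>\<^bsub>C q\<^esub> y \<in> source.cocycles q" by (rule subgroup.m_closed[OF source.cocycles_subgroup xy(1,3)])
    then show "?f (\<xi> \<otimes>\<^bsub>cohomology C d q\<^esub> \<eta>) = ?f \<xi> \<otimes>\<^bsub>cohomology C' d' q\<^esub> ?f \<eta>"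
      using xy car by (simp add: source.mult_cohomology target.mult_cohomology map_class map_cocycles)
  qed (rule map_cohomology_closed)
  moreover have "inj_on ?f (carrier (cohomology C d q))"
  proof (rule inj_onI)
    fix \<xi> \<eta> assume *: "\<xi> \<in> carrier (cohomology C d q)" "\<eta> \<in> carrier (cohomology C d q)" "?f \<xi> = ?f \<eta>"
    then obtain x y where xy: "x \<in> source.cocycles q" "\<xi> = source.B q #>\<^bsub>C q\<^esub> x"
        "y \<in> source.cocycles q" "\<eta> = source.B q #>\<^bsub>C q\<^esub> y"
      by (auto simp: source.carrier_cohomology)
    have "\<phi> q x \<otimes>\<^bsub>C' q\<^esub> inv\<^bsub>C' q\<^esub> \<phi> q y \<in> target.B q"
      using * xy by (simp add: map_class target.class_eq_iff map_cocycles)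
    moreover have "x \<otimes>\<^bsub>C q\<^esub> inv\<^bsub>C q\<^esub> y \<in> source.cocycles q"
      by (rule subgroup.m_closed[OF source.cocycles_subgroup xy(1)
            subgroup.m_inv_closed[OF source.cocycles_subgroup xy(3)]])
    ultimately have "x \<otimes>\<^bsub>C q\<^esub> inv\<^bsub>C q\<^esub> y \<in> source.B q" using xy car by (intro inj) simp_all
    then show "\<xi> = \<eta>" using xy by (simp add: source.class_eq_iff)
  qed
  moreover have "carrier (cohomology C' d' q) \<subseteq> ?f ` carrier (cohomology C d q)"
  proof
    fix \<zeta> assume "\<zeta> \<in> carrier (cohomology C' d' q)"
    then obtain z where z: "z \<in> target.cocycles q" "\<zeta> = target.B q #>\<^bsub>C' q\<^esub> z"
      by (auto simp: target.carrier_cohomology)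
    obtain x where x: "x \<in> source.cocycles q" "z \<otimes>\<^bsub>C' q\<^esub> inv\<^bsub>C' q\<^esub> \<phi> q x \<in> target.B q" using surj z by blast
    then have "\<zeta> = ?f (source.B q #>\<^bsub>C q\<^esub> x)" using z by (simp add: map_class target.class_eq_iff map_cocycles)
    then show "\<zeta> \<in> ?f ` carrier (cohomology C d q)" using x by (auto simp: source.carrier_cohomology)
  qed
  ultimately show ?thesis
    using map_cohomology_closed by (auto simp: iso_def bij_betw_def)
qed

end

text \<open>The comparison is built from the building to the group and inverted at the end. A square
  that commutes on cochains commutes on classes, and the two isomorphisms in it may then be
  reversed.\<close>

lemma inverse_natural:
  assumes f: "complex_map C1 d1 C1' d1' f" and g: "complex_map C2 d2 C2' d2' g"
    and a: "complex_map C1 d1 C2 d2 a" and b: "complex_map C1' d1' C2' d2' b"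
    and sq: "\<And>x. x \<in> carrier (C1 q) \<Longrightarrow> b q (f q x) = g q (a q x)"
    and isof: "cohomology_map C1' d1' q (f q) \<in> iso (cohomology C1 d1 q) (cohomology C1' d1' q)"
    and isog: "cohomology_map C2' d2' q (g q) \<in> iso (cohomology C2 d2 q) (cohomology C2' d2' q)"
    and \<xi>: "\<xi> \<in> carrier (cohomology C1' d1' q)"
  shows "inv_into (carrier (cohomology C2 d2 q)) (cohomology_map C2' d2' q (g q)) (cohomology_map C2' d2' q (b q) \<xi>) =
    cohomology_map C2 d2 q (a q) (inv_into (carrier (cohomology C1 d1 q)) (cohomology_map C1' d1' q (f q)) \<xi>)"
proof -
  interpret f: complex_map C1 d1 C1' d1' f by (rule f)
  interpret g: complex_map C2 d2 C2' d2' g by (rule g)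
  interpret a: complex_map C1 d1 C2 d2 a by (rule a)
  interpret b: complex_map C1' d1' C2' d2' b by (rule b)
  let ?F = "cohomology_map C1' d1' q (f q)" and ?G = "cohomology_map C2' d2' q (g q)"
  have bF: "bij_betw ?F (carrier (cohomology C1 d1 q)) (carrier (cohomology C1' d1' q))"
    and bG: "inj_on ?G (carrier (cohomology C2 d2 q))"
    using isof isog by (auto simp: iso_def bij_betw_def)
  obtain \<eta> where \<eta>: "\<eta> \<in> carrier (cohomology C1 d1 q)" "\<xi> = ?F \<eta>" using bF \<xi> by (auto simp: bij_betw_def)
  then obtain x where x: "x \<in> f.source.cocycles q" "\<eta> = f.source.B q #>\<^bsub>C1 q\<^esub> x"
    by (auto simp: f.source.carrier_cohomology)
  have "x \<in> carrier (C1 q)" using x by (simp add: f.source.cocycles_def)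
  then have "cohomology_map C2' d2' q (b q) \<xi> = ?G (cohomology_map C2 d2 q (a q) \<eta>)"
    using x \<eta> by (simp add: f.map_class b.map_class a.map_class g.map_class f.map_cocycles a.map_cocycles sq)
  then have "inv_into (carrier (cohomology C2 d2 q)) ?G (cohomology_map C2' d2' q (b q) \<xi>) = cohomology_map C2 d2 q (a q) \<eta>"
    using inv_into_f_f[OF bG a.map_cohomology_closed[OF \<eta>(1)]] by simp
  moreover have "inv_into (carrier (cohomology C1 d1 q)) ?F \<xi> = \<eta>"
    using \<eta> bF by (simp add: bij_betw_def)
  ultimately show ?thesis by simp
qed

lemma iso_inv_into:
  assumes G: "group G" and f: "f \<in> iso G H"
  shows "inv_into (carrier G) f \<in> iso H G"
  using group.iso_set_sym[OF G f] .

lemma (in complex) cohomology_group: "group (cohomology C d q)"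
proof -
  let ?K = "subgroup_of (C q) (cocycles q)"
  have "group ?K" by (rule subgroup.subgroup_is_group[OF cocycles_subgroup C.is_group])
  then have "comm_group ?K"
    by (rule group.group_comm_groupI) (auto simp: cocycles_def C.m_comm)
  moreover have "subgroup (B q) ?K"
    by (rule C.subgroup_incl[OF coboundaries_subgroup cocycles_subgroup coboundaries_cocycles])
  ultimately have "group (?K Mod B q)"
    by (intro normal.factorgroup_is_group comm_group.subgroup_imp_normal)
  then show ?thesis by (simp add: cohomology_def cocycles_def kernel_def)
qed

section \<open>Group actions on acyclic complexes\<close>

text \<open>\<open>acyclic\<close> asks for no compatibility of the filling with the group;
  equivariance is arranged afterwards.\<close>

locale acyclic_action = group G + coeff_ring S for G (structure) and S +
  fixes act :: "'a \<Rightarrow> 'v \<Rightarrow> 'v" and B :: "'v list set"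
  assumes act_mult: "g \<in> carrier G \<Longrightarrow> h \<in> carrier G \<Longrightarrow> act (g \<otimes> h) x = act g (act h x)"
    and act_one: "act \<one> x = x"
    and face_closed_B: "face_closed B" and Nil_B: "[] \<in> B"
    and act_B: "g \<in> carrier G \<Longrightarrow> b \<in> B \<Longrightarrow> map (act g) b \<in> B"
    and acyclic: "z \<in> chains S (deg B q) \<Longrightarrow> bd z = 0 \<Longrightarrow> \<exists>y\<in>chains S (deg B (Suc q)). bd y = z"
begin

abbreviation tuples :: "'a list set" where
  "tuples \<equiv> lists (carrier G)"

abbreviation left_mult :: "'a \<Rightarrow> 'a \<Rightarrow> 'a" where
  "left_mult g \<equiv> (\<otimes>) g"

lemma face_closed_tuples: "face_closed tuples"
  by (auto simp: face_closed_def)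

lemma left_mult_tuples: "g \<in> carrier G \<Longrightarrow> a \<in> tuples \<Longrightarrow> map (left_mult g) a \<in> tuples"
  by auto

definition fill :: "nat \<Rightarrow> ('v list \<Rightarrow>\<^sub>0 rat) \<Rightarrow> ('v list \<Rightarrow>\<^sub>0 rat)" where
  "fill q z = (SOME y. y \<in> chains S (deg B (Suc q)) \<and> bd y = z)"

lemma fill: "z \<in> chains S (deg B q) \<Longrightarrow> bd z = 0 \<Longrightarrow> fill q z \<in> chains S (deg B (Suc q)) \<and> bd (fill q z) = z"
  unfolding fill_def by (rule someI_ex) (use acyclic in blast)

text \<open>The arbitrary choice in \<open>fill\<close> is used at the identity and translated by
  \<open>g\<close>. So it becomes equivariant once \<open>g\<close> and \<open>z\<close> are moved
  together, as in \<open>conj_fill_equivariant\<close>.\<close>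

definition conj_fill :: "nat \<Rightarrow> 'a \<Rightarrow> ('v list \<Rightarrow>\<^sub>0 rat) \<Rightarrow> ('v list \<Rightarrow>\<^sub>0 rat)" where
  "conj_fill q g z = mapc (act g) (fill q (mapc (act (inv g)) z))"

lemma mapc_act_mult:
  "g \<in> carrier G \<Longrightarrow> h \<in> carrier G \<Longrightarrow> mapc (act g) (mapc (act h) z) = mapc (act (g \<otimes> h)) z"
proof -
  assume "g \<in> carrier G" "h \<in> carrier G"
  then have "act g \<circ> act h = act (g \<otimes> h)" by (auto simp: act_mult)
  then show ?thesis by (simp add: mapc_mapc)
qed

lemma mapc_act_one: "mapc (act \<one>) z = z"
  by (rule mapc_id) (rule act_one)

lemma mapc_act_chains: "g \<in> carrier G \<Longrightarrow> z \<in> chains S (deg B q) \<Longrightarrow> mapc (act g) z \<in> chains S (deg B q)"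
  by (rule mapc_chains) (auto simp: deg_def act_B)

lemma conj_fill:
  assumes g: "g \<in> carrier G" and z: "z \<in> chains S (deg B q)" "bd z = 0"
  shows "conj_fill q g z \<in> chains S (deg B (Suc q))" "bd (conj_fill q g z) = z"
proof -
  have "mapc (act (inv g)) z \<in> chains S (deg B q)" "bd (mapc (act (inv g)) z) = 0"
    using g z by (simp_all add: mapc_act_chains bd_mapc mapc_linear)
  note f = fill[OF this]
  show "conj_fill q g z \<in> chains S (deg B (Suc q))" using f g by (simp add: conj_fill_def mapc_act_chains)
  have "bd (conj_fill q g z) = mapc (act g) (mapc (act (inv g)) z)" using f by (simp add: conj_fill_def bd_mapc)
  also have "\<dots> = z" using g by (simp add: mapc_act_mult mapc_act_one)
  finally show "bd (conj_fill q g z) = z" .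
qed

lemma conj_fill_equivariant:
  assumes "g \<in> carrier G" "k \<in> carrier G"
  shows "conj_fill q (k \<otimes> g) (mapc (act k) z) = mapc (act k) (conj_fill q g z)"
proof -
  have "inv (k \<otimes> g) \<otimes> k = inv g" using assms by (simp add: inv_mult_group m_assoc)
  then show ?thesis using assms by (simp add: conj_fill_def mapc_act_mult)
qed

text \<open>Nonempty tuples are permuted freely: the first entry singles out one translate and
  serves as the group element of \<open>conj_fill\<close>.\<close>

theorem tuples_to_complex: "\<exists>\<psi>. equivariant_chain_map S tuples B (carrier G) left_mult act \<psi>"
proof (rule chain_map_exists[OF face_closed_tuples Nil_B left_mult_tuples])
  show "equivariant_filling S tuples B (carrier G) left_mult act (\<lambda>q a. conj_fill q (hd a))"
    unfolding equivariant_filling_def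
  proof (intro allI ballI impI)
    fix q a and z :: "'v list \<Rightarrow>\<^sub>0 rat" assume *: "a \<in> tuples - {[]}" "z \<in> chains S (deg B q)" "bd z = 0"
    then have hd: "hd a \<in> carrier G" by (cases a) auto
    have "hd (map (left_mult g) a) = g \<otimes> hd a" for g using * by (simp add: hd_map)
    then show "conj_fill q (hd a) z \<in> chains S (deg B (Suc q)) \<and> bd (conj_fill q (hd a) z) = z \<and>
        (\<forall>g\<in>carrier G. conj_fill q (hd (map (left_mult g) a)) (mapc (act g) z) = mapc (act g) (conj_fill q (hd a) z))"
      using conj_fill[OF hd *(2,3)] conj_fill_equivariant[OF hd] by simp
  qed
qed

lemma prepend_tuples:
  "g \<in> carrier G \<Longrightarrow> z \<in> chains S (deg tuples q) \<Longrightarrow> prepend g z \<in> chains S (deg tuples (Suc q))"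
  by (rule prepend_chains) (auto simp: deg_def)

text \<open>The cone with the first entry as apex fills cycles of tuples, and it is equivariant
  because the apex moves with the tuple.\<close>

theorem tuples_homotopy:
  assumes "equivariant_chain_map S tuples tuples (carrier G) left_mult left_mult f"
    "equivariant_chain_map S tuples tuples (carrier G) left_mult left_mult f'"
  shows "\<exists>D. equivariant_homotopy S tuples tuples (carrier G) left_mult left_mult f f' D"
proof (rule homotopy_exists[OF face_closed_tuples left_mult_tuples _ assms])
  show "equivariant_filling S tuples tuples (carrier G) left_mult left_mult (\<lambda>q a. prepend (hd a))"
    unfolding equivariant_filling_def
  proof (intro allI ballI impI)
    fix q a and z :: "'a list \<Rightarrow>\<^sub>0 rat" assume *: "a \<in> tuples - {[]}" "z \<in> chains S (deg tuples q)" "bd z = 0"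
    then have hd: "hd a \<in> carrier G" by (cases a) auto
    have "hd (map (left_mult g) a) = g \<otimes> hd a" for g using * by (simp add: hd_map)
    then show "prepend (hd a) z \<in> chains S (deg tuples (Suc q)) \<and> bd (prepend (hd a) z) = z \<and>
        (\<forall>g\<in>carrier G. prepend (hd (map (left_mult g) a)) (mapc (left_mult g) z) = mapc (left_mult g) (prepend (hd a) z))"
      using prepend_tuples[OF hd *(2)] *(3) by (simp add: bd_prepend mapc_prepend prepend_linear)
  qed
qed

end

text \<open>The orders of the stabilisers are the denominators of the averages below.\<close>

locale proper_acyclic_action = acyclic_action G S act B
  for G (structure) and S and act :: "'a \<Rightarrow> 'v \<Rightarrow> 'v" and B :: "'v list set" +
  assumes stabiliser: "b \<in> B - {[]} \<Longrightarrow> finite {g \<in> carrier G. map (act g) b = b} \<and>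
      inverse (of_nat (card {g \<in> carrier G. map (act g) b = b})) \<in> S"
begin

definition orbit_rep :: "'v list \<Rightarrow> 'v list" where
  "orbit_rep a = (SOME b. b \<in> B \<and> (\<exists>g\<in>carrier G. map (act g) b = a))"

text \<open>
  The translates from the chosen representative of the orbit of \<open>a\<close> to \<open>a\<close>, a coset of the
  stabiliser: averaging over it is the equivariant replacement for the choice of one translate.
\<close>

definition transporters :: "'v list \<Rightarrow> 'a set" where
  "transporters a = {g \<in> carrier G. map (act g) (orbit_rep a) = a}"

lemma map_act_mult: "g \<in> carrier G \<Longrightarrow> h \<in> carrier G \<Longrightarrow> map (act (g \<otimes> h)) b = map (act g) (map (act h) b)"
  by (simp add: act_mult)

lemma map_act_inv: "g \<in> carrier G \<Longrightarrow> map (act (inv g)) (map (act g) b) = b"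
proof -
  assume "g \<in> carrier G"
  then have "map (act (inv g)) (map (act g) b) = map (act \<one>) b"
    by (simp only: map_act_mult[symmetric] inv_closed l_inv)
  then show ?thesis by (simp add: act_one map_idI)
qed

lemma orbit_rep: "a \<in> B \<Longrightarrow> orbit_rep a \<in> B \<and> (\<exists>g\<in>carrier G. map (act g) (orbit_rep a) = a)"
  unfolding orbit_rep_def by (rule someI[of _ a]) (auto intro!: bexI[of _ \<one>] simp: act_one map_idI)

text \<open>The representative is chosen by a condition that depends only on the orbit.\<close>

lemma orbit_rep_act: 
  assumes "g \<in> carrier G"
  shows "orbit_rep (map (act g) a) = orbit_rep a"
proof -
  have "(\<exists>h\<in>carrier G. map (act h) b = map (act g) a) \<longleftrightarrow> (\<exists>h\<in>carrier G. map (act h) b = a)" for b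
  proof
    assume "\<exists>h\<in>carrier G. map (act h) b = map (act g) a"
    then obtain h where h: "h \<in> carrier G" "map (act h) b = map (act g) a" by blast
    then have "map (act (inv g \<otimes> h)) b = a" using assms by (simp only: map_act_mult inv_closed map_act_inv)
    then show "\<exists>h\<in>carrier G. map (act h) b = a" using h assms by blast
  next
    assume "\<exists>h\<in>carrier G. map (act h) b = a"
    then obtain h where h: "h \<in> carrier G" "map (act h) b = a" by blast
    then have "map (act (g \<otimes> h)) b = map (act g) a" using assms by (simp only: map_act_mult)
    then show "\<exists>h\<in>carrier G. map (act h) b = map (act g) a" using h assms by blast
  qed
  then show ?thesis unfolding orbit_rep_def by simp
qed

lemma transporters_act:
  assumes g: "g \<in> carrier G"
  shows "transporters (map (act g) a) = left_mult g ` transporters a"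
proof (intro equalityI subsetI)
  fix h assume "h \<in> transporters (map (act g) a)"
  then have h: "h \<in> carrier G" "map (act h) (orbit_rep a) = map (act g) a"
    using g by (auto simp: transporters_def orbit_rep_act)
  then have "map (act (inv g \<otimes> h)) (orbit_rep a) = a" using g by (simp only: map_act_mult inv_closed map_act_inv)
  then have "inv g \<otimes> h \<in> transporters a" using g h by (simp add: transporters_def)
  moreover have "h = g \<otimes> (inv g \<otimes> h)" using g h by (simp flip: m_assoc)
  ultimately show "h \<in> left_mult g ` transporters a" by blast
next
  fix h assume "h \<in> left_mult g ` transporters a"
  then obtain k where k: "h = g \<otimes> k" "k \<in> carrier G" "map (act k) (orbit_rep a) = a"
    by (auto simp: transporters_def)
  then have "map (act h) (orbit_rep a) = map (act g) a" using g by (simp only: map_act_mult)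
  then show "h \<in> transporters (map (act g) a)" using g k by (simp add: transporters_def orbit_rep_act)
qed

lemma transporters_carrier: "g \<in> transporters a \<Longrightarrow> g \<in> carrier G"
  by (simp add: transporters_def)

lemma transporters_card:
  assumes a: "a \<in> B - {[]}"
  shows "inverse (of_nat (card (transporters a))) \<in> S" "card (transporters a) \<noteq> 0"
proof -
  let ?b = "orbit_rep a"
  let ?St = "{g \<in> carrier G. map (act g) ?b = ?b}"
  obtain g where g: "g \<in> carrier G" "map (act g) ?b = a" and bB: "?b \<in> B" using orbit_rep a by blast
  then have "?b \<in> B - {[]}" using a by auto
  note st = stabiliser[OF this]
  have "transporters a = left_mult g ` ?St"
  proof (intro equalityI subsetI)
    fix h assume h: "h \<in> transporters a"
    then have hc: "h \<in> carrier G" "map (act h) ?b = map (act g) ?b" using g by (auto simp: transporters_def)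
    then have "map (act (inv g \<otimes> h)) ?b = ?b" using g(1) by (simp only: map_act_mult inv_closed map_act_inv)
    moreover have "h = g \<otimes> (inv g \<otimes> h)" using g hc by (simp flip: m_assoc)
    ultimately show "h \<in> left_mult g ` ?St" using g hc by blast
  next
    fix h assume "h \<in> left_mult g ` ?St"
    then obtain k where k: "h = g \<otimes> k" "k \<in> carrier G" "map (act k) ?b = ?b" by blast
    then have "map (act h) ?b = a" using g by (simp only: map_act_mult)
    then show "h \<in> transporters a" using g k by (simp add: transporters_def)
  qed
  moreover have "inj_on (left_mult g) ?St" using g by (auto intro!: inj_onI)
  ultimately have card: "card (transporters a) = card ?St" by (simp add: card_image)
  then show "inverse (of_nat (card (transporters a))) \<in> S" using st by simp
  have "\<one> \<in> ?St" by (simp add: act_one map_idI)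
  then show "card (transporters a) \<noteq> 0" unfolding card using st by (metis (lifting) card_0_eq empty_iff)
qed

definition average :: "'v list \<Rightarrow> ('a \<Rightarrow> ('d \<Rightarrow>\<^sub>0 rat)) \<Rightarrow> ('d \<Rightarrow>\<^sub>0 rat)" where
  "average a f = cscale (inverse (of_nat (card (transporters a)))) (\<Sum>g\<in>transporters a. f g)"

lemma average_chains:
  "a \<in> B - {[]} \<Longrightarrow> (\<And>g. g \<in> carrier G \<Longrightarrow> f g \<in> chains S A) \<Longrightarrow> average a f \<in> chains S A"
  unfolding average_def by (intro scale_chains sum_chains transporters_card) (auto intro: transporters_carrier)

lemma sum_const_chain: "(\<Sum>g\<in>A. z) = cscale (of_nat (card A)) z"
  by (induction A rule: infinite_finite_induct) (auto simp: scale_add)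

text \<open>A mean of chains with a common boundary has this boundary, since the weights add up to
  1.\<close>

lemma average_bd:
  assumes "a \<in> B - {[]}" "\<And>g. g \<in> carrier G \<Longrightarrow> bd (f g) = z"
  shows "bd (average a f) = z"
proof -
  have "(\<Sum>g\<in>transporters a. bd (f g)) = (\<Sum>g\<in>transporters a. z)"
    using assms(2) transporters_carrier by (intro sum.cong) auto
  then show ?thesis
    using transporters_card(2)[OF assms(1)] by (simp add: average_def bd_linear sum_const_chain)
qed

text \<open>Left multiplication by \<open>k\<close> carries the transporters of \<open>a\<close>
  bijectively to those of its translate, so both averages run over corresponding summands.\<close>

lemma average_act:
  assumes k: "k \<in> carrier G" and eq: "\<And>g. g \<in> carrier G \<Longrightarrow> f' (k \<otimes> g) = mapc u (f g)"
  shows "average (map (act k) a) f' = mapc u (average a f)"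
proof -
  have inj: "inj_on (left_mult k) (transporters a)"
    using k by (auto intro!: inj_onI simp: transporters_def)
  have "(\<Sum>g\<in>transporters (map (act k) a). f' g) = (\<Sum>g\<in>transporters a. f' (k \<otimes> g))"
    unfolding transporters_act[OF k] using inj by (simp add: sum.reindex)
  also have "\<dots> = (\<Sum>g\<in>transporters a. mapc u (f g))"
    by (rule sum.cong) (auto intro: eq transporters_carrier)
  finally show ?thesis
    unfolding average_def transporters_act[OF k] card_image[OF inj] by (simp add: mapc_linear transporters_act[OF k])
qed

text \<open>Any group element can be the apex of a cone over a cycle of tuples. A simplex does not
  determine one, and the average over all its transporters removes the choice.\<close>

theorem complex_to_tuples: "\<exists>\<phi>. equivariant_chain_map S B tuples (carrier G) act left_mult \<phi>"
proof (rule chain_map_exists[OF face_closed_B _ act_B])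
  show "[] \<in> tuples" by simp
  show "equivariant_filling S B tuples (carrier G) act left_mult (\<lambda>q a z. average a (\<lambda>g. prepend g z))"
    unfolding equivariant_filling_def
  proof (intro allI ballI impI conjI)
    fix q a and z :: "'a list \<Rightarrow>\<^sub>0 rat" assume *: "a \<in> B - {[]}" "z \<in> chains S (deg tuples q)" "bd z = 0"
    show "average a (\<lambda>g. prepend g z) \<in> chains S (deg tuples (Suc q))"
      by (rule average_chains[OF *(1)]) (rule prepend_tuples[OF _ *(2)])
    show "bd (average a (\<lambda>g. prepend g z)) = z"
      by (rule average_bd[OF *(1)]) (simp add: bd_prepend *(3) prepend_linear)
    fix k assume "k \<in> carrier G"
    then show "average (map (act k) a) (\<lambda>g. prepend g (mapc (left_mult k) z)) =
        mapc (left_mult k) (average a (\<lambda>g. prepend g z))"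
      by (rule average_act) (simp add: mapc_prepend)
  qed
qed

theorem complex_homotopy:
  assumes "equivariant_chain_map S B B (carrier G) act act f" "equivariant_chain_map S B B (carrier G) act act f'"
  shows "\<exists>D. equivariant_homotopy S B B (carrier G) act act f f' D"
proof (rule homotopy_exists[OF face_closed_B act_B _ assms])
  show "equivariant_filling S B B (carrier G) act act (\<lambda>q a z. average a (\<lambda>g. conj_fill q g z))"
    unfolding equivariant_filling_def
  proof (intro allI ballI impI conjI)
    fix q a and z :: "'v list \<Rightarrow>\<^sub>0 rat" assume *: "a \<in> B - {[]}" "z \<in> chains S (deg B q)" "bd z = 0"
    show "average a (\<lambda>g. conj_fill q g z) \<in> chains S (deg B (Suc q))"
      by (rule average_chains[OF *(1)]) (rule conj_fill(1)[OF _ *(2,3)])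
    show "bd (average a (\<lambda>g. conj_fill q g z)) = z"
      by (rule average_bd[OF *(1)]) (rule conj_fill(2)[OF _ *(2,3)])
    fix k assume "k \<in> carrier G"
    then show "average (map (act k) a) (\<lambda>g. conj_fill q g (mapc (act k) z)) =
        mapc (act k) (average a (\<lambda>g. conj_fill q g z))"
      by (rule average_act) (rule conj_fill_equivariant[OF _ \<open>k \<in> carrier G\<close>])
  qed
qed

end

section \<open>Invariant functions on simplices\<close>

context p_divisible_group
begin

text \<open>A common model for both sides. Homogeneous group cochains have this form with tuples as
  lists, and the invariant oriented cochains are identified with it by listing simplices by type.
  Degree \<open>q\<close> uses lists of length \<open>q + 1\<close>, which leaves out the
  augmentation.\<close>

definition fun_cochains :: "'v list set \<Rightarrow> 'g set \<Rightarrow> ('g \<Rightarrow> 'v \<Rightarrow> 'v) \<Rightarrow> nat \<Rightarrow> ('v list \<Rightarrow> 'a) monoid" where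
  "fun_cochains B G act q = subgroup_of (product_group (deg B (Suc q)) (\<lambda>_. R))
     {f \<in> deg B (Suc q) \<rightarrow>\<^sub>E carrier R. \<forall>g\<in>G. \<forall>b\<in>deg B (Suc q). f (map (act g) b) = f b}"

definition fun_coboundary :: "'v list set \<Rightarrow> nat \<Rightarrow> ('v list \<Rightarrow> 'a) \<Rightarrow> ('v list \<Rightarrow> 'a)" where
  "fun_coboundary B q f = (\<lambda>b\<in>deg B (Suc (Suc q)). pair f (face b))"

definition pull :: "('c list \<Rightarrow> ('v list \<Rightarrow>\<^sub>0 rat)) \<Rightarrow> 'c list set \<Rightarrow> nat \<Rightarrow> ('v list \<Rightarrow> 'a) \<Rightarrow> ('c list \<Rightarrow> 'a)" where
  "pull \<psi> A q c = (\<lambda>a\<in>deg A (Suc q). pair c (\<psi> a))"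

lemma fun_cochains_simps [simp]:
  "f \<otimes>\<^bsub>fun_cochains B G act q\<^esub> g = (\<lambda>b\<in>deg B (Suc q). f b \<otimes> g b)"
  "\<one>\<^bsub>fun_cochains B G act q\<^esub> = (\<lambda>b\<in>deg B (Suc q). \<one>)"
  by (simp_all add: fun_cochains_def)

lemma fun_cochains_carrier:
  "f \<in> carrier (fun_cochains B G act q) \<longleftrightarrow> f \<in> extensional (deg B (Suc q)) \<and>
     f \<in> deg B (Suc q) \<rightarrow> carrier R \<and> (\<forall>g\<in>G. \<forall>b\<in>deg B (Suc q). f (map (act g) b) = f b)"
  by (auto simp: fun_cochains_def PiE_def)

lemma fun_cochains_eqI:
  "f \<in> extensional I \<Longrightarrow> g \<in> extensional I \<Longrightarrow> (\<And>b. b \<in> I \<Longrightarrow> f b = g b) \<Longrightarrow> f = g"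
  by (rule extensionalityI)

lemma fun_cochains_group:
  assumes act: "\<And>g b. g \<in> G \<Longrightarrow> b \<in> B \<Longrightarrow> map (act g) b \<in> B"
  shows "comm_group (fun_cochains B G act q)"
proof -
  have act': "map (act g) b \<in> deg B n" if "g \<in> G" "b \<in> deg B n" for g b n
    using that act by (auto simp: deg_def)
  have cl: "f b \<in> carrier R" if "f \<in> carrier (fun_cochains B G act q)" "b \<in> deg B (Suc q)" for f b
    using that by (auto simp: fun_cochains_carrier)
  show ?thesis
  proof (rule comm_groupI)
    fix x y z assume "x \<in> carrier (fun_cochains B G act q)" "y \<in> carrier (fun_cochains B G act q)"
      "z \<in> carrier (fun_cochains B G act q)"
    then show "x \<otimes>\<^bsub>fun_cochains B G act q\<^esub> y \<otimes>\<^bsub>fun_cochains B G act q\<^esub> z =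
        x \<otimes>\<^bsub>fun_cochains B G act q\<^esub> (y \<otimes>\<^bsub>fun_cochains B G act q\<^esub> z)"
      by (auto intro!: restrict_ext simp: cl m_assoc)
  next
    fix x y assume xy: "x \<in> carrier (fun_cochains B G act q)" "y \<in> carrier (fun_cochains B G act q)"
    then show "x \<otimes>\<^bsub>fun_cochains B G act q\<^esub> y \<in> carrier (fun_cochains B G act q)"
      using cl act' by (auto simp: fun_cochains_carrier)
    show "x \<otimes>\<^bsub>fun_cochains B G act q\<^esub> y = y \<otimes>\<^bsub>fun_cochains B G act q\<^esub> x"
      using xy by (auto intro!: restrict_ext simp: cl m_comm)
  next
    show "\<one>\<^bsub>fun_cochains B G act q\<^esub> \<in> carrier (fun_cochains B G act q)"
      using act' by (auto simp: fun_cochains_carrier)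
  next
    fix x assume x: "x \<in> carrier (fun_cochains B G act q)"
    show "\<one>\<^bsub>fun_cochains B G act q\<^esub> \<otimes>\<^bsub>fun_cochains B G act q\<^esub> x = x"
      using x cl[OF x] by (intro fun_cochains_eqI[of _ "deg B (Suc q)"]) (auto simp: fun_cochains_carrier)
    show "\<exists>y\<in>carrier (fun_cochains B G act q). y \<otimes>\<^bsub>fun_cochains B G act q\<^esub> x = \<one>\<^bsub>fun_cochains B G act q\<^esub>"
      by (rule bexI[of _ "\<lambda>b\<in>deg B (Suc q). inv (x b)"])
        (use x cl[OF x] act' in \<open>auto simp: fun_cochains_carrier intro!: restrict_ext\<close>)
  qed
qed

lemma fun_cochains_inv:
  assumes act: "\<And>g b. g \<in> G \<Longrightarrow> b \<in> B \<Longrightarrow> map (act g) b \<in> B"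
    and f: "f \<in> carrier (fun_cochains B G act q)" and b: "b \<in> deg B (Suc q)"
  shows "(inv\<^bsub>fun_cochains B G act q\<^esub> f) b = inv (f b)"
proof -
  interpret C: comm_group "fun_cochains B G act q" by (rule fun_cochains_group[OF act])
  have "(inv\<^bsub>fun_cochains B G act q\<^esub> f) b \<otimes> f b = \<one>"
    using fun_cong[OF C.l_inv[OF f], of b] b by simp
  moreover have "(inv\<^bsub>fun_cochains B G act q\<^esub> f) b \<in> carrier R" "f b \<in> carrier R"
    using C.inv_closed[OF f] f b by (auto simp: fun_cochains_carrier)
  ultimately show ?thesis using inv_equality by simp
qed

lemma pair_restrict:
  "x \<in> chains (p_fractions p) B \<Longrightarrow> f \<in> B \<rightarrow> carrier R \<Longrightarrow> pair (restrict f B) x = pair f x"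
  by (rule pair_cong) auto

lemma pair_mapc:
  assumes c: "c \<in> carrier (fun_cochains B G act q)" and g: "g \<in> G" "\<And>b. b \<in> B \<Longrightarrow> map (act g) b \<in> B"
    and x: "x \<in> chains (p_fractions p) (deg B (Suc q))"
  shows "pair c (mapc (act g) x) = pair c x"
proof -
  have c': "c \<in> deg B (Suc q) \<rightarrow> carrier R" using c by (simp add: fun_cochains_carrier)
  have "pair c (mapc (act g) x) = pair (\<lambda>b. pair c (unit_chain (map (act g) b))) x"
    unfolding mapc_def using g by (intro pair_lext[OF x _ c'] unit_chains) (auto simp: deg_def)
  also have "\<dots> = pair c x"
  proof (rule pair_cong[OF x _ c'])
    fix b assume b: "b \<in> deg B (Suc q)"
    then have "map (act g) b \<in> deg B (Suc q)" using g by (auto simp: deg_def)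
    then show "pair c (unit_chain (map (act g) b)) = c b"
      using c g(1) b pair_unit[of c "map (act g) b"] funcset_mem[OF c', of "map (act g) b"]
      by (simp add: fun_cochains_carrier)
  qed
  finally show ?thesis .
qed

lemma pair_bd:
  assumes "c \<in> deg B (Suc q) \<rightarrow> carrier R" "face_closed B" "x \<in> chains (p_fractions p) (deg B (Suc (Suc q)))"
  shows "pair c (bd x) = pair (fun_coboundary B q c) x"
proof -
  have "pair c (bd x) = pair (\<lambda>b. pair c (face b)) x"
    unfolding bd_def by (rule pair_lext[OF assms(3) face_chains[OF assms(2)] assms(1)])
  also have "\<dots> = pair (fun_coboundary B q c) x"
    unfolding fun_coboundary_def
    by (rule pair_restrict[symmetric, OF assms(3)]) (auto intro!: pair_closed[OF face_chains[OF assms(2)] assms(1)])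
  finally show ?thesis .
qed

lemma fun_coboundary_eq: "b \<in> deg B (Suc (Suc q)) \<Longrightarrow> fun_coboundary B q f b = pair f (face b)"
  by (simp add: fun_coboundary_def)

lemma fun_cochains_complex:
  assumes B: "face_closed B" and act: "\<And>g b. g \<in> G \<Longrightarrow> b \<in> B \<Longrightarrow> map (act g) b \<in> B"
  shows "complex (fun_cochains B G act) (fun_coboundary B)"
proof -
  note fc = face_chains[OF B]
  have in_carrier: "fun_coboundary B q c \<in> carrier (fun_cochains B G act (Suc q))"
    if c: "c \<in> carrier (fun_cochains B G act q)" for c q
  proof -
    have c': "c \<in> deg B (Suc q) \<rightarrow> carrier R" using c by (simp add: fun_cochains_carrier)
    have "fun_coboundary B q c (map (act g) b) = fun_coboundary B q c b"
      if "g \<in> G" "b \<in> deg B (Suc (Suc q))" for g b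
    proof -
      have "map (act g) b \<in> deg B (Suc (Suc q))" using that act by (auto simp: deg_def)
      then show ?thesis
        using that pair_mapc[OF c that(1) act fc[OF that(2)]] by (simp add: fun_coboundary_eq mapc_face)
    qed
    moreover have "fun_coboundary B q c \<in> extensional (deg B (Suc (Suc q)))" by (simp add: fun_coboundary_def)
    moreover have "fun_coboundary B q c \<in> deg B (Suc (Suc q)) \<rightarrow> carrier R"
      using pair_closed[OF fc c'] by (auto simp: fun_coboundary_def)
    ultimately show ?thesis by (simp add: fun_cochains_carrier)
  qed
  show ?thesis
  proof (rule complex.intro, unfold cochain_complex_def, intro allI conjI ballI)
    fix q
    show "comm_group (fun_cochains B G act q)" by (rule fun_cochains_group[OF act])
    show "fun_coboundary B q \<in> hom (fun_cochains B G act q) (fun_cochains B G act (Suc q))"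
    proof (rule homI)
      fix x y assume xy: "x \<in> carrier (fun_cochains B G act q)" "y \<in> carrier (fun_cochains B G act q)"
      then have xy': "x \<in> deg B (Suc q) \<rightarrow> carrier R" "y \<in> deg B (Suc q) \<rightarrow> carrier R"
        by (simp_all add: fun_cochains_carrier)
      have "pair (\<lambda>b\<in>deg B (Suc q). x b \<otimes> y b) (face b) = pair x (face b) \<otimes> pair y (face b)"
        if "b \<in> deg B (Suc (Suc q))" for b
        using pair_restrict[OF fc[OF that], of "\<lambda>b. x b \<otimes> y b"] pair_mult[OF fc[OF that] xy'] xy'
        by (simp add: Pi_iff)
      then show "fun_coboundary B q (x \<otimes>\<^bsub>fun_cochains B G act q\<^esub> y) =
          fun_coboundary B q x \<otimes>\<^bsub>fun_cochains B G act (Suc q)\<^esub> fun_coboundary B q y"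
        by (auto simp: fun_coboundary_def)
    qed (rule in_carrier)
    fix x assume x: "x \<in> carrier (fun_cochains B G act q)"
    then have x': "x \<in> deg B (Suc q) \<rightarrow> carrier R" by (simp add: fun_cochains_carrier)
    have "pair (fun_coboundary B q x) (face b) = \<one>" if "b \<in> deg B (Suc (Suc (Suc q)))" for b
      using pair_bd[OF x' B fc[OF that]] by (simp add: bd_face)
    then show "fun_coboundary B (Suc q) (fun_coboundary B q x) = \<one>\<^bsub>fun_cochains B G act (Suc (Suc q))\<^esub>"
      by (auto simp: fun_coboundary_def[of B "Suc q"])
  qed
qed

lemma pull_complex_map:
  assumes A: "face_closed A" and B: "face_closed B"
    and actA: "\<And>g a. g \<in> G \<Longrightarrow> a \<in> A \<Longrightarrow> map (actA g) a \<in> A"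
    and actB: "\<And>g b. g \<in> G \<Longrightarrow> b \<in> B \<Longrightarrow> map (actB g) b \<in> B"
    and \<psi>: "equivariant_chain_map (p_fractions p) A B G actA actB \<psi>"
  shows "complex_map (fun_cochains B G actB) (fun_coboundary B) (fun_cochains A G actA) (fun_coboundary A) (pull \<psi> A)"
proof -
  note \<psi>D = \<psi>[unfolded equivariant_chain_map_def, THEN conjunct2, rule_format]
  have \<psi>c: "\<psi> a \<in> chains (p_fractions p) (deg B n)" if "a \<in> deg A n" for a n using \<psi>D[OF that] by blast
  have pull_carrier: "pull \<psi> A q c \<in> carrier (fun_cochains A G actA q)"
    if c: "c \<in> carrier (fun_cochains B G actB q)" for c q
  proof -
    have c': "c \<in> deg B (Suc q) \<rightarrow> carrier R" using c by (simp add: fun_cochains_carrier)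
    have "pull \<psi> A q c (map (actA g) a) = pull \<psi> A q c a" if "g \<in> G" "a \<in> deg A (Suc q)" for g a
    proof -
      have "map (actA g) a \<in> deg A (Suc q)" using that actA by (auto simp: deg_def)
      moreover have "\<psi> (map (actA g) a) = mapc (actB g) (\<psi> a)" using \<psi>D[OF that(2)] that(1) by blast
      ultimately show ?thesis using that pair_mapc[OF c that(1) actB \<psi>c[OF that(2)]] by (simp add: pull_def)
    qed
    then show ?thesis using pair_closed[OF \<psi>c c'] by (auto simp: fun_cochains_carrier pull_def)
  qed
  have "cochain_map (fun_cochains B G actB) (fun_coboundary B) (fun_cochains A G actA) (fun_coboundary A) (pull \<psi> A)"
    unfolding cochain_map_def
  proof (intro allI conjI ballI)
    fix q
    show "pull \<psi> A q \<in> hom (fun_cochains B G actB q) (fun_cochains A G actA q)"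
    proof (rule homI)
      fix x y assume xy: "x \<in> carrier (fun_cochains B G actB q)" "y \<in> carrier (fun_cochains B G actB q)"
      then have xy': "x \<in> deg B (Suc q) \<rightarrow> carrier R" "y \<in> deg B (Suc q) \<rightarrow> carrier R"
        by (simp_all add: fun_cochains_carrier)
      have "pair (\<lambda>b\<in>deg B (Suc q). x b \<otimes> y b) (\<psi> a) = pair x (\<psi> a) \<otimes> pair y (\<psi> a)"
        if "a \<in> deg A (Suc q)" for a
        using pair_restrict[OF \<psi>c[OF that], of "\<lambda>b. x b \<otimes> y b"] pair_mult[OF \<psi>c[OF that] xy'] xy'
        by (simp add: Pi_iff)
      then show "pull \<psi> A q (x \<otimes>\<^bsub>fun_cochains B G actB q\<^esub> y) = pull \<psi> A q x \<otimes>\<^bsub>fun_cochains A G actA q\<^esub> pull \<psi> A q y"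
        by (auto simp: pull_def)
    qed (rule pull_carrier)
    fix c assume c: "c \<in> carrier (fun_cochains B G actB q)"
    then have c': "c \<in> deg B (Suc q) \<rightarrow> carrier R" by (simp add: fun_cochains_carrier)
    have "pair (fun_coboundary B q c) (\<psi> a) = pair (pull \<psi> A q c) (face a)" if a: "a \<in> deg A (Suc (Suc q))" for a
    proof -
      have "pair (fun_coboundary B q c) (\<psi> a) = pair c (lext \<psi> (face a))"
        using pair_bd[OF c' B \<psi>c[OF a]] \<psi>D[OF a] by simp
      also have "\<dots> = pair (\<lambda>a. pair c (\<psi> a)) (face a)" by (rule pair_lext[OF face_chains[OF A a] \<psi>c c'])
      also have "\<dots> = pair (pull \<psi> A q c) (face a)"
        unfolding pull_def by (rule pair_restrict[symmetric, OF face_chains[OF A a]]) (auto intro!: pair_closed[OF \<psi>c c'])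
      finally show ?thesis .
    qed
    then show "pull \<psi> A (Suc q) (fun_coboundary B q c) = fun_coboundary A q (pull \<psi> A q c)"
      by (auto simp: pull_def[of \<psi> A "Suc q"] fun_coboundary_def[of A])
  qed
  then show ?thesis
    using fun_cochains_complex[where G = G and act = actA, OF A actA]
      fun_cochains_complex[where G = G and act = actB, OF B actB]
    by (simp add: complex_map_def complex_map_axioms_def)
qed

text \<open>On a cocycle the term with the boundary of \<open>D\<close> vanishes, so the two
  pullbacks differ by the coboundary of the pullback of \<open>c\<close> along
  \<open>D\<close>.\<close>

lemma pull_homotopic:
  assumes A: "face_closed A" and B: "face_closed B"
    and actA: "\<And>g a. g \<in> G \<Longrightarrow> a \<in> A \<Longrightarrow> map (actA g) a \<in> A"
    and actB: "\<And>g b. g \<in> G \<Longrightarrow> b \<in> B \<Longrightarrow> map (actB g) b \<in> B"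
    and f: "equivariant_chain_map (p_fractions p) A B G actA actB f"
    and f': "equivariant_chain_map (p_fractions p) A B G actA actB f'"
    and D: "equivariant_homotopy (p_fractions p) A B G actA actB f f' D"
    and c: "c \<in> carrier (fun_cochains B G actB q)" "fun_coboundary B q c = \<one>\<^bsub>fun_cochains B G actB (Suc q)\<^esub>"
  shows "pull f A q c \<otimes>\<^bsub>fun_cochains A G actA q\<^esub> inv\<^bsub>fun_cochains A G actA q\<^esub> pull f' A q c
    \<in> coboundaries (fun_cochains A G actA) (fun_coboundary A) q"
proof -
  interpret f: complex_map "fun_cochains B G actB" "fun_coboundary B" "fun_cochains A G actA" "fun_coboundary A" "pull f A"
    by (rule pull_complex_map[OF A B actA actB f])
  interpret f': complex_map "fun_cochains B G actB" "fun_coboundary B" "fun_cochains A G actA" "fun_coboundary A" "pull f' A"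
    by (rule pull_complex_map[OF A B actA actB f'])
  note DD = D[unfolded equivariant_homotopy_def, THEN conjunct2, rule_format]
  note fD = f[unfolded equivariant_chain_map_def, THEN conjunct2, rule_format]
    f'[unfolded equivariant_chain_map_def, THEN conjunct2, rule_format]
  have Dc: "D a \<in> chains (p_fractions p) (deg B (Suc n))" if "a \<in> deg A n" for a n using DD[OF that] by blast
  have c': "c \<in> deg B (Suc q) \<rightarrow> carrier R" using c by (simp add: fun_cochains_carrier)
  let ?x = "pull f A q c \<otimes>\<^bsub>fun_cochains A G actA q\<^esub> inv\<^bsub>fun_cochains A G actA q\<^esub> pull f' A q c"
  have x: "?x a = pair c (lext D (face a))" if a: "a \<in> deg A (Suc q)" for a
  proof -
    have fa: "f a \<in> chains (p_fractions p) (deg B (Suc q))" "f' a \<in> chains (p_fractions p) (deg B (Suc q))"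
      using fD a by blast+
    have LD: "lext D (face a) \<in> chains (p_fractions p) (deg B (Suc q))"
      by (rule lext_chains[OF face_chains[OF A a] Dc])
    have "?x a = pair c (f a) \<otimes> inv (pair c (f' a))"
      using a fun_cochains_inv[OF actA f'.map.hom_closed[OF c(1)] a] by (simp add: pull_def)
    also have "\<dots> = pair c (bd (D a) + lext D (face a))"
      using DD[OF a] by (simp add: pair_diff[OF fa c'])
    also have "\<dots> = pair c (bd (D a)) \<otimes> pair c (lext D (face a))"
      by (rule pair_add[OF bd_chains[OF B Dc[OF a]] LD c'])
    also have "pair c (bd (D a)) = \<one>"
    proof -
      have "pair c (bd (D a)) = pair (\<lambda>b\<in>deg B (Suc (Suc q)). \<one>) (D a)"
        using pair_bd[OF c' B Dc[OF a]] c(2) by simp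
      also have "\<dots> = \<one>" using pair_restrict[OF Dc[OF a], of "\<lambda>_. \<one>"] pair_one[OF Dc[OF a]] by simp
      finally show ?thesis .
    qed
    finally show ?thesis using pair_closed[OF LD c'] by simp
  qed
  have ext: "?x \<in> extensional (deg A (Suc q))" by simp
  show ?thesis
  proof (cases q)
    case 0
    \<comment> \<open>In degree 0 only the trivial element is a coboundary. The boundary of a single
      vertex is the empty list, where the homotopy is zero.\<close>
    have "?x a = \<one>" if "a \<in> deg A (Suc 0)" for a
    proof -
      have "length a = 1" using that by (simp add: deg_def)
      then obtain v where "a = [v]" by (cases a) auto
      then have "lext D (face a) = D []" by (simp add: prepend_linear)
      then show ?thesis using x[of a] that 0 D by (simp add: equivariant_homotopy_def)
    qed
    then have "?x = \<one>\<^bsub>fun_cochains A G actA 0\<^esub>"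
      using ext 0 by (intro fun_cochains_eqI[of _ "deg A (Suc 0)"]) auto
    then show ?thesis using 0 by (simp add: coboundaries_def)
  next
    case (Suc m)
    let ?e = "\<lambda>a\<in>deg A (Suc m). pair c (D a)"
    have cD: "(\<lambda>a. pair c (D a)) \<in> deg A (Suc m) \<rightarrow> carrier R"
      using pair_closed[OF Dc c'[unfolded Suc]] Suc by auto
    have "?e (map (actA g) a) = ?e a" if "g \<in> G" "a \<in> deg A (Suc m)" for g a
    proof -
      have "map (actA g) a \<in> deg A (Suc m)" using that actA by (auto simp: deg_def)
      moreover have "D (map (actA g) a) = mapc (actB g) (D a)" using DD[OF that(2)] that(1) by blast
      ultimately show ?thesis using that pair_mapc[OF c(1) that(1) actB, of "D a"] Dc[OF that(2)] Suc by simp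
    qed
    then have e: "?e \<in> carrier (fun_cochains A G actA m)" using cD by (auto simp: fun_cochains_carrier)
    have "?x a = fun_coboundary A m ?e a" if a: "a \<in> deg A (Suc q)" for a
    proof -
      have a': "a \<in> deg A (Suc (Suc m))" using a Suc by simp
      note fa = face_chains[OF A a']
      have "pair c (lext D (face a)) = pair (\<lambda>a. pair c (D a)) (face a)"
        using c' Dc unfolding Suc by (intro pair_lext[OF fa]) auto
      also have "\<dots> = pair ?e (face a)" by (rule pair_restrict[symmetric, OF fa cD])
      finally show ?thesis using x[OF a] by (simp add: fun_coboundary_eq[OF a'])
    qed
    then have "?x = fun_coboundary A m ?e"
      using ext Suc by (intro fun_cochains_eqI[of _ "deg A (Suc q)"]) (auto simp: fun_coboundary_def)
    then show ?thesis using e Suc unfolding coboundaries_def by simp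
  qed
qed

lemma pull_unit_chain: "c \<in> carrier (fun_cochains B G act q) \<Longrightarrow> pull unit_chain B q c = c"
  by (intro fun_cochains_eqI[of _ "deg B (Suc q)"])
    (auto simp: pull_def fun_cochains_carrier intro!: pair_unit)

lemma pull_compose:
  assumes f: "equivariant_chain_map (p_fractions p) A B G actA actB f"
    and f': "equivariant_chain_map (p_fractions p) B C G actB actC f'"
    and c: "c \<in> carrier (fun_cochains C G actC q)"
  shows "pull (\<lambda>a. lext f' (f a)) A q c = pull f A q (pull f' B q c)"
proof -
  have c': "c \<in> deg C (Suc q) \<rightarrow> carrier R" using c by (simp add: fun_cochains_carrier)
  have fa: "f a \<in> chains (p_fractions p) (deg B (Suc q))" if "a \<in> deg A (Suc q)" for a
    using f that unfolding equivariant_chain_map_def by blast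
  have fb: "f' b \<in> chains (p_fractions p) (deg C (Suc q))" if "b \<in> deg B (Suc q)" for b
    using f' that unfolding equivariant_chain_map_def by blast
  have "pair c (lext f' (f a)) = pair (\<lambda>b\<in>deg B (Suc q). pair c (f' b)) (f a)" if "a \<in> deg A (Suc q)" for a
  proof -
    have "pair c (lext f' (f a)) = pair (\<lambda>b. pair c (f' b)) (f a)" by (rule pair_lext[OF fa[OF that] fb c'])
    also have "\<dots> = pair (\<lambda>b\<in>deg B (Suc q). pair c (f' b)) (f a)"
      by (rule pair_restrict[symmetric, OF fa[OF that]]) (auto intro!: pair_closed[OF fb c'])
    finally show ?thesis .
  qed
  then show ?thesis by (auto simp: pull_def)
qed

text \<open>Pulling back along \<open>\<phi>\<close> inverts the map on cocycles up to coboundaries: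
  \<open>E\<close> shows this for \<open>B\<close> and gives injectivity, \<open>D\<close> shows it
  for \<open>A\<close> and gives surjectivity.\<close>

theorem pull_inj_surj:
  assumes A: "face_closed A" and B: "face_closed B"
    and actA: "\<And>g a. g \<in> G \<Longrightarrow> a \<in> A \<Longrightarrow> map (actA g) a \<in> A"
    and actB: "\<And>g b. g \<in> G \<Longrightarrow> b \<in> B \<Longrightarrow> map (actB g) b \<in> B"
    and \<psi>: "equivariant_chain_map (p_fractions p) A B G actA actB \<psi>"
    and \<phi>: "equivariant_chain_map (p_fractions p) B A G actB actA \<phi>"
    and D: "equivariant_homotopy (p_fractions p) A A G actA actA unit_chain (\<lambda>a. lext \<phi> (\<psi> a)) D"
    and E: "equivariant_homotopy (p_fractions p) B B G actB actB unit_chain (\<lambda>b. lext \<psi> (\<phi> b)) E"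
  shows "\<lbrakk>c \<in> complex.cocycles (fun_cochains B G actB) (fun_coboundary B) q;
      pull \<psi> A q c \<in> coboundaries (fun_cochains A G actA) (fun_coboundary A) q\<rbrakk> \<Longrightarrow>
      c \<in> coboundaries (fun_cochains B G actB) (fun_coboundary B) q"
    and "z \<in> complex.cocycles (fun_cochains A G actA) (fun_coboundary A) q \<Longrightarrow>
      \<exists>c\<in>complex.cocycles (fun_cochains B G actB) (fun_coboundary B) q.
        z \<otimes>\<^bsub>fun_cochains A G actA q\<^esub> inv\<^bsub>fun_cochains A G actA q\<^esub> pull \<psi> A q c
          \<in> coboundaries (fun_cochains A G actA) (fun_coboundary A) q"
proof -
  interpret \<psi>: complex_map "fun_cochains B G actB" "fun_coboundary B" "fun_cochains A G actA" "fun_coboundary A" "pull \<psi> A"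
    by (rule pull_complex_map[OF A B actA actB \<psi>])
  interpret \<phi>: complex_map "fun_cochains A G actA" "fun_coboundary A" "fun_cochains B G actB" "fun_coboundary B" "pull \<phi> B"
    by (rule pull_complex_map[OF B A actB actA \<phi>])
  note idA = chain_map_id[OF A, of G actA] and idB = chain_map_id[OF B, of G actB]
  note compA = chain_map_compose[OF A B \<psi> \<phi>] and compB = chain_map_compose[OF B A \<phi> \<psi>]
  {
    assume c: "c \<in> \<psi>.source.cocycles q" and b: "pull \<psi> A q c \<in> \<psi>.target.B q"
    then have cc: "c \<in> carrier (fun_cochains B G actB q)" "fun_coboundary B q c = \<one>\<^bsub>fun_cochains B G actB (Suc q)\<^esub>"
      by (auto simp: \<psi>.source.cocycles_def)
    let ?y = "pull \<phi> B q (pull \<psi> A q c)"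
    have y: "?y \<in> \<psi>.source.B q" by (rule \<phi>.map_coboundaries[OF b])
    have "c \<otimes>\<^bsub>fun_cochains B G actB q\<^esub> inv\<^bsub>fun_cochains B G actB q\<^esub> ?y \<in> \<psi>.source.B q"
      using pull_homotopic[OF B B actB actB idB compB E cc]
      unfolding pull_unit_chain[OF cc(1)] pull_compose[OF \<phi> \<psi> cc(1)] .
    then have "c \<otimes>\<^bsub>fun_cochains B G actB q\<^esub> inv\<^bsub>fun_cochains B G actB q\<^esub> ?y \<otimes>\<^bsub>fun_cochains B G actB q\<^esub> ?y \<in> \<psi>.source.B q"
      by (rule subgroup.m_closed[OF \<psi>.source.coboundaries_subgroup _ y])
    moreover have "c \<otimes>\<^bsub>fun_cochains B G actB q\<^esub> inv\<^bsub>fun_cochains B G actB q\<^esub> ?y \<otimes>\<^bsub>fun_cochains B G actB q\<^esub> ?y = c"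
      using cc(1) subgroup.mem_carrier[OF \<psi>.source.coboundaries_subgroup y]
      by (simp add: \<psi>.source.C.m_assoc del: fun_cochains_simps)
    ultimately show "c \<in> \<psi>.source.B q" by simp
  next
    assume z: "z \<in> \<psi>.target.cocycles q"
    then have zc: "z \<in> carrier (fun_cochains A G actA q)" "fun_coboundary A q z = \<one>\<^bsub>fun_cochains A G actA (Suc q)\<^esub>"
      by (auto simp: \<psi>.target.cocycles_def)
    have "z \<otimes>\<^bsub>fun_cochains A G actA q\<^esub> inv\<^bsub>fun_cochains A G actA q\<^esub> pull \<psi> A q (pull \<phi> B q z) \<in> \<psi>.target.B q"
      using pull_homotopic[OF A A actA actA idA compA D zc]
      unfolding pull_unit_chain[OF zc(1)] pull_compose[OF \<psi> \<phi> zc(1)] .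
    then show "\<exists>c\<in>\<psi>.source.cocycles q. z \<otimes>\<^bsub>fun_cochains A G actA q\<^esub> inv\<^bsub>fun_cochains A G actA q\<^esub> pull \<psi> A q c
          \<in> \<psi>.target.B q"
      using \<phi>.map_cocycles[OF z] by blast
  }
qed

end

section \<open>Oriented chains of a complex with vertex types\<close>

text \<open>Links the recursion to the alternating sums in \<open>simplex_boundary\<close> and
  \<open>group_coboundary\<close>.\<close>

lemma face_omit: "face xs = (\<Sum>i<length xs. cscale ((-1) ^ i) (unit_chain (omit i xs)))"
proof (induction xs)
  case (Cons x xs)
  have "prepend x (face xs) = (\<Sum>i<length xs. cscale ((-1) ^ i) (unit_chain (x # omit i xs)))"
    unfolding Cons prepend_def by (simp add: lext_sum)
  moreover have "omit (Suc i) (x # xs) = x # omit i xs" "omit 0 (x # xs) = xs" for i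
    by (simp_all add: omit_def)
  ultimately show ?case by (simp add: sum.lessThan_Suc_shift sum_negf single_uminus del: sum.lessThan_Suc)
qed simp

text \<open>Oriented chains have integer coefficients, chains on lists rational ones.\<close>

definition of_int_chain :: "('b \<Rightarrow>\<^sub>0 int) \<Rightarrow> ('b \<Rightarrow>\<^sub>0 rat)" where
  "of_int_chain x = Poly_Mapping.map of_int x"

lemma lookup_of_int_chain [simp]: "Poly_Mapping.lookup (of_int_chain x) b = of_int (Poly_Mapping.lookup x b)"
  by (simp add: of_int_chain_def Poly_Mapping.map.rep_eq when_def)

lemma of_int_chain_linear:
  "of_int_chain (x + y) = of_int_chain x + of_int_chain y" "of_int_chain (x - y) = of_int_chain x - of_int_chain y"
  "of_int_chain 0 = 0" "of_int_chain (frag_of b) = unit_chain b"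
  "of_int_chain (frag_cmul c x) = cscale (of_int c) (of_int_chain x)" "of_int_chain (- x) = - of_int_chain x"
  by (auto intro!: poly_mapping_eqI simp: lookup_add lookup_minus lookup_single when_def lookup_frag_cmul)

lemma of_int_chain_sum: "of_int_chain (sum f A) = (\<Sum>a\<in>A. of_int_chain (f a))"
  by (induction A rule: infinite_finite_induct) (auto simp: of_int_chain_linear)

lemma coeff_ring_Ints: "coeff_ring \<int>"
  by standard auto

lemma orientation_self: "vs \<in> orientation vs"
proof -
  have "vs = permute_list id vs" by (simp add: permute_list_def map_nth)
  then show ?thesis unfolding orientation_def using permutes_id evenperm_id by blast
qed

lemma orientation_even:
  assumes \<pi>: "\<pi> permutes {..<length vs}" "evenperm \<pi>"
  shows "orientation (permute_list \<pi> vs) = orientation vs"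
proof -
  have perm: "permutation \<rho>" if "\<rho> permutes {..<length vs}" for \<rho> using that permutation_permutes by blast
  have sub: "orientation (permute_list \<rho> ws) \<subseteq> orientation ws"
    if \<rho>: "\<rho> permutes {..<length ws}" "evenperm \<rho>" and len: "length ws = length vs" for \<rho> ws
  proof
    fix us assume "us \<in> orientation (permute_list \<rho> ws)"
    then obtain \<tau> where \<tau>: "\<tau> permutes {..<length ws}" "evenperm \<tau>" "us = permute_list \<tau> (permute_list \<rho> ws)"
      by (auto simp: orientation_def)
    have "us = permute_list (\<rho> \<circ> \<tau>) ws" using permute_list_compose[OF \<tau>(1)] \<tau>(3) by simp
    moreover have "evenperm (\<rho> \<circ> \<tau>)" using \<rho> \<tau> len by (simp add: evenperm_comp perm)
    moreover have "\<rho> \<circ> \<tau> permutes {..<length ws}" using \<rho> \<tau> by (simp add: permutes_compose)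
    ultimately show "us \<in> orientation ws" unfolding orientation_def by blast
  qed
  let ?\<pi> = "inv_into UNIV \<pi>"
  have i: "?\<pi> permutes {..<length vs}" "evenperm ?\<pi>"
    using \<pi> permutes_inv[OF \<pi>(1)] evenperm_inv[OF perm[OF \<pi>(1)]] by simp_all
  have "permute_list ?\<pi> (permute_list \<pi> vs) = permute_list (\<pi> \<circ> ?\<pi>) vs"
    using permute_list_compose[OF i(1)] by simp
  also have "\<pi> \<circ> ?\<pi> = id" using permutes_inv_o(1)[OF \<pi>(1)] .
  finally have "vs = permute_list ?\<pi> (permute_list \<pi> vs)" by (simp add: permute_list_def map_nth id_def)
  then have "orientation vs \<subseteq> orientation (permute_list \<pi> vs)" using sub[of ?\<pi> "permute_list \<pi> vs"] i by simp
  then show ?thesis using sub[of \<pi> vs] \<pi> by blast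
qed

lemma permute_list_of_same_set:
  assumes "distinct vs" "distinct ws" "set vs = set ws"
  obtains \<pi> where "\<pi> permutes {..<length vs}" "ws = permute_list \<pi> vs"
proof -
  have "mset ws = mset vs" using assms by (simp add: set_eq_iff_mset_eq_distinct)
  then show thesis using mset_eq_permutation[of ws vs] that by metis
qed

text \<open>A simplicial complex with a colouring of its vertices that is injective on each simplex;
  listing the vertices by colour gives every simplex a preferred ordering.\<close>

locale typed_complex =
  fixes \<Delta> :: "'v set set" and k :: "'v \<Rightarrow> int"
  assumes faces: "\<sigma> \<in> \<Delta> \<Longrightarrow> \<tau> \<subseteq> \<sigma> \<Longrightarrow> \<tau> \<noteq> {} \<Longrightarrow> \<tau> \<in> \<Delta>"
    and type_inj: "\<sigma> \<in> \<Delta> \<Longrightarrow> inj_on k \<sigma>"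
begin

definition typed_lists :: "'v list set" where
  "typed_lists = {xs. ascending k xs \<and> (xs = [] \<or> set xs \<in> \<Delta>)}"

abbreviation FA where "FA q \<equiv> free_Abelian_group (oriented_simplices \<Delta> q)"
abbreviation N where "N q \<equiv> orientation_relations \<Delta> q"
abbreviation sorted_simplices where "sorted_simplices q \<equiv> deg typed_lists (Suc q)"

definition simplex_list :: "nat \<Rightarrow> 'v list \<Rightarrow> bool" where
  "simplex_list q vs \<longleftrightarrow> length vs = Suc q \<and> distinct vs \<and> set vs \<in> \<Delta>"

text \<open>The members of an orientation differ by even permutations, so they all have the same
  signed sorting and any of them may be chosen.\<close>

definition sort_oriented :: "'v list set \<Rightarrow> ('v list \<Rightarrow>\<^sub>0 rat)" where
  "sort_oriented \<sigma> = sortc k (SOME vs. vs \<in> \<sigma>)"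

definition sort_chain :: "('v list set \<Rightarrow>\<^sub>0 int) \<Rightarrow> ('v list \<Rightarrow>\<^sub>0 rat)" where
  "sort_chain x = lext sort_oriented (of_int_chain x)"

lemma sort_chain_linear:
  "sort_chain (x + y) = sort_chain x + sort_chain y" "sort_chain (x - y) = sort_chain x - sort_chain y"
  "sort_chain 0 = 0" "sort_chain (frag_of \<sigma>) = sort_oriented \<sigma>"
  "sort_chain (frag_cmul c x) = cscale (of_int c) (sort_chain x)" "sort_chain (- x) = - sort_chain x"
  "sort_chain (sum f A) = (\<Sum>a\<in>A. sort_chain (f a))"
  by (simp_all add: sort_chain_def of_int_chain_linear of_int_chain_sum lext_add lext_diff lext_scale lext_uminus lext_sum)

lemma oriented_simplices_iff: "\<sigma> \<in> oriented_simplices \<Delta> q \<longleftrightarrow> (\<exists>vs. \<sigma> = orientation vs \<and> simplex_list q vs)"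
  by (auto simp: oriented_simplices_def simplex_list_def)

lemma orientation_sortc: "ws \<in> orientation vs \<Longrightarrow> sortc k ws = sortc k vs"
  by (auto simp: orientation_def sortc_permute_list sign_def)

lemma sort_oriented_orientation [simp]: "sort_oriented (orientation vs) = sortc k vs"
  unfolding sort_oriented_def by (rule orientation_sortc, rule someI, rule orientation_self)

lemma sorted_simplices_list: "s \<in> sorted_simplices q \<Longrightarrow> simplex_list q s"
proof -
  assume s: "s \<in> sorted_simplices q"
  then have "distinct (map k s)" by (auto simp: deg_def typed_lists_def strict_sorted_iff)
  then show ?thesis using s by (auto simp: deg_def typed_lists_def simplex_list_def distinct_map)
qed

lemma sort_simplex_list:
  assumes vs: "simplex_list q vs"
  obtains s \<pi> where "s \<in> sorted_simplices q" "\<pi> permutes {..<length vs}" "s = permute_list \<pi> vs"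
proof -
  let ?s = "sort_key k vs"
  have inj: "inj_on k (set vs)" using vs type_inj by (simp add: simplex_list_def)
  have "distinct (map k ?s)" using vs inj by (simp add: simplex_list_def distinct_map)
  then have "ascending k ?s" by (simp add: strict_sorted_iff)
  then have "?s \<in> sorted_simplices q" using vs by (simp add: deg_def typed_lists_def simplex_list_def)
  moreover obtain \<pi> where "\<pi> permutes {..<length vs}" "?s = permute_list \<pi> vs"
    using permute_list_of_same_set[of vs ?s] vs by (auto simp: simplex_list_def)
  ultimately show thesis by (rule that)
qed

lemma sortc_sorted: "s \<in> sorted_simplices q \<Longrightarrow> sortc k s = unit_chain s"
  by (rule sortc_ascending) (simp add: deg_def typed_lists_def)

lemma FA_simps: "x \<in> carrier (FA q) \<longleftrightarrow> Poly_Mapping.keys x \<subseteq> oriented_simplices \<Delta> q"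
  by (simp add: carrier_free_Abelian_group_iff)

lemma N_subgroup: "subgroup (N q) (FA q)"
  unfolding orientation_relations_def
proof (rule group.generate_is_subgroup)
  show "group (FA q)" by simp
  show "{frag_of \<sigma> + frag_of \<tau> |\<sigma> \<tau>. q \<noteq> 0 \<and> \<sigma> \<in> oriented_simplices \<Delta> q \<and> \<tau> \<in> oriented_simplices \<Delta> q \<and>
      \<sigma> \<noteq> \<tau> \<and> underlying_simplex \<sigma> = underlying_simplex \<tau>} \<subseteq> carrier (FA q)"
    using keys_add by (force simp: FA_simps)
qed

lemma N_add: "a \<in> N q \<Longrightarrow> b \<in> N q \<Longrightarrow> a + b \<in> N q"
  using subgroup.m_closed[OF N_subgroup] by simp

lemma N_uminus: "a \<in> N q \<Longrightarrow> - a \<in> N q"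
  using subgroup.m_inv_closed[OF N_subgroup, of a q] subgroup.mem_carrier[OF N_subgroup, of a q] by simp

lemma N_diff: "a \<in> N q \<Longrightarrow> b \<in> N q \<Longrightarrow> a - b \<in> N q"
  using N_add[of a q "- b"] N_uminus by simp

lemma N_zero: "0 \<in> N q"
  using subgroup.one_closed[OF N_subgroup] by simp

lemma underlying_orientation: "underlying_simplex (orientation vs) = set vs"
proof -
  have "set ws = set vs" if "ws \<in> orientation vs" for ws using that by (auto simp: orientation_def)
  then have "underlying_simplex (orientation vs) = (\<Union>ws\<in>orientation vs. set vs)"
    unfolding underlying_simplex_def by (intro SUP_cong refl) simp
  moreover have "orientation vs \<noteq> {}" using orientation_self[of vs] by blast
  ultimately show ?thesis by simp
qed

lemma unit_neq_uminus: "unit_chain s \<noteq> - unit_chain s"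
  by (metis lookup_single_eq lookup_uminus one_neq_neg_one)

text \<open>The permutation that sorts \<open>vs\<close> is even or odd. In the even case both lists
  have one orientation; in the odd case the orientations are opposite, and their sum is one of the
  relations.\<close>

lemma orientation_class:
  assumes vs: "simplex_list q vs"
  shows "\<exists>s\<in>sorted_simplices q. (sortc k vs = unit_chain s \<and> frag_of (orientation vs) - frag_of (orientation s) \<in> N q) \<or>
    (sortc k vs = - unit_chain s \<and> frag_of (orientation vs) + frag_of (orientation s) \<in> N q)"
proof -
  obtain s \<pi> where s: "s \<in> sorted_simplices q" and \<pi>: "\<pi> permutes {..<length vs}" "s = permute_list \<pi> vs"
    using sort_simplex_list[OF vs] by blast
  have sl: "simplex_list q s" by (rule sorted_simplices_list[OF s])
  have su: "unit_chain s = cscale (of_int (sign \<pi>)) (sortc k vs)"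
    using sortc_sorted[OF s] sortc_permute_list[OF \<pi>(1), of k] \<pi>(2) by simp
  show ?thesis
  proof (cases "evenperm \<pi>")
    case True
    then have "orientation s = orientation vs" using orientation_even \<pi> by simp
    then have "sortc k vs = unit_chain s \<and> frag_of (orientation vs) - frag_of (orientation s) \<in> N q"
      using su True N_zero[of q] by (simp add: sign_def)
    then show ?thesis using s by blast
  next
    case False
    then have neg: "sortc k vs = - unit_chain s" using su by (simp add: sign_def)
    \<comment> \<open>The relations are imposed only in positive dimension, and a single vertex has
      no odd permutation.\<close>
    have q0: "q \<noteq> 0"
    proof
      assume "q = 0"
      then have "\<pi> permutes {0}" using \<pi>(1) vs by (simp add: simplex_list_def lessThan_Suc)
      then show False using False by (simp add: permutes_sing)
    qed
    have ne: "orientation vs \<noteq> orientation s"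
    proof
      assume "orientation vs = orientation s"
      then have "sortc k vs = sortc k s" by (metis sort_oriented_orientation)
      then show False using neg sortc_sorted[OF s] unit_neq_uminus by metis
    qed
    have un: "underlying_simplex (orientation vs) = underlying_simplex (orientation s)"
      using \<pi> by (simp add: underlying_orientation)
    have o: "orientation vs \<in> oriented_simplices \<Delta> q" "orientation s \<in> oriented_simplices \<Delta> q"
      using vs sl oriented_simplices_iff by blast+
    have "frag_of (orientation vs) + frag_of (orientation s) \<in> N q"
      unfolding orientation_relations_def
      by (intro generate.incl CollectI exI conjI) (rule refl q0 o ne un)+
    then show ?thesis using s neg by blast
  qed
qed

text \<open>Different orientations of one simplex are related by an odd permutation, so their signed
  sortings cancel.\<close>

lemma sort_chain_N: "n \<in> N q \<Longrightarrow> sort_chain n = 0"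
  unfolding orientation_relations_def
proof (induction rule: generate.induct)
  have gen: "sort_chain h = 0" if "h \<in> {frag_of \<sigma> + frag_of \<tau> |\<sigma> \<tau>. q \<noteq> 0 \<and> \<sigma> \<in> oriented_simplices \<Delta> q \<and>
      \<tau> \<in> oriented_simplices \<Delta> q \<and> \<sigma> \<noteq> \<tau> \<and> underlying_simplex \<sigma> = underlying_simplex \<tau>}" for h
  proof -
    note h_in = that
    obtain \<sigma> \<tau> where st: "h = frag_of \<sigma> + frag_of \<tau>" "\<sigma> \<in> oriented_simplices \<Delta> q" "\<tau> \<in> oriented_simplices \<Delta> q"
        "\<sigma> \<noteq> \<tau>" "underlying_simplex \<sigma> = underlying_simplex \<tau>"
      using h_in by blast
    obtain vs ws where vw: "\<sigma> = orientation vs" "simplex_list q vs" "\<tau> = orientation ws" "simplex_list q ws"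
      using st(2,3) unfolding oriented_simplices_iff by blast
    have h: "h = frag_of (orientation vs) + frag_of (orientation ws)" "simplex_list q vs" "simplex_list q ws"
        "orientation vs \<noteq> orientation ws" "set vs = set ws"
      using st vw by (simp_all add: underlying_orientation)
    obtain \<pi> where \<pi>: "\<pi> permutes {..<length vs}" "ws = permute_list \<pi> vs"
      using permute_list_of_same_set[of vs ws] h by (auto simp: simplex_list_def)
    have "\<not> evenperm \<pi>" using orientation_even[OF \<pi>(1)] h(4) \<pi>(2) by auto
    then have "sortc k ws = - sortc k vs" using sortc_permute_list[OF \<pi>(1), of k] \<pi>(2) by (simp add: sign_def)
    then show ?thesis by (simp add: h(1) sort_chain_linear)
  qed
  {
    case one
    show ?case by (simp add: sort_chain_linear)
  next
    case (incl h)
    then show ?case by (rule gen)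
  next
    case (inv h)
    have "h \<in> carrier (FA q)" using inv keys_add by (force simp: FA_simps)
    then show ?case using gen[OF inv] by (simp add: sort_chain_linear)
  next
    case (eng h1 h2)
    then show ?case by (simp add: sort_chain_linear)
  }
qed

lemma sort_chain_chains: "x \<in> carrier (FA q) \<Longrightarrow> sort_chain x \<in> chains \<int> (sorted_simplices q)"
  unfolding FA_simps
proof (induction rule: frag_induction)
  case zero
  show ?case using coeff_ring.zero_chains[OF coeff_ring_Ints] by (simp add: sort_chain_linear)
next
  case (one \<sigma>)
  then obtain vs where vs: "\<sigma> = orientation vs" "simplex_list q vs" by (auto simp: oriented_simplices_iff)
  then obtain s where s: "s \<in> sorted_simplices q" "sortc k vs = unit_chain s \<or> sortc k vs = - unit_chain s"
    using orientation_class[of q vs] by blast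
  note u = coeff_ring.unit_chains[OF coeff_ring_Ints s(1)]
  show ?case using s(2) u coeff_ring.uminus_chains[OF coeff_ring_Ints u]
    by (auto simp: sort_chain_linear vs(1))
next
  case (diff a b)
  then show ?case using coeff_ring.diff_chains[OF coeff_ring_Ints] by (simp add: sort_chain_linear)
qed

lemma frag_of_oriented: "simplex_list q vs \<Longrightarrow> frag_of (orientation vs) \<in> carrier (FA q)"
  by (auto simp: FA_simps oriented_simplices_iff)

text \<open>On integral chains, \<open>T\<close> inverts \<open>sort_chain\<close> modulo the relations.\<close>

lemma sort_chain_zero: "x \<in> carrier (FA q) \<Longrightarrow> sort_chain x = 0 \<Longrightarrow> x \<in> N q"
proof -
  \<comment> \<open>The image of \<open>sort_chain\<close> consists of rational coefficients that
    are integers, and \<open>floor\<close> brings them back to type \<open>int\<close>. It is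
    additive on integral chains, whence the assumptions in \<open>Td\<close>.\<close>
  define T where "T z = frag_extend (\<lambda>s. frag_of (orientation s)) (Poly_Mapping.map floor z)" for z :: "'v list \<Rightarrow>\<^sub>0 rat"
  have lm: "Poly_Mapping.lookup (Poly_Mapping.map floor z) b = \<lfloor>Poly_Mapping.lookup z b\<rfloor>" for z :: "'v list \<Rightarrow>\<^sub>0 rat" and b
    by (simp add: Poly_Mapping.map.rep_eq when_def)
  have T0: "T 0 = 0" and T1: "T (unit_chain s) = frag_of (orientation s)"
    and Tm: "T (- unit_chain s) = - frag_of (orientation s)" for s
  proof -
    have "Poly_Mapping.map floor (0 :: 'v list \<Rightarrow>\<^sub>0 rat) = 0" by (rule poly_mapping_eqI) (simp add: lm)
    then show "T 0 = 0" by (simp add: T_def)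
    have "Poly_Mapping.map floor (unit_chain s) = frag_of s"
      by (rule poly_mapping_eqI) (simp add: lm lookup_single when_def)
    then show "T (unit_chain s) = frag_of (orientation s)" by (simp add: T_def)
    have "\<lfloor>- 1 :: rat\<rfloor> = - 1" using floor_of_int[of "- 1", where 'a = rat] by simp
    then have "Poly_Mapping.map floor (- unit_chain s) = - frag_of s"
      by (intro poly_mapping_eqI) (simp add: lm lookup_single when_def)
    then show "T (- unit_chain s) = - frag_of (orientation s)" by (simp add: T_def frag_extend_minus)
  qed
  have Td: "T (y - z) = T y - T z" if yz: "y \<in> chains \<int> A" "z \<in> chains \<int> A" for y z A
  proof -
    have "Poly_Mapping.map floor (y - z) = Poly_Mapping.map floor y - Poly_Mapping.map floor z"
    proof (rule poly_mapping_eqI)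
      fix b
      have "Poly_Mapping.lookup y b \<in> \<int>" "Poly_Mapping.lookup z b \<in> \<int>" using yz by (simp_all add: chains_def)
      then obtain m n where "Poly_Mapping.lookup y b = of_int m" "Poly_Mapping.lookup z b = of_int n"
        by (meson Ints_cases)
      then show "Poly_Mapping.lookup (Poly_Mapping.map floor (y - z)) b =
          Poly_Mapping.lookup (Poly_Mapping.map floor y - Poly_Mapping.map floor z) b"
        by (simp add: lm lookup_minus flip: of_int_diff)
    qed
    then show ?thesis by (simp add: T_def frag_extend_diff)
  qed
  have "x - T (sort_chain x) \<in> N q" if "Poly_Mapping.keys x \<subseteq> oriented_simplices \<Delta> q" for x
  proof -
    have "x - T (sort_chain x) \<in> N q \<and> sort_chain x \<in> chains \<int> (sorted_simplices q)"
      using that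
    proof (induction rule: frag_induction)
      case zero
      show ?case using N_zero coeff_ring.zero_chains[OF coeff_ring_Ints] by (simp add: sort_chain_linear T0)
    next
      case (one \<sigma>)
      then have c: "sort_chain (frag_of \<sigma>) \<in> chains \<int> (sorted_simplices q)"
        by (intro sort_chain_chains) (simp add: FA_simps)
      obtain vs where \<sigma>: "\<sigma> = orientation vs" "simplex_list q vs" using one by (auto simp: oriented_simplices_iff)
      then show ?case using orientation_class[OF \<sigma>(2)] c by (auto simp: sort_chain_linear T1 Tm)
    next
      case (diff a b)
      have n: "(a - T (sort_chain a)) - (b - T (sort_chain b)) \<in> N q" by (rule N_diff) (use diff in simp_all)
      have c: "sort_chain a \<in> chains \<int> (sorted_simplices q)" "sort_chain b \<in> chains \<int> (sorted_simplices q)"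
        using diff by simp_all
      have eq: "a - b - T (sort_chain (a - b)) = (a - T (sort_chain a)) - (b - T (sort_chain b))"
        using Td[OF c] by (simp add: sort_chain_linear)
      have "sort_chain (a - b) \<in> chains \<int> (sorted_simplices q)"
        unfolding sort_chain_linear(2) by (rule coeff_ring.diff_chains[OF coeff_ring_Ints c])
      then show ?case using n by (simp only: eq simp_thms)
    qed
    then show ?thesis by blast
  qed
  note key = this[of x]
  assume x: "x \<in> carrier (FA q)" "sort_chain x = 0"
  then have "x - T 0 \<in> N q" using key by (simp only: FA_simps)
  then show "x \<in> N q" by (simp only: T0 diff_zero)
qed

definition coset :: "nat \<Rightarrow> ('v list set \<Rightarrow>\<^sub>0 int) \<Rightarrow> ('v list set \<Rightarrow>\<^sub>0 int) set" where
  "coset q x = N q #>\<^bsub>FA q\<^esub> x"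

lemma coset_mem: "y \<in> coset q x \<longleftrightarrow> y - x \<in> N q"
  unfolding coset_def r_coset_def by (auto intro!: bexI[of _ "y - x"])

lemma coset_self: "x \<in> coset q x"
  by (simp add: coset_mem N_zero)

lemma carrier_oriented_chains: "carrier (oriented_chains \<Delta> q) = coset q ` carrier (FA q)"
  by (auto simp: oriented_chains_def FactGroup_def RCOSETS_def coset_def)

text \<open>The kernel of \<open>sort_chain\<close> is exactly the group of relations, so sorted
  chains are faithful coordinates on the quotient.\<close>

lemma coset_eq_iff:
  assumes "x \<in> carrier (FA q)" "y \<in> carrier (FA q)"
  shows "coset q x = coset q y \<longleftrightarrow> sort_chain x = sort_chain y"
proof
  assume "coset q x = coset q y"
  then have "x - y \<in> N q" using coset_self[of x q] by (simp add: coset_mem)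
  then show "sort_chain x = sort_chain y" using sort_chain_N[of "x - y" q] by (simp add: sort_chain_linear)
next
  assume eq: "sort_chain x = sort_chain y"
  have "x - y \<in> carrier (FA q)" using assms keys_diff[of x y] by (auto simp: FA_simps)
  then have n: "x - y \<in> N q" using eq by (intro sort_chain_zero) (simp_all add: sort_chain_linear)
  show "coset q x = coset q y"
  proof (intro equalityI subsetI)
    fix z assume "z \<in> coset q x"
    then show "z \<in> coset q y" using N_add[OF _ n, of "z - x"] by (simp add: coset_mem)
  next
    fix z assume "z \<in> coset q y"
    then show "z \<in> coset q x" using N_diff[OF _ n, of "z - y"] by (simp add: coset_mem)
  qed
qed

lemma coset_chain: "x \<in> carrier (FA q) \<Longrightarrow> y \<in> coset q x \<Longrightarrow> y \<in> carrier (FA q) \<and> sort_chain y = sort_chain x"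
proof -
  assume x: "x \<in> carrier (FA q)" and y: "y \<in> coset q x"
  have n: "y - x \<in> N q" using y by (simp add: coset_mem)
  have "y = (y - x) + x" by simp
  then have "y \<in> carrier (FA q)"
    using subgroup.mem_carrier[OF N_subgroup n] x keys_add[of "y - x" x] by (auto simp: FA_simps)
  then show ?thesis using sort_chain_N[OF n] by (simp add: sort_chain_linear)
qed

lemma mult_oriented_chains:
  "x \<in> carrier (FA q) \<Longrightarrow> y \<in> carrier (FA q) \<Longrightarrow>
    coset q x \<otimes>\<^bsub>oriented_chains \<Delta> q\<^esub> coset q y = coset q (x + y)"
proof -
  assume xy: "x \<in> carrier (FA q)" "y \<in> carrier (FA q)"
  have "comm_group (FA q)" by (simp add: abelian_free_Abelian_group)
  then have "N q \<lhd> FA q" using comm_group.subgroup_imp_normal N_subgroup by blast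
  then show ?thesis
    using normal.rcos_sum[of "N q" "FA q" x y] xy by (simp add: oriented_chains_def FactGroup_def coset_def)
qed

lemma FA_add: "x \<in> carrier (FA q) \<Longrightarrow> y \<in> carrier (FA q) \<Longrightarrow> x + y \<in> carrier (FA q)"
  using keys_add[of x y] by (auto simp: FA_simps)

text \<open>A map of free groups that is expressed by some \<theta> on sorted chains is compatible
  with the relations, and the union in \<open>quot_map\<close> is then a single coset.\<close>

lemma quot_map_coset:
  assumes x: "x \<in> carrier (FA m)"
    and \<phi>: "\<And>y. y \<in> carrier (FA m) \<Longrightarrow> \<phi> y \<in> carrier (FA q) \<and> sort_chain (\<phi> y) = \<theta> (sort_chain y)"
  shows "quot_map (FA q) (N q) \<phi> (coset m x) = coset q (\<phi> x)"
proof -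
  have "coset q (\<phi> y) = coset q (\<phi> x)" if "y \<in> coset m x" for y
    using coset_chain[OF x that] \<phi> x by (subst coset_eq_iff) auto
  then have "(\<Union>y\<in>coset m x. coset q (\<phi> y)) = coset q (\<phi> x)" using coset_self by blast
  then show ?thesis by (simp add: quot_map_def coset_def)
qed

lemma frag_extend_carrier:
  "(\<And>\<sigma>. \<sigma> \<in> oriented_simplices \<Delta> m \<Longrightarrow> h \<sigma> \<in> carrier (FA q) \<and> sort_chain (h \<sigma>) = \<theta> (sort_oriented \<sigma>)) \<Longrightarrow>
    \<theta> 0 = 0 \<Longrightarrow> (\<And>a b. \<theta> (a - b) = \<theta> a - \<theta> b) \<Longrightarrow> x \<in> carrier (FA m) \<Longrightarrow>
    frag_extend h x \<in> carrier (FA q) \<and> sort_chain (frag_extend h x) = \<theta> (sort_chain x)"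
  unfolding FA_simps[of x m]
proof (rotate_tac 3, induction rule: frag_induction)
  case zero
  then show ?case by (simp add: sort_chain_linear FA_simps)
next
  case (one \<sigma>)
  then show ?case by (simp add: sort_chain_linear)
next
  case (diff a b)
  then have ab: "frag_extend h a \<in> carrier (FA q)" "sort_chain (frag_extend h a) = \<theta> (sort_chain a)"
    "frag_extend h b \<in> carrier (FA q)" "sort_chain (frag_extend h b) = \<theta> (sort_chain b)" by simp_all
  then show ?case
    using keys_diff[of "frag_extend h a" "frag_extend h b"] diff.prems(3)
    by (auto simp: frag_extend_diff sort_chain_linear FA_simps)
qed

lemma simplex_list_omit:
  assumes "simplex_list (Suc q) vs" "i < length vs"
  shows "simplex_list q (omit i vs)"
proof -
  have vs: "vs = take i vs @ vs ! i # drop (Suc i) vs" by (rule id_take_nth_drop[OF assms(2)])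
  have "distinct (take i vs @ vs ! i # drop (Suc i) vs)" using assms(1) vs by (simp add: simplex_list_def)
  then have d: "distinct (omit i vs)" by (simp add: omit_def)
  have l: "length (omit i vs) = Suc q" using assms by (simp add: omit_def simplex_list_def)
  have "set (omit i vs) \<subseteq> set vs" unfolding omit_def using set_take_subset set_drop_subset by fastforce
  moreover have "set (omit i vs) \<noteq> {}" using l by auto
  ultimately show ?thesis using d l assms(1) faces[of "set vs" "set (omit i vs)"] by (simp add: simplex_list_def)
qed

text \<open>Whichever ordering is picked in \<open>simplex_boundary\<close>, sorting its faces gives
  the boundary of the sorted simplex, by \<open>bd_sortc\<close>.\<close>

lemma simplex_boundary_sort:
  assumes "\<sigma> \<in> oriented_simplices \<Delta> (Suc q)"
  shows "simplex_boundary \<sigma> \<in> carrier (FA q) \<and> sort_chain (simplex_boundary \<sigma>) = bd (sort_oriented \<sigma>)"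
proof -
  obtain us where us: "\<sigma> = orientation us" "simplex_list (Suc q) us" using assms by (auto simp: oriented_simplices_iff)
  define vs where "vs = (SOME vs. vs \<in> \<sigma>)"
  have "vs \<in> \<sigma>" unfolding vs_def us(1) by (rule someI, rule orientation_self)
  then obtain \<pi> where "\<pi> permutes {..<length us}" "vs = permute_list \<pi> us" using us(1) by (auto simp: orientation_def)
  then have vs: "simplex_list (Suc q) vs" using us(2) by (simp add: simplex_list_def distinct_permute_list)
  have b: "simplex_boundary \<sigma> = (\<Sum>i<length vs. frag_cmul ((-1) ^ i) (frag_of (orientation (omit i vs))))"
    by (simp add: simplex_boundary_def vs_def Let_def)
  have "sort_chain (simplex_boundary \<sigma>) = lext (sortc k) (face vs)"
    unfolding b face_omit by (simp add: sort_chain_linear lext_sum)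
  also have "\<dots> = bd (sortc k vs)"
    using bd_sortc[of k vs] vs type_inj by (simp add: simplex_list_def)
  finally have "sort_chain (simplex_boundary \<sigma>) = bd (sort_oriented \<sigma>)" by (simp add: sort_oriented_def vs_def)
  moreover have "(\<Sum>i\<in>A. frag_cmul ((-1) ^ i) (frag_of (orientation (omit i vs)))) \<in> carrier (FA q)" if "A \<subseteq> {..<length vs}" for A
    using finite_subset[OF that finite_lessThan] that
  proof (induction A rule: finite_induct)
    case empty
    show ?case by (simp add: FA_simps)
  next
    case (insert i A)
    have "frag_of (orientation (omit i vs)) \<in> carrier (FA q)"
      using insert simplex_list_omit[OF vs] by (intro frag_of_oriented) auto
    then have "frag_cmul ((-1) ^ i) (frag_of (orientation (omit i vs))) \<in> carrier (FA q)"
      using keys_cmul by (fastforce simp: FA_simps)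
    then show ?case using insert FA_add by auto
  qed
  then have "simplex_boundary \<sigma> \<in> carrier (FA q)" unfolding b by blast
  ultimately show ?thesis by blast
qed

lemma oriented_boundary_coset:
  assumes "x \<in> carrier (FA (Suc q))"
  shows "\<exists>y\<in>carrier (FA q). oriented_boundary \<Delta> q (coset (Suc q) x) = coset q y \<and> sort_chain y = bd (sort_chain x)"
proof -
  have *: "frag_extend simplex_boundary z \<in> carrier (FA q) \<and> sort_chain (frag_extend simplex_boundary z) = bd (sort_chain z)"
    if "z \<in> carrier (FA (Suc q))" for z
    by (rule frag_extend_carrier[where \<theta> = bd, OF simplex_boundary_sort _ _ that]) (simp_all add: bd_linear)
  then show ?thesis
    unfolding oriented_boundary_def using quot_map_coset[where \<theta> = bd, OF assms *] *[OF assms] by blast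
qed

text \<open>A map that preserves types is injective on simplices and commutes with sorting, so no
  signs appear in its action on sorted chains.\<close>

lemma oriented_chain_map_coset:
  assumes x: "x \<in> carrier (FA q)"
    and \<alpha>: "\<And>\<sigma>. \<sigma> \<in> \<Delta> \<Longrightarrow> \<alpha> ` \<sigma> \<in> \<Delta>" "\<And>\<sigma> V. \<sigma> \<in> \<Delta> \<Longrightarrow> V \<in> \<sigma> \<Longrightarrow> k (\<alpha> V) = k V"
  shows "\<exists>y\<in>carrier (FA q). oriented_chain_map \<Delta> q \<alpha> (coset q x) = coset q y \<and> sort_chain y = mapc \<alpha> (sort_chain x)"
proof -
  have basis: "frag_of (map \<alpha> ` \<sigma>) \<in> carrier (FA q) \<and> sort_chain (frag_of (map \<alpha> ` \<sigma>)) = mapc \<alpha> (sort_oriented \<sigma>)"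
    if \<sigma>: "\<sigma> \<in> oriented_simplices \<Delta> q" for \<sigma>
  proof -
    obtain vs where vs: "\<sigma> = orientation vs" "simplex_list q vs" using \<sigma> by (auto simp: oriented_simplices_iff)
    have p: "map \<alpha> (permute_list \<pi> vs) = permute_list \<pi> (map \<alpha> vs)" if \<pi>: "\<pi> permutes {..<length vs}" for \<pi>
      by (rule permute_list_map[OF \<pi>, symmetric])
    have im: "map \<alpha> ` \<sigma> = orientation (map \<alpha> vs)"
    proof (intro equalityI subsetI)
      fix us assume "us \<in> map \<alpha> ` \<sigma>"
      then show "us \<in> orientation (map \<alpha> vs)" unfolding vs(1) using p by (auto simp: orientation_def)
    next
      fix us assume "us \<in> orientation (map \<alpha> vs)"
      then obtain \<pi> where \<pi>: "\<pi> permutes {..<length vs}" "evenperm \<pi>" "us = permute_list \<pi> (map \<alpha> vs)"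
        by (auto simp: orientation_def)
      have "permute_list \<pi> vs \<in> \<sigma>" using \<pi> unfolding vs(1) orientation_def by blast
      then show "us \<in> map \<alpha> ` \<sigma>" using p[OF \<pi>(1)] \<pi>(3) by (metis imageI)
    qed
    have D: "set vs \<in> \<Delta>" "distinct vs" using vs by (simp_all add: simplex_list_def)
    have "inj_on \<alpha> (set vs)"
    proof (rule inj_onI)
      fix V W assume VW: "V \<in> set vs" "W \<in> set vs" "\<alpha> V = \<alpha> W"
      then have "k V = k W" using \<alpha>(2)[OF D(1)] by metis
      then show "V = W" using inj_onD[OF type_inj[OF D(1)]] VW by blast
    qed
    then have "simplex_list q (map \<alpha> vs)" using vs(2) \<alpha>(1)[OF D(1)] by (simp add: simplex_list_def distinct_map)
    note c = frag_of_oriented[OF this]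
    have "sortc k (map \<alpha> vs) = mapc \<alpha> (sortc k vs)" by (rule sortc_mapc) (rule \<alpha>(2)[OF D(1)])
    then have "sort_chain (frag_of (orientation (map \<alpha> vs))) = mapc \<alpha> (sort_oriented \<sigma>)"
      by (simp add: sort_chain_linear vs(1))
    then show ?thesis unfolding im using c by blast
  qed
  have *: "frag_extend (\<lambda>\<sigma>. frag_of (map \<alpha> ` \<sigma>)) z \<in> carrier (FA q) \<and>
      sort_chain (frag_extend (\<lambda>\<sigma>. frag_of (map \<alpha> ` \<sigma>)) z) = mapc \<alpha> (sort_chain z)"
    if "z \<in> carrier (FA q)" for z
    by (rule frag_extend_carrier[where \<theta> = "mapc \<alpha>", OF basis _ _ that]) (simp_all add: mapc_linear)
  then show ?thesis
    unfolding oriented_chain_map_def using quot_map_coset[where \<theta> = "mapc \<alpha>", OF x *] *[OF x] by blast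
qed

lemma face_closed_typed_lists: "face_closed typed_lists"
  unfolding face_closed_def
proof (intro allI impI)
  fix us x vs assume *: "us @ x # vs \<in> typed_lists"
  then show "us @ vs \<in> typed_lists"
    using faces[of "set (us @ x # vs)" "set (us @ vs)"] by (auto simp: typed_lists_def sorted_wrt_append)
qed

end

subsection \<open>Transport of complexes along bijections\<close>

text \<open>\<open>U\<close> identifies a known complex with \<open>M\<close>, and \<open>T\<close>
  undoes it. The structure of a complex on homomorphisms out of quotients of free groups is obtained
  in this way from functions on lists.\<close>

locale complex_transport = complex C d for C :: "nat \<Rightarrow> 'b monoid" and d +
  fixes M :: "nat \<Rightarrow> 'c monoid" and e and U :: "nat \<Rightarrow> 'b \<Rightarrow> 'c" and T :: "nat \<Rightarrow> 'c \<Rightarrow> 'b"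
  assumes U_carrier: "carrier (M q) = U q ` carrier (C q)"
    and U_mult: "x \<in> carrier (C q) \<Longrightarrow> y \<in> carrier (C q) \<Longrightarrow> U q x \<otimes>\<^bsub>M q\<^esub> U q y = U q (x \<otimes>\<^bsub>C q\<^esub> y)"
    and U_one: "\<one>\<^bsub>M q\<^esub> = U q \<one>\<^bsub>C q\<^esub>"
    and U_d: "x \<in> carrier (C q) \<Longrightarrow> e q (U q x) = U (Suc q) (d q x)"
    and T_U: "x \<in> carrier (C q) \<Longrightarrow> T q (U q x) = x"
begin

lemma d_carrier: "x \<in> carrier (C q) \<Longrightarrow> d q x \<in> carrier (C (Suc q))"
  using hom_in_carrier[OF d_hom] .

lemma transported_complex: "complex M e"
proof
  have "comm_group (M q)" for q
  proof -
    have "U q \<in> hom (C q) (M q)" by (rule homI) (simp_all add: U_carrier U_mult)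
    then have "comm_group (M q\<lparr>carrier := U q ` carrier (C q), one := U q \<one>\<^bsub>C q\<^esub>\<rparr>)"
      by (rule C.hom_imp_img_comm_group)
    then show ?thesis by (simp flip: U_carrier U_one)
  qed
  moreover have "e q \<in> hom (M q) (M (Suc q))" for q
  proof (rule homI)
    fix x y assume "x \<in> carrier (M q)" "y \<in> carrier (M q)"
    then obtain x' y' where x': "x' \<in> carrier (C q)" "x = U q x'" "y' \<in> carrier (C q)" "y = U q y'"
      by (auto simp: U_carrier)
    then show "e q (x \<otimes>\<^bsub>M q\<^esub> y) = e q x \<otimes>\<^bsub>M (Suc q)\<^esub> e q y"
      using hom_mult[OF d_hom[of q], of x' y'] by (simp add: U_mult U_d d_carrier)
  qed (auto simp: U_carrier U_d d_carrier)
  moreover have "e (Suc q) (e q x) = \<one>\<^bsub>M (Suc (Suc q))\<^esub>" if "x \<in> carrier (M q)" for q x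
    using that by (auto simp: U_carrier U_d d_carrier d_d U_one)
  ultimately show "cochain_complex M e" unfolding cochain_complex_def by blast
qed

lemma transported_coboundaries: "coboundaries M e q = U q ` coboundaries C d q"
proof (cases q)
  case 0
  then show ?thesis by (simp add: coboundaries_def U_one)
next
  case (Suc m)
  then show ?thesis by (simp add: coboundaries_def U_carrier image_image U_d cong: image_cong_simp)
qed

lemma transported_cocycles: "x \<in> cocycles q \<Longrightarrow> U q x \<in> complex.cocycles M e q"
    "y \<in> complex.cocycles M e q \<Longrightarrow> \<exists>x\<in>cocycles q. y = U q x"
proof -
  interpret M: complex M e by (rule transported_complex)
  show "x \<in> cocycles q \<Longrightarrow> U q x \<in> M.cocycles q" by (auto simp: M.cocycles_def cocycles_def U_carrier U_d U_one)
  assume "y \<in> M.cocycles q"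
  then obtain x where x: "x \<in> carrier (C q)" "y = U q x" "e q y = \<one>\<^bsub>M (Suc q)\<^esub>"
    by (auto simp: M.cocycles_def U_carrier)
  then have "T (Suc q) (U (Suc q) (d q x)) = T (Suc q) (U (Suc q) \<one>\<^bsub>C (Suc q)\<^esub>)" by (simp add: U_d U_one)
  then have "d q x = \<one>\<^bsub>C (Suc q)\<^esub>" using x(1) by (simp add: T_U d_carrier)
  then show "\<exists>x\<in>cocycles q. y = U q x" using x by (auto simp: cocycles_def)
qed

lemma transported_map:
  assumes \<phi>: "complex_map C d C' d' \<phi>"
  shows "complex_map M e C' d' (\<lambda>q x. \<phi> q (T q x))"
proof -
  interpret \<phi>: complex_map C d C' d' \<phi> by (rule \<phi>)
  have "cochain_map M e C' d' (\<lambda>q x. \<phi> q (T q x))"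
    unfolding cochain_map_def
  proof (intro allI conjI ballI)
    show "(\<lambda>x. \<phi> q (T q x)) \<in> hom (M q) (C' q)" for q
      by (rule homI) (auto simp: U_carrier U_mult T_U \<phi>.map.hom_mult)
    show "\<phi> (Suc q) (T (Suc q) (e q x)) = d' q (\<phi> q (T q x))" if "x \<in> carrier (M q)" for q x
      using that by (auto simp: U_carrier U_d T_U d_carrier \<phi>.map_d)
  qed
  then show ?thesis using transported_complex \<phi>.target.complex_axioms
    by (simp add: complex_map_def complex_map_axioms_def)
qed

lemma transported_map_iso:
  assumes \<phi>: "complex_map C d C' d' \<phi>"
    and inj: "\<And>x. x \<in> cocycles q \<Longrightarrow> \<phi> q x \<in> coboundaries C' d' q \<Longrightarrow> x \<in> B q"
    and surj: "\<And>z. z \<in> complex.cocycles C' d' q \<Longrightarrow>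
      \<exists>x\<in>cocycles q. z \<otimes>\<^bsub>C' q\<^esub> inv\<^bsub>C' q\<^esub> \<phi> q x \<in> coboundaries C' d' q"
  shows "cohomology_map C' d' q (\<lambda>x. \<phi> q (T q x)) \<in> iso (cohomology M e q) (cohomology C' d' q)"
proof (rule complex_map.cohomology_map_iso[OF transported_map[OF \<phi>]])
  have car: "x \<in> cocycles q \<Longrightarrow> x \<in> carrier (C q)" for x by (simp add: cocycles_def)
  show "y \<in> coboundaries M e q" if y: "y \<in> complex.cocycles M e q" "\<phi> q (T q y) \<in> coboundaries C' d' q" for y
  proof -
    obtain x where x: "x \<in> cocycles q" "y = U q x" using transported_cocycles(2)[OF y(1)] by blast
    then have "x \<in> B q" using inj y(2) by (simp add: T_U car)
    then show ?thesis by (simp add: transported_coboundaries x(2))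
  qed
  show "\<exists>y\<in>complex.cocycles M e q. z \<otimes>\<^bsub>C' q\<^esub> inv\<^bsub>C' q\<^esub> \<phi> q (T q y) \<in> coboundaries C' d' q"
    if z: "z \<in> complex.cocycles C' d' q" for z
  proof -
    obtain x where x: "x \<in> cocycles q" "z \<otimes>\<^bsub>C' q\<^esub> inv\<^bsub>C' q\<^esub> \<phi> q x \<in> coboundaries C' d' q"
      using surj[OF z] by blast
    then show ?thesis using transported_cocycles(1)[OF x(1)] by (intro bexI[of _ "U q x"]) (simp_all add: T_U car)
  qed
qed

end

lemma complex_map_transport:
  assumes t1: "complex_transport C1 d1 M1 e1 U1 T1" and t2: "complex_transport C2 d2 M2 e2 U2 T2"
    and \<alpha>: "complex_map C1 d1 C2 d2 \<alpha>"
    and a: "\<And>q x. x \<in> carrier (C1 q) \<Longrightarrow> a q (U1 q x) = U2 q (\<alpha> q x)"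
  shows "complex_map M1 e1 M2 e2 a"
proof -
  interpret t1: complex_transport C1 d1 M1 e1 U1 T1 by (rule t1)
  interpret t2: complex_transport C2 d2 M2 e2 U2 T2 by (rule t2)
  interpret \<alpha>: complex_map C1 d1 C2 d2 \<alpha> by (rule \<alpha>)
  have "cochain_map M1 e1 M2 e2 a"
    unfolding cochain_map_def
  proof (intro allI conjI ballI)
    show "a q \<in> hom (M1 q) (M2 q)" for q
      by (rule homI) (auto simp: t1.U_carrier t2.U_carrier t1.U_mult t2.U_mult a \<alpha>.map.hom_mult)
    show "a (Suc q) (e1 q x) = e2 q (a q x)" if "x \<in> carrier (M1 q)" for q x
      using that by (auto simp: t1.U_carrier t1.U_d t2.U_d a t1.d_carrier \<alpha>.map_d)
  qed
  then show ?thesis using t1.transported_complex t2.transported_complex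
    by (simp add: complex_map_def complex_map_axioms_def)
qed

text \<open>Agreement is asked for on cochains only, because the two formulas for the coboundary on
  tuples are compared only there.\<close>

lemma coboundaries_cong:
  "(\<And>q x. x \<in> carrier (C q) \<Longrightarrow> d q x = d' q x) \<Longrightarrow> coboundaries C d q = coboundaries C d' q"
  by (auto simp: coboundaries_def)

lemma cohomology_cong:
  "(\<And>q x. x \<in> carrier (C q) \<Longrightarrow> d q x = d' q x) \<Longrightarrow> cohomology C d q = cohomology C d' q"
  unfolding cohomology_def using coboundaries_cong[of C d d' q] by (simp add: kernel_def cong: conj_cong)

lemma complex_map_cong:
  assumes eq: "\<And>q x. x \<in> carrier (C q) \<Longrightarrow> d q x = e q x" "\<And>q x. x \<in> carrier (C' q) \<Longrightarrow> d' q x = e' q x"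
    and \<phi>: "complex_map C d C' d' \<phi>"
  shows "complex_map C e C' e' \<phi>"
proof -
  interpret \<phi>: complex_map C d C' d' \<phi> by (rule \<phi>)
  have "complex_transport C d C e (\<lambda>q x. x) (\<lambda>q x. x)" "complex_transport C' d' C' e' (\<lambda>q x. x) (\<lambda>q x. x)"
    using \<phi>.source.complex_axioms \<phi>.target.complex_axioms eq
    by (simp_all add: complex_transport_def complex_transport_axioms_def)
  then show ?thesis by (rule complex_map_transport[OF _ _ \<phi>]) simp
qed

subsection \<open>Homogeneous cochains as functions on tuples\<close>

lemma group_tuples_eq: "group_tuples G q = deg (lists (carrier G)) (Suc q)"
  by (auto simp: group_tuples_def deg_def)

lemma omit_lists: "gs \<in> lists A \<Longrightarrow> omit i gs \<in> lists A"
  by (auto simp: omit_def dest: in_set_takeD in_set_dropD)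

lemma length_omit: "i < length gs \<Longrightarrow> length (omit i gs) = length gs - 1"
  by (simp add: omit_def)

context p_divisible_group
begin

lemma pair_sum_unit_chain:
  assumes "finite I" "\<And>i. i \<in> I \<Longrightarrow> b i \<in> B" and f: "f \<in> B \<rightarrow> carrier R"
  shows "pair f (\<Sum>i\<in>I. cscale (of_int (c i)) (unit_chain (b i))) = (\<Otimes>i\<in>I. f (b i) [^] (c i :: int)) \<and>
    (\<Sum>i\<in>I. cscale (of_int (c i)) (unit_chain (b i))) \<in> chains (p_fractions p) B"
  using assms(1,2)
proof (induction I rule: finite_induct)
  case empty
  show ?case by (simp add: zero_chains)
next
  case (insert i I)
  have fi: "f (b j) \<in> carrier R" if "j \<in> insert i I" for j using insert.prems[OF that] f by blast
  have bi: "unit_chain (b i) \<in> chains (p_fractions p) B" using insert.prems by (intro unit_chains) simp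
  have sc: "cscale (of_int (c i)) (unit_chain (b i)) \<in> chains (p_fractions p) B"
    by (rule scale_chains[OF of_int_p_fractions bi])
  have IH: "pair f (\<Sum>i\<in>I. cscale (of_int (c i)) (unit_chain (b i))) = (\<Otimes>i\<in>I. f (b i) [^] c i)"
    "(\<Sum>i\<in>I. cscale (of_int (c i)) (unit_chain (b i))) \<in> chains (p_fractions p) B"
    using insert by simp_all
  have "pair f (cscale (of_int (c i)) (unit_chain (b i))) = f (b i) [^] c i"
    using fi pair_scale[OF of_int_p_fractions bi f] by (simp add: frac_pow_of_int)
  moreover have "(\<Otimes>j\<in>insert i I. f (b j) [^] c j) = f (b i) [^] c i \<otimes> (\<Otimes>j\<in>I. f (b j) [^] c j)"
    using insert.hyps fi by (intro finprod_insert) auto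
  ultimately show ?case
    using insert.hyps IH pair_add[OF sc IH(2) f] add_chains[OF sc IH(2)] by simp
qed

text \<open>Serves both sides of naturality in the group: for simplices only the group shrinks, for
  tuples the lists shrink with it.\<close>

lemma restrict_complex_map:
  assumes B: "face_closed B" "face_closed B'" "B' \<subseteq> B" and G: "G' \<subseteq> G"
    and act: "\<And>g b. g \<in> G \<Longrightarrow> b \<in> B \<Longrightarrow> map (act g) b \<in> B" "\<And>g b. g \<in> G' \<Longrightarrow> b \<in> B' \<Longrightarrow> map (act g) b \<in> B'"
  shows "complex_map (fun_cochains B G act) (fun_coboundary B) (fun_cochains B' G' act) (fun_coboundary B')
    (\<lambda>q f. restrict f (deg B' (Suc q)))"
proof -
  have dg: "b \<in> deg B q" if "b \<in> deg B' q" for b q using that B(3) by (auto simp: deg_def)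
  have md: "map (act g) b \<in> deg B' q" if "g \<in> G'" "b \<in> deg B' q" for g b q using that act(2) by (auto simp: deg_def)
  have "cochain_map (fun_cochains B G act) (fun_coboundary B) (fun_cochains B' G' act) (fun_coboundary B')
    (\<lambda>q f. restrict f (deg B' (Suc q)))"
    unfolding cochain_map_def
  proof (intro allI conjI ballI)
    fix q
    show "(\<lambda>f. restrict f (deg B' (Suc q))) \<in> hom (fun_cochains B G act q) (fun_cochains B' G' act q)"
    proof (rule homI)
      fix f assume f: "f \<in> carrier (fun_cochains B G act q)"
      then have v: "f (map (act g) b) = f b" if "g \<in> G'" "b \<in> deg B' (Suc q)" for g b
        using that G dg by (auto simp: fun_cochains_carrier)
      have "f \<in> deg B' (Suc q) \<rightarrow> carrier R" using f dg by (auto simp: fun_cochains_carrier)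
      then show "restrict f (deg B' (Suc q)) \<in> carrier (fun_cochains B' G' act q)"
        using v md by (simp add: fun_cochains_carrier Pi_iff)
    qed (auto simp: dg intro!: restrict_ext)
    fix f assume f: "f \<in> carrier (fun_cochains B G act q)"
    then have f': "f \<in> deg B' (Suc q) \<rightarrow> carrier R" using dg by (auto simp: fun_cochains_carrier)
    have "pair f (face b) = pair (restrict f (deg B' (Suc q))) (face b)" if "b \<in> deg B' (Suc (Suc q))" for b
      by (rule pair_restrict[symmetric, OF face_chains[OF B(2) that] f'])
    then show "restrict (fun_coboundary B q f) (deg B' (Suc (Suc q))) = fun_coboundary B' q (restrict f (deg B' (Suc q)))"
      by (auto simp: fun_coboundary_def dg intro!: restrict_ext)
  qed
  then show ?thesis
    using fun_cochains_complex[where G = G and act = act, OF B(1) act(1)]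
      fun_cochains_complex[where G = G' and act = act, OF B(2) act(2)]
    by (simp add: complex_map_def complex_map_axioms_def)
qed


end

text \<open>Evaluation on \<open>face\<close> expands into the signed product over omitted entries,
  because integral scalars act as ordinary powers.\<close>

lemma group_coboundary_eq:
  fixes R :: "'r monoid" (structure)
  assumes R: "p_divisible_group R p" and f: "f \<in> deg (lists (carrier G)) (Suc q) \<rightarrow> carrier R"
  shows "p_divisible_group.fun_coboundary R p (lists (carrier G)) q f = group_coboundary G R q f"
proof -
  interpret p_divisible_group R p by (rule R)
  have "pair f (face gs) = (\<Otimes>i\<in>{..Suc q}. f (omit i gs) [^] ((-1) ^ i :: int))"
    if gs: "gs \<in> deg (lists (carrier G)) (Suc (Suc q))" for gs
  proof -
    have "omit i gs \<in> deg (lists (carrier G)) (Suc q)" if "i \<in> {..Suc q}" for i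
      using gs that omit_lists[of gs "carrier G" i] length_omit[of i gs] by (simp add: deg_def)
    then have "pair f (\<Sum>i\<in>{..Suc q}. cscale (of_int ((-1) ^ i)) (unit_chain (omit i gs))) =
        (\<Otimes>i\<in>{..Suc q}. f (omit i gs) [^] ((-1) ^ i :: int))"
      using pair_sum_unit_chain[OF finite_atMost _ f, of "Suc q" "\<lambda>i. omit i gs" "\<lambda>i. (-1) ^ i"] by blast
    moreover have "face gs = (\<Sum>i\<in>{..Suc q}. cscale (of_int ((-1) ^ i)) (unit_chain (omit i gs)))"
      using gs by (simp add: face_omit deg_def lessThan_Suc_atMost)
    ultimately show ?thesis by simp
  qed
  then show ?thesis unfolding fun_coboundary_def group_coboundary_def group_tuples_eq by (auto intro: restrict_ext)
qed

lemma group_cochains_eq: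
  fixes R :: "'r monoid"
  assumes "p_divisible_group R p"
  shows "group_cochains G R trivial_action q =
    p_divisible_group.fun_cochains R (lists (carrier G)) (carrier G) (\<lambda>g. (\<otimes>\<^bsub>G\<^esub>) g) q"
  unfolding group_cochains_def p_divisible_group.fun_cochains_def[OF assms] group_tuples_eq by simp

subsection \<open>Invariant cochains on oriented simplices\<close>

lemma coeff_complex_map:
  assumes R: "p_divisible_group R p" and S: "p_divisible_group S p" and h: "h \<in> hom R S"
    and B: "face_closed B" and act: "\<And>g b. g \<in> G \<Longrightarrow> b \<in> B \<Longrightarrow> map (act g) b \<in> B"
  shows "complex_map (p_divisible_group.fun_cochains R B G act) (p_divisible_group.fun_coboundary R p B)
    (p_divisible_group.fun_cochains S B G act) (p_divisible_group.fun_coboundary S p B)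
    (\<lambda>q f. restrict (h \<circ> f) (deg B (Suc q)))"
proof -
  interpret R: p_divisible_group R p by (rule R)
  interpret S: p_divisible_group S p by (rule S)
  have md: "map (act g) b \<in> deg B q" if "g \<in> G" "b \<in> deg B q" for g b q using that act by (auto simp: deg_def)
  have "cochain_map (R.fun_cochains B G act) (R.fun_coboundary B) (S.fun_cochains B G act) (S.fun_coboundary B)
    (\<lambda>q f. restrict (h \<circ> f) (deg B (Suc q)))"
    unfolding cochain_map_def
  proof (intro allI conjI ballI)
    fix q
    show "(\<lambda>f. restrict (h \<circ> f) (deg B (Suc q))) \<in> hom (R.fun_cochains B G act q) (S.fun_cochains B G act q)"
    proof (rule homI)
      fix f assume f: "f \<in> carrier (R.fun_cochains B G act q)"
      then show "restrict (h \<circ> f) (deg B (Suc q)) \<in> carrier (S.fun_cochains B G act q)"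
        using md hom_in_carrier[OF h] by (simp add: R.fun_cochains_carrier S.fun_cochains_carrier Pi_iff)
    next
      fix f f' assume "f \<in> carrier (R.fun_cochains B G act q)" "f' \<in> carrier (R.fun_cochains B G act q)"
      then show "restrict (h \<circ> (f \<otimes>\<^bsub>R.fun_cochains B G act q\<^esub> f')) (deg B (Suc q)) =
          restrict (h \<circ> f) (deg B (Suc q)) \<otimes>\<^bsub>S.fun_cochains B G act q\<^esub> restrict (h \<circ> f') (deg B (Suc q))"
        using hom_mult[OF h] by (auto simp: R.fun_cochains_carrier Pi_iff intro!: restrict_ext)
    qed
    fix f assume "f \<in> carrier (R.fun_cochains B G act q)"
    then have f: "f \<in> deg B (Suc q) \<rightarrow> carrier R" by (simp add: R.fun_cochains_carrier)
    then have hf: "h \<circ> f \<in> deg B (Suc q) \<rightarrow> carrier S" using hom_in_carrier[OF h] by (simp add: Pi_iff)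
    have "h (R.pair f (face b)) = S.pair (restrict (h \<circ> f) (deg B (Suc q))) (face b)" if "b \<in> deg B (Suc (Suc q))" for b
      using p_divisible_hom[OF R S h R.face_chains[OF B that] f] S.pair_restrict[OF R.face_chains[OF B that] hf]
      by (simp add: comp_def)
    then show "restrict (h \<circ> R.fun_coboundary B q f) (deg B (Suc (Suc q))) =
        S.fun_coboundary B q (restrict (h \<circ> f) (deg B (Suc q)))"
      by (auto simp: R.fun_coboundary_def S.fun_coboundary_def intro!: restrict_ext)
  qed
  then show ?thesis
    using R.fun_cochains_complex[where G = G and act = act, OF B act]
      S.fun_cochains_complex[where G = G and act = act, OF B act]
    by (simp add: complex_map_def complex_map_axioms_def)
qed

lemma (in p_divisible_group) Ints_chains: "x \<in> chains \<int> A \<Longrightarrow> x \<in> chains (p_fractions p) A"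
proof -
  assume x: "x \<in> chains \<int> A"
  have "Poly_Mapping.lookup x b \<in> p_fractions p" for b
  proof -
    have "Poly_Mapping.lookup x b \<in> \<int>" using x by (simp add: chains_def)
    then show ?thesis by (elim Ints_cases) (simp add: of_int_p_fractions)
  qed
  then show "x \<in> chains (p_fractions p) A" using x by (simp add: chains_def)
qed

context typed_complex
begin

text \<open>The values on simplices oriented by type, which determine an oriented cochain.\<close>

definition to_fun :: "nat \<Rightarrow> (('v list set \<Rightarrow>\<^sub>0 int) set \<Rightarrow> 'r) \<Rightarrow> 'v list \<Rightarrow> 'r" where
  "to_fun q m = (\<lambda>s\<in>sorted_simplices q. m (coset q (frag_of (orientation s))))"

lemma map_typed_lists:
  assumes s: "s \<in> typed_lists"
    and \<alpha>: "\<And>\<sigma>. \<sigma> \<in> \<Delta> \<Longrightarrow> \<alpha> ` \<sigma> \<in> \<Delta>" "\<And>\<sigma> V. \<sigma> \<in> \<Delta> \<Longrightarrow> V \<in> \<sigma> \<Longrightarrow> k (\<alpha> V) = k V"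
  shows "map \<alpha> s \<in> typed_lists"
proof (cases "s = []")
  case False
  then have D: "set s \<in> \<Delta>" "ascending k s" using s by (auto simp: typed_lists_def)
  have "map k (map \<alpha> s) = map k s" using \<alpha>(2)[OF D(1)] by simp
  then have "ascending k (map \<alpha> s)" using D(2) by (simp only:)
  then show ?thesis using \<alpha>(1)[OF D(1)] unfolding typed_lists_def by simp
qed (use s in simp)

end

locale oriented_cochains = typed_complex \<Delta> k + R: p_divisible_group R p
  for \<Delta> :: "'v set set" and k and R :: "'r monoid" (structure) and p
begin

text \<open>Any representative of the coset may be chosen, since \<open>sort_chain\<close> is
  constant on it.\<close>

definition of_fun :: "nat \<Rightarrow> ('v list \<Rightarrow> 'r) \<Rightarrow> ('v list set \<Rightarrow>\<^sub>0 int) set \<Rightarrow> 'r" where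
  "of_fun q f = (\<lambda>Y\<in>carrier (oriented_chains \<Delta> q). R.pair f (sort_chain (SOME x. x \<in> Y)))"

lemma sort_chain_fractions: "x \<in> carrier (FA q) \<Longrightarrow> sort_chain x \<in> chains (p_fractions p) (sorted_simplices q)"
  by (rule R.Ints_chains[OF sort_chain_chains])

lemma of_fun_coset: "x \<in> carrier (FA q) \<Longrightarrow> of_fun q f (coset q x) = R.pair f (sort_chain x)"
proof -
  assume x: "x \<in> carrier (FA q)"
  have "(SOME y. y \<in> coset q x) \<in> coset q x" by (rule someI, rule coset_self)
  then have "sort_chain (SOME y. y \<in> coset q x) = sort_chain x" using coset_chain[OF x] by blast
  then show ?thesis using x by (simp add: of_fun_def carrier_oriented_chains)
qed

lemma of_fun_extensional: "of_fun q f \<in> extensional (carrier (oriented_chains \<Delta> q))"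
  unfolding of_fun_def by (rule restrict_extensional)

lemma oriented_cochains_eqI:
  assumes "m \<in> extensional (carrier (oriented_chains \<Delta> q))" "m' \<in> extensional (carrier (oriented_chains \<Delta> q))"
    and "\<And>x. x \<in> carrier (FA q) \<Longrightarrow> m (coset q x) = m' (coset q x)"
  shows "m = m'"
  by (rule extensionalityI[OF assms(1,2)]) (auto simp: carrier_oriented_chains assms(3))

lemma to_fun_of_fun:
  assumes "f \<in> extensional (sorted_simplices q)" "f \<in> sorted_simplices q \<rightarrow> carrier R"
  shows "to_fun q (of_fun q f) = f"
proof (rule extensionalityI[OF _ assms(1)])
  show "to_fun q (of_fun q f) \<in> extensional (sorted_simplices q)" by (simp add: to_fun_def)
  fix s assume s: "s \<in> sorted_simplices q"
  have "of_fun q f (coset q (frag_of (orientation s))) = R.pair f (unit_chain s)"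
    unfolding of_fun_coset[OF frag_of_oriented[OF sorted_simplices_list[OF s]]]
    by (simp add: sort_chain_linear sortc_sorted[OF s])
  then show "to_fun q (of_fun q f) s = f s" using s assms(2) by (simp add: to_fun_def Pi_iff)
qed

lemma simplicial_cochains_simps:
  "m \<in> carrier (simplicial_cochains \<Delta> R q) \<longleftrightarrow>
     m \<in> hom (oriented_chains \<Delta> q) R \<and> m \<in> extensional (carrier (oriented_chains \<Delta> q))"
  "m \<otimes>\<^bsub>simplicial_cochains \<Delta> R q\<^esub> m' = (\<lambda>Y\<in>carrier (oriented_chains \<Delta> q). m Y \<otimes> m' Y)"
  "\<one>\<^bsub>simplicial_cochains \<Delta> R q\<^esub> = (\<lambda>Y\<in>carrier (oriented_chains \<Delta> q). \<one>)"
  by (simp_all add: simplicial_cochains_def Hom_group_def product_group_def)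

text \<open>Additivity reduces the claim to a single oriented simplex, which modulo the relations is
  plus or minus a sorted one.\<close>

lemma simplicial_cochain_pair:
  assumes m: "m \<in> carrier (simplicial_cochains \<Delta> R q)" and x: "x \<in> carrier (FA q)"
  shows "m (coset q x) = R.pair (to_fun q m) (sort_chain x)"
proof -
  have hom: "m \<in> hom (oriented_chains \<Delta> q) R" using m by (simp add: simplicial_cochains_simps)
  have cl: "m (coset q y) \<in> carrier R" if "y \<in> carrier (FA q)" for y
    using hom_in_carrier[OF hom] that by (simp add: carrier_oriented_chains)
  have add: "m (coset q (y + z)) = m (coset q y) \<otimes> m (coset q z)" if "y \<in> carrier (FA q)" "z \<in> carrier (FA q)" for y z
    using hom_mult[OF hom, of "coset q y" "coset q z"] that
    by (simp only: mult_oriented_chains carrier_oriented_chains imageI)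
  have z: "0 \<in> carrier (FA q)" by (simp add: FA_simps)
  have m0: "m (coset q 0) = \<one>" using add[OF z z] cl[OF z] by simp
  have f: "to_fun q m \<in> sorted_simplices q \<rightarrow> carrier R"
    using cl frag_of_oriented sorted_simplices_list by (auto simp: to_fun_def)
  have "x \<in> carrier (FA q) \<and> m (coset q x) = R.pair (to_fun q m) (sort_chain x)"
    using x[unfolded FA_simps]
  proof (induction rule: frag_induction)
    case zero
    show ?case using m0 z by (simp add: sort_chain_linear)
  next
    case (one \<sigma>)
    then obtain vs where vs: "\<sigma> = orientation vs" "simplex_list q vs" by (auto simp: oriented_simplices_iff)
    obtain s where s: "s \<in> sorted_simplices q" "sortc k vs = unit_chain s \<or> sortc k vs = - unit_chain s"
      using orientation_class[OF vs(2)] by blast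
    let ?x = "frag_of (orientation vs)" and ?s = "frag_of (orientation s)"
    have c: "?x \<in> carrier (FA q)" "?s \<in> carrier (FA q)"
      by (rule frag_of_oriented[OF vs(2)], rule frag_of_oriented[OF sorted_simplices_list[OF s(1)]])
    have ss: "sort_chain ?s = unit_chain s" by (simp add: sort_chain_linear sortc_sorted[OF s(1)])
    have fs: "to_fun q m s = m (coset q ?s)" using s(1) by (simp add: to_fun_def)
    have fsc: "to_fun q m s \<in> carrier R" unfolding fs by (rule cl[OF c(2)])
    have u: "unit_chain s \<in> chains (p_fractions p) (sorted_simplices q)" by (rule R.unit_chains[OF s(1)])
    from s(2) have "m (coset q ?x) = R.pair (to_fun q m) (sort_chain ?x)"
    proof
      assume eq: "sortc k vs = unit_chain s"
      then have "coset q ?x = coset q ?s" using coset_eq_iff[OF c] ss by (simp add: sort_chain_linear)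
      then show ?thesis using eq fs R.pair_unit[of "to_fun q m" s, OF fsc] by (simp add: sort_chain_linear)
    next
      assume eq: "sortc k vs = - unit_chain s"
      have "coset q (?x + ?s) = coset q 0"
        using coset_eq_iff[OF FA_add[OF c] z] ss eq by (simp add: sort_chain_linear)
      then have "m (coset q ?x) \<otimes> m (coset q ?s) = \<one>" using add[OF c] m0 by simp
      then have "m (coset q ?x) = inv (m (coset q ?s))" using cl[OF c(1)] cl[OF c(2)] by (simp add: R.inv_equality)
      then show ?thesis using eq fs R.pair_uminus[OF u f] R.pair_unit[of "to_fun q m" s, OF fsc]
        by (simp add: sort_chain_linear)
    qed
    then show ?case using c(1) vs(1) by simp
  next
    case (diff a b)
    have ab: "a \<in> carrier (FA q)" "b \<in> carrier (FA q)" using diff by simp_all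
    have d: "a - b \<in> carrier (FA q)" using ab keys_diff[of a b] by (auto simp: FA_simps)
    have "m (coset q a) = m (coset q (a - b)) \<otimes> m (coset q b)" using add[OF d ab(2)] by simp
    then have "m (coset q (a - b)) = m (coset q a) \<otimes> inv (m (coset q b))"
      using cl[OF d] cl[OF ab(2)] by (simp add: R.inv_solve_right)
    also have "\<dots> = R.pair (to_fun q m) (sort_chain a - sort_chain b)"
      using diff R.pair_diff[OF sort_chain_fractions[OF ab(1)] sort_chain_fractions[OF ab(2)] f] by simp
    finally show ?case using d by (simp add: sort_chain_linear)
  qed
  then show ?thesis by blast
qed

lemma of_fun_mem: "f \<in> sorted_simplices q \<rightarrow> carrier R \<Longrightarrow> of_fun q f \<in> carrier (simplicial_cochains \<Delta> R q)"
proof -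
  assume f: "f \<in> sorted_simplices q \<rightarrow> carrier R"
  have "of_fun q f \<in> hom (oriented_chains \<Delta> q) R"
  proof (rule homI)
    fix x assume "x \<in> carrier (oriented_chains \<Delta> q)"
    then show "of_fun q f x \<in> carrier R"
      using R.pair_closed[OF sort_chain_fractions f] by (auto simp: carrier_oriented_chains of_fun_coset)
  next
    fix x y assume "x \<in> carrier (oriented_chains \<Delta> q)" "y \<in> carrier (oriented_chains \<Delta> q)"
    then obtain a b where ab: "a \<in> carrier (FA q)" "x = coset q a" "b \<in> carrier (FA q)" "y = coset q b"
      unfolding carrier_oriented_chains by blast
    show "of_fun q f (x \<otimes>\<^bsub>oriented_chains \<Delta> q\<^esub> y) = of_fun q f x \<otimes> of_fun q f y"
      unfolding ab(2,4) mult_oriented_chains[OF ab(1,3)] of_fun_coset[OF FA_add[OF ab(1,3)]]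
        of_fun_coset[OF ab(1)] of_fun_coset[OF ab(3)] sort_chain_linear(1)
      by (rule R.pair_add[OF sort_chain_fractions[OF ab(1)] sort_chain_fractions[OF ab(3)] f])
  qed
  then show ?thesis using of_fun_extensional by (simp add: simplicial_cochains_simps)
qed

lemma of_fun_to_fun: "m \<in> carrier (simplicial_cochains \<Delta> R q) \<Longrightarrow> of_fun q (to_fun q m) = m"
  by (rule oriented_cochains_eqI[OF of_fun_extensional])
    (simp_all add: simplicial_cochains_simps(1) of_fun_coset simplicial_cochain_pair)

lemma to_fun_mem: "m \<in> carrier (simplicial_cochains \<Delta> R q) \<Longrightarrow> to_fun q m \<in> sorted_simplices q \<rightarrow> carrier R"
proof
  fix s assume m: "m \<in> carrier (simplicial_cochains \<Delta> R q)" and s: "s \<in> sorted_simplices q"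
  have "coset q (frag_of (orientation s)) \<in> carrier (oriented_chains \<Delta> q)"
    using frag_of_oriented[OF sorted_simplices_list[OF s]] unfolding carrier_oriented_chains by (rule imageI)
  then show "to_fun q m s \<in> carrier R"
    using m s hom_in_carrier[of m "oriented_chains \<Delta> q" R] by (simp add: to_fun_def simplicial_cochains_simps(1))
qed

lemma of_fun_coboundary:
  assumes f: "f \<in> sorted_simplices q \<rightarrow> carrier R"
  shows "simplicial_coboundary \<Delta> q (of_fun q f) = of_fun (Suc q) (R.fun_coboundary typed_lists q f)"
proof (rule oriented_cochains_eqI)
  fix x assume x: "x \<in> carrier (FA (Suc q))"
  obtain y where y: "y \<in> carrier (FA q)" "oriented_boundary \<Delta> q (coset (Suc q) x) = coset q y"
      "sort_chain y = bd (sort_chain x)"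
    using oriented_boundary_coset[OF x] by blast
  have "simplicial_coboundary \<Delta> q (of_fun q f) (coset (Suc q) x) = of_fun q f (coset q y)"
    using x y(2) by (simp add: simplicial_coboundary_def carrier_oriented_chains)
  also have "\<dots> = R.pair (R.fun_coboundary typed_lists q f) (sort_chain x)"
    unfolding of_fun_coset[OF y(1)] y(3)
    by (rule R.pair_bd[OF f face_closed_typed_lists sort_chain_fractions[OF x]])
  finally show "simplicial_coboundary \<Delta> q (of_fun q f) (coset (Suc q) x) =
      of_fun (Suc q) (R.fun_coboundary typed_lists q f) (coset (Suc q) x)"
    by (simp only: of_fun_coset[OF x])
qed (simp_all add: simplicial_coboundary_def of_fun_extensional)

lemma of_fun_chain_map:
  assumes f: "f \<in> sorted_simplices q \<rightarrow> carrier R"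
    and \<alpha>: "\<And>\<sigma>. \<sigma> \<in> \<Delta> \<Longrightarrow> \<alpha> ` \<sigma> \<in> \<Delta>" "\<And>\<sigma> V. \<sigma> \<in> \<Delta> \<Longrightarrow> V \<in> \<sigma> \<Longrightarrow> k (\<alpha> V) = k V"
  shows "restrict (of_fun q f \<circ> oriented_chain_map \<Delta> q \<alpha>) (carrier (oriented_chains \<Delta> q)) =
    of_fun q (\<lambda>s\<in>sorted_simplices q. f (map \<alpha> s))"
proof (rule oriented_cochains_eqI)
  have ms: "map \<alpha> s \<in> sorted_simplices q" if "s \<in> sorted_simplices q" for s
    using that map_typed_lists[OF _ \<alpha>] by (simp add: deg_def)
  then have fm: "(\<lambda>s. f (map \<alpha> s)) \<in> sorted_simplices q \<rightarrow> carrier R" using f by (simp add: Pi_iff)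
  fix x assume x: "x \<in> carrier (FA q)"
  note sx = sort_chain_fractions[OF x]
  have "\<exists>y\<in>carrier (FA q). oriented_chain_map \<Delta> q \<alpha> (coset q x) = coset q y \<and> sort_chain y = mapc \<alpha> (sort_chain x)"
    by (rule oriented_chain_map_coset[OF x]) (rule \<alpha>; assumption)+
  then obtain y where y: "y \<in> carrier (FA q)" "oriented_chain_map \<Delta> q \<alpha> (coset q x) = coset q y"
      "sort_chain y = mapc \<alpha> (sort_chain x)"
    by blast
  have "R.pair f (sort_chain y) = R.pair (\<lambda>s. R.pair f (unit_chain (map \<alpha> s))) (sort_chain x)"
    unfolding y(3) mapc_def by (rule R.pair_lext[OF sx R.unit_chains[OF ms] f])
  also have "\<dots> = R.pair (\<lambda>s. f (map \<alpha> s)) (sort_chain x)"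
    by (rule R.pair_cong[OF sx _ fm], rule R.pair_unit, rule funcset_mem[OF f], rule ms)
  also have "\<dots> = R.pair (\<lambda>s\<in>sorted_simplices q. f (map \<alpha> s)) (sort_chain x)"
    by (rule R.pair_restrict[symmetric, OF sx fm])
  finally show "restrict (of_fun q f \<circ> oriented_chain_map \<Delta> q \<alpha>) (carrier (oriented_chains \<Delta> q)) (coset q x) =
      of_fun q (\<lambda>s\<in>sorted_simplices q. f (map \<alpha> s)) (coset q x)"
    using x y(2) by (simp add: carrier_oriented_chains of_fun_coset[OF x] of_fun_coset[OF y(1)])
qed (simp_all add: of_fun_extensional)

text \<open>The action permutes sorted simplices, so invariance can be tested on them. The
  definition uses inverses, which over all elements of a group amounts to the same
  condition.\<close>

lemma of_fun_invariant:
  assumes G: "group G" and act: "\<And>g \<sigma>. g \<in> carrier G \<Longrightarrow> \<sigma> \<in> \<Delta> \<Longrightarrow> act g ` \<sigma> \<in> \<Delta>"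
      "\<And>g \<sigma> V. g \<in> carrier G \<Longrightarrow> \<sigma> \<in> \<Delta> \<Longrightarrow> V \<in> \<sigma> \<Longrightarrow> k (act g V) = k V"
    and f: "f \<in> extensional (sorted_simplices q)" "f \<in> sorted_simplices q \<rightarrow> carrier R"
  shows "of_fun q f \<in> carrier (invariant_cochains G act \<Delta> R q) \<longleftrightarrow>
    f \<in> carrier (R.fun_cochains typed_lists (carrier G) act q)"
proof -
  interpret G: group G by (rule G)
  have ms: "map (act g) s \<in> sorted_simplices q" if "g \<in> carrier G" "s \<in> sorted_simplices q" for g s
    using that map_typed_lists[OF _ act] by (simp add: deg_def)
  have step: "restrict (of_fun q f \<circ> oriented_chain_map \<Delta> q (act g)) (carrier (oriented_chains \<Delta> q)) = of_fun q f \<longleftrightarrow>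
      (\<forall>s\<in>sorted_simplices q. f (map (act g) s) = f s)" if g: "g \<in> carrier G" for g
  proof -
    let ?f = "\<lambda>s\<in>sorted_simplices q. f (map (act g) s)"
    have f': "?f \<in> extensional (sorted_simplices q)" "?f \<in> sorted_simplices q \<rightarrow> carrier R"
      using f(2) ms[OF g] by (auto simp: Pi_iff)
    have "of_fun q ?f = of_fun q f \<longleftrightarrow> ?f = f" using to_fun_of_fun[OF f'] to_fun_of_fun[OF f] by metis
    also have "\<dots> \<longleftrightarrow> (\<forall>s\<in>sorted_simplices q. f (map (act g) s) = f s)"
    proof
      assume "?f = f"
      then show "\<forall>s\<in>sorted_simplices q. f (map (act g) s) = f s" using restrict_apply' by (metis (no_types, lifting))
    next
      assume "\<forall>s\<in>sorted_simplices q. f (map (act g) s) = f s"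
      then show "?f = f" by (intro extensionalityI[OF f'(1) f(1)]) simp
    qed
    finally show ?thesis using of_fun_chain_map[OF f(2) act[OF g]] by simp
  qed
  have "of_fun q f \<in> carrier (invariant_cochains G act \<Delta> R q) \<longleftrightarrow>
      (\<forall>g\<in>carrier G. \<forall>s\<in>sorted_simplices q. f (map (act (inv\<^bsub>G\<^esub> g)) s) = f s)"
    using of_fun_mem[OF f(2)] step[OF G.inv_closed] by (simp add: invariant_cochains_def)
  also have "\<dots> \<longleftrightarrow> (\<forall>g\<in>carrier G. \<forall>s\<in>sorted_simplices q. f (map (act g) s) = f s)"
    using G.inv_closed G.inv_inv by metis
  finally show ?thesis using f by (simp add: R.fun_cochains_carrier)
qed

lemma invariant_cochains_transport:
  assumes G: "group G" and act: "\<And>g \<sigma>. g \<in> carrier G \<Longrightarrow> \<sigma> \<in> \<Delta> \<Longrightarrow> act g ` \<sigma> \<in> \<Delta>"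
      "\<And>g \<sigma> V. g \<in> carrier G \<Longrightarrow> \<sigma> \<in> \<Delta> \<Longrightarrow> V \<in> \<sigma> \<Longrightarrow> k (act g V) = k V"
  shows "complex_transport (R.fun_cochains typed_lists (carrier G) act) (R.fun_coboundary typed_lists)
    (invariant_cochains G act \<Delta> R) (simplicial_coboundary \<Delta>) of_fun to_fun"
proof -
  let ?C = "R.fun_cochains typed_lists (carrier G) act" and ?M = "invariant_cochains G act \<Delta> R"
  have inv_iff: "of_fun q f \<in> carrier (?M q) \<longleftrightarrow> f \<in> carrier (?C q)"
    if f: "f \<in> extensional (sorted_simplices q)" "f \<in> sorted_simplices q \<rightarrow> carrier R" for f q
    by (rule of_fun_invariant[OF G _ _ f]) (rule act; assumption)+
  have mt: "map (act g) s \<in> typed_lists" if "g \<in> carrier G" "s \<in> typed_lists" for g s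
    by (rule map_typed_lists[OF that(2) act[OF that(1)]])
  have C: "complex ?C (R.fun_coboundary typed_lists)"
    by (rule R.fun_cochains_complex[where G = "carrier G" and act = act, OF face_closed_typed_lists mt])
  have fc: "f \<in> extensional (sorted_simplices q)" "f \<in> sorted_simplices q \<rightarrow> carrier R" if "f \<in> carrier (?C q)" for f q
    using that by (simp_all add: R.fun_cochains_carrier)
  have M: "carrier (?M q) = of_fun q ` carrier (?C q)" for q
  proof (intro equalityI subsetI)
    fix m assume m: "m \<in> carrier (?M q)"
    then have ms: "m \<in> carrier (simplicial_cochains \<Delta> R q)" by (simp add: invariant_cochains_def)
    have "to_fun q m \<in> extensional (sorted_simplices q)" by (simp add: to_fun_def)
    then have "to_fun q m \<in> carrier (?C q)"
      using inv_iff[OF _ to_fun_mem[OF ms]] m of_fun_to_fun[OF ms] by simp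
    then show "m \<in> of_fun q ` carrier (?C q)" using of_fun_to_fun[OF ms] by (metis imageI)
  next
    fix m assume "m \<in> of_fun q ` carrier (?C q)"
    then obtain f where "m = of_fun q f" "f \<in> carrier (?C q)" by blast
    then show "m \<in> carrier (?M q)" using inv_iff[OF fc] by simp
  qed
  have "of_fun q f \<otimes>\<^bsub>?M q\<^esub> of_fun q f' = of_fun q (f \<otimes>\<^bsub>?C q\<^esub> f')" if ff: "f \<in> carrier (?C q)" "f' \<in> carrier (?C q)" for f f' q
  proof (rule oriented_cochains_eqI[OF _ of_fun_extensional])
    show "of_fun q f \<otimes>\<^bsub>?M q\<^esub> of_fun q f' \<in> extensional (carrier (oriented_chains \<Delta> q))"
      by (simp add: invariant_cochains_def simplicial_cochains_simps)
    fix x assume x: "x \<in> carrier (FA q)"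
    note sx = sort_chain_fractions[OF x]
    have "coset q x \<in> carrier (oriented_chains \<Delta> q)" unfolding carrier_oriented_chains using x by (rule imageI)
    then have "(of_fun q f \<otimes>\<^bsub>?M q\<^esub> of_fun q f') (coset q x) = R.pair f (sort_chain x) \<otimes> R.pair f' (sort_chain x)"
      by (simp add: invariant_cochains_def simplicial_cochains_simps of_fun_coset[OF x])
    also have "\<dots> = R.pair (\<lambda>s. f s \<otimes> f' s) (sort_chain x)"
      by (rule R.pair_mult[symmetric, OF sx fc(2)[OF ff(1)] fc(2)[OF ff(2)]])
    also have "\<dots> = R.pair (\<lambda>s\<in>sorted_simplices q. f s \<otimes> f' s) (sort_chain x)"
      by (rule R.pair_restrict[symmetric, OF sx]) (use fc(2)[OF ff(1)] fc(2)[OF ff(2)] in \<open>simp add: Pi_iff\<close>)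
    finally show "(of_fun q f \<otimes>\<^bsub>?M q\<^esub> of_fun q f') (coset q x) = of_fun q (f \<otimes>\<^bsub>?C q\<^esub> f') (coset q x)"
      by (simp add: of_fun_coset[OF x])
  qed
  moreover have "\<one>\<^bsub>?M q\<^esub> = of_fun q \<one>\<^bsub>?C q\<^esub>" for q
  proof (rule oriented_cochains_eqI[OF _ of_fun_extensional])
    show "\<one>\<^bsub>?M q\<^esub> \<in> extensional (carrier (oriented_chains \<Delta> q))"
      by (simp add: invariant_cochains_def simplicial_cochains_simps)
    fix x assume x: "x \<in> carrier (FA q)"
    note sx = sort_chain_fractions[OF x]
    have "coset q x \<in> carrier (oriented_chains \<Delta> q)" unfolding carrier_oriented_chains using x by (rule imageI)
    moreover have "R.pair (\<lambda>s\<in>sorted_simplices q. \<one>) (sort_chain x) = \<one>"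
      using R.pair_restrict[OF sx, of "\<lambda>_. \<one>"] R.pair_one[OF sx] by simp
    ultimately show "\<one>\<^bsub>?M q\<^esub> (coset q x) = of_fun q \<one>\<^bsub>?C q\<^esub> (coset q x)"
      by (simp add: invariant_cochains_def simplicial_cochains_simps of_fun_coset[OF x])
  qed
  ultimately show ?thesis
    using C M of_fun_coboundary[OF fc(2)] to_fun_of_fun[OF fc]
    by (simp add: complex_transport_def complex_transport_axioms_def)
qed

end

subsection \<open>Comparison with group cohomology\<close>

text \<open>The group here is the ambient one, whose stabilisers may be infinite; finiteness is a
  condition on subgroups, imposed in \<open>proper_on\<close>.\<close>

locale typed_action = typed_complex \<Delta> k + A: acyclic_action G "p_fractions p" act "typed_complex.typed_lists \<Delta> k"
  for \<Delta> :: "'v set set" and k and G :: "('g, 'x) monoid_scheme" (structure) and act :: "'g \<Rightarrow> 'v \<Rightarrow> 'v" and p :: nat +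
  assumes act_simplex: "g \<in> carrier G \<Longrightarrow> \<sigma> \<in> \<Delta> \<Longrightarrow> act g ` \<sigma> \<in> \<Delta>"
    and act_type: "g \<in> carrier G \<Longrightarrow> \<sigma> \<in> \<Delta> \<Longrightarrow> V \<in> \<sigma> \<Longrightarrow> k (act g V) = k V"
begin

abbreviation left_mult :: "'g \<Rightarrow> 'g \<Rightarrow> 'g" where "left_mult \<equiv> \<lambda>g. (\<otimes>) g"

text \<open>One chain map for the whole group, so that the comparison maps of its subgroups are compatible.\<close>

definition orbit_map :: "'g list \<Rightarrow> ('v list \<Rightarrow>\<^sub>0 rat)" where
  "orbit_map = (SOME \<psi>. equivariant_chain_map (p_fractions p) (lists (carrier G)) typed_lists (carrier G) left_mult act \<psi>)"

definition proper_on :: "'g set \<Rightarrow> bool" where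
  "proper_on \<Gamma> \<longleftrightarrow> subgroup \<Gamma> G \<and> (\<forall>b\<in>typed_lists - {[]}. finite {g \<in> \<Gamma>. map (act g) b = b} \<and>
      inverse (of_nat (card {g \<in> \<Gamma>. map (act g) b = b})) \<in> p_fractions p)"

text \<open>A chain map from tuples to simplices pulls cochains back from the building to the group.
  A map in the other direction would involve averages that depend on the subgroup.\<close>

definition comparison :: "'g set \<Rightarrow> 'r monoid \<Rightarrow> nat \<Rightarrow> (('v list set \<Rightarrow>\<^sub>0 int) set \<Rightarrow> 'r) \<Rightarrow> ('g list \<Rightarrow> 'r)" where
  "comparison \<Gamma> R q m = p_divisible_group.pull R p orbit_map (lists \<Gamma>) q (to_fun q m)"

abbreviation inv_cochains :: "'g set \<Rightarrow> 'r monoid \<Rightarrow> nat \<Rightarrow> (('v list set \<Rightarrow>\<^sub>0 int) set \<Rightarrow> 'r) monoid" where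
  "inv_cochains \<Gamma> R \<equiv> invariant_cochains (subgroup_of G \<Gamma>) act \<Delta> R"

abbreviation grp_cochains :: "'g set \<Rightarrow> 'r monoid \<Rightarrow> nat \<Rightarrow> ('g list \<Rightarrow> 'r) monoid" where
  "grp_cochains \<Gamma> R \<equiv> group_cochains (subgroup_of G \<Gamma>) R trivial_action"

abbreviation grp_d :: "'g set \<Rightarrow> 'r monoid \<Rightarrow> nat \<Rightarrow> ('g list \<Rightarrow> 'r) \<Rightarrow> ('g list \<Rightarrow> 'r)" where
  "grp_d \<Gamma> R \<equiv> group_coboundary (subgroup_of G \<Gamma>) R"

abbreviation typed_cochains :: "'g set \<Rightarrow> 'r monoid \<Rightarrow> nat \<Rightarrow> ('v list \<Rightarrow> 'r) monoid" where
  "typed_cochains \<Gamma> R \<equiv> p_divisible_group.fun_cochains R typed_lists \<Gamma> act"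

abbreviation typed_d :: "'r monoid \<Rightarrow> nat \<Rightarrow> ('v list \<Rightarrow> 'r) \<Rightarrow> ('v list \<Rightarrow> 'r)" where
  "typed_d R \<equiv> p_divisible_group.fun_coboundary R p typed_lists"

abbreviation tuple_cochains :: "'g set \<Rightarrow> 'r monoid \<Rightarrow> nat \<Rightarrow> ('g list \<Rightarrow> 'r) monoid" where
  "tuple_cochains \<Gamma> R \<equiv> p_divisible_group.fun_cochains R (lists \<Gamma>) \<Gamma> left_mult"

abbreviation tuple_d :: "'g set \<Rightarrow> 'r monoid \<Rightarrow> nat \<Rightarrow> ('g list \<Rightarrow> 'r) \<Rightarrow> ('g list \<Rightarrow> 'r)" where
  "tuple_d \<Gamma> R \<equiv> p_divisible_group.fun_coboundary R p (lists \<Gamma>)"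

lemma proper_on_subgroup: "proper_on \<Gamma> \<Longrightarrow> subgroup \<Gamma> G"
  by (simp add: proper_on_def)

lemma proper_on_carrier: "proper_on \<Gamma> \<Longrightarrow> g \<in> \<Gamma> \<Longrightarrow> g \<in> carrier G"
  using subgroup.subset[OF proper_on_subgroup] by blast

lemma proper_on_group: "proper_on \<Gamma> \<Longrightarrow> group (subgroup_of G \<Gamma>)"
  using subgroup.subgroup_is_group[OF proper_on_subgroup A.group_axioms] .

lemma proper_on_act: "proper_on \<Gamma> \<Longrightarrow> g \<in> \<Gamma> \<Longrightarrow> b \<in> typed_lists \<Longrightarrow> map (act g) b \<in> typed_lists"
  by (rule A.act_B[OF proper_on_carrier])

lemma proper_on_tuples: "proper_on \<Gamma> \<Longrightarrow> g \<in> \<Gamma> \<Longrightarrow> a \<in> lists \<Gamma> \<Longrightarrow> map (left_mult g) a \<in> lists \<Gamma>"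
  using subgroup.m_closed[OF proper_on_subgroup] by (auto simp: in_lists_conv_set)

lemma proper_on_proper_action:
  assumes \<Gamma>: "proper_on \<Gamma>"
  shows "proper_acyclic_action (subgroup_of G \<Gamma>) (p_fractions p) act typed_lists"
proof -
  note c = proper_on_carrier[OF \<Gamma>]
  have "acyclic_action (subgroup_of G \<Gamma>) (p_fractions p) act typed_lists"
    using proper_on_group[OF \<Gamma>] A.coeff_ring_axioms A.act_mult A.act_one A.face_closed_B A.Nil_B A.act_B A.acyclic c
    by (simp add: acyclic_action_def acyclic_action_axioms_def)
  moreover have "finite {g \<in> \<Gamma>. map (act g) b = b} \<and> inverse (of_nat (card {g \<in> \<Gamma>. map (act g) b = b})) \<in> p_fractions p"
    if b: "b \<in> typed_lists - {[]}" for b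
    using \<Gamma> b unfolding proper_on_def by blast
  ultimately show ?thesis by (simp add: proper_acyclic_action_def proper_acyclic_action_axioms_def)
qed

lemma orbit_map:
  assumes \<Gamma>: "proper_on \<Gamma>"
  shows "equivariant_chain_map (p_fractions p) (lists \<Gamma>) typed_lists \<Gamma> left_mult act orbit_map"
proof -
  have *: "equivariant_chain_map (p_fractions p) (lists (carrier G)) typed_lists (carrier G) left_mult act orbit_map"
    unfolding orbit_map_def by (rule someI_ex[OF A.tuples_to_complex])
  have "a \<in> deg (lists (carrier G)) q" if "a \<in> deg (lists \<Gamma>) q" for a q
    using that proper_on_carrier[OF \<Gamma>] by (auto simp: deg_def)
  then show ?thesis using * proper_on_carrier[OF \<Gamma>] unfolding equivariant_chain_map_def by blast
qed

lemma face_closed_lists: "face_closed (lists \<Gamma>)"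
  by (auto simp: face_closed_def)

lemma oriented_cochains: "p_divisible_group R p \<Longrightarrow> oriented_cochains \<Delta> k R p"
  by (simp add: oriented_cochains_def typed_complex_axioms)

lemma cochains_transport:
  assumes \<Gamma>: "proper_on \<Gamma>" and R: "p_divisible_group R p"
  shows "complex_transport (typed_cochains \<Gamma> R) (typed_d R) (inv_cochains \<Gamma> R) (simplicial_coboundary \<Delta>)
    (oriented_cochains.of_fun \<Delta> k R p) to_fun"
proof -
  interpret O: oriented_cochains \<Delta> k R p by (rule oriented_cochains[OF R])
  have act: "act g ` \<sigma> \<in> \<Delta>" if "g \<in> carrier (subgroup_of G \<Gamma>)" "\<sigma> \<in> \<Delta>" for g \<sigma>
    using that proper_on_carrier[OF \<Gamma>] by (simp add: act_simplex)
  have type: "k (act g V) = k V" if "g \<in> carrier (subgroup_of G \<Gamma>)" "\<sigma> \<in> \<Delta>" "V \<in> \<sigma>" for g \<sigma> V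
    using that proper_on_carrier[OF \<Gamma>] act_type[of g \<sigma> V] by simp
  have "complex_transport (O.R.fun_cochains typed_lists (carrier (subgroup_of G \<Gamma>)) act) (O.R.fun_coboundary typed_lists)
      (inv_cochains \<Gamma> R) (simplicial_coboundary \<Delta>) O.of_fun to_fun"
    by (rule O.invariant_cochains_transport[OF proper_on_group[OF \<Gamma>]]) (rule act type; assumption)+
  then show ?thesis by simp
qed

lemma grp_cochains_eq: "p_divisible_group R p \<Longrightarrow> grp_cochains \<Gamma> R = tuple_cochains \<Gamma> R"
  using group_cochains_eq[of R p "subgroup_of G \<Gamma>"] by (intro ext) simp

lemma grp_d_eq:
  "p_divisible_group R p \<Longrightarrow> f \<in> carrier (grp_cochains \<Gamma> R q) \<Longrightarrow> tuple_d \<Gamma> R q f = grp_d \<Gamma> R q f"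
  using group_coboundary_eq[of R p f "subgroup_of G \<Gamma>" q]
  by (simp add: grp_cochains_eq p_divisible_group.fun_cochains_carrier)

lemma orbit_map_pull:
  assumes \<Gamma>: "proper_on \<Gamma>" and R: "p_divisible_group R p"
  shows "complex_map (typed_cochains \<Gamma> R) (typed_d R) (tuple_cochains \<Gamma> R) (tuple_d \<Gamma> R)
    (p_divisible_group.pull R p orbit_map (lists \<Gamma>))"
  by (rule p_divisible_group.pull_complex_map[where G = \<Gamma> and actA = left_mult and actB = act, OF R face_closed_lists face_closed_typed_lists
        proper_on_tuples[OF \<Gamma>] proper_on_act[OF \<Gamma>] orbit_map[OF \<Gamma>]])

lemma comparison_map:
  assumes \<Gamma>: "proper_on \<Gamma>" and R: "p_divisible_group R p"
  shows "complex_map (inv_cochains \<Gamma> R) (simplicial_coboundary \<Delta>) (grp_cochains \<Gamma> R) (grp_d \<Gamma> R) (comparison \<Gamma> R)"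
proof -
  have "complex_map (inv_cochains \<Gamma> R) (simplicial_coboundary \<Delta>) (grp_cochains \<Gamma> R) (tuple_d \<Gamma> R) (comparison \<Gamma> R)"
    using complex_transport.transported_map[OF cochains_transport[OF \<Gamma> R] orbit_map_pull[OF \<Gamma> R]]
    by (simp add: comparison_def[abs_def] grp_cochains_eq[OF R])
  then show ?thesis by (rule complex_map_cong[rotated 2]) (simp_all add: grp_d_eq[OF R])
qed

text \<open>The reverse chain map \<open>\<phi>\<close> and the homotopies \<open>D\<close> and
  \<open>E\<close> are built for this subgroup with its finite stabilisers. They prove bijectivity
  but do not enter the comparison map.\<close>

lemma comparison_iso:
  assumes \<Gamma>: "proper_on \<Gamma>" and R: "p_divisible_group R p"
  shows "cohomology_map (grp_cochains \<Gamma> R) (grp_d \<Gamma> R) q (comparison \<Gamma> R q)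
    \<in> iso (cohomology (inv_cochains \<Gamma> R) (simplicial_coboundary \<Delta>) q) (cohomology (grp_cochains \<Gamma> R) (grp_d \<Gamma> R) q)"
proof -
  interpret R: p_divisible_group R p by (rule R)
  interpret P: proper_acyclic_action "subgroup_of G \<Gamma>" "p_fractions p" act typed_lists
    by (rule proper_on_proper_action[OF \<Gamma>])
  note faces = face_closed_lists[of \<Gamma>] face_closed_typed_lists
  note acts = proper_on_tuples[OF \<Gamma>] proper_on_act[OF \<Gamma>]
  obtain \<phi> where \<phi>: "equivariant_chain_map (p_fractions p) typed_lists (lists \<Gamma>) \<Gamma> act left_mult \<phi>"
    using P.complex_to_tuples by auto
  obtain D where D: "equivariant_homotopy (p_fractions p) (lists \<Gamma>) (lists \<Gamma>) \<Gamma> left_mult left_mult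
      unit_chain (\<lambda>a. lext \<phi> (orbit_map a)) D"
    using P.tuples_homotopy[of unit_chain "\<lambda>a. lext \<phi> (orbit_map a)"]
      A.chain_map_id[OF faces(1), of \<Gamma> left_mult] A.chain_map_compose[OF faces orbit_map[OF \<Gamma>] \<phi>] by auto
  obtain E where E: "equivariant_homotopy (p_fractions p) typed_lists typed_lists \<Gamma> act act
      unit_chain (\<lambda>b. lext orbit_map (\<phi> b)) E"
    using P.complex_homotopy[of unit_chain "\<lambda>b. lext orbit_map (\<phi> b)"]
      A.chain_map_id[OF faces(2), of \<Gamma> act] A.chain_map_compose[OF faces(2,1) \<phi> orbit_map[OF \<Gamma>]] by auto
  note ps = R.pull_inj_surj[where G = \<Gamma> and actA = left_mult and actB = act, OF faces acts orbit_map[OF \<Gamma>] \<phi> D E]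
  have inj: "c \<in> coboundaries (typed_cochains \<Gamma> R) (typed_d R) q"
    if c: "c \<in> complex.cocycles (typed_cochains \<Gamma> R) (typed_d R) q"
      "R.pull orbit_map (lists \<Gamma>) q c \<in> coboundaries (tuple_cochains \<Gamma> R) (tuple_d \<Gamma> R) q" for c
    by (rule ps(1)) (assumption | rule c)+
  have surj: "\<exists>c\<in>complex.cocycles (typed_cochains \<Gamma> R) (typed_d R) q. z \<otimes>\<^bsub>tuple_cochains \<Gamma> R q\<^esub>
      inv\<^bsub>tuple_cochains \<Gamma> R q\<^esub> R.pull orbit_map (lists \<Gamma>) q c \<in> coboundaries (tuple_cochains \<Gamma> R) (tuple_d \<Gamma> R) q"
    if z: "z \<in> complex.cocycles (tuple_cochains \<Gamma> R) (tuple_d \<Gamma> R) q" for z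
    by (rule ps(2)) (assumption | rule z)+
  have "cohomology_map (tuple_cochains \<Gamma> R) (tuple_d \<Gamma> R) q (comparison \<Gamma> R q)
    \<in> iso (cohomology (inv_cochains \<Gamma> R) (simplicial_coboundary \<Delta>) q) (cohomology (tuple_cochains \<Gamma> R) (tuple_d \<Gamma> R) q)"
    unfolding comparison_def
    by (rule complex_transport.transported_map_iso[OF cochains_transport[OF \<Gamma> R] orbit_map_pull[OF \<Gamma> R]])
      (rule inj surj; assumption)+
  moreover have "cohomology (tuple_cochains \<Gamma> R) (tuple_d \<Gamma> R) q = cohomology (grp_cochains \<Gamma> R) (grp_d \<Gamma> R) q"
    unfolding grp_cochains_eq[OF R, symmetric] by (rule cohomology_cong) (rule grp_d_eq[OF R])
  moreover have "coboundaries (tuple_cochains \<Gamma> R) (tuple_d \<Gamma> R) q = coboundaries (grp_cochains \<Gamma> R) (grp_d \<Gamma> R) q"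
    unfolding grp_cochains_eq[OF R, symmetric] by (rule coboundaries_cong) (rule grp_d_eq[OF R])
  ultimately show ?thesis by (simp add: cohomology_map_def grp_cochains_eq[OF R])
qed

definition cohomology_comparison ::
  "'g set \<Rightarrow> 'r monoid \<Rightarrow> nat \<Rightarrow> ('g list \<Rightarrow> 'r) set \<Rightarrow> (('v list set \<Rightarrow>\<^sub>0 int) set \<Rightarrow> 'r) set" where
  "cohomology_comparison \<Gamma> R q = inv_into (carrier (cohomology (inv_cochains \<Gamma> R) (simplicial_coboundary \<Delta>) q))
     (cohomology_map (grp_cochains \<Gamma> R) (grp_d \<Gamma> R) q (comparison \<Gamma> R q))"

theorem cohomology_comparison_iso:
  assumes \<Gamma>: "proper_on \<Gamma>" and R: "p_divisible_group R p"
  shows "cohomology_comparison \<Gamma> R q \<in>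
    iso (group_cohomology (subgroup_of G \<Gamma>) R trivial_action q) (invariant_cohomology (subgroup_of G \<Gamma>) act \<Delta> R q)"
proof -
  interpret complex_map "inv_cochains \<Gamma> R" "simplicial_coboundary \<Delta>" "grp_cochains \<Gamma> R" "grp_d \<Gamma> R" "comparison \<Gamma> R"
    by (rule comparison_map[OF \<Gamma> R])
  show ?thesis
    unfolding cohomology_comparison_def group_cohomology_def invariant_cohomology_def
    by (rule iso_inv_into[OF source.cohomology_group comparison_iso[OF \<Gamma> R]])
qed

text \<open>Homomorphisms of coefficients commute with evaluation on chains and hence with pullback
  along \<open>orbit_map\<close>, so the square commutes already on cochains.\<close>

theorem cohomology_comparison_coeff:
  assumes \<Gamma>: "proper_on \<Gamma>" and R: "p_divisible_group R p" and S: "p_divisible_group S p" and h: "h \<in> hom R S"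
    and \<xi>: "\<xi> \<in> carrier (group_cohomology (subgroup_of G \<Gamma>) R trivial_action q)"
  shows "cohomology_comparison \<Gamma> S q (group_cohomology_coeff (subgroup_of G \<Gamma>) S trivial_action h q \<xi>) =
    invariant_cohomology_coeff (subgroup_of G \<Gamma>) act \<Delta> S h q (cohomology_comparison \<Gamma> R q \<xi>)"
proof -
  interpret R: oriented_cochains \<Delta> k R p by (rule oriented_cochains[OF R])
  interpret S: oriented_cochains \<Delta> k S p by (rule oriented_cochains[OF S])
  interpret T: complex_transport "typed_cochains \<Gamma> R" "typed_d R" "inv_cochains \<Gamma> R" "simplicial_coboundary \<Delta>" R.of_fun to_fun
    by (rule cochains_transport[OF \<Gamma> R])
  let ?a = "\<lambda>q f. restrict (h \<circ> f) (carrier (oriented_chains \<Delta> q))"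
  let ?b = "\<lambda>q f. restrict (h \<circ> f) (group_tuples (subgroup_of G \<Gamma>) q)"
  have fc: "f \<in> sorted_simplices q \<rightarrow> carrier R" if "f \<in> carrier (typed_cochains \<Gamma> R q)" for f q
    using that by (simp add: R.R.fun_cochains_carrier)
  have hf: "h \<circ> f \<in> sorted_simplices q \<rightarrow> carrier S" if "f \<in> carrier (typed_cochains \<Gamma> R q)" for f q
    using fc[OF that] hom_in_carrier[OF h] by (auto simp: Pi_iff)
  have pair_h: "h (R.R.pair f y) = S.R.pair (restrict (h \<circ> f) (sorted_simplices q)) y"
    if f: "f \<in> carrier (typed_cochains \<Gamma> R q)" and y: "y \<in> chains (p_fractions p) (sorted_simplices q)" for f q y
    using p_divisible_hom[OF R S h y fc[OF f]] S.R.pair_restrict[OF y hf[OF f]] by (simp add: comp_def)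
  have aU: "?a q (R.of_fun q f) = S.of_fun q (restrict (h \<circ> f) (sorted_simplices q))"
    if f: "f \<in> carrier (typed_cochains \<Gamma> R q)" for f q
  proof (rule S.oriented_cochains_eqI[OF _ S.of_fun_extensional])
    fix x assume x: "x \<in> carrier (FA q)"
    have "coset q x \<in> carrier (oriented_chains \<Delta> q)" unfolding carrier_oriented_chains using x by (rule imageI)
    then show "?a q (R.of_fun q f) (coset q x) = S.of_fun q (restrict (h \<circ> f) (sorted_simplices q)) (coset q x)"
      by (simp add: R.of_fun_coset[OF x] S.of_fun_coset[OF x] pair_h[OF f R.sort_chain_fractions[OF x]])
  qed simp
  have typed: "complex_map (typed_cochains \<Gamma> R) (typed_d R) (typed_cochains \<Gamma> S) (typed_d S)
      (\<lambda>q f. restrict (h \<circ> f) (sorted_simplices q))"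
    by (rule coeff_complex_map[where G = \<Gamma> and act = act, OF R S h face_closed_typed_lists proper_on_act[OF \<Gamma>]])
  have a: "complex_map (inv_cochains \<Gamma> R) (simplicial_coboundary \<Delta>) (inv_cochains \<Gamma> S) (simplicial_coboundary \<Delta>) ?a"
    by (rule complex_map_transport[OF cochains_transport[OF \<Gamma> R] cochains_transport[OF \<Gamma> S] typed]) (rule aU)
  have "complex_map (tuple_cochains \<Gamma> R) (tuple_d \<Gamma> R) (tuple_cochains \<Gamma> S) (tuple_d \<Gamma> S)
      (\<lambda>q f. restrict (h \<circ> f) (deg (lists \<Gamma>) (Suc q)))"
    by (rule coeff_complex_map[where G = \<Gamma> and act = left_mult, OF R S h face_closed_lists proper_on_tuples[OF \<Gamma>]])
  then have "complex_map (grp_cochains \<Gamma> R) (tuple_d \<Gamma> R) (grp_cochains \<Gamma> S) (tuple_d \<Gamma> S) ?b"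
    by (simp add: grp_cochains_eq[OF R] grp_cochains_eq[OF S] group_tuples_eq)
  then have b: "complex_map (grp_cochains \<Gamma> R) (grp_d \<Gamma> R) (grp_cochains \<Gamma> S) (grp_d \<Gamma> S) ?b"
    by (rule complex_map_cong[rotated 2]) (simp_all add: grp_d_eq[OF R] grp_d_eq[OF S])
  have sq: "?b q (comparison \<Gamma> R q m) = comparison \<Gamma> S q (?a q m)" if m: "m \<in> carrier (inv_cochains \<Gamma> R q)" for m
  proof -
    obtain f where f: "f \<in> carrier (typed_cochains \<Gamma> R q)" "m = R.of_fun q f" using m by (auto simp: T.U_carrier)
    have t: "to_fun q (?a q m) = restrict (h \<circ> f) (sorted_simplices q)"
      unfolding f(2) aU[OF f(1)] using hf[OF f(1)] by (intro S.to_fun_of_fun) auto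
    have \<psi>: "orbit_map a \<in> chains (p_fractions p) (sorted_simplices q)" if "a \<in> deg (lists \<Gamma>) (Suc q)" for a
      using orbit_map[OF \<Gamma>] that unfolding equivariant_chain_map_def by blast
    show ?thesis
      unfolding comparison_def t R.R.pull_def S.R.pull_def group_tuples_eq
      by (rule extensionalityI[where A = "deg (lists \<Gamma>) (Suc q)"]) (auto simp: f(2) T.T_U[OF f(1)] pair_h[OF f(1) \<psi>])
  qed
  show ?thesis
    unfolding cohomology_comparison_def group_cohomology_coeff_def invariant_cohomology_coeff_def
    by (rule inverse_natural[where f = "comparison \<Gamma> R" and g = "comparison \<Gamma> S" and a = ?a and b = ?b,
          OF comparison_map[OF \<Gamma> R] comparison_map[OF \<Gamma> S] a b sq comparison_iso[OF \<Gamma> R] comparison_iso[OF \<Gamma> S]])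
      (use \<xi> in \<open>simp_all add: group_cohomology_def\<close>)
qed

text \<open>Both comparison maps evaluate on the same chains \<open>orbit_map a\<close>, so
  restriction to tuples of the smaller group commutes with them on cochains.\<close>

theorem cohomology_comparison_res:
  assumes \<Gamma>: "proper_on \<Gamma>" and \<Gamma>': "proper_on \<Gamma>'" "\<Gamma>' \<subseteq> \<Gamma>" and R: "p_divisible_group R p"
    and \<xi>: "\<xi> \<in> carrier (group_cohomology (subgroup_of G \<Gamma>) R trivial_action q)"
  shows "cohomology_comparison \<Gamma>' R q (group_cohomology_res (subgroup_of G \<Gamma>') R trivial_action q \<xi>) =
    invariant_cohomology_res (subgroup_of G \<Gamma>') act \<Delta> R q (cohomology_comparison \<Gamma> R q \<xi>)"
proof -
  interpret R: oriented_cochains \<Delta> k R p by (rule oriented_cochains[OF R])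
  let ?b = "\<lambda>q f. restrict f (group_tuples (subgroup_of G \<Gamma>') q)"
  have a: "complex_map (inv_cochains \<Gamma> R) (simplicial_coboundary \<Delta>) (inv_cochains \<Gamma>' R) (simplicial_coboundary \<Delta>) (\<lambda>q m. m)"
  proof (rule complex_map_transport[OF cochains_transport[OF \<Gamma> R] cochains_transport[OF \<Gamma>'(1) R]])
    show "complex_map (typed_cochains \<Gamma> R) (typed_d R) (typed_cochains \<Gamma>' R) (typed_d R)
        (\<lambda>q f. restrict f (sorted_simplices q))"
      by (rule R.R.restrict_complex_map[where act = act, OF face_closed_typed_lists face_closed_typed_lists order_refl \<Gamma>'(2)
            proper_on_act[OF \<Gamma>] proper_on_act[OF \<Gamma>'(1)]])
    fix q f assume "f \<in> carrier (typed_cochains \<Gamma> R q)"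
    then show "R.of_fun q f = R.of_fun q (restrict f (sorted_simplices q))"
      by (simp add: R.R.fun_cochains_carrier extensional_restrict)
  qed
  have "complex_map (tuple_cochains \<Gamma> R) (tuple_d \<Gamma> R) (tuple_cochains \<Gamma>' R) (tuple_d \<Gamma>' R)
      (\<lambda>q f. restrict f (deg (lists \<Gamma>') (Suc q)))"
    by (rule R.R.restrict_complex_map[where act = left_mult, OF face_closed_lists face_closed_lists lists_mono[OF \<Gamma>'(2)] \<Gamma>'(2)
          proper_on_tuples[OF \<Gamma>] proper_on_tuples[OF \<Gamma>'(1)]])
  then have "complex_map (grp_cochains \<Gamma> R) (tuple_d \<Gamma> R) (grp_cochains \<Gamma>' R) (tuple_d \<Gamma>' R) ?b"
    by (simp add: grp_cochains_eq[OF R] group_tuples_eq)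
  then have b: "complex_map (grp_cochains \<Gamma> R) (grp_d \<Gamma> R) (grp_cochains \<Gamma>' R) (grp_d \<Gamma>' R) ?b"
    by (rule complex_map_cong[rotated 2]) (simp_all add: grp_d_eq[OF R])
  have "a \<in> deg (lists \<Gamma>) (Suc q)" if "a \<in> deg (lists \<Gamma>') (Suc q)" for a
    using that lists_mono[OF \<Gamma>'(2)] by (auto simp: deg_def)
  then have sq: "?b q (comparison \<Gamma> R q m) = comparison \<Gamma>' R q m" for m
    unfolding comparison_def R.R.pull_def group_tuples_eq
    by (intro extensionalityI[where A = "deg (lists \<Gamma>') (Suc q)"]) auto
  show ?thesis
    unfolding cohomology_comparison_def group_cohomology_res_def invariant_cohomology_res_def
    by (rule inverse_natural[where f = "comparison \<Gamma> R" and g = "comparison \<Gamma>' R" and a = "\<lambda>q m. m" and b = ?b,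
          OF comparison_map[OF \<Gamma> R] comparison_map[OF \<Gamma>'(1) R] a b sq comparison_iso[OF \<Gamma> R] comparison_iso[OF \<Gamma>'(1) R]])
      (use \<xi> in \<open>simp add: group_cohomology_def\<close>)
qed

end

subsection \<open>The arithmetic group acting on the building\<close>

text \<open>If a prime \<open>l\<close> divided the part of the order prime to \<open>p\<close>,
  Sylow's theorem would give a subgroup of order \<open>l\<close>. A nontrivial element of it has an
  order that divides \<open>l\<close> and is a power of \<open>p\<close>, which forces
  \<open>l = p\<close>.\<close>

lemma p_subgroup_card:
  assumes G: "group G" and H: "subgroup H G" "finite H" and p: "Factorial_Ring.prime p"
    and ord: "\<And>g. g \<in> H \<Longrightarrow> group.ord G g \<noteq> 0 \<Longrightarrow> \<exists>k. group.ord G g = p ^ k"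
  shows "\<exists>k. card H = p ^ k"
proof -
  interpret G: group G by (rule G)
  interpret H: group "G\<lparr>carrier := H\<rparr>" by (rule subgroup.subgroup_is_group[OF H(1) G])
  have ne: "card H \<noteq> 0" using H(2) subgroup.one_closed[OF H(1)] by auto
  have np: "\<not> is_unit p" using p not_prime_unit by blast
  obtain m where m: "card H = p ^ multiplicity p (card H) * m" "\<not> p dvd m"
    using multiplicity_decompose'[OF ne np] by blast
  have "m = 1"
  proof (rule ccontr)
    assume "m \<noteq> 1"
    then obtain l where l: "Factorial_Ring.prime l" "l dvd m" using prime_factor_nat by blast
    then have "l dvd card H" using m(1) dvd_mult by metis
    then obtain c where "card H = l * c" by (elim dvdE)
    then have "order (G\<lparr>carrier := H\<rparr>) = l ^ 1 * c" by (simp add: order_def)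
    then have "\<exists>P. subgroup P (G\<lparr>carrier := H\<rparr>) \<and> card P = l ^ 1"
      by (rule sylow_thm[OF l(1) H.group_axioms]) (simp add: H(2))
    then obtain P where P: "subgroup P (G\<lparr>carrier := H\<rparr>)" "card P = l" by auto
    have PG: "subgroup P G" by (rule G.incl_subgroup[OF H(1) P(1)])
    interpret P: group "G\<lparr>carrier := P\<rparr>" by (rule subgroup.subgroup_is_group[OF PG G])
    have "\<not> P \<subseteq> {\<one>\<^bsub>G\<^esub>}"
    proof
      assume "P \<subseteq> {\<one>\<^bsub>G\<^esub>}"
      then have "card P \<le> 1" using card_mono[of "{\<one>\<^bsub>G\<^esub>}" P] by simp
      then show False using P(2) prime_gt_1_nat[OF l(1)] by simp
    qed
    then obtain g where g: "g \<in> P" "g \<noteq> \<one>\<^bsub>G\<^esub>" by blast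
    have gH: "g \<in> H" using subgroup.subset[OF P(1)] g(1) by auto
    have gG: "g \<in> carrier G" by (rule subgroup.mem_carrier[OF PG g(1)])
    have "g [^]\<^bsub>G\<^esub> l = \<one>\<^bsub>G\<^esub>"
      using P.pow_order_eq_1[of g] g(1) P(2) G.nat_pow_consistent[of g l P] by (simp add: order_def)
    then have dvd: "group.ord G g dvd l" using G.pow_eq_id[OF gG] by blast
    then have "group.ord G g \<noteq> 0" using l(1) by (metis dvd_0_left_iff not_prime_0)
    then obtain k where k: "group.ord G g = p ^ k" using ord[OF gH] by blast
    have "k \<noteq> 0" using k G.ord_eq_1[OF gG] g(2) by (metis power_0)
    then have "p dvd l" using dvd k by (metis dvd_power dvd_trans gr0I)
    then have "p = l" using primes_dvd_imp_eq p l(1) by blast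
    then show False using m(2) l(2) by simp
  qed
  then show ?thesis using m(1) by auto
qed

text \<open>In characteristic 0 the multiples of 1 would be infinitely many elements of the finite
  constant field.\<close>

lemma (in constant_field) prime_CHAR: "Factorial_Ring.prime CHAR('k)"
proof (rule prime_CHAR_semidom, rule ccontr)
  assume "\<not> CHAR('k) > 0"
  then have zero: "of_nat n \<noteq> (0 :: 'k)" if "n > 0" for n using that by (simp add: CHAR_eq0_iff)
  have inj: "inj (of_nat :: nat \<Rightarrow> 'k)"
  proof (rule linorder_injI)
    fix m n :: nat
    assume "m < n"
    then show "of_nat m \<noteq> (of_nat n :: 'k)" using zero[of "n - m"] by (simp add: of_nat_diff)
  qed
  have F: "subring F (ring_of_type_algebra :: 'k ring)"
    using subfield_F by (simp add: subfield_def subdomain_def subcring_def)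
  have F01: "0 \<in> F" "1 \<in> F" and Fadd: "a \<in> F \<Longrightarrow> b \<in> F \<Longrightarrow> a + b \<in> F" for a b
    using subringE(2,3)[OF F] subringE(7)[OF F, of a b] by (simp_all add: ring_of_type_algebra_def)
  have "of_nat n \<in> F" for n by (induction n) (simp_all add: F01 Fadd)
  then have "range (of_nat :: nat \<Rightarrow> 'k) \<subseteq> F" by blast
  then have "finite (range (of_nat :: nat \<Rightarrow> 'k))" using finite_F by (rule finite_subset)
  then show False using finite_imageD[OF _ inj] by simp
qed

theorem mainTheorem1:
  fixes F :: "'k::field set" and v :: "'k \<Rightarrow> int"
    and \<iota> :: "'k \<Rightarrow> 'l::field" and w :: "'l \<Rightarrow> int" and n p :: nat
  assumes "global_function_field F" and "p = CHAR('k)"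
    and "place F v" and "valued_completion v \<iota> w"
    and "n \<ge> 1" and "CARD('n::finite) = n + 1"
  shows "\<exists>\<Phi> :: ('k ^ 'n ^ 'n) set \<Rightarrow> 'r monoid \<Rightarrow> nat \<Rightarrow> (('k ^ 'n ^ 'n) list \<Rightarrow> 'r) set
                 \<Rightarrow> ((('l, 'n) vertex list set \<Rightarrow>\<^sub>0 int) set \<Rightarrow> 'r) set.
    \<comment> \<open>isomorphisms in every degree\<close>
    (\<forall>\<Gamma> R q. arithmetic_subgroup F v \<Gamma> \<and> without_p'_torsion p SL_group \<Gamma> \<and>
       comm_group R \<and> p_invertible p R \<longrightarrow>
       \<Phi> \<Gamma> R q \<in> iso (group_cohomology (subgroup_of SL_group \<Gamma>) R trivial_action q)
                    (invariant_cohomology (subgroup_of SL_group \<Gamma>) (building_action \<iota>) (building w) R q)) \<and>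
    \<comment> \<open>natural in the coefficients\<close>
    (\<forall>\<Gamma> R S h q. arithmetic_subgroup F v \<Gamma> \<and> without_p'_torsion p SL_group \<Gamma> \<and>
       comm_group R \<and> p_invertible p R \<and> comm_group S \<and> p_invertible p S \<and> h \<in> hom R S \<longrightarrow>
       (\<forall>x\<in>carrier (group_cohomology (subgroup_of SL_group \<Gamma>) R trivial_action q).
          \<Phi> \<Gamma> S q (group_cohomology_coeff (subgroup_of SL_group \<Gamma>) S trivial_action h q x) =
          invariant_cohomology_coeff (subgroup_of SL_group \<Gamma>) (building_action \<iota>) (building w) S h q
            (\<Phi> \<Gamma> R q x))) \<and>
    \<comment> \<open>natural in the group\<close>
    (\<forall>\<Gamma> \<Gamma>' R q. arithmetic_subgroup F v \<Gamma> \<and> without_p'_torsion p SL_group \<Gamma> \<and>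
       arithmetic_subgroup F v \<Gamma>' \<and> without_p'_torsion p SL_group \<Gamma>' \<and> \<Gamma>' \<subseteq> \<Gamma> \<and>
       comm_group R \<and> p_invertible p R \<longrightarrow>
       (\<forall>x\<in>carrier (group_cohomology (subgroup_of SL_group \<Gamma>) R trivial_action q).
          \<Phi> \<Gamma>' R q (group_cohomology_res (subgroup_of SL_group \<Gamma>') R trivial_action q x) =
          invariant_cohomology_res (subgroup_of SL_group \<Gamma>') (building_action \<iota>) (building w) R q
            (\<Phi> \<Gamma> R q x)))"
proof -
  interpret constant_field F using assms(1) by unfold_locales
  interpret w: discretely_valued w using assms(4) by (simp add: valued_completion_def discretely_valued_def)
  have p: "Factorial_Ring.prime p" using prime_CHAR assms(2) by simp
  have \<iota>: "\<iota> 1 = 1" "\<And>x y. \<iota> (x + y) = \<iota> x + \<iota> y" "\<And>x y. \<iota> (x * y) = \<iota> x * \<iota> y"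
    using assms(4) by (simp_all add: valued_completion_def)
  let ?G = "SL_group :: ('k ^ 'n ^ 'n) monoid"
  let ?act = "building_action \<iota> :: 'k ^ 'n ^ 'n \<Rightarrow> ('l, 'n) vertex \<Rightarrow> _"
  let ?D = "building w :: ('l, 'n) vertex set set"
  let ?k = "w.vertex_type :: ('l, 'n) vertex \<Rightarrow> int"
  interpret SL: group ?G by (rule SL_group_group)
  have det: "det (map_matrix \<iota> g) = 1" if "g \<in> carrier ?G" for g
    using that by (simp add: SL_group_def map_det_ring_hom(1)[OF \<iota>] \<iota>(1))
  have act_mult: "?act (g \<otimes>\<^bsub>?G\<^esub> h) W = ?act g (?act h W)" for g h W
    by (simp add: SL_group_def building_action_def map_det_ring_hom(2)[OF \<iota>] image_image matrix_vector_mul_assoc)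
  have act_one: "?act \<one>\<^bsub>?G\<^esub> W = W" for W
    by (simp add: SL_group_def building_action_def map_det_ring_hom(3)[OF \<iota>])
  have act_simplex: "?act g ` \<sigma> \<in> ?D" if "g \<in> carrier ?G" "\<sigma> \<in> ?D" for g \<sigma>
    unfolding w.building_action_eq_move by (rule w.move_building[OF _ that(2)]) (simp add: det[OF that(1)])
  have act_type: "?k (?act g V) = ?k V" if "g \<in> carrier ?G" "\<sigma> \<in> ?D" "V \<in> \<sigma>" for g \<sigma> V
    unfolding w.building_action_eq_move by (rule w.vertex_type_move[OF det[OF that(1)] that(2,3)])
  interpret T: typed_complex ?D ?k
    by unfold_locales ((rule w.building_face; assumption) | (rule w.vertex_type_inj_on; assumption))+
  have lists: "T.typed_lists = w.simplex_lists" by (simp add: T.typed_lists_def w.simplex_lists_def)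
  have "acyclic_action ?G (p_fractions p) ?act T.typed_lists"
  proof (intro acyclic_action.intro acyclic_action_axioms.intro)
    show "map (?act g) b \<in> T.typed_lists" if "g \<in> carrier ?G" "b \<in> T.typed_lists" for g b
      by (rule T.map_typed_lists[OF that(2)]) (rule act_simplex act_type, rule that(1), assumption+)+
    show "\<exists>y\<in>chains (p_fractions p) (deg T.typed_lists (Suc q)). bd y = z"
      if "z \<in> chains (p_fractions p) (deg T.typed_lists q)" "bd z = 0" for z q
      using w.simplex_lists_acyclic[OF coeff_ring_p_fractions] that unfolding lists by blast
    show "[] \<in> T.typed_lists" by (simp add: T.typed_lists_def)
  qed (rule SL.group_axioms coeff_ring_p_fractions act_mult act_one T.face_closed_typed_lists)+
  then interpret TA: typed_action ?D ?k ?G ?act p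
    by (intro typed_action.intro typed_action_axioms.intro T.typed_complex_axioms act_simplex act_type)
  \<comment> \<open>A matrix that fixes the list \<open>b\<close> fixes its vertices one by one, so
    the stabiliser of \<open>b\<close> is a subgroup contained in the finite stabiliser of the first
    vertex \<open>V\<close>.\<close>
  have proper: "TA.proper_on \<Gamma>" if \<Gamma>: "arithmetic_subgroup F v \<Gamma>" "without_p'_torsion p SL_group \<Gamma>" for \<Gamma>
    unfolding TA.proper_on_def
  proof (intro conjI ballI)
    show sub: "subgroup \<Gamma> ?G" using \<Gamma>(1) by (simp add: arithmetic_subgroup_def)
    fix b assume b: "b \<in> T.typed_lists - {[]}"
    then obtain V vs where V: "b = V # vs" by (cases b) auto
    have D: "set b \<in> ?D" "V \<in> set b" using b V by (auto simp: T.typed_lists_def)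
    let ?St = "{g \<in> \<Gamma>. map (?act g) b = b}"
    have "?St \<subseteq> {g \<in> \<Gamma>. ?act g V = V}" by (auto simp: V)
    then show fin: "finite ?St"
      using stabiliser_finite[OF assms(1,3,4) \<Gamma>(1) D] by (rule finite_subset)
    have "subgroup ?St ?G"
    proof (rule SL.subgroupI)
      show "?St \<subseteq> carrier ?G" using subgroup.subset[OF sub] by blast
      have "\<one>\<^bsub>?G\<^esub> \<in> ?St" using subgroup.one_closed[OF sub] by (simp add: act_one map_idI)
      then show "?St \<noteq> {}" by blast
      fix g assume g: "g \<in> ?St"
      then have gc: "g \<in> carrier ?G" and gb: "map (?act g) b = b" using subgroup.mem_carrier[OF sub] by simp_all
      have "map (?act (inv\<^bsub>?G\<^esub> g)) (map (?act g) b) = map (?act (inv\<^bsub>?G\<^esub> g \<otimes>\<^bsub>?G\<^esub> g)) b"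
        by (simp add: act_mult)
      also have "\<dots> = b" using gc by (simp add: act_one map_idI)
      finally have "map (?act (inv\<^bsub>?G\<^esub> g)) b = b" unfolding gb .
      then show "inv\<^bsub>?G\<^esub> g \<in> ?St" using g subgroup.m_inv_closed[OF sub, of g] by simp
      fix h assume h: "h \<in> ?St"
      then have hb: "map (?act h) b = b" by simp
      have "map (?act (g \<otimes>\<^bsub>?G\<^esub> h)) b = map (?act g) (map (?act h) b)" by (simp add: act_mult)
      then have "map (?act (g \<otimes>\<^bsub>?G\<^esub> h)) b = b" unfolding hb gb .
      then show "g \<otimes>\<^bsub>?G\<^esub> h \<in> ?St" using g h subgroup.m_closed[OF sub, of g h] by simp
    qed
    then obtain m where "card ?St = p ^ m"
      using p_subgroup_card[OF SL.group_axioms _ fin p] \<Gamma>(2) unfolding without_p'_torsion_def by blast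
    then show "inverse (of_nat (card ?St)) \<in> p_fractions p"
      using inverse_power_p_fractions[OF prime_gt_0_nat[OF p], of m] by simp
  qed
  have div: "p_divisible_group R p" if "comm_group R" "p_invertible p R" for R :: "'r monoid"
    using that prime_gt_0_nat[OF p] by (simp add: p_divisible_group_def p_divisible_group_axioms_def)
  show ?thesis
  proof (intro exI[of _ TA.cohomology_comparison] conjI allI impI ballI, goal_cases)
    case (1 \<Gamma> R q)
    then show ?case by (intro TA.cohomology_comparison_iso proper div) simp_all
  next
    case (2 \<Gamma> R S h q x)
    then show ?case by (intro TA.cohomology_comparison_coeff[where R = R] proper div) simp_all
  next
    case (3 \<Gamma> \<Gamma>' R q x)
    then show ?case by (intro TA.cohomology_comparison_res[where \<Gamma> = \<Gamma>] proper div) simp_all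
  qed
qed

end
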